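(* Let $A = kQ/I$ be a quadratic string algebra and $n \geq 2$. Then $$\dim_k \mathrm{HH}^{n}(A) = \left| {}^{-}(0,0)_n^{-} \right| + |\mathcal{E}_n| - |N\mathcal{E}_{n-1}| + \left| \left( (1,0)_n \sqcup {}^{-}(0,1)_n \right) \cap (AP_n//Q_1) \right| + c_n,$$ where $$c_n = \begin{cases} \dim_k k\mathcal{G}_n/\operatorname{Im}(1-\tau) & \text{if } n \text{ is even and } \operatorname{char} k \neq 2,\\ \dim_k k\mathcal{G}_{n-1}/\operatorname{Im}(1-\tau) & \text{if } n \text{ is odd and } \operatorname{char} k \neq 2,\\ \dim_k k\mathcal{G}_n/\operatorname{Im}(1-\tau) + \dim_k k\mathcal{G}_{n-1}/\operatorname{Im}(1-\tau) & \text{if } \operatorname{char} k = 2. \end{cases}$$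
   Context: Let $k$ be an algebraically closed field and $Q=(Q_0,Q_1,s,t)$ a finite connected quiver. Paths are written $\alpha_1\cdots\alpha_l$ with $t(\alpha_i)=s(\alpha_{i+1})$; $e_x$ is the trivial path at a vertex $x$, and $Q_0$ also denotes the set of trivial paths. For arrows $\alpha,\beta$, "$\alpha\beta\in I$" (resp. "$\alpha\beta\notin I$") means $t(\alpha)=s(\beta)$ and the path $\alpha\beta$ lies (resp. does not lie) in $I$. A quadratic string algebra is $A=kQ/I$ where $I$ is an admissible ideal of $kQ$ ($F^m\subseteq I\subseteq F^2$ for some $m\ge 2$, $F$ the arrow ideal) generated by paths of length two, such that: (S1) each vertex is the source of at most two arrows and the target of at most two arrows; (S2) for each arrow $\alpha$ there is at most one arrow $\beta$ with $\alpha\beta\notin I$ and at most one arrow $\gamma$ with $\gamma\alpha\notin I$. $\mathrm{HH}^n(A)=\mathrm{Ext}^n_{A-A}(A,A)$ is Hochschild cohomology. $\mathcal{P}$ is the set of paths in $Q$ not in $I$. Put $AP_1=Q_1$ and, for $n\ge2$, $AP_n=\{\alpha_1\cdots\alpha_n: \alpha_i\in Q_1,\ \alpha_i\alpha_{i+1}\in I,\ 1\le i<n\}$. For sets $X,Y$ of paths, $(X//Y)=\{(\rho,\gamma)\in X\times Y: s(\rho)=s(\gamma),\ t(\rho)=t(\gamma)\}$. For $n\ge 2$ and $(\rho,\gamma)\in(AP_n//\mathcal{P})$ with $\rho=\alpha_1\cdots\alpha_n$: $(\rho,\gamma)\in(a,b)_n$, $a,b\in\{0,1\}$, where $a=1$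 iff $\gamma$ starts with the arrow $\alpha_1$ and $b=1$ iff $\gamma$ ends with the arrow $\alpha_n$; these four sets partition $(AP_n//\mathcal{P})$. For any set $S$ of pairs $(\rho,\gamma)$ with $\gamma\in\mathcal{P}$: ${}^{-}S$ is the subset of those for which no arrow $\beta$ makes $\beta\gamma$ a path not in $I$; $S^{-}$ the subset of those for which no arrow $\beta$ makes $\gamma\beta$ a path not in $I$; ${}^{-}S^{-}={}^{-}S\cap S^{-}$. For $n\ge1$, a pair $w=(\alpha_1\cdots\alpha_n,e_{s(\alpha_1)})\in(AP_n//Q_0)$ is complete if $\alpha_n\alpha_1\in I$ and incomplete if $\alpha_n\alpha_1\notin I$; $\mathcal{C}_n$ and $\mathcal{I}_n$ denote the sets of complete and incomplete pairs. On $\mathcal{C}_n$ define $\tau(\alpha_1\cdots\alpha_n,e_{s(\alpha_1)})=(\alpha_n\alpha_1\cdots\alpha_{n-1},e_{s(\alpha_n)})$, extended linearly. $\mathcal{C}_n(0)$ is the set of $(\alpha_1\cdots\alpha_n,e_{s(\alpha_1)})\in\mathcal{C}_n$ such that there is no arrow $\gamma\ne\alpha_n$ with $\gamma\alpha_1\in I$ and no arrow $\beta\neq\alpha_1$ with $\alpha_n\beta\in I$. A complete pair $w$ is gentle if $\tau^m(w)\in\mathcal{C}_n(0)$ for all $m\in\mathbb{Z}$; $\mathcal{G}_n$ is the set of gentle pairs, and $1-\tau$ is regarded as a linear map $k\mathcal{G}_n\to k\mathcal{G}_n$. An incomplete pair $(\alpha_1\cdots\alpha_n,e_{s(\alpha_1)})$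 is empty if there are no arrows $\beta,\gamma$ with $t(\beta)=s(\alpha_1)=s(\gamma)$ and $\beta\gamma\in I$; $\mathcal{E}_n$ is the set of empty pairs and $N\mathcal{E}_n=\mathcal{I}_n\setminus\mathcal{E}_n$. For a set $S$, $kS$ is the vector space with basis $S$. *)

theory Defs
  imports
    "HOL-Computational_Algebra.Polynomial"
    "HOL-Algebra.QuotRing"
    "HOL-Algebra.Ideal_Product"
    "Jordan_Normal_Form.VS_Connect"
    "Graph_Theory.Graph_Theory"
begin

section \<open>Vector spaces over a field given as a type\<close>

text \<open>
  The ground field is a type \<open>'k\<close>, used through \<^term>\<open>class_ring :: 'k::field ring\<close>.
  Vector spaces and algebras are \<open>('k, 'x) module\<close> records; a mere vector space leaves the
  \<open>mult\<close> and \<open>one\<close> components of the record unused, as in \<open>HOL-Algebra\<close>.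
\<close>

abbreviation kdim :: "('k::field, 'x, 'z) module_scheme \<Rightarrow> nat" where
  "kdim V \<equiv> vectorspace.dim (class_ring :: 'k ring) V"

abbreviation kfin_dim :: "('k::field, 'x, 'z) module_scheme \<Rightarrow> bool" where
  "kfin_dim V \<equiv> vectorspace.fin_dim (class_ring :: 'k ring) V"

definition free_space :: "'s set \<Rightarrow> ('k::field, 's \<Rightarrow> 'k) module" where
  "free_space S =
     \<lparr>carrier = {f. finite {s. f s \<noteq> 0} \<and> {s. f s \<noteq> 0} \<subseteq> S},
      monoid.mult = undefined, one = undefined,
      zero = (\<lambda>_. 0), add = (\<lambda>f g s. f s + g s),
      smult = (\<lambda>c f s. c * f s)\<rparr>"

definition basis_vec :: "'s \<Rightarrow> 's \<Rightarrow> 'k::field" where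
  "basis_vec s = (\<lambda>t. if t = s then 1 else 0)"

text \<open>
  The factor ring of the library, equipped with the induced scalar multiplication.  It serves
  both as the quotient of an algebra by an ideal and as the quotient of a vector space by a
  subspace (its multiplication then being irrelevant).
\<close>

definition kquot :: "('k, 'x, 'z) module_scheme \<Rightarrow> 'x set \<Rightarrow> ('k, 'x set) module" where
  "kquot V W = ring.extend (V Quot W)
     (module.fields (\<lambda>c X. \<Union>x\<in>X. W +>\<^bsub>V\<^esub> (c \<odot>\<^bsub>V\<^esub> x)))"


section \<open>Bimodules and Ext\<close>

record ('k, 'r, 'm) bimod = "('k, 'm) module" +
  lact :: "'r \<Rightarrow> 'm \<Rightarrow> 'm"
  ract :: "'m \<Rightarrow> 'r \<Rightarrow> 'm"

text \<open>Bimodules over a \<open>k\<close>-algebra, on which \<open>k\<close> acts centrally.\<close>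

locale bimodule =
  fixes A :: "('k::field, 'r) module" and M :: "('k, 'r, 'm) bimod"
  assumes vectorspace: "vectorspace class_ring M"
    and lact_closed: "\<lbrakk>a \<in> carrier A; x \<in> carrier M\<rbrakk> \<Longrightarrow> lact M a x \<in> carrier M"
    and ract_closed: "\<lbrakk>x \<in> carrier M; a \<in> carrier A\<rbrakk> \<Longrightarrow> ract M x a \<in> carrier M"
    and lact_add_left: "\<lbrakk>a \<in> carrier A; b \<in> carrier A; x \<in> carrier M\<rbrakk> \<Longrightarrow>
          lact M (a \<oplus>\<^bsub>A\<^esub> b) x = lact M a x \<oplus>\<^bsub>M\<^esub> lact M b x"
    and lact_add_right: "\<lbrakk>a \<in> carrier A; x \<in> carrier M; y \<in> carrier M\<rbrakk> \<Longrightarrow>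
          lact M a (x \<oplus>\<^bsub>M\<^esub> y) = lact M a x \<oplus>\<^bsub>M\<^esub> lact M a y"
    and ract_add_left: "\<lbrakk>x \<in> carrier M; y \<in> carrier M; a \<in> carrier A\<rbrakk> \<Longrightarrow>
          ract M (x \<oplus>\<^bsub>M\<^esub> y) a = ract M x a \<oplus>\<^bsub>M\<^esub> ract M y a"
    and ract_add_right: "\<lbrakk>x \<in> carrier M; a \<in> carrier A; b \<in> carrier A\<rbrakk> \<Longrightarrow>
          ract M x (a \<oplus>\<^bsub>A\<^esub> b) = ract M x a \<oplus>\<^bsub>M\<^esub> ract M x b"
    and lact_smult: "\<lbrakk>a \<in> carrier A; x \<in> carrier M\<rbrakk> \<Longrightarrow>
          lact M (c \<odot>\<^bsub>A\<^esub> a) x = c \<odot>\<^bsub>M\<^esub> lact M a x"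
    and ract_smult: "\<lbrakk>x \<in> carrier M; a \<in> carrier A\<rbrakk> \<Longrightarrow>
          ract M x (c \<odot>\<^bsub>A\<^esub> a) = c \<odot>\<^bsub>M\<^esub> ract M x a"
    and lact_mult: "\<lbrakk>a \<in> carrier A; b \<in> carrier A; x \<in> carrier M\<rbrakk> \<Longrightarrow>
          lact M (a \<otimes>\<^bsub>A\<^esub> b) x = lact M a (lact M b x)"
    and ract_mult: "\<lbrakk>x \<in> carrier M; a \<in> carrier A; b \<in> carrier A\<rbrakk> \<Longrightarrow>
          ract M x (a \<otimes>\<^bsub>A\<^esub> b) = ract M (ract M x a) b"
    and lact_ract: "\<lbrakk>a \<in> carrier A; x \<in> carrier M; b \<in> carrier A\<rbrakk> \<Longrightarrow>
          ract M (lact M a x) b = lact M a (ract M x b)"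
    and lact_one: "x \<in> carrier M \<Longrightarrow> lact M \<one>\<^bsub>A\<^esub> x = x"
    and ract_one: "x \<in> carrier M \<Longrightarrow> ract M x \<one>\<^bsub>A\<^esub> = x"

definition regular_bimodule :: "('k, 'r) module \<Rightarrow> ('k, 'r, 'r) bimod" where
  "regular_bimodule A = module.extend A (bimod.fields (monoid.mult A) (monoid.mult A))"

text \<open>
  Homomorphisms are extensional functions, so that they are determined by their values on
  the carrier.  They are automatically \<open>k\<close>-linear, as \<open>k\<close> acts through the unit of \<open>A\<close>.
\<close>

definition bimod_hom ::
  "('k::field, 'r) module \<Rightarrow> ('k, 'r, 'm) bimod \<Rightarrow> ('k, 'r, 'n) bimod \<Rightarrow> ('m \<Rightarrow> 'n) set" where
  "bimod_hom A M N = {f \<in> carrier M \<rightarrow>\<^sub>E carrier N.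
     (\<forall>x\<in>carrier M. \<forall>y\<in>carrier M. f (x \<oplus>\<^bsub>M\<^esub> y) = f x \<oplus>\<^bsub>N\<^esub> f y) \<and>
     (\<forall>a\<in>carrier A. \<forall>x\<in>carrier M. f (lact M a x) = lact N a (f x)) \<and>
     (\<forall>a\<in>carrier A. \<forall>x\<in>carrier M. f (ract M x a) = ract N (f x) a)}"

definition hom_space ::
  "('k::field, 'r) module \<Rightarrow> ('k, 'r, 'm) bimod \<Rightarrow> ('k, 'r, 'n) bimod \<Rightarrow> ('k, 'm \<Rightarrow> 'n) module" where
  "hom_space A M N =
     \<lparr>carrier = bimod_hom A M N, monoid.mult = undefined, one = undefined,
      zero = (\<lambda>x\<in>carrier M. \<zero>\<^bsub>N\<^esub>),
      add = (\<lambda>f g. \<lambda>x\<in>carrier M. f x \<oplus>\<^bsub>N\<^esub> g x),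
      smult = (\<lambda>c f. \<lambda>x\<in>carrier M. c \<odot>\<^bsub>N\<^esub> f x)\<rparr>"

text \<open>
  Projectivity is the lifting property along surjective homomorphisms \<open>M \<rightarrow> N\<close>.  HOL cannot
  quantify over bimodules of all types, so \<open>M\<close> and \<open>N\<close> are taken with elements of type
  \<open>'m \<times> 'r \<times> 'r \<Rightarrow> 'k\<close>.  This is no restriction: if \<open>B\<close> is a \<open>k\<close>-basis of \<open>A\<close>, the free bimodule
  on the set \<open>carrier P\<close> is realised by the finitely supported functions on
  \<open>carrier P \<times> B \<times> B\<close>, and \<open>P\<close> itself has a copy in this type (indicator functions).  Hence
  the lifting property below makes \<open>P\<close> a direct summand of a free bimodule, which yields
  lifting along surjections between bimodules of any type.
\<close>

definition projective_bimodule :: "('k::field, 'r) module \<Rightarrow> ('k, 'r, 'm) bimod \<Rightarrow> bool" where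
  "projective_bimodule A P \<longleftrightarrow> bimodule A P \<and>
     (\<forall>(M :: ('k, 'r, 'm \<times> 'r \<times> 'r \<Rightarrow> 'k) bimod) (N :: ('k, 'r, 'm \<times> 'r \<times> 'r \<Rightarrow> 'k) bimod).
        bimodule A M \<longrightarrow> bimodule A N \<longrightarrow>
        (\<forall>g\<in>bimod_hom A M N. g ` carrier M = carrier N \<longrightarrow>
           (\<forall>f\<in>bimod_hom A P N. \<exists>h\<in>bimod_hom A P M. \<forall>x\<in>carrier P. g (h x) = f x)))"

definition projective_resolution ::
  "('k::field, 'r) module \<Rightarrow> ('k, 'r, 'n) bimod \<Rightarrow>
   (nat \<Rightarrow> ('k, 'r, 'm) bimod) \<Rightarrow> (nat \<Rightarrow> 'm \<Rightarrow> 'm) \<Rightarrow> ('m \<Rightarrow> 'n) \<Rightarrow> bool" where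
  "projective_resolution A M P d \<epsilon> \<longleftrightarrow>
     (\<forall>i. projective_bimodule A (P i)) \<and>
     (\<forall>i. d i \<in> bimod_hom A (P (Suc i)) (P i)) \<and>
     \<epsilon> \<in> bimod_hom A (P 0) M \<and>
     \<epsilon> ` carrier (P 0) = carrier M \<and>
     d 0 ` carrier (P 1) = {x \<in> carrier (P 0). \<epsilon> x = \<zero>\<^bsub>M\<^esub>} \<and>
     (\<forall>i. d (Suc i) ` carrier (P (Suc (Suc i))) =
            {x \<in> carrier (P (Suc i)). d i x = \<zero>\<^bsub>P i\<^esub>})"

text \<open>
  \<open>ext_space A P d N n\<close> is the \<open>n\<close>-th cohomology of the complex of bimodule homomorphisms from
  \<open>P\<close> to \<open>N\<close>; for a projective resolution \<open>P\<close> of \<open>M\<close> it is \<open>Ext\<close> of degree \<open>n\<close> of \<open>M\<close> by \<open>N\<close>.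
\<close>

definition cocycles ::
  "('k::field, 'r) module \<Rightarrow> (nat \<Rightarrow> ('k, 'r, 'm) bimod) \<Rightarrow> (nat \<Rightarrow> 'm \<Rightarrow> 'm) \<Rightarrow>
   ('k, 'r, 'n) bimod \<Rightarrow> nat \<Rightarrow> ('m \<Rightarrow> 'n) set" where
  "cocycles A P d N n =
     {f \<in> bimod_hom A (P n) N. \<forall>x\<in>carrier (P (Suc n)). f (d n x) = \<zero>\<^bsub>N\<^esub>}"

definition coboundaries ::
  "('k::field, 'r) module \<Rightarrow> (nat \<Rightarrow> ('k, 'r, 'm) bimod) \<Rightarrow> (nat \<Rightarrow> 'm \<Rightarrow> 'm) \<Rightarrow>
   ('k, 'r, 'n) bimod \<Rightarrow> nat \<Rightarrow> ('m \<Rightarrow> 'n) set" where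
  "coboundaries A P d N n =
     (case n of
        0 \<Rightarrow> {\<lambda>x\<in>carrier (P 0). \<zero>\<^bsub>N\<^esub>}
      | Suc i \<Rightarrow> (\<lambda>f. compose (carrier (P (Suc i))) f (d i)) ` bimod_hom A (P i) N)"

definition ext_space ::
  "('k::field, 'r) module \<Rightarrow> (nat \<Rightarrow> ('k, 'r, 'm) bimod) \<Rightarrow> (nat \<Rightarrow> 'm \<Rightarrow> 'm) \<Rightarrow>
   ('k, 'r, 'n) bimod \<Rightarrow> nat \<Rightarrow> ('k, ('m \<Rightarrow> 'n) set) module" where
  "ext_space A P d N n =
     kquot ((hom_space A (P n) N)\<lparr>carrier := cocycles A P d N n\<rparr>) (coboundaries A P d N n)"

text \<open>Hochschild cohomology, for a projective resolution \<open>P\<close> of \<open>A\<close> as a bimodule over itself.\<close>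

abbreviation HH ::
  "('k::field, 'r) module \<Rightarrow> (nat \<Rightarrow> ('k, 'r, 'm) bimod) \<Rightarrow> (nat \<Rightarrow> 'm \<Rightarrow> 'm) \<Rightarrow>
   nat \<Rightarrow> ('k, ('m \<Rightarrow> 'r) set) module" where
  "HH A P d n \<equiv> ext_space A P d (regular_bimodule A) n"


section \<open>Quivers and path algebras\<close>

text \<open>
  A quiver is a \<^typ>\<open>('v, 'a) pre_digraph\<close>, loops and parallel arrows being allowed.
  A path is its source vertex together with its list of arrows, composed from left to right;
  \<open>(x, [])\<close> is the trivial path at \<open>x\<close>.
\<close>

type_synonym ('v, 'a) qpath = "'v \<times> 'a list"

definition paths :: "('v, 'a) pre_digraph \<Rightarrow> ('v, 'a) qpath set" where
  "paths Q = {(u, p). \<exists>v. pre_digraph.awalk Q u p v}"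

definition path_end :: "('v, 'a) pre_digraph \<Rightarrow> ('v, 'a) qpath \<Rightarrow> 'v" where
  "path_end Q p = last (pre_digraph.awalk_verts Q (fst p) (snd p))"

definition trivial_paths :: "('v, 'a) pre_digraph \<Rightarrow> ('v, 'a) qpath set" where
  "trivial_paths Q = (\<lambda>x. (x, [])) ` verts Q"

definition arrow_paths :: "('v, 'a) pre_digraph \<Rightarrow> ('v, 'a) qpath set" where
  "arrow_paths Q = (\<lambda>\<alpha>. (tail Q \<alpha>, [\<alpha>])) ` arcs Q"

text \<open>
  The coefficient of a product at a path \<open>(u, p)\<close> is the sum over all ways of cutting \<open>p\<close> in two.
\<close>

definition path_algebra ::
  "('v, 'a) pre_digraph \<Rightarrow> ('k::field, ('v, 'a) qpath \<Rightarrow> 'k) module" where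
  "path_algebra Q = (free_space (paths Q))
     \<lparr>monoid.mult := (\<lambda>f g (u, p). \<Sum>i\<le>length p.
                 f (u, take i p) * g (path_end Q (u, take i p), drop i p)),
      one := (\<lambda>q. if q \<in> trivial_paths Q then 1 else 0)\<rparr>"

definition arrow_ideal :: "('v, 'a) pre_digraph \<Rightarrow> (('v, 'a) qpath \<Rightarrow> 'k::field) set" where
  "arrow_ideal Q = Idl\<^bsub>path_algebra Q\<^esub> (basis_vec ` arrow_paths Q)"

primrec ideal_power :: "('r, 'z) ring_scheme \<Rightarrow> 'r set \<Rightarrow> nat \<Rightarrow> 'r set" where
  "ideal_power R J 0 = carrier R"
| "ideal_power R J (Suc m) = ideal_prod R (ideal_power R J m) J"

definition admissible :: "('v, 'a) pre_digraph \<Rightarrow> (('v, 'a) qpath \<Rightarrow> 'k::field) set \<Rightarrow> bool" where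
  "admissible Q I \<longleftrightarrow> ideal I (path_algebra Q) \<and>
     (\<exists>m\<ge>2. ideal_power (path_algebra Q) (arrow_ideal Q) m \<subseteq> I) \<and>
     I \<subseteq> ideal_power (path_algebra Q) (arrow_ideal Q) 2"

definition quiver_algebra ::
  "('v, 'a) pre_digraph \<Rightarrow> (('v, 'a) qpath \<Rightarrow> 'k::field) set \<Rightarrow>
   ('k, (('v, 'a) qpath \<Rightarrow> 'k) set) module" where
  "quiver_algebra Q I = kquot (path_algebra Q) I"


section \<open>Quadratic string algebras\<close>

text \<open>
  For arrows \<open>\<alpha>\<close> and \<open>\<beta>\<close>, both predicates include that the path \<open>\<alpha>\<beta>\<close> exists: in the first case
  it lies in \<open>I\<close>, in the second it does not.
\<close>

definition zero_prod ::
  "('v, 'a) pre_digraph \<Rightarrow> (('v, 'a) qpath \<Rightarrow> 'k::field) set \<Rightarrow> 'a \<Rightarrow> 'a \<Rightarrow> bool" where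
  "zero_prod Q I \<alpha> \<beta> \<longleftrightarrow> \<alpha> \<in> arcs Q \<and> \<beta> \<in> arcs Q \<and> head Q \<alpha> = tail Q \<beta> \<and>
     basis_vec (tail Q \<alpha>, [\<alpha>, \<beta>]) \<in> I"

definition nonzero_prod ::
  "('v, 'a) pre_digraph \<Rightarrow> (('v, 'a) qpath \<Rightarrow> 'k::field) set \<Rightarrow> 'a \<Rightarrow> 'a \<Rightarrow> bool" where
  "nonzero_prod Q I \<alpha> \<beta> \<longleftrightarrow> \<alpha> \<in> arcs Q \<and> \<beta> \<in> arcs Q \<and> head Q \<alpha> = tail Q \<beta> \<and>
     basis_vec (tail Q \<alpha>, [\<alpha>, \<beta>]) \<notin> I"

locale quadratic_string_algebra = fin_digraph Q
  for Q :: "('v, 'a) pre_digraph" +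
  fixes I :: "(('v, 'a) qpath \<Rightarrow> 'k::alg_closed_field) set"
  assumes connected: "Digraph_Component.connected Q"
    and admissible: "admissible Q I"
    and quadratic: "\<exists>R \<subseteq> {p \<in> paths Q. length (snd p) = 2}.
                      I = Idl\<^bsub>path_algebra Q\<^esub> (basis_vec ` R)"
    and S1: "\<And>v. v \<in> verts Q \<Longrightarrow> out_degree Q v \<le> 2 \<and> in_degree Q v \<le> 2"
    and S2: "\<And>\<alpha>. \<alpha> \<in> arcs Q \<Longrightarrow>
               card {\<beta>. nonzero_prod Q I \<alpha> \<beta>} \<le> 1 \<and> card {\<gamma>. nonzero_prod Q I \<gamma> \<alpha>} \<le> 1"


section \<open>Combinatorics of pairs of parallel paths\<close>

definition nonzero_paths ::
  "('v, 'a) pre_digraph \<Rightarrow> (('v, 'a) qpath \<Rightarrow> 'k::field) set \<Rightarrow> ('v, 'a) qpath set" where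
  "nonzero_paths Q I = {p \<in> paths Q. basis_vec p \<notin> I}"

text \<open>Only used for \<open>n \<ge> 1\<close>; for \<open>n = 1\<close> this is the set of arrows.\<close>

definition AP ::
  "('v, 'a) pre_digraph \<Rightarrow> (('v, 'a) qpath \<Rightarrow> 'k::field) set \<Rightarrow> nat \<Rightarrow> ('v, 'a) qpath set" where
  "AP Q I n = {(u, p). (u, p) \<in> paths Q \<and> length p = n \<and>
     (\<forall>i. Suc i < n \<longrightarrow> zero_prod Q I (p ! i) (p ! Suc i))}"

type_synonym ('v, 'a) qpair = "('v, 'a) qpath \<times> ('v, 'a) qpath"

definition parallel ::
  "('v, 'a) pre_digraph \<Rightarrow> ('v, 'a) qpath set \<Rightarrow> ('v, 'a) qpath set \<Rightarrow> ('v, 'a) qpair set" where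
  "parallel Q X Y = {(\<rho>, \<gamma>). \<rho> \<in> X \<and> \<gamma> \<in> Y \<and> fst \<rho> = fst \<gamma> \<and> path_end Q \<rho> = path_end Q \<gamma>}"

text \<open>\<open>pairs_ab Q I a b n\<close> is the set \<open>(a, b)\<^sub>n\<close>.\<close>

definition pairs_ab ::
  "('v, 'a) pre_digraph \<Rightarrow> (('v, 'a) qpath \<Rightarrow> 'k::field) set \<Rightarrow> nat \<Rightarrow> nat \<Rightarrow> nat \<Rightarrow>
   ('v, 'a) qpair set" where
  "pairs_ab Q I a b n = {(\<rho>, \<gamma>) \<in> parallel Q (AP Q I n) (nonzero_paths Q I).
     a = of_bool (snd \<gamma> \<noteq> [] \<and> hd (snd \<gamma>) = hd (snd \<rho>)) \<and>
     b = of_bool (snd \<gamma> \<noteq> [] \<and> last (snd \<gamma>) = last (snd \<rho>))}"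

definition left_max ::
  "('v, 'a) pre_digraph \<Rightarrow> (('v, 'a) qpath \<Rightarrow> 'k::field) set \<Rightarrow>
   ('v, 'a) qpair set \<Rightarrow> ('v, 'a) qpair set" where
  "left_max Q I S = {(\<rho>, \<gamma>) \<in> S. \<not> (\<exists>\<beta>\<in>arcs Q. head Q \<beta> = fst \<gamma> \<and>
     (tail Q \<beta>, \<beta> # snd \<gamma>) \<in> nonzero_paths Q I)}"

definition right_max ::
  "('v, 'a) pre_digraph \<Rightarrow> (('v, 'a) qpath \<Rightarrow> 'k::field) set \<Rightarrow>
   ('v, 'a) qpair set \<Rightarrow> ('v, 'a) qpair set" where
  "right_max Q I S = {(\<rho>, \<gamma>) \<in> S. \<not> (\<exists>\<beta>\<in>arcs Q. tail Q \<beta> = path_end Q \<gamma> \<and>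
     (fst \<gamma>, snd \<gamma> @ [\<beta>]) \<in> nonzero_paths Q I)}"

definition complete_pairs ::
  "('v, 'a) pre_digraph \<Rightarrow> (('v, 'a) qpath \<Rightarrow> 'k::field) set \<Rightarrow> nat \<Rightarrow> ('v, 'a) qpair set" where
  "complete_pairs Q I n = {(\<rho>, \<gamma>) \<in> parallel Q (AP Q I n) (trivial_paths Q).
     zero_prod Q I (last (snd \<rho>)) (hd (snd \<rho>))}"

definition incomplete_pairs ::
  "('v, 'a) pre_digraph \<Rightarrow> (('v, 'a) qpath \<Rightarrow> 'k::field) set \<Rightarrow> nat \<Rightarrow> ('v, 'a) qpair set" where
  "incomplete_pairs Q I n = {(\<rho>, \<gamma>) \<in> parallel Q (AP Q I n) (trivial_paths Q).
     nonzero_prod Q I (last (snd \<rho>)) (hd (snd \<rho>))}"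

definition tau :: "('v, 'a) pre_digraph \<Rightarrow> ('v, 'a) qpair \<Rightarrow> ('v, 'a) qpair" where
  "tau Q w = (case w of ((u, p), \<gamma>) \<Rightarrow>
     ((tail Q (last p), last p # butlast p), (tail Q (last p), [])))"

text \<open>The inverse of \<open>\<tau>\<close> is taken in the set of complete pairs, which \<open>\<tau>\<close> permutes.\<close>

definition tau_power ::
  "('v, 'a) pre_digraph \<Rightarrow> (('v, 'a) qpath \<Rightarrow> 'k::field) set \<Rightarrow> nat \<Rightarrow> int \<Rightarrow>
   ('v, 'a) qpair \<Rightarrow> ('v, 'a) qpair" where
  "tau_power Q I n m w =
     (if m \<ge> 0 then (tau Q ^^ nat m) w
      else (inv_into (complete_pairs Q I n) (tau Q) ^^ nat (- m)) w)"

definition complete_pairs_0 ::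
  "('v, 'a) pre_digraph \<Rightarrow> (('v, 'a) qpath \<Rightarrow> 'k::field) set \<Rightarrow> nat \<Rightarrow> ('v, 'a) qpair set" where
  "complete_pairs_0 Q I n = {(\<rho>, \<gamma>) \<in> complete_pairs Q I n.
     \<not> (\<exists>\<delta>. \<delta> \<noteq> last (snd \<rho>) \<and> zero_prod Q I \<delta> (hd (snd \<rho>))) \<and>
     \<not> (\<exists>\<beta>. \<beta> \<noteq> hd (snd \<rho>) \<and> zero_prod Q I (last (snd \<rho>)) \<beta>)}"

definition gentle_pairs ::
  "('v, 'a) pre_digraph \<Rightarrow> (('v, 'a) qpath \<Rightarrow> 'k::field) set \<Rightarrow> nat \<Rightarrow> ('v, 'a) qpair set" where
  "gentle_pairs Q I n = {w \<in> complete_pairs Q I n.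
     \<forall>m. tau_power Q I n m w \<in> complete_pairs_0 Q I n}"

definition empty_pairs ::
  "('v, 'a) pre_digraph \<Rightarrow> (('v, 'a) qpath \<Rightarrow> 'k::field) set \<Rightarrow> nat \<Rightarrow> ('v, 'a) qpair set" where
  "empty_pairs Q I n = {(\<rho>, \<gamma>) \<in> incomplete_pairs Q I n.
     \<not> (\<exists>\<beta> \<delta>. head Q \<beta> = fst \<rho> \<and> tail Q \<delta> = fst \<rho> \<and> zero_prod Q I \<beta> \<delta>)}"

definition nonempty_pairs ::
  "('v, 'a) pre_digraph \<Rightarrow> (('v, 'a) qpath \<Rightarrow> 'k::field) set \<Rightarrow> nat \<Rightarrow> ('v, 'a) qpair set" where
  "nonempty_pairs Q I n = incomplete_pairs Q I n - empty_pairs Q I n"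

text \<open>
  \<open>\<tau>\<close> extended linearly to the space with basis the gentle pairs: the coefficient of \<open>\<tau> f\<close> at \<open>w\<close>
  is the sum of the coefficients of \<open>f\<close> at the gentle pairs sent to \<open>w\<close>.
\<close>

definition tau_lin ::
  "('v, 'a) pre_digraph \<Rightarrow> (('v, 'a) qpath \<Rightarrow> 'k::field) set \<Rightarrow> nat \<Rightarrow>
   (('v, 'a) qpair \<Rightarrow> 'k) \<Rightarrow> (('v, 'a) qpair \<Rightarrow> 'k)" where
  "tau_lin Q I n f = (\<lambda>w. \<Sum>w' \<in> {w' \<in> gentle_pairs Q I n. tau Q w' = w}. f w')"

definition gentle_coinvariants ::
  "('v, 'a) pre_digraph \<Rightarrow> (('v, 'a) qpath \<Rightarrow> 'k::field) set \<Rightarrow> nat \<Rightarrow>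
   ('k, (('v, 'a) qpair \<Rightarrow> 'k) set) module" where
  "gentle_coinvariants Q I n =
     kquot (free_space (gentle_pairs Q I n))
       ((\<lambda>f w. f w - tau_lin Q I n f w) ` carrier (free_space (gentle_pairs Q I n)))"

definition c_number ::
  "('v, 'a) pre_digraph \<Rightarrow> (('v, 'a) qpath \<Rightarrow> 'k::field) set \<Rightarrow> nat \<Rightarrow> nat" where
  "c_number Q I n =
     (if CHAR('k) = 2 then kdim (gentle_coinvariants Q I n) + kdim (gentle_coinvariants Q I (n - 1))
      else if even n then kdim (gentle_coinvariants Q I n)
      else kdim (gentle_coinvariants Q I (n - 1)))"

end

theory Submission
  imports Defs "HOL-Library.Function_Algebras"
begin

text \<open>
  The ideal has a basis of paths, so \<open>A\<close> has the paths without a factor of the form \<open>\<alpha>\<beta> \<in> I\<close> as a basis and is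
  Koszul: the bimodules \<open>A \<otimes> k AP\<^sub>n \<otimes> A\<close>, tensored over the vertices, resolve \<open>A\<close>.  They are only needed
  as one resolution homotopy equivalent to any given projective one.
  Homomorphisms from them into \<open>A\<close> are functions on \<open>(AP\<^sub>n//P)\<close>, and the differential evaluates
  at \<open>(\<alpha>\<^sub>1\<dots>\<alpha>\<^sub>n, \<gamma>)\<close> the two pairs obtained by cancelling a common first, respectively last, arrow.

  The coordinates of a cocycle \<open>c\<close> of degree \<open>n\<close> are almost independent: by (S2) a pair with nontrivial
  \<open>\<gamma>\<close> occurs in at most two equations, and a cocycle is determined by its arbitrary values on an explicit set of
  pairs, consisting of all \<open>(1,a)\<^sub>n\<close>, the left maximal \<open>(0,1)\<^sub>n\<close>, the maximal \<open>(0,0)\<^sub>n\<close>, the empty pairs and,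
  since the equations force \<open>c(\<tau>\<inverse> w) = (-1)\<^sup>n c(w)\<close> on complete pairs, one pair per gentle orbit if
  \<open>n\<close> is even or the characteristic is 2.  The dimension of the coboundaries follows by rank and nullity,
  and cancelling arrows gives bijections between the remaining pairs of degrees \<open>n - 1\<close> and \<open>n\<close>.
\<close>

section \<open>Bimodules and their homomorphisms\<close>

text \<open>The given resolution is arbitrary, and its projectivity is tested on bimodules over one
  type only. Maps out of the Koszul bimodules exist towards every type because these are free; maps
  into them need an embedding into the test type. This is why the comparison is set up by hand in
  both directions.

  The dimension is \<open>card (kernel_coords n) + card (kernel_coords (n - 1)) - card (S (n -
  1))\<close>, where \<open>S\<close> collects all pairs, and the formula is what survives in this
  count. Coordinates of degree \<open>n\<close> sharing an end arrow and having
  \<open>\<gamma>\<close> of length at least two are matched with pairs of degree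
  \<open>n - 1\<close> whose \<open>\<gamma>\<close> can be prolonged, so only those with
  \<open>\<gamma>\<close> an arrow remain. Among these, the ones agreeing at both ends are matched
  with the complete pairs. Cocycles vanish on nonempty incomplete pairs, which are thus counted in
  \<open>S (n - 1)\<close> only: this is the negative term. Gentle orbits enter through the cocycles
  of degree \<open>n\<close> and of degree \<open>n - 1\<close>, each subject to the parity
  condition, and this gives the cases of \<open>c_n\<close>.\<close>

lemma vectorspace_class_ringI:
  fixes M :: "('k::field, 'x, 'z) module_scheme"
  assumes "\<And>x y. \<lbrakk>x \<in> carrier M; y \<in> carrier M\<rbrakk> \<Longrightarrow> x \<oplus>\<^bsub>M\<^esub> y \<in> carrier M"
    and "\<zero>\<^bsub>M\<^esub> \<in> carrier M"
    and "\<And>x y z. \<lbrakk>x \<in> carrier M; y \<in> carrier M; z \<in> carrier M\<rbrakk> \<Longrightarrow>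
           (x \<oplus>\<^bsub>M\<^esub> y) \<oplus>\<^bsub>M\<^esub> z = x \<oplus>\<^bsub>M\<^esub> (y \<oplus>\<^bsub>M\<^esub> z)"
    and "\<And>x y. \<lbrakk>x \<in> carrier M; y \<in> carrier M\<rbrakk> \<Longrightarrow> x \<oplus>\<^bsub>M\<^esub> y = y \<oplus>\<^bsub>M\<^esub> x"
    and "\<And>x. x \<in> carrier M \<Longrightarrow> \<zero>\<^bsub>M\<^esub> \<oplus>\<^bsub>M\<^esub> x = x"
    and "\<And>c x. x \<in> carrier M \<Longrightarrow> c \<odot>\<^bsub>M\<^esub> x \<in> carrier M"
    and "\<And>c c' x. x \<in> carrier M \<Longrightarrow> (c + c') \<odot>\<^bsub>M\<^esub> x = c \<odot>\<^bsub>M\<^esub> x \<oplus>\<^bsub>M\<^esub> c' \<odot>\<^bsub>M\<^esub> x"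
    and "\<And>c x y. \<lbrakk>x \<in> carrier M; y \<in> carrier M\<rbrakk> \<Longrightarrow>
           c \<odot>\<^bsub>M\<^esub> (x \<oplus>\<^bsub>M\<^esub> y) = c \<odot>\<^bsub>M\<^esub> x \<oplus>\<^bsub>M\<^esub> c \<odot>\<^bsub>M\<^esub> y"
    and "\<And>c c' x. x \<in> carrier M \<Longrightarrow> (c * c') \<odot>\<^bsub>M\<^esub> x = c \<odot>\<^bsub>M\<^esub> (c' \<odot>\<^bsub>M\<^esub> x)"
    and "\<And>x. x \<in> carrier M \<Longrightarrow> 1 \<odot>\<^bsub>M\<^esub> x = x"
    and "\<And>x. x \<in> carrier M \<Longrightarrow> 0 \<odot>\<^bsub>M\<^esub> x = \<zero>\<^bsub>M\<^esub>"
  shows "vectorspace class_ring M"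
proof -
  have "abelian_group M"
  proof (rule abelian_groupI)
    fix x assume x: "x \<in> carrier M"
    have "(- 1) \<odot>\<^bsub>M\<^esub> x \<oplus>\<^bsub>M\<^esub> x = \<zero>\<^bsub>M\<^esub>"
      using assms(7)[OF x, of "-1" 1] assms(10)[OF x] assms(11)[OF x] by simp
    then show "\<exists>y\<in>carrier M. y \<oplus>\<^bsub>M\<^esub> x = \<zero>\<^bsub>M\<^esub>" using assms(6)[OF x] by blast
  qed (use assms in auto)
  then have "Module.module class_ring M"
    by (rule moduleI[OF class_cring.is_cring]) (use assms in auto)
  then show ?thesis by (simp add: vectorspace_def class_field)
qed

context bimodule begin

sublocale V: vectorspace class_ring M
  by (rule vectorspace)

lemma smult_closed' [simp]: "x \<in> carrier M \<Longrightarrow> c \<odot>\<^bsub>M\<^esub> x \<in> carrier M"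
  using V.smult_closed[of c x] by simp

lemma smult_0 [simp]: "x \<in> carrier M \<Longrightarrow> 0 \<odot>\<^bsub>M\<^esub> x = \<zero>\<^bsub>M\<^esub>"
  using V.smult_l_null[of x] by simp

lemma smult_zero [simp]: "c \<odot>\<^bsub>M\<^esub> \<zero>\<^bsub>M\<^esub> = \<zero>\<^bsub>M\<^esub>"
  using V.smult_r_null[of c] by simp

lemma smult_1 [simp]: "x \<in> carrier M \<Longrightarrow> 1 \<odot>\<^bsub>M\<^esub> x = x"
  using V.smult_one[of x] by simp

lemma smult_add_l: "x \<in> carrier M \<Longrightarrow> (c + c') \<odot>\<^bsub>M\<^esub> x = c \<odot>\<^bsub>M\<^esub> x \<oplus>\<^bsub>M\<^esub> c' \<odot>\<^bsub>M\<^esub> x"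
  using V.smult_l_distr[of c c' x] by simp

lemma smult_add_r: "\<lbrakk>x \<in> carrier M; y \<in> carrier M\<rbrakk> \<Longrightarrow>
    c \<odot>\<^bsub>M\<^esub> (x \<oplus>\<^bsub>M\<^esub> y) = c \<odot>\<^bsub>M\<^esub> x \<oplus>\<^bsub>M\<^esub> c \<odot>\<^bsub>M\<^esub> y"
  using V.smult_r_distr[of c x y] by simp

lemma smult_smult: "x \<in> carrier M \<Longrightarrow> c \<odot>\<^bsub>M\<^esub> (c' \<odot>\<^bsub>M\<^esub> x) = (c * c') \<odot>\<^bsub>M\<^esub> x"
  using V.smult_assoc1[of c c' x] by simp

lemma smult_minus_1: "x \<in> carrier M \<Longrightarrow> (- 1) \<odot>\<^bsub>M\<^esub> x = \<ominus>\<^bsub>M\<^esub> x"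
  using V.smult_l_minus[of 1 x] by (simp add: class_ring_simps)

lemma lact_zero [simp]: "a \<in> carrier A \<Longrightarrow> lact M a \<zero>\<^bsub>M\<^esub> = \<zero>\<^bsub>M\<^esub>"
  using lact_add_right[of a "\<zero>\<^bsub>M\<^esub>" "\<zero>\<^bsub>M\<^esub>"] lact_closed[of a "\<zero>\<^bsub>M\<^esub>"]
  by (simp add: V.M.add.r_cancel_one')

lemma ract_zero [simp]: "a \<in> carrier A \<Longrightarrow> ract M \<zero>\<^bsub>M\<^esub> a = \<zero>\<^bsub>M\<^esub>"
  using ract_add_left[of "\<zero>\<^bsub>M\<^esub>" "\<zero>\<^bsub>M\<^esub>" a] ract_closed[of "\<zero>\<^bsub>M\<^esub>" a]
  by (simp add: V.M.add.r_cancel_one')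

end

locale kalgebra =
  fixes A :: "('k::field, 'r) module"
  assumes ring: "ring A" and vs: "vectorspace class_ring A"
    and smult_mult: "\<lbrakk>a \<in> carrier A; b \<in> carrier A\<rbrakk> \<Longrightarrow>
          (c \<odot>\<^bsub>A\<^esub> a) \<otimes>\<^bsub>A\<^esub> b = c \<odot>\<^bsub>A\<^esub> (a \<otimes>\<^bsub>A\<^esub> b)"
    and mult_smult: "\<lbrakk>a \<in> carrier A; b \<in> carrier A\<rbrakk> \<Longrightarrow>
          a \<otimes>\<^bsub>A\<^esub> (c \<odot>\<^bsub>A\<^esub> b) = c \<odot>\<^bsub>A\<^esub> (a \<otimes>\<^bsub>A\<^esub> b)"
begin

sublocale A: ring A
  by (rule ring)

sublocale AV: vectorspace class_ring A
  by (rule vs)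

lemma A_smult_closed [simp]: "a \<in> carrier A \<Longrightarrow> c \<odot>\<^bsub>A\<^esub> a \<in> carrier A"
  using AV.smult_closed[of c a] by simp

lemma bimodule_regular: "bimodule A (regular_bimodule A)"
proof (rule bimodule.intro)
  show "vectorspace class_ring (regular_bimodule A)"
    using AV.smult_l_distr AV.smult_r_distr AV.smult_assoc1 AV.smult_one AV.smult_l_null
    by (intro vectorspace_class_ringI)
       (auto simp: regular_bimodule_def module.defs bimod.defs A.a_ac)
qed (simp_all add: regular_bimodule_def module.defs bimod.defs A.l_distr A.r_distr
      smult_mult mult_smult A.m_assoc)

lemma hom_closed: "\<lbrakk>f \<in> bimod_hom A M N; x \<in> carrier M\<rbrakk> \<Longrightarrow> f x \<in> carrier N"
  by (auto simp: bimod_hom_def)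

lemma hom_add: "\<lbrakk>f \<in> bimod_hom A M N; x \<in> carrier M; y \<in> carrier M\<rbrakk> \<Longrightarrow>
    f (x \<oplus>\<^bsub>M\<^esub> y) = f x \<oplus>\<^bsub>N\<^esub> f y"
  by (auto simp: bimod_hom_def)

lemma hom_lact: "\<lbrakk>f \<in> bimod_hom A M N; a \<in> carrier A; x \<in> carrier M\<rbrakk> \<Longrightarrow>
    f (lact M a x) = lact N a (f x)"
  by (auto simp: bimod_hom_def)

lemma hom_ract: "\<lbrakk>f \<in> bimod_hom A M N; a \<in> carrier A; x \<in> carrier M\<rbrakk> \<Longrightarrow>
    f (ract M x a) = ract N (f x) a"
  by (auto simp: bimod_hom_def)

lemma hom_eqI: "\<lbrakk>f \<in> bimod_hom A M N; g \<in> bimod_hom A M N'; \<And>x. x \<in> carrier M \<Longrightarrow> f x = g x\<rbrakk> \<Longrightarrow> f = g"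
  by (auto simp: bimod_hom_def PiE_def intro: extensionalityI)

lemma hom_zero:
  assumes "bimodule A M" "bimodule A N" "f \<in> bimod_hom A M N"
  shows "f \<zero>\<^bsub>M\<^esub> = \<zero>\<^bsub>N\<^esub>"
proof -
  interpret M: bimodule A M by fact
  interpret N: bimodule A N by fact
  have "f \<zero>\<^bsub>M\<^esub> \<oplus>\<^bsub>N\<^esub> f \<zero>\<^bsub>M\<^esub> = f \<zero>\<^bsub>M\<^esub>"
    using hom_add[OF assms(3), of "\<zero>\<^bsub>M\<^esub>" "\<zero>\<^bsub>M\<^esub>"] by simp
  then show ?thesis using hom_closed[OF assms(3), of "\<zero>\<^bsub>M\<^esub>"]
    by (simp add: N.V.M.add.r_cancel_one')
qed

text \<open>The scalar \<open>c\<close> acts as the algebra element \<open>c \<odot> \<one>\<close>,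
  so compatibility with the left action suffices.\<close>

lemma hom_smult:
  assumes "bimodule A M" "bimodule A N" "f \<in> bimod_hom A M N" "x \<in> carrier M"
  shows "f (c \<odot>\<^bsub>M\<^esub> x) = c \<odot>\<^bsub>N\<^esub> f x"
proof -
  interpret M: bimodule A M by fact
  interpret N: bimodule A N by fact
  have "lact M (c \<odot>\<^bsub>A\<^esub> \<one>\<^bsub>A\<^esub>) x = c \<odot>\<^bsub>M\<^esub> x"
    using assms by (simp add: M.lact_smult M.lact_one)
  moreover have "lact N (c \<odot>\<^bsub>A\<^esub> \<one>\<^bsub>A\<^esub>) (f x) = c \<odot>\<^bsub>N\<^esub> f x"
    using assms hom_closed[OF assms(3,4)] by (simp add: N.lact_smult N.lact_one)
  ultimately show ?thesis using hom_lact[OF assms(3) _ assms(4), of "c \<odot>\<^bsub>A\<^esub> \<one>\<^bsub>A\<^esub>"] by simp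
qed

lemma hom_minus:
  assumes "bimodule A M" "bimodule A N" "f \<in> bimod_hom A M N" "x \<in> carrier M"
  shows "f (\<ominus>\<^bsub>M\<^esub> x) = \<ominus>\<^bsub>N\<^esub> f x"
proof -
  interpret M: bimodule A M by fact
  interpret N: bimodule A N by fact
  show ?thesis using hom_smult[OF assms, of "-1"] assms(4) hom_closed[OF assms(3,4)]
    by (simp add: M.smult_minus_1 N.smult_minus_1)
qed

lemma hom_diff:
  assumes "bimodule A M" "bimodule A N" "f \<in> bimod_hom A M N" "x \<in> carrier M" "y \<in> carrier M"
  shows "f (x \<ominus>\<^bsub>M\<^esub> y) = f x \<ominus>\<^bsub>N\<^esub> f y"
proof -
  interpret M: bimodule A M by fact
  show ?thesis using assms hom_minus[OF assms(1,2,3,5)] by (simp add: a_minus_def hom_add)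
qed

lemma hom_compose:
  assumes "f \<in> bimod_hom A M N" "g \<in> bimod_hom A N L" "bimodule A M"
  shows "compose (carrier M) g f \<in> bimod_hom A M L"
proof -
  interpret M: bimodule A M by fact
  show ?thesis using assms(1,2)
    by (auto simp: bimod_hom_def compose_def M.lact_closed M.ract_closed Pi_iff PiE_def)
qed

lemma hom_add_fun:
  assumes "bimodule A M" "bimodule A N" "f \<in> bimod_hom A M N" "g \<in> bimod_hom A M N"
  shows "(\<lambda>x\<in>carrier M. f x \<oplus>\<^bsub>N\<^esub> g x) \<in> bimod_hom A M N"
proof -
  interpret M: bimodule A M by fact
  interpret N: bimodule A N by fact
  note c = hom_closed[OF assms(3)] hom_closed[OF assms(4)]
  show ?thesis unfolding bimod_hom_def
    using assms(3,4) by (auto simp: c M.lact_closed M.ract_closed hom_add hom_lact hom_ract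
       N.lact_add_right N.ract_add_left N.V.M.a_ac)
qed

text \<open>Both actions of \<open>c \<odot> \<one>\<close> are multiplication by \<open>c\<close>,
  and this element is central in \<open>A\<close>; hence scalars can be pulled out of both actions
  in their module argument, which is what makes the multiple of a homomorphism a
  homomorphism.\<close>

lemma hom_smult_fun:
  assumes "bimodule A M" "bimodule A N" "f \<in> bimod_hom A M N"
  shows "(\<lambda>x\<in>carrier M. c \<odot>\<^bsub>N\<^esub> f x) \<in> bimod_hom A M N"
proof -
  interpret M: bimodule A M by fact
  interpret N: bimodule A N by fact
  have "lact N a (c \<odot>\<^bsub>N\<^esub> y) = c \<odot>\<^bsub>N\<^esub> lact N a y" "ract N (c \<odot>\<^bsub>N\<^esub> y) a = c \<odot>\<^bsub>N\<^esub> ract N y a"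
    if "a \<in> carrier A" "y \<in> carrier N" for a y
  proof -
    have e: "lact N (c \<odot>\<^bsub>A\<^esub> \<one>\<^bsub>A\<^esub>) y = c \<odot>\<^bsub>N\<^esub> y" "ract N y (c \<odot>\<^bsub>A\<^esub> \<one>\<^bsub>A\<^esub>) = c \<odot>\<^bsub>N\<^esub> y"
      using that by (simp_all add: N.lact_smult N.lact_one N.ract_smult N.ract_one)
    have c: "c \<odot>\<^bsub>A\<^esub> \<one>\<^bsub>A\<^esub> \<in> carrier A" by simp
    have "lact N a (c \<odot>\<^bsub>N\<^esub> y) = lact N (a \<otimes>\<^bsub>A\<^esub> (c \<odot>\<^bsub>A\<^esub> \<one>\<^bsub>A\<^esub>)) y"
      using that N.lact_mult[OF that(1) c that(2)] by (simp add: e)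
    also have "a \<otimes>\<^bsub>A\<^esub> (c \<odot>\<^bsub>A\<^esub> \<one>\<^bsub>A\<^esub>) = c \<odot>\<^bsub>A\<^esub> a" using that by (simp add: mult_smult)
    finally show "lact N a (c \<odot>\<^bsub>N\<^esub> y) = c \<odot>\<^bsub>N\<^esub> lact N a y" using that by (simp add: N.lact_smult)
    have "ract N (c \<odot>\<^bsub>N\<^esub> y) a = ract N y ((c \<odot>\<^bsub>A\<^esub> \<one>\<^bsub>A\<^esub>) \<otimes>\<^bsub>A\<^esub> a)"
      using that N.ract_mult[OF that(2) c that(1)] by (simp add: e)
    also have "(c \<odot>\<^bsub>A\<^esub> \<one>\<^bsub>A\<^esub>) \<otimes>\<^bsub>A\<^esub> a = c \<odot>\<^bsub>A\<^esub> a" using that by (simp add: smult_mult)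
    finally show "ract N (c \<odot>\<^bsub>N\<^esub> y) a = c \<odot>\<^bsub>N\<^esub> ract N y a" using that by (simp add: N.ract_smult)
  qed
  then show ?thesis unfolding bimod_hom_def using assms(3) hom_closed[OF assms(3)]
    by (auto simp: M.lact_closed M.ract_closed hom_add hom_lact hom_ract N.smult_add_r)
qed

lemma hom_diff_fun:
  assumes "bimodule A M" "bimodule A N" "f \<in> bimod_hom A M N" "g \<in> bimod_hom A M N"
  shows "(\<lambda>x\<in>carrier M. f x \<ominus>\<^bsub>N\<^esub> g x) \<in> bimod_hom A M N"
proof -
  interpret N: bimodule A N by fact
  have "(\<lambda>x\<in>carrier M. f x \<ominus>\<^bsub>N\<^esub> g x) =
     (\<lambda>x\<in>carrier M. f x \<oplus>\<^bsub>N\<^esub> (\<lambda>x\<in>carrier M. (-1) \<odot>\<^bsub>N\<^esub> g x) x)"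
    by (auto simp: fun_eq_iff restrict_def a_minus_def N.smult_minus_1 hom_closed[OF assms(4)])
  then show ?thesis using hom_add_fun[OF assms(1,2,3) hom_smult_fun[OF assms(1,2,4)]] by metis
qed

lemma hom_id: "bimodule A M \<Longrightarrow> (\<lambda>x\<in>carrier M. x) \<in> bimod_hom A M M"
proof -
  assume "bimodule A M"
  then interpret M: bimodule A M .
  show ?thesis by (auto simp: bimod_hom_def M.lact_closed M.ract_closed)
qed

end

text \<open>A lifting property in which \<open>d\<close> need not be surjective: only maps
  \<open>f\<close> into its image are lifted. This is the form used step by step along a resolution,
  and it is shared by free and by projective sources, for which it is proved in different
  ways.\<close>

definition lifts ::
  "('k::field, 'r) module \<Rightarrow> ('k, 'r, 'x) bimod \<Rightarrow> ('k, 'r, 'm) bimod \<Rightarrow> ('k, 'r, 'n) bimod \<Rightarrow>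
   ('m \<Rightarrow> 'n) \<Rightarrow> bool" where
  "lifts A X M N d \<longleftrightarrow> (\<forall>f\<in>bimod_hom A X N. f ` carrier X \<subseteq> d ` carrier M \<longrightarrow>
     (\<exists>h\<in>bimod_hom A X M. \<forall>x\<in>carrier X. d (h x) = f x))"

text \<open>
  Projectivity quantifies over bimodules of one type only; other bimodules are moved there along an
  injection of their carriers.
\<close>

definition transport_bimod :: "('m \<Rightarrow> 'n) \<Rightarrow> ('k, 'r, 'm) bimod \<Rightarrow> ('k, 'r, 'n) bimod" where
  "transport_bimod i M = (let j = inv_into (carrier M) i in
     \<lparr>carrier = i ` carrier M, monoid.mult = undefined, one = undefined,
      zero = i \<zero>\<^bsub>M\<^esub>, add = (\<lambda>x y. i (j x \<oplus>\<^bsub>M\<^esub> j y)), smult = (\<lambda>c x. i (c \<odot>\<^bsub>M\<^esub> j x)),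
      lact = (\<lambda>a x. i (lact M a (j x))), ract = (\<lambda>x a. i (ract M (j x) a))\<rparr>)"

lemma bimodule_transport:
  assumes "bimodule A M" "inj_on i (carrier M)"
  shows "bimodule A (transport_bimod i M)"
proof -
  interpret M: bimodule A M by fact
  note inv_into_f_f[OF assms(2), simp]
  show ?thesis
  proof (rule bimodule.intro)
    show "vectorspace class_ring (transport_bimod i M)"
      by (rule vectorspace_class_ringI)
         (auto simp: transport_bimod_def Let_def M.V.M.a_ac M.smult_add_l M.smult_add_r M.smult_smult)
  qed (auto simp: transport_bimod_def Let_def M.lact_closed M.ract_closed M.lact_add_left M.lact_add_right
        M.ract_add_left M.ract_add_right M.lact_smult M.ract_smult M.lact_mult M.ract_mult M.lact_ract
        M.lact_one M.ract_one)
qed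

lemma transport_hom:
  assumes "bimodule A M" "inj_on i (carrier M)"
  shows "(\<lambda>x\<in>carrier M. i x) \<in> bimod_hom A M (transport_bimod i M)"
    and "(\<lambda>y\<in>carrier (transport_bimod i M). inv_into (carrier M) i y)
           \<in> bimod_hom A (transport_bimod i M) M"
proof -
  interpret M: bimodule A M by fact
  note inv_into_f_f[OF assms(2), simp]
  show "(\<lambda>x\<in>carrier M. i x) \<in> bimod_hom A M (transport_bimod i M)"
    by (auto simp: bimod_hom_def transport_bimod_def Let_def M.lact_closed M.ract_closed)
  show "(\<lambda>y\<in>carrier (transport_bimod i M). inv_into (carrier M) i y)
           \<in> bimod_hom A (transport_bimod i M) M"
    by (auto simp: bimod_hom_def transport_bimod_def Let_def M.lact_closed M.ract_closed)
qed

context kalgebra begin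

text \<open>Replacing the target by the image makes \<open>d\<close> surjective, as the definition
  of projectivity requires.\<close>

lemma bimodule_image:
  assumes "bimodule A M" "bimodule A N" "d \<in> bimod_hom A M N"
  shows "bimodule A (N\<lparr>carrier := d ` carrier M\<rparr>)"
proof -
  interpret M: bimodule A M by fact
  interpret N: bimodule A N by fact
  have sub: "d ` carrier M \<subseteq> carrier N" using hom_closed[OF assms(3)] by blast
  then have [simp]: "y \<in> carrier N" if "y \<in> d ` carrier M" for y using that by blast
  have add: "x \<oplus>\<^bsub>N\<^esub> y \<in> d ` carrier M" if "x \<in> d ` carrier M" "y \<in> d ` carrier M" for x y
    using that by (auto simp flip: hom_add[OF assms(3)])
  have zero: "\<zero>\<^bsub>N\<^esub> \<in> d ` carrier M"
    by (simp flip: hom_zero[OF assms])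
  have smult: "c \<odot>\<^bsub>N\<^esub> x \<in> d ` carrier M" if "x \<in> d ` carrier M" for x c
    using that by (auto simp flip: hom_smult[OF assms])
  have lact: "lact N a x \<in> d ` carrier M" if "x \<in> d ` carrier M" "a \<in> carrier A" for x a
    using that by (auto simp flip: hom_lact[OF assms(3)] simp: M.lact_closed)
  have ract: "ract N x a \<in> d ` carrier M" if "x \<in> d ` carrier M" "a \<in> carrier A" for x a
    using that by (auto simp flip: hom_ract[OF assms(3)] simp: M.ract_closed)
  show ?thesis
  proof (rule bimodule.intro)
    show "vectorspace class_ring (N\<lparr>carrier := d ` carrier M\<rparr>)"
      by (rule vectorspace_class_ringI)
         (simp_all add: add zero smult N.V.M.a_ac N.smult_add_l N.smult_add_r N.smult_smult)
  qed (simp_all add: lact ract N.lact_add_left N.lact_add_right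
        N.ract_add_left N.ract_add_right N.lact_smult N.ract_smult N.lact_mult N.ract_mult N.lact_ract
        N.lact_one N.ract_one)
qed

text \<open>The target is cut down to the image of \<open>d\<close>, and both bimodules are moved
  into the test type along \<open>i\<close> and \<open>j\<close>. There projectivity applies, and
  the lift is carried back along the inverse of \<open>i\<close>.\<close>

lemma projective_lifts:
  fixes P :: "('k, 'r, 'm) bimod" and M :: "('k, 'r, 'x) bimod" and N :: "('k, 'r, 'y) bimod"
    and i :: "'x \<Rightarrow> 'm \<times> 'r \<times> 'r \<Rightarrow> 'k" and j :: "'y \<Rightarrow> 'm \<times> 'r \<times> 'r \<Rightarrow> 'k"
  assumes "projective_bimodule A P" and M: "bimodule A M" and N: "bimodule A N"
    and d: "d \<in> bimod_hom A M N"
    and i: "inj_on i (carrier M)" and j: "inj_on j (carrier N)"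
  shows "lifts A P M N d"
  unfolding lifts_def
proof (intro ballI impI)
  fix f assume f: "f \<in> bimod_hom A P N" and im: "f ` carrier P \<subseteq> d ` carrier M"
  define N' where "N' = N\<lparr>carrier := d ` carrier M\<rparr>"
  have N': "bimodule A N'" unfolding N'_def by (rule bimodule_image[OF M N d])
  have P: "bimodule A P" using assms(1) by (simp add: projective_bimodule_def)
  have sub: "d ` carrier M \<subseteq> carrier N" using hom_closed[OF d] by blast
  have j': "inj_on j (carrier N')" using inj_on_subset[OF j sub] by (simp add: N'_def)
  have d': "d \<in> bimod_hom A M N'" and f': "f \<in> bimod_hom A P N'"
    using d f im by (auto simp: N'_def bimod_hom_def)
  let ?TM = "transport_bimod i M" and ?TN = "transport_bimod j N'"
  note iM = transport_hom[OF M i] and jN = transport_hom[OF N' j']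
  have TM: "bimodule A ?TM" by (rule bimodule_transport[OF M i])
  have TN: "bimodule A ?TN" by (rule bimodule_transport[OF N' j'])
  \<comment> \<open>This is \<open>j \<circ> d \<circ> i\<inverse>\<close>, the copy of
    \<open>d\<close> between the transported bimodules; it is surjective since the target is the
    copy of the image.\<close>
  define g where "g = compose (carrier ?TM) (\<lambda>x\<in>carrier N'. j x)
     (compose (carrier ?TM) d (\<lambda>y\<in>carrier ?TM. inv_into (carrier M) i y))"
  have g: "g \<in> bimod_hom A ?TM ?TN" unfolding g_def
    by (rule hom_compose[OF hom_compose[OF iM(2) d' TM] jN(1) TM])
  have cTM: "carrier ?TM = i ` carrier M" and cTN: "carrier ?TN = j ` carrier N'"
    and cN': "carrier N' = d ` carrier M"
    by (simp_all add: transport_bimod_def Let_def N'_def)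
  have gi: "g (i x) = j (d x)" if "x \<in> carrier M" for x
    using that by (simp add: g_def compose_def cTM cN' inv_into_f_f[OF i])
  have "g ` carrier ?TM = carrier ?TN"
    by (auto simp: cTM cTN cN' image_image gi cong: image_cong)
  moreover have fj: "compose (carrier P) (\<lambda>x\<in>carrier N'. j x) f \<in> bimod_hom A P ?TN"
    by (rule hom_compose[OF f' jN(1) P])
  ultimately obtain h where h: "h \<in> bimod_hom A P ?TM"
    and gh: "\<And>x. x \<in> carrier P \<Longrightarrow> g (h x) = compose (carrier P) (\<lambda>x\<in>carrier N'. j x) f x"
    using assms(1)[unfolded projective_bimodule_def, THEN conjunct2, rule_format, OF TM TN g] by metis
  let ?h = "compose (carrier P) (\<lambda>y\<in>carrier ?TM. inv_into (carrier M) i y) h"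
  have "?h \<in> bimod_hom A P M" by (rule hom_compose[OF h iM(2) P])
  moreover have "d (?h x) = f x" if x: "x \<in> carrier P" for x
  proof -
    have hx: "h x \<in> i ` carrier M" using hom_closed[OF h x] by (simp add: cTM)
    then obtain m where m: "m \<in> carrier M" "h x = i m" by blast
    have fx: "f x \<in> carrier N'" using hom_closed[OF f' x] .
    have dm: "d m \<in> carrier N'" using m by (simp add: cN')
    have "j (d m) = j (f x)" using gh[OF x] x m fx by (simp add: gi compose_def)
    then have "d m = f x" using j' fx dm by (simp add: inj_on_eq_iff)
    then show ?thesis using x m by (simp add: compose_def cTM inv_into_f_f[OF i])
  qed
  ultimately show "\<exists>h\<in>bimod_hom A P M. \<forall>x\<in>carrier P. d (h x) = f x" by blast
qed

end

section \<open>Comparison of resolutions\<close>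

text \<open>Complexes and resolutions are kept apart because a comparison map asks for exactness of
  its target only; from its source it needs a complex with liftings.\<close>

locale bimod_complex = kalgebra A
  for A :: "('k::field, 'r) module" +
  fixes N :: "('k, 'r, 'n) bimod" and X :: "nat \<Rightarrow> ('k, 'r, 'x) bimod"
    and d :: "nat \<Rightarrow> 'x \<Rightarrow> 'x" and e :: "'x \<Rightarrow> 'n"
  assumes N: "bimodule A N" and X: "bimodule A (X i)"
    and d: "d i \<in> bimod_hom A (X (Suc i)) (X i)"
    and e: "e \<in> bimod_hom A (X 0) N"
    and dd: "x \<in> carrier (X (Suc (Suc i))) \<Longrightarrow> d i (d (Suc i) x) = \<zero>\<^bsub>X i\<^esub>"
    and ed: "x \<in> carrier (X 1) \<Longrightarrow> e (d 0 x) = \<zero>\<^bsub>N\<^esub>"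

locale bimod_resolution = bimod_complex A N X d e
  for A :: "('k::field, 'r) module" and N :: "('k, 'r, 'n) bimod" and X :: "nat \<Rightarrow> ('k, 'r, 'x) bimod"
    and d :: "nat \<Rightarrow> 'x \<Rightarrow> 'x" and e :: "'x \<Rightarrow> 'n" +
  assumes e_surj: "y \<in> carrier N \<Longrightarrow> y \<in> e ` carrier (X 0)"
    and e_exact: "\<lbrakk>x \<in> carrier (X 0); e x = \<zero>\<^bsub>N\<^esub>\<rbrakk> \<Longrightarrow> x \<in> d 0 ` carrier (X 1)"
    and d_exact: "\<lbrakk>x \<in> carrier (X (Suc i)); d i x = \<zero>\<^bsub>X i\<^esub>\<rbrakk> \<Longrightarrow>
                    x \<in> d (Suc i) ` carrier (X (Suc (Suc i)))"

lemma bimod_resolution_of_projective: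
  assumes "kalgebra A" "bimodule A N" "projective_resolution A N P d e"
  shows "bimod_resolution A N P d e"
proof -
  interpret kalgebra A by fact
  note p = assms(3)[unfolded projective_resolution_def]
  show ?thesis
  proof (intro bimod_resolution.intro bimod_complex.intro bimod_complex_axioms.intro
      bimod_resolution_axioms.intro)
    fix i x y
    show "kalgebra A" "bimodule A N" by fact+
    show "bimodule A (P i)" using p by (simp add: projective_bimodule_def)
    show "d i \<in> bimod_hom A (P (Suc i)) (P i)" using p by simp
    show "e \<in> bimod_hom A (P 0) N" using p by simp
    have im: "d (Suc i) ` carrier (P (Suc (Suc i))) = {x \<in> carrier (P (Suc i)). d i x = \<zero>\<^bsub>P i\<^esub>}"
      "d 0 ` carrier (P 1) = {x \<in> carrier (P 0). e x = \<zero>\<^bsub>N\<^esub>}" "e ` carrier (P 0) = carrier N"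
      using p by simp_all
    show "x \<in> carrier (P (Suc (Suc i))) \<Longrightarrow> d i (d (Suc i) x) = \<zero>\<^bsub>P i\<^esub>" using im(1) by blast
    show "x \<in> carrier (P 1) \<Longrightarrow> e (d 0 x) = \<zero>\<^bsub>N\<^esub>" using im(2) by blast
    show "y \<in> carrier N \<Longrightarrow> y \<in> e ` carrier (P 0)" using im(3) by simp
    show "\<lbrakk>x \<in> carrier (P 0); e x = \<zero>\<^bsub>N\<^esub>\<rbrakk> \<Longrightarrow> x \<in> d 0 ` carrier (P 1)" using im(2) by simp
    show "\<lbrakk>x \<in> carrier (P (Suc i)); d i x = \<zero>\<^bsub>P i\<^esub>\<rbrakk> \<Longrightarrow>
        x \<in> d (Suc i) ` carrier (P (Suc (Suc i)))" using im(1) by simp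
  qed
qed

definition chain_map where
  "chain_map A N X dX eX Y dY eY f \<longleftrightarrow> (\<forall>i. f i \<in> bimod_hom A (X i) (Y i)) \<and>
     (\<forall>x\<in>carrier (X 0). eY (f 0 x) = eX x) \<and>
     (\<forall>i. \<forall>x\<in>carrier (X (Suc i)). dY i (f (Suc i) x) = f i (dX i x))"

lemma chain_map_exists:
  assumes X: "bimod_complex A N X dX eX" and Y: "bimod_resolution A N Y dY eY"
    and l0: "lifts A (X 0) (Y 0) N eY"
    and l: "\<And>i. lifts A (X (Suc i)) (Y (Suc i)) (Y i) (dY i)"
  shows "\<exists>f. chain_map A N X dX eX Y dY eY f"
proof -
  interpret X: bimod_complex A N X dX eX by fact
  interpret Y: bimod_resolution A N Y dY eY by fact
  let ?Q = "\<lambda>i f g. \<forall>x\<in>carrier (X (Suc i)). dY i (g x) = f (dX i x)"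
  \<comment> \<open>The invariant that keeps the recursion going: the next composite lands in the
    image of the differential of the target, so that it can be lifted once more.\<close>
  let ?E = "\<lambda>i f. \<forall>x\<in>carrier (X (Suc i)). f (dX i x) \<in> dY i ` carrier (Y (Suc i))"
  let ?R = "\<lambda>i f. f \<in> bimod_hom A (X i) (Y i) \<and> ?E i f \<and> (i = 0 \<longrightarrow> (\<forall>x\<in>carrier (X 0). eY (f x) = eX x))"
  have base: "\<exists>f. ?R 0 f"
  proof -
    have "eX ` carrier (X 0) \<subseteq> eY ` carrier (Y 0)"
      using X.hom_closed[OF X.e] Y.e_surj by blast
    then obtain f where f: "f \<in> bimod_hom A (X 0) (Y 0)" "\<forall>x\<in>carrier (X 0). eY (f x) = eX x"
      using l0 X.e unfolding lifts_def by blast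
    have "f (dX 0 x) \<in> dY 0 ` carrier (Y (Suc 0))" if "x \<in> carrier (X (Suc 0))" for x
      using X.hom_closed[OF X.d that] f X.ed that X.hom_closed[OF f(1)] Y.e_exact by fastforce
    then show ?thesis using f by blast
  qed
  have step: "\<exists>g. ?R (Suc i) g \<and> ?Q i f g" if R: "?R i f" for i f
  proof -
    have c: "compose (carrier (X (Suc i))) f (dX i) \<in> bimod_hom A (X (Suc i)) (Y i)"
      using R X.hom_compose[OF X.d _ X.X] by blast
    have "compose (carrier (X (Suc i))) f (dX i) ` carrier (X (Suc i)) \<subseteq> dY i ` carrier (Y (Suc i))"
      using R by (auto simp: compose_def)
    then obtain g where g: "g \<in> bimod_hom A (X (Suc i)) (Y (Suc i))"
      and gQ: "\<forall>x\<in>carrier (X (Suc i)). dY i (g x) = compose (carrier (X (Suc i))) f (dX i) x"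
      using l[of i] c unfolding lifts_def by blast
    have Q: "?Q i f g" using gQ by (simp add: compose_def)
    have "g (dX (Suc i) x) \<in> dY (Suc i) ` carrier (Y (Suc (Suc i)))" if x: "x \<in> carrier (X (Suc (Suc i)))"
      for x
    proof (rule Y.d_exact)
      have dx: "dX (Suc i) x \<in> carrier (X (Suc i))" using X.hom_closed[OF X.d x] .
      then show "g (dX (Suc i) x) \<in> carrier (Y (Suc i))" using X.hom_closed[OF g] by blast
      have "dY i (g (dX (Suc i) x)) = f (dX i (dX (Suc i) x))" using Q dx by blast
      also have "\<dots> = f \<zero>\<^bsub>X i\<^esub>" using X.dd[OF x] by simp
      also have "\<dots> = \<zero>\<^bsub>Y i\<^esub>" using R X.hom_zero[OF X.X Y.X] by blast
      finally show "dY i (g (dX (Suc i) x)) = \<zero>\<^bsub>Y i\<^esub>" .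
    qed
    then show ?thesis using g Q by blast
  qed
  have "\<exists>f. \<forall>i. ?R i (f i) \<and> ?Q i (f i) (f (Suc i))"
    by (rule dependent_nat_choice[of ?R ?Q]) (rule base, erule step)
  then obtain f where f': "\<forall>i. ?R i (f i) \<and> ?Q i (f i) (f (Suc i))" by (rule exE)
  have f: "?R i (f i)" "?Q i (f i) (f (Suc i))" for i
    by (rule conjunct1[OF spec[OF f', of i]], rule conjunct2[OF spec[OF f', of i]])
  have "f i \<in> bimod_hom A (X i) (Y i)" "x \<in> carrier (X 0) \<Longrightarrow> eY (f 0 x) = eX x" for i x
    using f(1)[of i] f(1)[of 0] by simp_all
  then show ?thesis unfolding chain_map_def using f(2) by (intro exI[of _ f]) simp
qed

lemma chain_homotopy_exists:
  assumes X: "bimod_complex A N X dX eX" and Y: "bimod_resolution A N Y dY eY"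
    and l: "\<And>i. lifts A (X i) (Y (Suc i)) (Y i) (dY i)"
    and f: "chain_map A N X dX eX Y dY eY f" and g: "chain_map A N X dX eX Y dY eY g"
  shows "\<exists>h. (\<forall>i. h i \<in> bimod_hom A (X i) (Y (Suc i))) \<and>
     (\<forall>x\<in>carrier (X 0). f 0 x \<ominus>\<^bsub>Y 0\<^esub> g 0 x = dY 0 (h 0 x)) \<and>
     (\<forall>i. \<forall>x\<in>carrier (X (Suc i)). f (Suc i) x \<ominus>\<^bsub>Y (Suc i)\<^esub> g (Suc i) x =
        dY (Suc i) (h (Suc i) x) \<oplus>\<^bsub>Y (Suc i)\<^esub> h i (dX i x))"
proof -
  interpret X: bimod_complex A N X dX eX by fact
  interpret Y: bimod_resolution A N Y dY eY by fact
  interpret N: bimodule A N by (rule X.N)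
  interpret Xi: bimodule A "X i" for i by (rule X.X)
  interpret Yi: bimodule A "Y i" for i by (rule Y.X)
  have fh: "f i \<in> bimod_hom A (X i) (Y i)" and gh: "g i \<in> bimod_hom A (X i) (Y i)"
    and fe: "x \<in> carrier (X 0) \<Longrightarrow> eY (f 0 x) = eX x" and ge: "x \<in> carrier (X 0) \<Longrightarrow> eY (g 0 x) = eX x"
    and fd: "x \<in> carrier (X (Suc i)) \<Longrightarrow> dY i (f (Suc i) x) = f i (dX i x)"
    and gd: "x \<in> carrier (X (Suc i)) \<Longrightarrow> dY i (g (Suc i) x) = g i (dX i x)" for i x
    using f g by (auto simp: chain_map_def)
  \<comment> \<open>The difference of the two chain maps is a chain map over the zero map of
    \<open>N\<close>; the homotopy is constructed for it.\<close>
  define k where "k i = (\<lambda>x\<in>carrier (X i). f i x \<ominus>\<^bsub>Y i\<^esub> g i x)" for i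
  have kh: "k i \<in> bimod_hom A (X i) (Y i)" for i
    unfolding k_def by (rule X.hom_diff_fun[OF X.X Y.X fh gh])
  have ke: "eY (k 0 x) = \<zero>\<^bsub>N\<^esub>" if "x \<in> carrier (X 0)" for x
    using that X.hom_diff[OF Y.X X.N Y.e X.hom_closed[OF fh that] X.hom_closed[OF gh that]]
      X.hom_closed[OF X.e that] by (simp add: k_def fe ge a_minus_def N.V.M.r_neg)
  have kd: "dY i (k (Suc i) x) = k i (dX i x)" if x: "x \<in> carrier (X (Suc i))" for i x
    using x X.hom_diff[OF Y.X Y.X Y.d X.hom_closed[OF fh x] X.hom_closed[OF gh x]]
      X.hom_closed[OF X.d x] by (simp add: k_def fd gd)
  \<comment> \<open>The invariant of the recursion: what remains of \<open>k\<close> after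
    subtracting \<open>h \<circ> dX\<close> is a cycle, hence a boundary, and its lift is the next
    component of the homotopy.\<close>
  let ?E = "\<lambda>i h. \<forall>x\<in>carrier (X (Suc i)). dY i (k (Suc i) x \<ominus>\<^bsub>Y (Suc i)\<^esub> h (dX i x)) = \<zero>\<^bsub>Y i\<^esub>"
  let ?R = "\<lambda>i h. h \<in> bimod_hom A (X i) (Y (Suc i)) \<and> ?E i h \<and> (i = 0 \<longrightarrow> (\<forall>x\<in>carrier (X 0). dY 0 (h x)
      = k 0 x))"
  let ?Q = "\<lambda>i h h'. \<forall>x\<in>carrier (X (Suc i)). k (Suc i) x =
        dY (Suc i) (h' x) \<oplus>\<^bsub>Y (Suc i)\<^esub> h (dX i x)"
  have base: "\<exists>h. ?R 0 h"
  proof -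
    have "k 0 ` carrier (X 0) \<subseteq> dY 0 ` carrier (Y (Suc 0))"
      using Y.e_exact ke X.hom_closed[OF kh] by fastforce
    then obtain h where h: "h \<in> bimod_hom A (X 0) (Y (Suc 0))" "\<forall>x\<in>carrier (X 0). dY 0 (h x) = k 0 x"
      using l[of 0] kh unfolding lifts_def by blast
    have "dY 0 (k (Suc 0) x \<ominus>\<^bsub>Y (Suc 0)\<^esub> h (dX 0 x)) = \<zero>\<^bsub>Y 0\<^esub>" if x: "x \<in> carrier (X (Suc 0))" for x
    proof -
      have dx: "dX 0 x \<in> carrier (X 0)" using X.hom_closed[OF X.d x] .
      show ?thesis
        using X.hom_diff[OF Y.X Y.X Y.d X.hom_closed[OF kh x] X.hom_closed[OF h(1) dx]] kd[OF x] h(2) dx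
          X.hom_closed[OF kh dx] by (simp add: a_minus_def Yi.V.M.r_neg)
    qed
    then show ?thesis using h by blast
  qed
  have step: "\<exists>h'. ?R (Suc i) h' \<and> ?Q i h h'" if R: "?R i h" for i h
  proof -
    have hh: "h \<in> bimod_hom A (X i) (Y (Suc i))" using R by blast
    have c: "compose (carrier (X (Suc i))) h (dX i) \<in> bimod_hom A (X (Suc i)) (Y (Suc i))"
      by (rule X.hom_compose[OF X.d hh X.X])
    define m where "m = (\<lambda>x\<in>carrier (X (Suc i)). k (Suc i) x \<ominus>\<^bsub>Y (Suc i)\<^esub> compose (carrier (X (Suc i))) h
        (dX i) x)"
    have mh: "m \<in> bimod_hom A (X (Suc i)) (Y (Suc i))"
      unfolding m_def by (rule X.hom_diff_fun[OF X.X Y.X kh c])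
    have mx: "m x = k (Suc i) x \<ominus>\<^bsub>Y (Suc i)\<^esub> h (dX i x)" if "x \<in> carrier (X (Suc i))" for x
      using that by (simp add: m_def compose_def)
    have "m ` carrier (X (Suc i)) \<subseteq> dY (Suc i) ` carrier (Y (Suc (Suc i)))"
    proof
      fix y assume "y \<in> m ` carrier (X (Suc i))"
      then obtain x where x: "x \<in> carrier (X (Suc i))" "y = m x" by blast
      then have "dY i y = \<zero>\<^bsub>Y i\<^esub>" using R mx by auto
      then show "y \<in> dY (Suc i) ` carrier (Y (Suc (Suc i)))"
        using Y.d_exact X.hom_closed[OF mh x(1)] x(2) by simp
    qed
    then obtain h' where h': "h' \<in> bimod_hom A (X (Suc i)) (Y (Suc (Suc i)))"
      and h'Q: "\<forall>x\<in>carrier (X (Suc i)). dY (Suc i) (h' x) = m x"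
      using l[of "Suc i"] mh unfolding lifts_def by blast
    have Q: "k (Suc i) x = dY (Suc i) (h' x) \<oplus>\<^bsub>Y (Suc i)\<^esub> h (dX i x)" if x: "x \<in> carrier (X (Suc i))" for x
      using h'Q x X.hom_closed[OF kh x] X.hom_closed[OF hh X.hom_closed[OF X.d x]]
      by (simp add: mx a_minus_def Yi.V.M.a_assoc Yi.V.M.l_neg)
    have "dY (Suc i) (k (Suc (Suc i)) x \<ominus>\<^bsub>Y (Suc (Suc i))\<^esub> h' (dX (Suc i) x)) = \<zero>\<^bsub>Y (Suc i)\<^esub>"
      if x: "x \<in> carrier (X (Suc (Suc i)))" for x
    proof -
      have dx: "dX (Suc i) x \<in> carrier (X (Suc i))" using X.hom_closed[OF X.d x] .
      have "h (dX i (dX (Suc i) x)) = \<zero>\<^bsub>Y (Suc i)\<^esub>"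
        using X.dd[OF x] X.hom_zero[OF X.X Y.X hh] by simp
      then have "k (Suc i) (dX (Suc i) x) = dY (Suc i) (h' (dX (Suc i) x))"
        using Q[OF dx] X.hom_closed[OF Y.d X.hom_closed[OF h' dx]] by simp
      then show ?thesis
        using X.hom_diff[OF Y.X Y.X Y.d X.hom_closed[OF kh x] X.hom_closed[OF h' dx]] kd[OF x]
          X.hom_closed[OF kh dx] by (simp add: a_minus_def Yi.V.M.r_neg)
    qed
    then show ?thesis using h' Q by blast
  qed
  have "\<exists>h. \<forall>i. ?R i (h i) \<and> ?Q i (h i) (h (Suc i))"
    by (rule dependent_nat_choice[of ?R ?Q]) (rule base, erule step)
  then obtain h where h': "\<forall>i. ?R i (h i) \<and> ?Q i (h i) (h (Suc i))" by (rule exE)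
  have h: "?R i (h i)" "?Q i (h i) (h (Suc i))" for i
    by (rule conjunct1[OF spec[OF h', of i]], rule conjunct2[OF spec[OF h', of i]])
  have "f i x \<ominus>\<^bsub>Y i\<^esub> g i x = k i x" if "x \<in> carrier (X i)" for i x
    using that by (simp add: k_def)
  moreover have "dY 0 (h 0 x) = k 0 x" if "x \<in> carrier (X 0)" for x using h(1)[of 0] that by simp
  moreover have "h i \<in> bimod_hom A (X i) (Y (Suc i))" for i using h(1)[of i] by simp
  ultimately show ?thesis using h(2) by (intro exI[of _ h]) simp
qed

section \<open>The basis of paths\<close>

context wf_digraph begin

lemma path_end_simps [simp]:
  "path_end G (u, []) = u" "path_end G (u, a # p) = path_end G (head G a, p)"
  by (simp_all add: path_end_def)

lemma path_end_append: "path_end G (u, p @ q) = path_end G (path_end G (u, p), q)"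
  by (induction p arbitrary: u) simp_all

lemma Nil_in_paths [simp]: "(u, []) \<in> paths G \<longleftrightarrow> u \<in> verts G"
  by (auto simp: paths_def awalk_def)

lemma Cons_in_paths [simp]:
  "(u, a # p) \<in> paths G \<longleftrightarrow> a \<in> arcs G \<and> u = tail G a \<and> (head G a, p) \<in> paths G"
  by (auto simp: paths_def awalk_def)

lemma path_start: "(u, p) \<in> paths G \<Longrightarrow> u \<in> verts G"
  by (auto simp: paths_def awalk_def)

lemma append_in_paths:
  "(u, p @ q) \<in> paths G \<longleftrightarrow> (u, p) \<in> paths G \<and> (path_end G (u, p), q) \<in> paths G"
proof (induction p arbitrary: u)
  case Nil
  then show ?case by (auto dest: path_start)
qed auto

lemma path_end_in_verts: "(u, p) \<in> paths G \<Longrightarrow> path_end G (u, p) \<in> verts G"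
  by (induction p arbitrary: u) auto

end

type_synonym ('v, 'a) bar_tuple = "'v \<times> 'a list \<times> 'a list \<times> 'a list"

section \<open>The ideal of relations and the nonzero paths\<close>

locale qsa = quadratic_string_algebra Q I
  for Q :: "('v, 'a) pre_digraph" and I :: "(('v, 'a) qpath \<Rightarrow> 'k::alg_closed_field) set"
begin

abbreviation "KQ \<equiv> path_algebra Q :: ('k, ('v, 'a) qpath \<Rightarrow> 'k) module"
abbreviation "A \<equiv> quiver_algebra Q I"
abbreviation "N \<equiv> nonzero_paths Q I"
abbreviation "zp \<equiv> zero_prod Q I"
abbreviation "nz p \<equiv> successively (\<lambda>a b. \<not> zp a b) p"
abbreviation "zs p \<equiv> successively zp p"
abbreviation "pe u p \<equiv> path_end Q (u, p)"

lemma ideal: "ideal I KQ"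
  using admissible by (simp add: admissible_def)

sublocale I: ideal I KQ
  by (rule ideal)

lemma carrier_KQ: "carrier KQ = {f. finite {s. f s \<noteq> 0} \<and> {s. f s \<noteq> 0} \<subseteq> paths Q}"
  and zero_KQ [simp]: "\<zero>\<^bsub>KQ\<^esub> = (\<lambda>_. 0)"
  and add_KQ [simp]: "f \<oplus>\<^bsub>KQ\<^esub> g = (\<lambda>s. f s + g s)"
  and smult_KQ [simp]: "c \<odot>\<^bsub>KQ\<^esub> f = (\<lambda>s. c * f s)"
  and one_KQ: "\<one>\<^bsub>KQ\<^esub> = (\<lambda>q. if q \<in> trivial_paths Q then 1 else 0)"
  and mult_KQ: "f \<otimes>\<^bsub>KQ\<^esub> g = (\<lambda>(u, p). \<Sum>i\<le>length p. f (u, take i p) * g (pe u (take i p), drop i p))"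
  by (simp_all add: path_algebra_def free_space_def)

lemma basis_in_KQ [simp]: "p \<in> paths Q \<Longrightarrow> basis_vec p \<in> carrier KQ"
  by (auto simp: carrier_KQ basis_vec_def)

lemma smult_in_KQ [simp]: "f \<in> carrier KQ \<Longrightarrow> (\<lambda>s. c * f s) \<in> carrier KQ"
  by (auto simp: carrier_KQ intro: finite_subset[rotated])

lemma minus_KQ: assumes "f \<in> carrier KQ" shows "\<ominus>\<^bsub>KQ\<^esub> f = (\<lambda>s. - f s)"
proof (rule I.add.inv_equality)
  show "(\<lambda>s. - f s) \<in> carrier KQ" using smult_in_KQ[OF assms, of "-1"] by simp
qed (use assms in simp_all)

lemma basis_mult:
  "basis_vec (u, p) \<otimes>\<^bsub>KQ\<^esub> basis_vec (v, q) =
     (if pe u p = v then basis_vec (u, p @ q) else (\<lambda>_. 0 :: 'k))"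
proof (intro ext, clarify)
  fix w r
  \<comment> \<open>Only the cut after \<open>length p\<close> arrows can match both factors, so at
    most one summand of the product survives.\<close>
  have *: "basis_vec (u, p) (w, take i r) * basis_vec (v, q) (pe w (take i r), drop i r) =
      (if i = length p then (if w = u \<and> r = p @ q \<and> pe u p = v then 1 else 0) else (0::'k))"
    if "i \<le> length r" for i
  proof -
    define r1 r2 where "r1 = take i r" and "r2 = drop i r"
    have r: "r = r1 @ r2" "i = length r1" using that by (simp_all add: r1_def r2_def)
    show ?thesis
    proof (cases "r1 = p")
      case True
      then show ?thesis by (simp add: r basis_vec_def)
    next
      case False
      then have "\<not> (length r1 = length p \<and> r1 @ r2 = p @ q)" by auto
      then show ?thesis using False by (simp add: r basis_vec_def)
    qed
  qed
  have "(basis_vec (u, p) \<otimes>\<^bsub>KQ\<^esub> basis_vec (v, q)) (w, r) =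
      (\<Sum>i\<le>length r. if i = length p then (if w = u \<and> r = p @ q \<and> pe u p = v then 1 else 0) else (0::'k))"
    unfolding mult_KQ prod.case by (intro sum.cong refl *) simp
  also have "\<dots> = (if pe u p = v then basis_vec (u, p @ q) else (\<lambda>_. 0)) (w, r)"
    by (auto simp: basis_vec_def)
  finally show "(basis_vec (u, p) \<otimes>\<^bsub>KQ\<^esub> basis_vec (v, q)) (w, r) =
     (if pe u p = v then basis_vec (u, p @ q) else (\<lambda>_. 0 :: 'k)) (w, r)" .
qed

lemma smult_mult_KQ:
  "(\<lambda>s. c * f s) \<otimes>\<^bsub>KQ\<^esub> g = (\<lambda>s. c * (f \<otimes>\<^bsub>KQ\<^esub> g) s)"
  "f \<otimes>\<^bsub>KQ\<^esub> (\<lambda>s. c * g s) = (\<lambda>s. c * (f \<otimes>\<^bsub>KQ\<^esub> g) s)"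
  by (auto simp: mult_KQ sum_distrib_left mult_ac intro!: sum.cong)

lemma I_smult: assumes "f \<in> I" shows "(\<lambda>s. c * f s) \<in> I"
proof -
  have fc: "f \<in> carrier KQ" using assms I.Icarr by blast
  have one: "\<one>\<^bsub>KQ\<^esub> \<in> carrier KQ" by simp
  have "(\<lambda>s. c * \<one>\<^bsub>KQ\<^esub> s) \<otimes>\<^bsub>KQ\<^esub> f \<in> I"
    using smult_in_KQ[OF one] assms I.I_l_closed by blast
  then show ?thesis using fc by (simp add: smult_mult_KQ)
qed

lemma zero_path_in_I:
  assumes "(u, p) \<in> paths Q" "\<not> nz p" shows "basis_vec (u, p) \<in> I"
  using assms
proof (induction p arbitrary: u)
  case (Cons a p)
  note path = Cons.prems(1)
  show ?case
  proof (cases "nz p")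
    case False
    then have "basis_vec (head Q a, p) \<in> I" using Cons by auto
    then have "basis_vec (u, [a]) \<otimes>\<^bsub>KQ\<^esub> basis_vec (head Q a, p) \<in> I"
      using path head_in_verts by (intro I.I_l_closed) auto
    then show ?thesis by (simp add: basis_mult)
  next
    case True
    then obtain b q where p: "p = b # q" "zp a b" using Cons.prems(2) by (cases p) auto
    then have "basis_vec (tail Q a, [a, b]) \<in> I" by (simp add: zero_prod_def)
    then have "basis_vec (tail Q a, [a, b]) \<otimes>\<^bsub>KQ\<^esub> basis_vec (head Q b, q) \<in> I"
      using path p by (intro I.I_r_closed) auto
    then show ?thesis using path by (simp add: basis_mult p)
  qed
qed simp

text \<open>The functions supported on paths with a zero factor form an ideal containing the
  quadratic generators, which gives one inclusion. Conversely every such path is a multiple of a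
  zero product of two arrows, and a function of finite support is a linear combination of its
  paths.\<close>

lemma I_eq: "I = {f \<in> carrier KQ. \<forall>u p. f (u, p) \<noteq> 0 \<longrightarrow> \<not> nz p}" (is "_ = ?J")
proof
  have fin: "finite {s. f s \<noteq> 0} \<Longrightarrow> f \<in> carrier KQ \<Longrightarrow> \<forall>u p. f (u, p) \<noteq> 0 \<longrightarrow> \<not> nz p \<Longrightarrow> f \<in> I"
    for f :: "('v, 'a) qpath \<Rightarrow> 'k"
  proof (induction "{s. f s \<noteq> 0}" arbitrary: f rule: finite_psubset_induct)
    case (psubset f)
    show ?case
    proof (cases "\<exists>s. f s \<noteq> 0")
      case False
      then have "f = \<zero>\<^bsub>KQ\<^esub>" by auto
      then show ?thesis using additive_subgroup.zero_closed[OF I.additive_subgroup_axioms] by simp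
    next
      case True
      then obtain u p where s: "f (u, p) \<noteq> 0" by auto
      define g where "g = (\<lambda>t. if t = (u, p) then 0 else f t)"
      have gs: "{s. g s \<noteq> 0} \<subset> {s. f s \<noteq> 0}" using s by (auto simp: g_def)
      then have "g \<in> carrier KQ" using psubset.prems(1) finite_subset by (fastforce simp: carrier_KQ)
      then have gI: "g \<in> I" using psubset.hyps(2)[OF gs] psubset.prems by (auto simp: g_def)
      have up: "(u, p) \<in> paths Q" using s psubset.prems(1) by (auto simp: carrier_KQ)
      have "(\<lambda>t. f (u, p) * basis_vec (u, p) t) \<in> I"
        by (rule I_smult[OF zero_path_in_I[OF up]]) (use s psubset.prems in auto)
      then have "g \<oplus>\<^bsub>KQ\<^esub> (\<lambda>t. f (u, p) * basis_vec (u, p) t) \<in> I" using gI by blast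
      also have "g \<oplus>\<^bsub>KQ\<^esub> (\<lambda>t. f (u, p) * basis_vec (u, p) t) = f"
        by (auto simp: g_def basis_vec_def)
      finally show ?thesis .
    qed
  qed
  show "?J \<subseteq> I" using fin by (auto simp: carrier_KQ)
  \<comment> \<open>A subpath of a nonzero path is nonzero; therefore no cut of a nonzero path
    contributes to the coefficient of a product with a factor in the candidate ideal.\<close>
  have dr: "\<not> nz p" if "\<not> nz (take i p) \<or> \<not> nz (drop i p)" for i p
    using that append_take_drop_id[of i p] by (metis successively_append_iff)
  have J: "ideal ?J KQ"
  proof (rule idealI)
    show "ring KQ" by (rule I.ring_axioms)
    show "subgroup ?J (add_monoid KQ)"
    proof
      fix f assume f: "f \<in> ?J"
      then have "inv\<^bsub>add_monoid KQ\<^esub> f = (\<lambda>s. - f s)" using minus_KQ by (simp add: a_inv_def)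
      moreover have "(\<lambda>s. - f s) \<in> carrier KQ"
        using smult_in_KQ[of f "-1"] f by simp
      ultimately show "inv\<^bsub>add_monoid KQ\<^esub> f \<in> ?J" using f by auto
    next
      fix f g assume fg: "f \<in> ?J" "g \<in> ?J"
      then have "f \<oplus>\<^bsub>KQ\<^esub> g \<in> carrier KQ" by blast
      moreover have "f (u, p) + g (u, p) \<noteq> 0 \<Longrightarrow> f (u, p) \<noteq> 0 \<or> g (u, p) \<noteq> 0" for u p by auto
      ultimately show "f \<otimes>\<^bsub>add_monoid KQ\<^esub> g \<in> ?J" using fg by auto blast
    next
      show "\<one>\<^bsub>add_monoid KQ\<^esub> \<in> ?J" using I.zero_closed I.Icarr by fastforce
    qed auto
    fix f g assume f: "f \<in> ?J" and g: "g \<in> carrier KQ"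
    have f0: "f (u, q) = 0" if "nz q" for u q using f that by auto
    have "nz (take i p)" "nz (drop i p)" if "nz p" for i p using dr that by blast+
    then have "(g \<otimes>\<^bsub>KQ\<^esub> f) (u, p) = 0" "(f \<otimes>\<^bsub>KQ\<^esub> g) (u, p) = 0" if "nz p" for u p
      using that by (auto simp: mult_KQ f0)
    moreover have "g \<otimes>\<^bsub>KQ\<^esub> f \<in> carrier KQ" "f \<otimes>\<^bsub>KQ\<^esub> g \<in> carrier KQ" using f g by auto
    ultimately show "g \<otimes>\<^bsub>KQ\<^esub> f \<in> ?J" "f \<otimes>\<^bsub>KQ\<^esub> g \<in> ?J" by auto
  qed
  obtain R where R: "R \<subseteq> {p \<in> paths Q. length (snd p) = 2}" and I: "I = Idl\<^bsub>KQ\<^esub> (basis_vec ` R)"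
    using quadratic by blast
  have "basis_vec ` R \<subseteq> ?J"
  proof
    fix f :: "('v, 'a) qpath \<Rightarrow> 'k" assume "f \<in> basis_vec ` R"
    then obtain u p where up: "f = basis_vec (u, p)" "(u, p) \<in> R" by auto
    then have p: "(u, p) \<in> paths Q" "length p = 2" using R by auto
    then obtain a b where ab: "p = [a, b]" by (auto simp: length_Suc_conv numeral_2_eq_2)
    have "f \<in> I" unfolding I
      by (rule subsetD[OF I.genideal_self]) (use up R in \<open>auto intro: basis_in_KQ\<close>)
    then have "zp a b" using up ab p by (auto simp: zero_prod_def)
    moreover have "f \<in> carrier KQ" using up p by simp
    moreover have "q = [a, b]" if "f (v, q) \<noteq> 0" for v q
      using that up ab by (simp add: basis_vec_def split: if_splits)
    moreover have "\<not> nz [a, b]" using \<open>zp a b\<close> by simp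
    ultimately show "f \<in> ?J" by blast
  qed
  then have "Idl\<^bsub>KQ\<^esub> (basis_vec ` R) \<subseteq> ?J" by (rule I.genideal_minimal[OF J])
  then show "I \<subseteq> ?J" using I by blast
qed

lemma mem_I_iff: "f \<in> I \<longleftrightarrow> f \<in> carrier KQ \<and> (\<forall>u p. f (u, p) \<noteq> 0 \<longrightarrow> \<not> nz p)"
  using subsetD[OF equalityD1[OF I_eq], of f] subsetD[OF equalityD2[OF I_eq], of f]
  unfolding mem_Collect_eq by (rule iffI)

lemma N_iff: "(u, p) \<in> N \<longleftrightarrow> (u, p) \<in> paths Q \<and> nz p"
proof -
  have "\<not> nz p" if "basis_vec (u, p) \<in> I"
    using that unfolding mem_I_iff by (auto simp: basis_vec_def)
  then show ?thesis using zero_path_in_I[of u p] unfolding nonzero_paths_def by blast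
qed

lemma nonzero_prod_iff:
  "nonzero_prod Q I a b \<longleftrightarrow> a \<in> arcs Q \<and> b \<in> arcs Q \<and> head Q a = tail Q b \<and> \<not> zp a b"
  by (auto simp: nonzero_prod_def zero_prod_def)

lemma AP_iff: "(u, p) \<in> AP Q I n \<longleftrightarrow> (u, p) \<in> paths Q \<and> length p = n \<and> zs p"
  by (auto simp: AP_def successively_conv_nth)

text \<open>Links lengths of paths with powers of the arrow ideal, so that admissibility bounds the
  length of nonzero paths.\<close>

lemma path_in_power:
  assumes "(u, p) \<in> paths Q"
  shows "basis_vec (u, p) \<in> ideal_power KQ (arrow_ideal Q) (length p)"
  using assms
proof (induction p rule: rev_induct)
  case (snoc a p)
  have arrows: "(basis_vec :: _ \<Rightarrow> _ \<Rightarrow> 'k) ` arrow_paths Q \<subseteq> carrier KQ"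
    by (auto simp: arrow_paths_def intro!: basis_in_KQ)
  have a: "a \<in> arcs Q" "tail Q a = pe u p" "(u, p) \<in> paths Q" using snoc.prems by (auto simp: append_in_paths)
  have "(basis_vec (pe u p, [a]) :: _ \<Rightarrow> 'k) \<in> arrow_ideal Q" unfolding arrow_ideal_def
    by (rule subsetD[OF I.genideal_self[OF arrows]]) (use a in \<open>auto simp: arrow_paths_def image_image
        intro!: image_eqI[of _ _ a]\<close>)
  then have "basis_vec (u, p) \<otimes>\<^bsub>KQ\<^esub> basis_vec (pe u p, [a]) \<in>
      ideal_power KQ (arrow_ideal Q) (Suc (length p))"
    using snoc.IH[OF a(3)] by (auto intro: ideal_prod.prod)
  then show ?case by (simp add: basis_mult)
qed (auto intro!: basis_in_KQ)

text \<open>A path of length at least \<open>m\<close> has an initial part of length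
  \<open>m\<close>, which lies in the \<open>m\<close>-th power of the arrow ideal and hence in
  \<open>I\<close>. So nonzero paths are shorter than \<open>m\<close>.\<close>

lemma finite_N: "finite N"
proof -
  obtain m where m: "ideal_power KQ (arrow_ideal Q) m \<subseteq> I"
    using admissible by (auto simp: admissible_def)
  have len: "length p < m" if up: "(u, p) \<in> N" for u p
  proof (rule ccontr)
    assume l: "\<not> length p < m"
    have "(u, take m p @ drop m p) \<in> paths Q" "nz (take m p @ drop m p)"
      using up by (simp_all add: N_iff)
    then have n: "(u, take m p) \<in> paths Q" "nz (take m p)"
      by (simp_all only: append_in_paths successively_append_iff)
    moreover have "length (take m p) = m" using l by simp
    ultimately have "basis_vec (u, take m p) \<in> I"
      using path_in_power[of u "take m p"] m by auto
    moreover have "(u, take m p) \<in> N" using n by (simp add: N_iff)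
    ultimately show False by (simp add: nonzero_paths_def)
  qed
  have "N \<subseteq> verts Q \<times> {p. set p \<subseteq> arcs Q \<and> length p \<le> m}"
  proof (rule subrelI)
    fix u p assume up: "(u, p) \<in> N"
    then have "u \<in> verts Q" "set p \<subseteq> arcs Q" by (auto simp: N_iff paths_def awalk_def)
    then show "(u, p) \<in> verts Q \<times> {p. set p \<subseteq> arcs Q \<and> length p \<le> m}" using len[OF up] by auto
  qed
  then show ?thesis by (rule finite_subset) (intro finite_cartesian_product finite_lists_length_le
      finite_verts finite_arcs)
qed

end

text \<open>Reduces linear statements about coefficient functions, and with them about elements of
  \<open>A\<close> and of the Koszul bimodules, to basis vectors.\<close>

lemma finite_support_induct [consumes 2, case_names zero add]:
  fixes f :: "'s \<Rightarrow> 'k::field"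
  assumes "finite T" "\<And>s. s \<notin> T \<Longrightarrow> f s = 0"
    and "P (\<lambda>_. 0)"
    and "\<And>g c t. \<lbrakk>\<And>s. s \<notin> T \<Longrightarrow> g s = 0; P g; t \<in> T\<rbrakk> \<Longrightarrow> P (\<lambda>s. g s + c * basis_vec t s)"
  shows "P f"
proof -
  have "P f" if "finite S" "S \<subseteq> T" "\<And>s. s \<notin> S \<Longrightarrow> f s = 0" for S and f :: "'s \<Rightarrow> 'k"
    using that
  proof (induction S arbitrary: f rule: finite_induct)
    case empty
    then have "f = (\<lambda>_. 0)" by auto
    then show ?case using assms(3) by simp
  next
    case (insert t S)
    have "P (\<lambda>s. (f(t := 0)) s + f t * basis_vec t s)"
    proof (rule assms(4))
      show "P (f(t := 0))" using insert by (intro insert.IH) auto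
    qed (use insert in auto)
    moreover have "(\<lambda>s. (f(t := 0)) s + f t * basis_vec t s) = f" by (auto simp: basis_vec_def)
    ultimately show ?case by simp
  qed
  from this[OF assms(1) subset_refl assms(2)] show ?thesis .
qed

section \<open>The quotient algebra in path coordinates\<close>

context qsa begin

definition cs :: "(('v, 'a) qpath \<Rightarrow> 'k) \<Rightarrow> (('v, 'a) qpath \<Rightarrow> 'k) set" where
  "cs f = I +>\<^bsub>KQ\<^esub> f"

definition path_class :: "('v, 'a) qpath \<Rightarrow> (('v, 'a) qpath \<Rightarrow> 'k) set" where
  "path_class p = cs (basis_vec p)"

text \<open>Coordinates in the basis of nonzero paths. The choice of the representative is
  immaterial: two of them differ by an element of \<open>I\<close>, which vanishes on
  \<open>N\<close>.\<close>

definition coef :: "(('v, 'a) qpath \<Rightarrow> 'k) set \<Rightarrow> ('v, 'a) qpath \<Rightarrow> 'k" where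
  "coef X = (\<lambda>p. if p \<in> N then (SOME f. f \<in> X) p else 0)"

lemma A_simps:
  "carrier A = cs ` carrier KQ" "\<zero>\<^bsub>A\<^esub> = I" "\<one>\<^bsub>A\<^esub> = cs \<one>\<^bsub>KQ\<^esub>"
  "monoid.mult A = rcoset_mult KQ I" "add A = set_add KQ"
  "smult A = (\<lambda>c X. \<Union>x\<in>X. cs (c \<odot>\<^bsub>KQ\<^esub> x))"
  by (auto simp: quiver_algebra_def kquot_def ring.defs module.defs FactRing_def A_RCOSETS_def'
      cs_def[abs_def])

lemma cs_eq_iff:
  assumes "f \<in> carrier KQ" "g \<in> carrier KQ"
  shows "cs f = cs g \<longleftrightarrow> (\<forall>p\<in>N. f p = g p)"
proof -
  have d: "f \<ominus>\<^bsub>KQ\<^esub> g = (\<lambda>s. f s - g s)" using assms by (simp add: a_minus_def minus_KQ)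
  have "f \<ominus>\<^bsub>KQ\<^esub> g \<in> carrier KQ" using assms by simp
  then have c: "(\<lambda>s. f s - g s) \<in> carrier KQ" by (simp only: d)
  have paths: "f (u, p) = g (u, p)" if "(u, p) \<notin> paths Q" for u p
  proof -
    have "f (u, p) = 0" "g (u, p) = 0" using assms that by (auto simp: carrier_KQ)
    then show ?thesis by simp
  qed
  have "cs f = cs g \<longleftrightarrow> (\<lambda>s. f s - g s) \<in> I"
    using I.quotient_eq_iff_same_a_r_cos[OF I.ideal_axioms assms] by (simp add: cs_def d)
  also have "\<dots> \<longleftrightarrow> (\<forall>p\<in>N. f p = g p)"
    using c paths unfolding mem_I_iff by (force simp: N_iff)
  finally show ?thesis .
qed

lemma coef_cs:
  assumes "f \<in> carrier KQ"
  shows "coef (cs f) = (\<lambda>p. if p \<in> N then f p else 0)"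
proof -
  have "f \<in> cs f" unfolding cs_def by (rule I.a_rcos_self[OF assms])
  then have s: "(SOME g. g \<in> cs f) \<in> cs f" by (rule someI[of "\<lambda>g. g \<in> cs f"])
  have c: "(SOME g. g \<in> cs f) \<in> carrier KQ"
    using s I.a_r_coset_subset_G[OF I.a_subset assms] by (auto simp: cs_def)
  have "cs (SOME g. g \<in> cs f) = cs f"
    using I.a_repr_independence[OF s[unfolded cs_def] assms I.a_subgroup] by (simp add: cs_def)
  then show ?thesis using cs_eq_iff[OF c assms] by (auto simp: coef_def)
qed

lemma cs_add: "\<lbrakk>f \<in> carrier KQ; g \<in> carrier KQ\<rbrakk> \<Longrightarrow> cs f \<oplus>\<^bsub>A\<^esub> cs g = cs (\<lambda>s. f s + g s)"
  using I.a_rcos_sum[of f g] unfolding A_simps(5) cs_def by simp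

lemma cs_mult: "\<lbrakk>f \<in> carrier KQ; g \<in> carrier KQ\<rbrakk> \<Longrightarrow> cs f \<otimes>\<^bsub>A\<^esub> cs g = cs (f \<otimes>\<^bsub>KQ\<^esub> g)"
  using I.rcoset_mult_add[of f g] unfolding A_simps(4) cs_def by simp

lemma cs_smult: assumes "f \<in> carrier KQ" shows "c \<odot>\<^bsub>A\<^esub> cs f = cs (\<lambda>s. c * f s)"
proof -
  have "cs (\<lambda>s. c * x s) = cs (\<lambda>s. c * f s)" if x: "x \<in> cs f" for x
  proof -
    have xc: "x \<in> carrier KQ"
      using x I.a_r_coset_subset_G[OF I.a_subset assms] by (auto simp: cs_def)
    have "cs x = cs f"
      using I.a_repr_independence[OF x[unfolded cs_def] assms I.a_subgroup] by (simp add: cs_def)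
    then show ?thesis using xc assms by (simp add: cs_eq_iff)
  qed
  then have "(\<Union>x\<in>cs f. cs (\<lambda>s. c * x s)) = (\<Union>x\<in>cs f. cs (\<lambda>s. c * f s))"
    by (intro SUP_cong refl)
  moreover have "f \<in> cs f" unfolding cs_def by (rule I.a_rcos_self[OF assms])
  ultimately show ?thesis unfolding A_simps(6) smult_KQ by (metis UN_constant empty_iff)
qed

lemma cs_zero: "cs (\<lambda>_. 0) = \<zero>\<^bsub>A\<^esub>"
  using I.a_coset_add_zero[OF I.a_subset] unfolding A_simps(2) cs_def by simp

lemma kalgebra_A: "kalgebra A"
proof (rule kalgebra.intro)
  interpret R: ring "KQ Quot I" by (rule I.quotient_is_ring)
  have eqs: "carrier A = carrier (KQ Quot I)" "\<zero>\<^bsub>A\<^esub> = \<zero>\<^bsub>KQ Quot I\<^esub>" "\<one>\<^bsub>A\<^esub> = \<one>\<^bsub>KQ Quot I\<^esub>"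
    "monoid.mult A = monoid.mult (KQ Quot I)" "add A = add (KQ Quot I)"
    by (simp_all add: quiver_algebra_def kquot_def ring.defs module.defs)
  show ring: "ring A"
  proof (rule ringI)
    show "abelian_group A"
    proof (rule abelian_groupI)
      fix x assume "x \<in> carrier A"
      then show "\<exists>y\<in>carrier A. y \<oplus>\<^bsub>A\<^esub> x = \<zero>\<^bsub>A\<^esub>"
        unfolding eqs by (intro bexI[of _ "\<ominus>\<^bsub>KQ Quot I\<^esub> x"] R.l_neg R.a_inv_closed)
    qed (unfold eqs, simp_all add: R.a_ac)
    show "Group.monoid A" by (rule monoidI) (unfold eqs, simp_all add: R.m_assoc)
  qed (unfold eqs, simp_all add: R.l_distr R.r_distr)
  interpret A: ring A by (rule ring)
  have rep: "\<exists>f\<in>carrier KQ. x = cs f" if "x \<in> carrier A" for x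
    using that by (auto simp: A_simps(1))
  have add: "(\<lambda>s. f s + g s) \<in> carrier KQ" if "f \<in> carrier KQ" "g \<in> carrier KQ" for f g
    using I.a_closed[OF that] by simp
  show "vectorspace class_ring A"
  proof (rule vectorspace_class_ringI)
    fix c c' :: 'k and x y
    assume "x \<in> carrier A"
    then obtain f where f: "f \<in> carrier KQ" "x = cs f" using rep by blast
    show "c \<odot>\<^bsub>A\<^esub> x \<in> carrier A" using f by (simp add: cs_smult A_simps(1))
    show "(c + c') \<odot>\<^bsub>A\<^esub> x = c \<odot>\<^bsub>A\<^esub> x \<oplus>\<^bsub>A\<^esub> c' \<odot>\<^bsub>A\<^esub> x"
      using f by (simp add: cs_smult cs_add distrib_right)
    show "(c * c') \<odot>\<^bsub>A\<^esub> x = c \<odot>\<^bsub>A\<^esub> (c' \<odot>\<^bsub>A\<^esub> x)" using f by (simp add: cs_smult mult.assoc)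
    show "1 \<odot>\<^bsub>A\<^esub> x = x" "0 \<odot>\<^bsub>A\<^esub> x = \<zero>\<^bsub>A\<^esub>" using f by (simp_all add: cs_smult cs_zero)
    assume "y \<in> carrier A"
    then obtain g where g: "g \<in> carrier KQ" "y = cs g" using rep by blast
    show "c \<odot>\<^bsub>A\<^esub> (x \<oplus>\<^bsub>A\<^esub> y) = c \<odot>\<^bsub>A\<^esub> x \<oplus>\<^bsub>A\<^esub> c \<odot>\<^bsub>A\<^esub> y"
      using f g by (simp add: cs_smult cs_add add distrib_left)
  qed (simp_all add: A.a_ac)
  fix a b c assume a: "a \<in> carrier A" and b: "b \<in> carrier A"
  obtain f where f: "f \<in> carrier KQ" "a = cs f" using rep[OF a] by blast
  obtain g where g: "g \<in> carrier KQ" "b = cs g" using rep[OF b] by blast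
  note fg = f(1) g(1) and ab = f(2) g(2)
  have m: "f \<otimes>\<^bsub>KQ\<^esub> g \<in> carrier KQ" using fg by simp
  show "(c \<odot>\<^bsub>A\<^esub> a) \<otimes>\<^bsub>A\<^esub> b = c \<odot>\<^bsub>A\<^esub> (a \<otimes>\<^bsub>A\<^esub> b)"
    unfolding ab by (subst cs_smult[OF fg(1)], subst cs_mult[OF smult_in_KQ[OF fg(1)] fg(2)],
      subst smult_mult_KQ(1)[of c f g], subst cs_mult[OF fg], subst cs_smult[OF m]) (rule refl)
  show "a \<otimes>\<^bsub>A\<^esub> (c \<odot>\<^bsub>A\<^esub> b) = c \<odot>\<^bsub>A\<^esub> (a \<otimes>\<^bsub>A\<^esub> b)"
    unfolding ab by (subst cs_smult[OF fg(2)], subst cs_mult[OF fg(1) smult_in_KQ[OF fg(2)]],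
      subst smult_mult_KQ(2)[of f c g], subst cs_mult[OF fg], subst cs_smult[OF m]) (rule refl)
qed

sublocale kalgebra A
  by (rule kalgebra_A)

lemma N_sub: "N \<subseteq> paths Q"
  by (auto simp: nonzero_paths_def)

lemma cs_closed [simp]: "f \<in> carrier KQ \<Longrightarrow> cs f \<in> carrier A"
  by (simp add: A_simps)

lemma path_class_closed [simp]: "p \<in> N \<Longrightarrow> path_class p \<in> carrier A"
  using N_sub by (auto simp: path_class_def)

lemma supported_in_KQ: assumes "\<And>p. p \<notin> N \<Longrightarrow> g p = 0" shows "g \<in> carrier KQ"
proof -
  have "{s. g s \<noteq> 0} \<subseteq> N" using assms by auto
  then show ?thesis using finite_subset[OF _ finite_N] N_sub by (auto simp: carrier_KQ)
qed

lemma coef_outside: "p \<notin> N \<Longrightarrow> coef a p = 0"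
  by (simp add: coef_def)

lemma coef_surj: assumes "\<And>p. p \<notin> N \<Longrightarrow> g p = 0" shows "\<exists>a\<in>carrier A. coef a = g"
  using assms supported_in_KQ[OF assms] by (intro bexI[of _ "cs g"]) (auto simp: coef_cs)

lemma coef_inj: "\<lbrakk>a \<in> carrier A; b \<in> carrier A; coef a = coef b\<rbrakk> \<Longrightarrow> a = b"
proof (clarsimp simp: A_simps(1))
  fix f g assume fg: "f \<in> carrier KQ" "g \<in> carrier KQ" and eq: "coef (cs f) = coef (cs g)"
  have "f p = g p" if "p \<in> N" for p using fun_cong[OF eq, of p] fg that by (simp add: coef_cs)
  then show "cs f = cs g" using fg by (simp add: cs_eq_iff)
qed

lemma coef_add: "\<lbrakk>a \<in> carrier A; b \<in> carrier A\<rbrakk> \<Longrightarrow> coef (a \<oplus>\<^bsub>A\<^esub> b) = (\<lambda>p. coef a p + coef b p)"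
proof (clarsimp simp: A_simps(1))
  fix f g assume "f \<in> carrier KQ" "g \<in> carrier KQ"
  moreover from this have "(\<lambda>s. f s + g s) \<in> carrier KQ" using I.a_closed[of f g] by simp
  ultimately show "coef (cs f \<oplus>\<^bsub>A\<^esub> cs g) = (\<lambda>p. coef (cs f) p + coef (cs g) p)"
    by (auto simp: cs_add coef_cs)
qed

lemma coef_smult: "a \<in> carrier A \<Longrightarrow> coef (c \<odot>\<^bsub>A\<^esub> a) = (\<lambda>p. c * coef a p)"
  by (auto simp: A_simps(1) cs_smult coef_cs)

lemma coef_zero: "coef \<zero>\<^bsub>A\<^esub> = (\<lambda>_. 0)"
  using coef_cs[of "\<lambda>_. 0"] I.zero_closed by (simp add: cs_zero)

lemma coef_path_class: assumes "p \<in> N" shows "coef (path_class p) = basis_vec p"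
proof -
  have "basis_vec p \<in> carrier KQ" using assms N_sub by (intro basis_in_KQ) auto
  then show ?thesis using assms by (auto simp: path_class_def coef_cs basis_vec_def)
qed

lemma coef_one: "coef \<one>\<^bsub>A\<^esub> = (\<lambda>p. if p \<in> trivial_paths Q then 1 else 0)"
proof -
  have "coef \<one>\<^bsub>A\<^esub> = (\<lambda>p. if p \<in> N then \<one>\<^bsub>KQ\<^esub> p else 0)"
    unfolding A_simps(3) by (rule coef_cs[OF I.one_closed])
  also have "\<dots> = (\<lambda>p. if p \<in> trivial_paths Q then 1 else 0)"
    by (rule ext) (auto simp: one_KQ trivial_paths_def N_iff)
  finally show ?thesis .
qed

lemma path_class_mult:
  assumes "(u, p) \<in> N" "(v, q) \<in> N"
  shows "path_class (u, p) \<otimes>\<^bsub>A\<^esub> path_class (v, q) = (if pe u p = v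
      \<and> nz (p @ q) then path_class (u, p @ q) else \<zero>\<^bsub>A\<^esub>)"
proof -
  have p: "(u, p) \<in> paths Q" "(v, q) \<in> paths Q" using assms N_sub by auto
  have z: "(\<lambda>_. 0) \<in> carrier KQ" using I.zero_closed by simp
  have "cs (basis_vec (u, p @ q)) = cs (\<lambda>_. 0)" if "pe u p = v" "\<not> nz (p @ q)"
  proof -
    have "basis_vec (u, p @ q) \<in> carrier KQ"
      using that p by (intro basis_in_KQ) (simp add: append_in_paths)
    then show ?thesis using that z by (subst cs_eq_iff) (auto simp: N_iff basis_vec_def)
  qed
  then show ?thesis using p by (auto simp: path_class_def cs_mult basis_mult cs_zero)
qed

lemma A_induct [consumes 1, case_names zero add]:
  assumes "a \<in> carrier A" and "P \<zero>\<^bsub>A\<^esub>"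
    and "\<And>a c p. \<lbrakk>a \<in> carrier A; P a; p \<in> N\<rbrakk> \<Longrightarrow> P (a \<oplus>\<^bsub>A\<^esub> c \<odot>\<^bsub>A\<^esub> path_class p)"
  shows "P a"
proof -
  have "P (cs g)" if "\<And>p. p \<notin> N \<Longrightarrow> g p = 0" for g :: "('v, 'a) qpath \<Rightarrow> 'k"
  proof (rule finite_support_induct[where P = "\<lambda>g. P (cs g)" and T = N and f = g])
    show "P (cs (\<lambda>_. 0))" using assms(2) by (simp add: cs_zero)
    fix g :: "('v, 'a) qpath \<Rightarrow> 'k" and c t
    assume g0: "\<And>p. p \<notin> N \<Longrightarrow> g p = 0" and P: "P (cs g)" and t: "t \<in> N"
    have g: "g \<in> carrier KQ" using g0 by (rule supported_in_KQ)
    have b: "basis_vec t \<in> carrier KQ" using t N_sub by (intro basis_in_KQ) auto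
    have "P (cs g \<oplus>\<^bsub>A\<^esub> c \<odot>\<^bsub>A\<^esub> path_class t)" using P g t by (intro assms(3)) auto
    then show "P (cs (\<lambda>s. g s + c * basis_vec t s))"
      using g b by (simp add: path_class_def cs_smult cs_add)
  qed (rule finite_N, rule that)
  then have "P (cs (coef a))" by (auto simp: coef_outside)
  moreover have "cs (coef a) = a"
    using assms(1) by (intro coef_inj) (auto simp: supported_in_KQ coef_outside coef_cs)
  ultimately show ?thesis by simp
qed

section \<open>The Koszul resolution\<close>

text \<open>Bilinear extension of a partial action of paths on basis elements; the value
  \<open>None\<close> stands for a product that is zero.\<close>

definition gact ::
  "(('v, 'a) qpath \<Rightarrow> 't \<Rightarrow> 't option) \<Rightarrow> 't set \<Rightarrow> (('v, 'a) qpath \<Rightarrow> 'k) set \<Rightarrow> ('t \<Rightarrow> 'k) \<Rightarrow> 't \<Rightarrow> 'k" where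
  "gact act T a b = (\<lambda>t. \<Sum>s\<in>N. \<Sum>x\<in>T. coef a s * b x * of_bool (act s x = Some t))"

lemma gact_linear:
  "\<lbrakk>a \<in> carrier A; a' \<in> carrier A\<rbrakk> \<Longrightarrow>
     gact act T (a \<oplus>\<^bsub>A\<^esub> a') b = (\<lambda>t. gact act T a b t + gact act T a' b t)"
  "a \<in> carrier A \<Longrightarrow> gact act T (c \<odot>\<^bsub>A\<^esub> a) b = (\<lambda>t. c * gact act T a b t)"
  "gact act T \<zero>\<^bsub>A\<^esub> b = (\<lambda>_. 0)"
  "gact act T a (\<lambda>s. g s + h s) = (\<lambda>t. gact act T a g t + gact act T a h t)"
  "gact act T a (\<lambda>s. c * g s) = (\<lambda>t. c * gact act T a g t)"
  "gact act T a (\<lambda>_. 0) = (\<lambda>_. 0)"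
  by (auto simp: gact_def coef_add coef_smult coef_zero algebra_simps sum.distrib sum_distrib_left)

lemma gact_basis:
  assumes "finite T" "s \<in> N" "x \<in> T"
  shows "gact act T (path_class s) (basis_vec x) = (case act s x of None \<Rightarrow> (\<lambda>_. 0) | Some t \<Rightarrow> basis_vec t)"
proof
  fix t
  have "gact act T (path_class s) (basis_vec x) t =
     (\<Sum>s'\<in>N. \<Sum>x'\<in>T. if s' = s then if x' = x then of_bool (act s x = Some t) else 0 else 0)"
    unfolding gact_def coef_path_class[OF assms(2)] by (intro sum.cong refl) (auto simp: basis_vec_def)
  also have "\<dots> = (\<Sum>s'\<in>N. if s' = s then of_bool (act s x = Some t) else 0)"
    using assms by (intro sum.cong refl) simp
  also have "\<dots> = of_bool (act s x = Some t)" using assms finite_N by simp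
  finally show "gact act T (path_class s) (basis_vec x) t =
      (case act s x of None \<Rightarrow> (\<lambda>_. 0) | Some t \<Rightarrow> basis_vec t) t"
    by (auto simp: basis_vec_def split: option.split)
qed

lemma gact_outside:
  assumes "\<And>s x t. \<lbrakk>s \<in> N; x \<in> T; act s x = Some t\<rbrakk> \<Longrightarrow> t \<in> T" "t \<notin> T"
  shows "gact act T a b t = 0"
  unfolding gact_def using assms by (intro sum.neutral ballI) auto

text \<open>
  \<open>(u, p, r, q)\<close> stands for \<open>p \<otimes> r \<otimes> q\<close>, where \<open>p\<close> starts at \<open>u\<close>; the end points of \<open>p\<close> and \<open>r\<close>
  need not be recorded.
\<close>

definition bar_basis :: "nat \<Rightarrow> ('v, 'a) bar_tuple set" where
  "bar_basis n = {(u, p, r, q). (u, p @ r @ q) \<in> paths Q \<and> length r = n \<and> zs r \<and> nz p \<and> nz q}"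

fun lacts :: "('v, 'a) qpath \<Rightarrow> ('v, 'a) bar_tuple \<Rightarrow>
    ('v, 'a) bar_tuple option" where
  "lacts (w, s) (u, p, r, q) = (if pe w s = u \<and> nz (s @ p) then Some (w, s @ p, r, q) else None)"

fun racts :: "('v, 'a) qpath \<Rightarrow> ('v, 'a) bar_tuple \<Rightarrow>
    ('v, 'a) bar_tuple option" where
  "racts (w, s) (u, p, r, q) = (if pe u (p @ r @ q) = w \<and> nz (q @ s) then Some (u, p, r, q @ s) else None)"

lemma finite_bar_basis: "finite (bar_basis n)"
proof -
  let ?L = "{r. set r \<subseteq> arcs Q \<and> length r = n}"
  have "bar_basis n \<subseteq> verts Q \<times> snd ` N \<times> ?L \<times> snd ` N"
  proof (clarsimp simp: bar_basis_def)
    fix u p r q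
    assume path: "(u, p @ r @ q) \<in> paths Q" and "nz p" "nz q"
    then have "(u, p) \<in> N" "(pe (pe u p) r, q) \<in> N" by (auto simp: append_in_paths N_iff)
    moreover have "u \<in> verts Q" "set r \<subseteq> arcs Q" using path by (auto simp: paths_def awalk_def)
    ultimately show "u \<in> verts Q \<and> p \<in> snd ` N \<and> set r \<subseteq> arcs Q \<and> q \<in> snd ` N"
      by (metis imageI snd_conv)
  qed
  then show ?thesis
    by (rule finite_subset)
      (intro finite_cartesian_product finite_lists_length_eq finite_verts finite_arcs finite_imageI finite_N)
qed

lemma lacts_bar_basis: "\<lbrakk>s \<in> N; x \<in> bar_basis n; lacts s x = Some t\<rbrakk> \<Longrightarrow> t \<in> bar_basis n"
  by (cases s; cases x) (auto simp: bar_basis_def N_iff append_in_paths path_end_append split: if_splits)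

lemma racts_bar_basis: "\<lbrakk>s \<in> N; x \<in> bar_basis n; racts s x = Some t\<rbrakk> \<Longrightarrow> t \<in> bar_basis n"
  by (cases s; cases x) (auto simp: bar_basis_def N_iff append_in_paths path_end_append split: if_splits)

definition bar :: "nat \<Rightarrow> ('k, (('v, 'a) qpath \<Rightarrow> 'k) set, ('v, 'a) bar_tuple \<Rightarrow> 'k) bimod" where
  "bar n = \<lparr>carrier = {b. \<forall>t. t \<notin> bar_basis n \<longrightarrow> b t = 0}, monoid.mult = undefined, one = undefined,
     zero = (\<lambda>_. 0), add = (\<lambda>f g s. f s + g s), smult = (\<lambda>c f s. c * f s),
     lact = gact lacts (bar_basis n), ract = (\<lambda>b a. gact racts (bar_basis n) a b)\<rparr>"

lemma bar_simps [simp]: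
  "carrier (bar n) = {b. \<forall>t. t \<notin> bar_basis n \<longrightarrow> b t = 0}" "\<zero>\<^bsub>bar n\<^esub> = (\<lambda>_. 0)"
  "f \<oplus>\<^bsub>bar n\<^esub> g = (\<lambda>s. f s + g s)" "c \<odot>\<^bsub>bar n\<^esub> f = (\<lambda>s. c * f s)"
  "lact (bar n) a b = gact lacts (bar_basis n) a b" "ract (bar n) b a = gact racts (bar_basis n) a b"
  by (simp_all add: bar_def)

lemma gact_gact_basis:
  assumes "s \<in> N" "s' \<in> N" "t \<in> bar_basis n" "\<And>t'. act' s' t = Some t' \<Longrightarrow> t' \<in> bar_basis n"
  shows "gact act (bar_basis n) (path_class s) (gact act' (bar_basis n) (path_class s') (basis_vec t)) =
    (case Option.bind (act' s' t) (act s) of None \<Rightarrow> (\<lambda>_. 0) | Some t \<Rightarrow> basis_vec t)"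
  using assms by (cases "act' s' t") (simp_all add: gact_basis[OF finite_bar_basis] gact_linear)

lemma bar_induct [consumes 1, case_names zero add]:
  assumes "b \<in> carrier (bar n)" "P (\<lambda>_. 0)"
    "\<And>g c t. \<lbrakk>g \<in> carrier (bar n); P g; t \<in> bar_basis n\<rbrakk> \<Longrightarrow> P (\<lambda>s. g s + c * basis_vec t s)"
  shows "P b"
  by (rule finite_support_induct[where P = P, OF finite_bar_basis[of n]]) (use assms in auto)

text \<open>The parameter \<open>F\<close> allows one proof for both module laws, the two factors
  being applied in opposite orders on the two sides. Three inductions, on the bimodule element and
  on both algebra elements, reduce the law to paths and basis tuples.\<close>

lemma gact_mult:
  assumes a: "a \<in> carrier A" and b: "b \<in> carrier A" and x: "x \<in> carrier (bar n)"
    and basis: "\<And>s s' t. \<lbrakk>s \<in> N; s' \<in> N; t \<in> bar_basis n\<rbrakk> \<Longrightarrow>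
        gact act (bar_basis n) (path_class s \<otimes>\<^bsub>A\<^esub> path_class s') (basis_vec t) = F (path_class s)
            (path_class s') (basis_vec t)"
    and F: "\<And>a b. F a b (\<lambda>_. 0) = (\<lambda>_. 0)"
      "\<And>a b g c t. F a b (\<lambda>s. g s + c * basis_vec t s) = (\<lambda>s. F a b g s + c * F a b (basis_vec t) s)"
      "\<And>b x. F \<zero>\<^bsub>A\<^esub> b x = (\<lambda>_. 0)" "\<And>a x. F a \<zero>\<^bsub>A\<^esub> x = (\<lambda>_. 0)"
      "\<And>a b c p x. \<lbrakk>a \<in> carrier A; p \<in> N\<rbrakk> \<Longrightarrow> F (a \<oplus>\<^bsub>A\<^esub> c \<odot>\<^bsub>A\<^esub> path_class p) b x = (\<lambda>s. F a b x s
          + c * F (path_class p) b x s)"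
      "\<And>a b c p x. \<lbrakk>b \<in> carrier A; p \<in> N\<rbrakk> \<Longrightarrow> F a (b \<oplus>\<^bsub>A\<^esub> c \<odot>\<^bsub>A\<^esub> path_class p) x = (\<lambda>s. F a b x s
          + c * F a (path_class p) x s)"
  shows "gact act (bar_basis n) (a \<otimes>\<^bsub>A\<^esub> b) x = F a b x"
proof -
  have 1: "gact act (bar_basis n) (path_class s \<otimes>\<^bsub>A\<^esub> path_class s') x = F (path_class s) (path_class s') x"
    if "s \<in> N" "s' \<in> N" for s s'
    using x by (induction x rule: bar_induct) (simp_all add: gact_linear F basis that)
  have 2: "gact act (bar_basis n) (path_class s \<otimes>\<^bsub>A\<^esub> b) x = F (path_class s) b x" if "s \<in> N" for s
    using b by (induction b rule: A_induct) (simp_all add: gact_linear F 1 that A.r_distr mult_smult)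
  show ?thesis
    using a by (induction a rule: A_induct) (simp_all add: gact_linear F 2 b A.l_distr smult_mult)
qed

lemma gact_comm:
  assumes a: "a \<in> carrier A" and b: "b \<in> carrier A" and x: "x \<in> carrier (bar n)"
  shows "gact racts (bar_basis n) b (gact lacts (bar_basis n) a x)
      = gact lacts (bar_basis n) a (gact racts (bar_basis n) b x)"
proof -
  have 0: "gact racts (bar_basis n) (path_class s') (gact lacts (bar_basis n) (path_class s) (basis_vec t)) =
           gact lacts (bar_basis n) (path_class s) (gact racts (bar_basis n) (path_class s') (basis_vec t))"
    if "s \<in> N" "s' \<in> N" "t \<in> bar_basis n" for s s' t
  proof -
    have "Option.bind (lacts s t) (racts s') = Option.bind (racts s' t) (lacts s)"
      by (cases s; cases s'; cases t) (simp add: path_end_append)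
    then show ?thesis
      using that lacts_bar_basis[OF that(1,3)] racts_bar_basis[OF that(2,3)] by (simp add: gact_gact_basis)
  qed
  have 1: "gact racts (bar_basis n) (path_class s') (gact lacts (bar_basis n) (path_class s) x) =
           gact lacts (bar_basis n) (path_class s) (gact racts (bar_basis n) (path_class s') x)" if "s \<in>
               N" "s' \<in> N" for s s'
    using x by (induction x rule: bar_induct) (simp_all add: gact_linear 0 that)
  have 2: "gact racts (bar_basis n) b (gact lacts (bar_basis n) (path_class s) x) =
           gact lacts (bar_basis n) (path_class s) (gact racts (bar_basis n) b x)" if "s \<in> N" for s
    using b by (induction b rule: A_induct) (simp_all add: gact_linear 1 that)
  show ?thesis using a by (induction a rule: A_induct) (simp_all add: gact_linear 2)
qed

text \<open>The unit is the sum of the trivial paths, and only the one at the start of a basis tuple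
  acts on it nontrivially.\<close>

lemma lact_one_bar: assumes "x \<in> carrier (bar n)" shows "gact lacts (bar_basis n) \<one>\<^bsub>A\<^esub> x = x"
proof
  fix t :: "('v, 'a) bar_tuple"
  have "gact lacts (bar_basis n) \<one>\<^bsub>A\<^esub> x t = (\<Sum>y\<in>bar_basis n. \<Sum>s\<in>N. coef \<one>\<^bsub>A\<^esub> s * x y * of_bool (lacts s y
      = Some t))"
    unfolding gact_def by (rule sum.swap)
  also have "\<dots> = (\<Sum>y\<in>bar_basis n. if y = t then x t else 0)"
  proof (rule sum.cong[OF refl])
    fix y assume y: "y \<in> bar_basis n"
    obtain u p r q where [simp]: "y = (u, p, r, q)" by (cases y)
    have u: "(u, []) \<in> N" using y by (auto simp: bar_basis_def N_iff dest: path_start)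
    have "(\<Sum>s\<in>N. coef \<one>\<^bsub>A\<^esub> s * x y * of_bool (lacts s y = Some t)) = (\<Sum>s\<in>N. if s = (u, []) then if y
        = t then x t else 0 else 0)"
      using y by (intro sum.cong refl) (auto simp: coef_one trivial_paths_def bar_basis_def N_iff split:
          if_splits)
    then show "(\<Sum>s\<in>N. coef \<one>\<^bsub>A\<^esub> s * x y * of_bool (lacts s y = Some t)) = (if y = t then x t else 0)"
      using u finite_N by (simp del: \<open>y = (u, p, r, q)\<close>)
  qed
  also have "\<dots> = x t"
  proof -
    have "t \<notin> bar_basis n \<Longrightarrow> x t = 0" using assms by (cases t) simp
    then show ?thesis using finite_bar_basis[of n] by auto
  qed
  finally show "gact lacts (bar_basis n) \<one>\<^bsub>A\<^esub> x t = x t" .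
qed

lemma ract_one_bar: assumes "x \<in> carrier (bar n)" shows "gact racts (bar_basis n) \<one>\<^bsub>A\<^esub> x = x"
proof
  fix t :: "('v, 'a) bar_tuple"
  have "gact racts (bar_basis n) \<one>\<^bsub>A\<^esub> x t = (\<Sum>y\<in>bar_basis n. \<Sum>s\<in>N. coef \<one>\<^bsub>A\<^esub> s * x y * of_bool (racts s y
      = Some t))"
    unfolding gact_def by (rule sum.swap)
  also have "\<dots> = (\<Sum>y\<in>bar_basis n. if y = t then x t else 0)"
  proof (rule sum.cong[OF refl])
    fix y assume y: "y \<in> bar_basis n"
    obtain u p r q where [simp]: "y = (u, p, r, q)" by (cases y)
    let ?v = "pe u (p @ r @ q)"
    have u: "(?v, []) \<in> N" using y path_end_in_verts by (auto simp: bar_basis_def N_iff)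
    have "(\<Sum>s\<in>N. coef \<one>\<^bsub>A\<^esub> s * x y * of_bool (racts s y = Some t)) = (\<Sum>s\<in>N. if s = (?v, []) then if y
        = t then x t else 0 else 0)"
      using y by (intro sum.cong refl) (auto simp: coef_one trivial_paths_def bar_basis_def N_iff split:
          if_splits)
    then show "(\<Sum>s\<in>N. coef \<one>\<^bsub>A\<^esub> s * x y * of_bool (racts s y = Some t)) = (if y = t then x t else 0)"
      using u finite_N by (simp del: \<open>y = (u, p, r, q)\<close>)
  qed
  also have "\<dots> = x t"
  proof -
    have "t \<notin> bar_basis n \<Longrightarrow> x t = 0" using assms by (cases t) simp
    then show ?thesis using finite_bar_basis[of n] by auto
  qed
  finally show "gact racts (bar_basis n) \<one>\<^bsub>A\<^esub> x t = x t" .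
qed

lemma bimodule_bar: "bimodule A (bar n)"
proof (rule bimodule.intro)
  show "vectorspace class_ring (bar n)"
    by (rule vectorspace_class_ringI) (auto simp: algebra_simps)
next
  fix a b x assume a: "a \<in> carrier A" and b: "b \<in> carrier A" and x: "x \<in> carrier (bar n)"
  have "gact lacts (bar_basis n) (a \<otimes>\<^bsub>A\<^esub> b) x
      = (\<lambda>a b x. gact lacts (bar_basis n) a (gact lacts (bar_basis n) b x)) a b x"
  proof (rule gact_mult[OF a b x])
    fix s s' t assume st: "s \<in> N" "s' \<in> N" "t \<in> bar_basis n"
    show "gact lacts (bar_basis n) (path_class s \<otimes>\<^bsub>A\<^esub> path_class s') (basis_vec t) =
        gact lacts (bar_basis n) (path_class s) (gact lacts (bar_basis n) (path_class s') (basis_vec t))"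
    proof -
      obtain w p v q u x r y where eqs: "s = (w, p)" "s' = (v, q)" "t = (u, x, r, y)"
        by (cases s; cases s'; cases t)
      have "gact lacts (bar_basis n) (path_class s \<otimes>\<^bsub>A\<^esub> path_class s') (basis_vec t) =
         (case Option.bind (lacts s' t) (lacts s) of None \<Rightarrow> (\<lambda>_. 0) | Some t \<Rightarrow> basis_vec t)"
      proof (cases "pe w p = v \<and> nz (p @ q)")
        case True
        then have "(w, p @ q) \<in> N" using st by (simp add: eqs N_iff append_in_paths)
        then show ?thesis using True st
          by (simp add: eqs path_class_mult gact_basis[OF finite_bar_basis] path_end_append
              successively_append_iff) auto
      next
        case False
        then show ?thesis using st
          by (auto simp: eqs path_class_mult gact_linear path_end_append successively_append_iff)
      qed
      then show ?thesis using st lacts_bar_basis[of s' t n] by (simp add: gact_gact_basis)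
    qed
  qed (simp_all add: gact_linear)
  then show "lact (bar n) (a \<otimes>\<^bsub>A\<^esub> b) x = lact (bar n) a (lact (bar n) b x)" by simp
  have "gact racts (bar_basis n) (a \<otimes>\<^bsub>A\<^esub> b) x
      = (\<lambda>a b x. gact racts (bar_basis n) b (gact racts (bar_basis n) a x)) a b x"
  proof (rule gact_mult[OF a b x])
    fix s s' t assume st: "s \<in> N" "s' \<in> N" "t \<in> bar_basis n"
    show "gact racts (bar_basis n) (path_class s \<otimes>\<^bsub>A\<^esub> path_class s') (basis_vec t) =
        gact racts (bar_basis n) (path_class s') (gact racts (bar_basis n) (path_class s) (basis_vec t))"
    proof -
      obtain w p v q u x r y where eqs: "s = (w, p)" "s' = (v, q)" "t = (u, x, r, y)"
        by (cases s; cases s'; cases t)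
      have "gact racts (bar_basis n) (path_class s \<otimes>\<^bsub>A\<^esub> path_class s') (basis_vec t) =
         (case Option.bind (racts s t) (racts s') of None \<Rightarrow> (\<lambda>_. 0) | Some t \<Rightarrow> basis_vec t)"
      proof (cases "pe w p = v \<and> nz (p @ q)")
        case True
        then have "(w, p @ q) \<in> N" using st by (simp add: eqs N_iff append_in_paths)
        then show ?thesis using True st
          by (simp add: eqs path_class_mult gact_basis[OF finite_bar_basis] path_end_append
              successively_append_iff) auto
      next
        case False
        then show ?thesis using st
          by (auto simp: eqs path_class_mult gact_linear path_end_append successively_append_iff)
      qed
      then show ?thesis using st racts_bar_basis[of s t n] by (simp add: gact_gact_basis)
    qed
  qed (simp_all add: gact_linear)
  then show "ract (bar n) x (a \<otimes>\<^bsub>A\<^esub> b) = ract (bar n) (ract (bar n) x a) b" by simp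
  show "ract (bar n) (lact (bar n) a x) b = lact (bar n) a (ract (bar n) x b)"
    using gact_comm[OF a b x] by simp
next
  fix a b assume "a \<in> carrier A" "b \<in> carrier (bar n)"
  show "lact (bar n) a b \<in> carrier (bar n)" "ract (bar n) b a \<in> carrier (bar n)"
    using gact_outside[of "bar_basis n" lacts, OF lacts_bar_basis] gact_outside[of "bar_basis n"
        racts, OF racts_bar_basis] by auto
qed (use lact_one_bar ract_one_bar in \<open>simp_all add: gact_linear\<close>)

end

section \<open>Freeness of the Koszul bimodules\<close>

context kalgebra begin

lemma finsum_additive:
  assumes M: "bimodule A M" and L: "bimodule A L" and fin: "finite T" and f: "f \<in> T \<rightarrow> carrier M"
    and h: "\<And>x y. \<lbrakk>x \<in> carrier M; y \<in> carrier M\<rbrakk> \<Longrightarrow> h (x \<oplus>\<^bsub>M\<^esub> y) = h x \<oplus>\<^bsub>L\<^esub> h y"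
    and h0: "h \<zero>\<^bsub>M\<^esub> = \<zero>\<^bsub>L\<^esub>" and hc: "\<And>x. x \<in> carrier M \<Longrightarrow> h x \<in> carrier L"
  shows "h (finsum M f T) = finsum L (\<lambda>t. h (f t)) T"
proof -
  interpret M: bimodule A M by fact
  interpret L: bimodule A L by fact
  show ?thesis using fin f
  proof (induction T rule: finite_induct)
    case (insert x T)
    then have "f x \<in> carrier M" "f \<in> T \<rightarrow> carrier M" "(\<lambda>t. h (f t)) \<in> T \<rightarrow> carrier L" "h (f x) \<in> carrier L"
      using hc by auto
    then show ?case using insert by (simp add: M.V.M.finsum_insert L.V.M.finsum_insert h M.V.M.finsum_closed)
  qed (simp add: h0)
qed

end

context qsa begin

lemma basis_in_bar: "t \<in> bar_basis n \<Longrightarrow> basis_vec t \<in> carrier (bar n)"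
  by (cases t) (auto simp: basis_vec_def)

text \<open>A linear map is a bimodule map as soon as it commutes with the action of paths on basis
  tuples; all other compatibilities follow by linearity in both arguments.\<close>

lemma bar_homI:
  assumes M: "bimodule A M"
    and h: "\<And>b. b \<in> carrier (bar n) \<Longrightarrow> h b \<in> carrier M"
    and add: "\<And>b b'. \<lbrakk>b \<in> carrier (bar n); b' \<in> carrier (bar n)\<rbrakk> \<Longrightarrow> h (\<lambda>s. b s + b' s) = h b \<oplus>\<^bsub>M\<^esub> h b'"
    and smult: "\<And>b c. b \<in> carrier (bar n) \<Longrightarrow> h (\<lambda>s. c * b s) = c \<odot>\<^bsub>M\<^esub> h b"
    and l: "\<And>s t. \<lbrakk>s \<in> N; t \<in> bar_basis n\<rbrakk> \<Longrightarrow>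
        h (gact lacts (bar_basis n) (path_class s) (basis_vec t)) = lact M (path_class s) (h (basis_vec t))"
    and r: "\<And>s t. \<lbrakk>s \<in> N; t \<in> bar_basis n\<rbrakk> \<Longrightarrow>
        h (gact racts (bar_basis n) (path_class s) (basis_vec t)) = ract M (h (basis_vec t)) (path_class s)"
  shows "restrict h (carrier (bar n)) \<in> bimod_hom A (bar n) M"
proof -
  interpret M: bimodule A M by fact
  interpret B: bimodule A "bar n" by (rule bimodule_bar)
  have z: "h (\<lambda>_. 0) = \<zero>\<^bsub>M\<^esub>" using smult[of "\<lambda>_. 0" 0] h[of "\<lambda>_. 0"] by simp
  have bas: "basis_vec t \<in> carrier (bar n)" if "t \<in> bar_basis n" for t using that by (rule basis_in_bar)
  have sm: "(\<lambda>s. c * b s) \<in> carrier (bar n)" if "b \<in> carrier (bar n)" for b c using that by simp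
  have lc: "gact lacts (bar_basis n) a b \<in> carrier (bar n)" if "a \<in> carrier A" "b \<in> carrier (bar n)" for a b
    using B.lact_closed[OF that] by (simp only: bar_simps)
  have rc: "gact racts (bar_basis n) a b \<in> carrier (bar n)" if "a \<in> carrier A" "b \<in> carrier (bar n)" for a b
    using B.ract_closed[OF that(2,1)] by (simp only: bar_simps)
  note simps = gact_linear z add smult h bas sm lc rc M.lact_add_left M.lact_add_right M.ract_add_left
    M.ract_add_right M.lact_smult M.ract_smult M.lact_closed M.ract_closed
  have lsm: "lact M a (c \<odot>\<^bsub>M\<^esub> x) = c \<odot>\<^bsub>M\<^esub> lact M a x" if "a \<in> carrier A" "x \<in> carrier M" for a c x
  proof -
    have "lact M a (c \<odot>\<^bsub>M\<^esub> x) = lact M a (lact M (c \<odot>\<^bsub>A\<^esub> \<one>\<^bsub>A\<^esub>) x)" using that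
      by (simp add: M.lact_smult M.lact_one)
    also have "\<dots> = lact M (a \<otimes>\<^bsub>A\<^esub> (c \<odot>\<^bsub>A\<^esub> \<one>\<^bsub>A\<^esub>)) x" using that by (simp add: M.lact_mult)
    finally show ?thesis using that by (simp add: mult_smult M.lact_smult)
  qed
  have rsm: "ract M (c \<odot>\<^bsub>M\<^esub> x) a = c \<odot>\<^bsub>M\<^esub> ract M x a" if "a \<in> carrier A" "x \<in> carrier M" for a c x
  proof -
    have "ract M (c \<odot>\<^bsub>M\<^esub> x) a = ract M (ract M x (c \<odot>\<^bsub>A\<^esub> \<one>\<^bsub>A\<^esub>)) a" using that
      by (simp add: M.ract_smult M.ract_one)
    also have "\<dots> = ract M x ((c \<odot>\<^bsub>A\<^esub> \<one>\<^bsub>A\<^esub>) \<otimes>\<^bsub>A\<^esub> a)" using that by (simp add: M.ract_mult)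
    finally show ?thesis using that by (simp add: smult_mult M.ract_smult)
  qed
  have l1: "h (gact lacts (bar_basis n) (path_class s) b) = lact M (path_class s) (h b)"
    if "s \<in> N" "b \<in> carrier (bar n)" for s b
    using that(2) by (induction b rule: bar_induct) (simp_all add: simps l that(1) lsm del: bar_simps)
  have r1: "h (gact racts (bar_basis n) (path_class s) b) = ract M (h b) (path_class s)"
    if "s \<in> N" "b \<in> carrier (bar n)" for s b
    using that(2) by (induction b rule: bar_induct) (simp_all add: simps r that(1) rsm del: bar_simps)
  have l0: "lact M \<zero>\<^bsub>A\<^esub> x = \<zero>\<^bsub>M\<^esub>" "ract M x \<zero>\<^bsub>A\<^esub> = \<zero>\<^bsub>M\<^esub>" if "x \<in> carrier M" for x
    using M.lact_smult[of "\<one>\<^bsub>A\<^esub>" x 0] M.ract_smult[of x "\<one>\<^bsub>A\<^esub>" 0] that AV.smult_l_null[of "\<one>\<^bsub>A\<^esub>"]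
    by (simp_all add: M.lact_one M.ract_one)
  have l2: "h (gact lacts (bar_basis n) a b) = lact M a (h b)" if "a \<in> carrier A" "b \<in> carrier (bar n)"
    for a b
    using that(1) by (induction a rule: A_induct) (simp_all add: simps l1 that(2) l0 del: bar_simps)
  have r2: "h (gact racts (bar_basis n) a b) = ract M (h b) a" if "a \<in> carrier A" "b \<in> carrier (bar n)"
    for a b
    using that(1) by (induction a rule: A_induct) (simp_all add: simps r1 that(2) l0 del: bar_simps)
  have car: "(\<lambda>s. b s + b' s) \<in> carrier (bar n)" if "b \<in> carrier (bar n)" "b' \<in> carrier (bar n)" for b b'
    using B.V.M.a_closed[OF that] by (simp only: bar_simps)
  show ?thesis unfolding bimod_hom_def
  proof (intro CollectI conjI ballI)
    show "restrict h (carrier (bar n)) \<in> carrier (bar n) \<rightarrow>\<^sub>E carrier M" using h by auto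
  next
    fix x y assume "x \<in> carrier (bar n)" "y \<in> carrier (bar n)"
    then show "restrict h (carrier (bar n)) (x \<oplus>\<^bsub>bar n\<^esub> y) =
      restrict h (carrier (bar n)) x \<oplus>\<^bsub>M\<^esub> restrict h (carrier (bar n)) y"
      using B.V.M.a_closed[of x y] add[of x y] by (simp only: restrict_apply' bar_simps(3))
  next
    fix a x assume "a \<in> carrier A" "x \<in> carrier (bar n)"
    then show "restrict h (carrier (bar n)) (lact (bar n) a x) = lact M a (restrict h (carrier (bar n)) x)"
      "restrict h (carrier (bar n)) (ract (bar n) x a) = ract M (restrict h (carrier (bar n)) x) a"
      using B.lact_closed[of a x] B.ract_closed[of x a] l2[of a x] r2[of a x]
      by (simp_all only: restrict_apply' bar_simps(5,6))
  qed
qed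

text \<open>The generator \<open>1 \<otimes> r \<otimes> 1\<close>, tensored over the
  vertices.\<close>

definition gen :: "('v, 'a) qpath \<Rightarrow> ('v, 'a) bar_tuple \<Rightarrow> 'k" where
  "gen x = basis_vec (fst x, [], snd x, [])"

lemma gen_bar_basis: "(u, r) \<in> AP Q I n \<Longrightarrow> (u, [], r, []) \<in> bar_basis n"
  by (simp add: AP_iff bar_basis_def)

lemma gen_in_bar: "x \<in> AP Q I n \<Longrightarrow> gen x \<in> carrier (bar n)"
  unfolding gen_def by (cases x) (simp only: fst_conv snd_conv basis_in_bar gen_bar_basis)

lemma bar_basis_parts:
  assumes "(u, p, r, q) \<in> bar_basis n"
  shows "(u, p) \<in> N" "(pe u p, r) \<in> AP Q I n" "(pe (pe u p) r, q) \<in> N"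
    "(u, []) \<in> N" "(pe u p, []) \<in> N" "(pe (pe u p) r, []) \<in> N" "(pe (pe (pe u p) r) q, []) \<in> N"
    "pe u (p @ r @ q) = pe (pe (pe u p) r) q"
  using assms by (auto simp: bar_basis_def N_iff AP_iff append_in_paths path_end_append path_end_in_verts
      dest: path_start)

lemma basis_from_gen:
  assumes "(u, p, r, q) \<in> bar_basis n"
  shows "gact lacts (bar_basis n) (path_class (u, p)) (gact racts (bar_basis n) (path_class (pe (pe u p) r,
      q)) (gen (pe u p, r)))
       = basis_vec (u, p, r, q)"
proof -
  note b = bar_basis_parts[OF assms]
  have nz: "nz p" "nz q" using assms by (auto simp: bar_basis_def)
  have t: "(pe u p, [], r, []) \<in> bar_basis n" by (rule gen_bar_basis[OF b(2)])
  then have t2: "(pe u p, [], r, q) \<in> bar_basis n" using b(3)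
    by (auto simp: bar_basis_def N_iff append_in_paths)
  show ?thesis unfolding gen_def using b nz t t2 by (simp add: gact_basis[OF finite_bar_basis])
qed

lemma bar_hom_eqI:
  assumes M: "bimodule A M" and f: "f \<in> bimod_hom A (bar n) M" and g: "g \<in> bimod_hom A (bar n) M"
    and eq: "\<And>x. x \<in> AP Q I n \<Longrightarrow> f (gen x) = g (gen x)"
  shows "f = g"
proof (rule hom_eqI[OF f g])
  note B = bimodule_bar[of n]
  have basis: "f (basis_vec t) = g (basis_vec t)" if t: "t \<in> bar_basis n" for t
  proof -
    obtain u p r q where tt: "t = (u, p, r, q)" by (cases t)
    note b = bar_basis_parts[OF t[unfolded tt]]
    have "h (basis_vec t) = lact M (path_class (u, p)) (ract M (h (gen (pe u p, r))) (path_class (pe (pe u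
        p) r, q)))"
      if h: "h \<in> bimod_hom A (bar n) M" for h
    proof -
      have gc: "gen (pe u p, r) \<in> carrier (bar n)" by (rule gen_in_bar[OF b(2)])
      have rc: "ract (bar n) (gen (pe u p, r)) (path_class (pe (pe u p) r, q)) \<in> carrier (bar n)"
        using bimodule.ract_closed[OF B gc path_class_closed[OF b(3)]] .
      have "h (basis_vec t) = h (lact (bar n) (path_class (u, p)) (ract (bar n) (gen (pe u p, r))
          (path_class (pe (pe u p) r, q))))"
        using basis_from_gen[OF t[unfolded tt]] by (simp only: bar_simps(5,6) tt)
      then show ?thesis
        by (simp only: hom_lact[OF h path_class_closed[OF b(1)] rc] hom_ract[OF h path_class_closed[OF b(3)]
            gc])
    qed
    from this[OF f] this[OF g] eq[OF b(2)] show ?thesis by simp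
  qed
  fix x assume "x \<in> carrier (bar n)"
  then show "f x = g x"
  proof (induction x rule: bar_induct)
    case zero
    then show ?case using hom_zero[OF B M f] hom_zero[OF B M g] by (simp only: bar_simps(2))
  next
    case (add x c t)
    have bt: "basis_vec t \<in> carrier (bar n)" by (rule basis_in_bar[OF add.hyps(2)])
    have sm: "c \<odot>\<^bsub>bar n\<^esub> basis_vec t \<in> carrier (bar n)"
      using bimodule.smult_closed'[OF B bt] .
    have "h (\<lambda>s. x s + c * basis_vec t s) = h x \<oplus>\<^bsub>M\<^esub> c \<odot>\<^bsub>M\<^esub> h (basis_vec t)"
      if h: "h \<in> bimod_hom A (bar n) M" for h
      using hom_add[OF h add.hyps(1) sm] hom_smult[OF B M h bt] by (simp only: bar_simps(3,4))
    from this[OF f] this[OF g] show ?case using add.IH basis[OF add.hyps(2)] by simp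
  qed
qed

text \<open>\<open>bar n\<close> is a direct sum of bimodules \<open>A e_u \<otimes> e_v A\<close>,
  one for each path in \<open>AP Q I n\<close> from \<open>u\<close> to \<open>v\<close>. So a
  homomorphism amounts to a choice of elements of \<open>e_u M e_v\<close>, and membership there is
  what \<open>end1\<close> and \<open>end2\<close> express. The tuple
  \<open>p \<otimes> r \<otimes> q\<close> must go to \<open>p m(r) q\<close>.\<close>

lemma bar_free:
  fixes m :: "('v, 'a) qpath \<Rightarrow> 'm"
  assumes M: "bimodule A M"
    and m: "\<And>x. x \<in> AP Q I n \<Longrightarrow> m x \<in> carrier M"
    and end1: "\<And>u r. (u, r) \<in> AP Q I n \<Longrightarrow> lact M (path_class (u, [])) (m (u, r)) = m (u, r)"
    and end2: "\<And>u r. (u, r) \<in> AP Q I n \<Longrightarrow> ract M (m (u, r)) (path_class (pe u r, [])) = m (u, r)"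
  shows "\<exists>h\<in>bimod_hom A (bar n) M. \<forall>x\<in>AP Q I n. h (gen x) = m x"
proof -
  interpret M: bimodule A M by fact
  define v where "v = (\<lambda>(u, p, r, q). lact M (path_class (u, p)) (ract M (m (pe u p, r)) (path_class (pe (pe
      u p) r, q))))"
  have vc: "v t \<in> carrier M" if "t \<in> bar_basis n" for t
  proof -
    obtain u p r q where tt: "t = (u, p, r, q)" by (cases t)
    show ?thesis using bar_basis_parts[OF that[unfolded tt]] m
      by (simp add: v_def tt M.lact_closed M.ract_closed)
  qed
  define h where "h = (\<lambda>b. finsum M (\<lambda>t. b t \<odot>\<^bsub>M\<^esub> v t) (bar_basis n))"
  have fc: "(\<lambda>t. b t \<odot>\<^bsub>M\<^esub> v t) \<in> bar_basis n \<rightarrow> carrier M" for b using vc by auto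
  have hc: "h b \<in> carrier M" for b unfolding h_def by (rule M.V.M.finsum_closed[OF fc])
  have hadd: "h (\<lambda>s. b s + b' s) = h b \<oplus>\<^bsub>M\<^esub> h b'" for b b'
  proof -
    have "h (\<lambda>s. b s + b' s) = finsum M (\<lambda>t. b t \<odot>\<^bsub>M\<^esub> v t \<oplus>\<^bsub>M\<^esub> b' t \<odot>\<^bsub>M\<^esub> v t) (bar_basis n)"
      unfolding h_def by (rule M.V.M.finsum_cong') (auto simp: vc M.smult_add_l)
    then show ?thesis using M.V.M.finsum_addf[OF fc fc, of b b'] by (simp add: h_def)
  qed
  have hsm: "h (\<lambda>s. c * b s) = c \<odot>\<^bsub>M\<^esub> h b" for b c
  proof -
    have "h (\<lambda>s. c * b s) = finsum M (\<lambda>t. c \<odot>\<^bsub>M\<^esub> (b t \<odot>\<^bsub>M\<^esub> v t)) (bar_basis n)"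
      unfolding h_def by (rule M.V.M.finsum_cong') (auto simp: vc M.smult_smult)
    also have "\<dots> = c \<odot>\<^bsub>M\<^esub> h b"
      unfolding h_def by (rule finsum_additive[OF M M finite_bar_basis fc, symmetric]) (simp_all add:
          M.smult_add_r)
    finally show ?thesis .
  qed
  have h0: "h (\<lambda>_. 0) = \<zero>\<^bsub>M\<^esub>" using hsm[of 0 "\<lambda>_. 0"] hc by simp
  have hb: "h (basis_vec t) = v t" if t: "t \<in> bar_basis n" for t
  proof -
    have "h (basis_vec t) = finsum M (\<lambda>s. if t = s then v s else \<zero>\<^bsub>M\<^esub>) (bar_basis n)"
      unfolding h_def using vc by (intro M.V.M.finsum_cong') (auto simp: basis_vec_def)
    also have "\<dots> = v t" using M.V.M.finsum_singleton[OF t finite_bar_basis, of v] vc by auto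
    finally show ?thesis .
  qed
  have hom: "restrict h (carrier (bar n)) \<in> bimod_hom A (bar n) M"
  proof (rule bar_homI[OF M hc hadd hsm])
    fix s t assume s: "s \<in> N" and t: "t \<in> bar_basis n"
    obtain w x u p r q where tt: "s = (w, x)" "t = (u, p, r, q)" by (cases s; cases t)
    note b = bar_basis_parts[OF t[unfolded tt]]
    let ?y = "ract M (m (pe u p, r)) (path_class (pe (pe u p) r, q))"
    let ?z = "lact M (path_class (u, p)) (m (pe u p, r))"
    have yc: "?y \<in> carrier M" using b m by (simp add: M.ract_closed)
    have zc: "?z \<in> carrier M" using b m by (simp add: M.lact_closed)
    have l0: "lact M \<zero>\<^bsub>A\<^esub> y = \<zero>\<^bsub>M\<^esub>" "ract M y \<zero>\<^bsub>A\<^esub> = \<zero>\<^bsub>M\<^esub>" if "y \<in> carrier M" for y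
      using M.lact_smult[of "\<one>\<^bsub>A\<^esub>" y 0] M.ract_smult[of y "\<one>\<^bsub>A\<^esub>" 0] that AV.smult_l_null[of "\<one>\<^bsub>A\<^esub>"]
      by (simp_all add: M.lact_one M.ract_one)
    have vt: "v t = lact M (path_class (u, p)) ?y" "v t = ract M ?z (path_class (pe (pe u p) r, q))"
      using b m by (simp_all add: v_def tt M.lact_ract)
    have "lact M (path_class s) (v t) = lact M (path_class (w, x) \<otimes>\<^bsub>A\<^esub> path_class (u, p)) ?y"
      unfolding vt(1) using M.lact_mult[OF path_class_closed[OF s] path_class_closed[OF b(1)] yc]
        by (simp add: tt)
    also have "\<dots> = h (gact lacts (bar_basis n) (path_class s) (basis_vec t))"
    proof (cases "pe w x = u \<and> nz (x @ p)")
      case True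
      then have "(w, x @ p, r, q) \<in> bar_basis n" using lacts_bar_basis[OF s t] by (simp add: tt)
      then show ?thesis using True s t b
        by (simp add: tt gact_basis[OF finite_bar_basis] hb path_class_mult v_def path_end_append)
    next
      case False
      then show ?thesis using s t b yc by (auto simp: tt gact_basis[OF finite_bar_basis] path_class_mult h0
          l0)
    qed
    finally show "h (gact lacts (bar_basis n) (path_class s) (basis_vec t))
        = lact M (path_class s) (h (basis_vec t))"
      by (simp add: hb[OF t])
    have "ract M (v t) (path_class s) = ract M ?z (path_class (pe (pe u p) r, q) \<otimes>\<^bsub>A\<^esub> path_class (w, x))"
      unfolding vt(2) using M.ract_mult[OF zc path_class_closed[OF b(3)] path_class_closed[OF s]]
        by (simp add: tt)
    also have "\<dots> = h (gact racts (bar_basis n) (path_class s) (basis_vec t))"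
    proof (cases "pe u (p @ r @ q) = w \<and> nz (q @ x)")
      case True
      then have t': "(u, p, r, q @ x) \<in> bar_basis n" using racts_bar_basis[OF s t] by (simp add: tt)
      then show ?thesis using True s t b bar_basis_parts(3)[OF t'] m
        by (simp add: tt gact_basis[OF finite_bar_basis] hb path_class_mult v_def M.lact_ract)
    next
      case False
      then show ?thesis using s t b zc by (auto simp: tt gact_basis[OF finite_bar_basis] path_class_mult h0
          l0)
    qed
    finally show "h (gact racts (bar_basis n) (path_class s) (basis_vec t))
        = ract M (h (basis_vec t)) (path_class s)"
      by (simp add: hb[OF t])
  qed
  have "restrict h (carrier (bar n)) (gen x) = m x" if x: "x \<in> AP Q I n" for x
  proof -
    obtain u r where xx: "x = (u, r)" by (cases x)
    have "restrict h (carrier (bar n)) (gen x) = v (u, [], r, [])"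
      using gen_in_bar[OF x] hb[OF gen_bar_basis, of u r] x
        by (simp only: restrict_apply' gen_def xx fst_conv snd_conv)
    then show ?thesis using end1 end2 x by (simp add: v_def xx)
  qed
  then show ?thesis using hom by blast
qed

lemma gen_ends:
  assumes "(u, r) \<in> AP Q I n"
  shows "gact lacts (bar_basis n) (path_class (u, [])) (gen (u, r)) = gen (u, r)"
    "gact racts (bar_basis n) (path_class (pe u r, [])) (gen (u, r)) = gen (u, r)"
  using assms gen_bar_basis[OF assms] bar_basis_parts[OF gen_bar_basis[OF assms]]
    by (simp_all add: gen_def gact_basis[OF finite_bar_basis])

lemma path_class_idem: "u \<in> verts Q \<Longrightarrow> path_class (u, []) \<otimes>\<^bsub>A\<^esub> path_class (u, []) = path_class (u, [])"
  by (simp add: path_class_mult N_iff)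

lemma AP_ends: "(u, r) \<in> AP Q I n \<Longrightarrow> u \<in> verts Q" "(u, r) \<in> AP Q I n \<Longrightarrow> pe u r \<in> verts Q"
  by (auto simp: AP_iff path_end_in_verts dest: path_start)

text \<open>Preimages of the values at the generators are chosen and extended by freeness. The
  target bimodules may have any type here, in contrast with \<open>projective_lifts\<close>.\<close>

lemma bar_lifts:
  assumes M: "bimodule A M" and L: "bimodule A L" and d: "d \<in> bimod_hom A M L"
  shows "lifts A (bar n) M L d"
  unfolding lifts_def
proof (intro ballI impI)
  interpret M: bimodule A M by fact
  interpret L: bimodule A L by fact
  fix f assume f: "f \<in> bimod_hom A (bar n) L" and im: "f ` carrier (bar n) \<subseteq> d ` carrier M"
  have "\<forall>x\<in>AP Q I n. \<exists>y. y \<in> carrier M \<and> d y = f (gen x)"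
  proof
    fix x assume "x \<in> AP Q I n"
    then have "f (gen x) \<in> d ` carrier M" by (intro subsetD[OF im] imageI gen_in_bar)
    then obtain y where "f (gen x) = d y" "y \<in> carrier M" by (rule imageE)
    then show "\<exists>y. y \<in> carrier M \<and> d y = f (gen x)" by (intro exI[of _ y] conjI) simp_all
  qed
  then obtain y where "\<forall>x\<in>AP Q I n. y x \<in> carrier M \<and> d (y x) = f (gen x)"
    by (drule_tac bchoice) (erule exE)
  then have y: "y x \<in> carrier M" "d (y x) = f (gen x)" if "x \<in> AP Q I n" for x
    using that by simp_all
  \<comment> \<open>A chosen preimage need not respect the end points of the generator, so it is
    multiplied by the idempotents of these vertices. Its image is unchanged, because
    \<open>f (gen (u, r))\<close> is fixed by both.\<close>
  define m where "m = (\<lambda>(u, r). lact M (path_class (u, [])) (ract M (y (u, r)) (path_class (pe u r, []))))"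
  have e: "path_class (u, []) \<in> carrier A" "path_class (pe u r, []) \<in> carrier A" if "(u, r) \<in> AP Q I n"
    for u r
    using AP_ends[OF that] by (simp_all add: N_iff)
  have mc: "m x \<in> carrier M" if x: "x \<in> AP Q I n" for x
    using x e y(1) by (cases x) (simp add: m_def M.lact_closed M.ract_closed)
  have "\<exists>h\<in>bimod_hom A (bar n) M. \<forall>x\<in>AP Q I n. h (gen x) = m x"
  proof (rule bar_free[OF M mc])
    fix u r assume ur: "(u, r) \<in> AP Q I n"
    note yc = y(1)[OF ur] and eu = e[OF ur]
    have rc: "ract M (y (u, r)) (path_class (pe u r, [])) \<in> carrier M" by (rule M.ract_closed[OF yc eu(2)])
    show "lact M (path_class (u, [])) (m (u, r)) = m (u, r)"
      using M.lact_mult[OF eu(1) eu(1) rc] path_class_idem[OF AP_ends(1)[OF ur]] by (simp add: m_def)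
    have "m (u, r) = ract M (lact M (path_class (u, [])) (y (u, r))) (path_class (pe u r, []))"
      using M.lact_ract[OF eu(1) yc eu(2)] by (simp add: m_def)
    then show "ract M (m (u, r)) (path_class (pe u r, [])) = m (u, r)"
      using M.ract_mult[OF M.lact_closed[OF eu(1) yc] eu(2) eu(2)] path_class_idem[OF AP_ends(2)[OF ur]]
        by simp
  qed
  then obtain h where h: "h \<in> bimod_hom A (bar n) M" and hm: "\<And>x. x \<in> AP Q I n \<Longrightarrow> h (gen x) = m x" by blast
  have "compose (carrier (bar n)) d h = f"
  proof (rule bar_hom_eqI[OF L hom_compose[OF h d bimodule_bar] f])
    fix x assume x: "x \<in> AP Q I n"
    obtain u r where xx: "x = (u, r)" by (cases x)
    note ur = x[unfolded xx]
    note gc = gen_in_bar[OF ur] and B = bimodule_bar[of n]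
    have "compose (carrier (bar n)) d h (gen x) = d (m x)"
      using gen_in_bar[OF x] hm[OF x] by (simp only: compose_eq)
    also have "\<dots> = lact L (path_class (u, [])) (ract L (f (gen x)) (path_class (pe u r, [])))"
      using e[OF ur] y(1)[OF ur] y(2)[OF ur]
      by (simp add: m_def xx hom_lact[OF d] hom_ract[OF d] M.ract_closed)
    also have "\<dots> = f (lact (bar n) (path_class (u, [])) (ract (bar n) (gen x) (path_class (pe u r, []))))"
      using hom_lact[OF f e(1)[OF ur] bimodule.ract_closed[OF B gc e(2)[OF ur]]] hom_ract[OF f e(2)[OF ur] gc]
      by (simp only: xx)
    also have "\<dots> = f (gen x)" by (simp only: bar_simps(5,6) gen_ends[OF ur] xx)
    finally show "compose (carrier (bar n)) d h (gen x) = f (gen x)" .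
  qed
  then have "d (h x) = f x" if "x \<in> carrier (bar n)" for x
    using compose_eq[OF that, of d h] by metis
  then show "\<exists>h\<in>bimod_hom A (bar n) M. \<forall>x\<in>carrier (bar n). d (h x) = f x"
    by (intro bexI[OF _ h] ballI)
qed

end

section \<open>The Koszul differential\<close>

lemma tuple4_ext: "(\<And>u p r q. f (u, p, r, q) = g (u, p, r, q)) \<Longrightarrow> f = g"
  by (simp add: fun_eq_iff)

context qsa begin

text \<open>
  Functions are coefficient vectors, so the coefficient of the image at \<open>p \<otimes> r \<otimes> q\<close> collects the two tuples
  from which an arrow of the middle path is moved to the last place of \<open>p\<close> or to the first place of \<open>q\<close>.
\<close>

definition dm :: "nat \<Rightarrow> (('v, 'a) bar_tuple \<Rightarrow> 'k) \<Rightarrow> ('v, 'a) bar_tuple \<Rightarrow> 'k" where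
  "dm n b = (\<lambda>(u, p, r, q). if (u, p, r, q) \<in> bar_basis n then
      (if p \<noteq> [] then b (u, butlast p, last p # r, q) else 0) +
      (- 1) ^ Suc n * (if q \<noteq> [] then b (u, p, r @ [hd q], tl q) else 0) else 0)"

definition dbar :: "nat \<Rightarrow> (('v, 'a) bar_tuple \<Rightarrow> 'k) \<Rightarrow> ('v, 'a) bar_tuple \<Rightarrow> 'k" where
  "dbar n = restrict (dm n) (carrier (bar (Suc n)))"

lemma dm_linear:
  "dm n (\<lambda>s. b s + b' s) = (\<lambda>t. dm n b t + dm n b' t)"
  "dm n (\<lambda>s. c * b s) = (\<lambda>t. c * dm n b t)"
  "dm n (\<lambda>s. 0) = (\<lambda>t. 0)"
  by (auto simp: dm_def algebra_simps)

text \<open>Translates the coefficient formula into the usual one: the first arrow of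
  \<open>r\<close> is multiplied onto \<open>p\<close>, the last one onto \<open>q\<close> with a
  sign, and either term disappears if its product vanishes in \<open>A\<close>. For
  \<open>n = 0\<close> both terms move the same arrow.\<close>

lemma dm_basis:
  assumes "(u, p, r, q) \<in> bar_basis (Suc n)"
  shows "dm n (basis_vec (u, p, r, q)) =
    (\<lambda>t. of_bool (nz (p @ [hd r])) * basis_vec (u, p @ [hd r], tl r, q) t +
      ((- 1) ^ Suc n * of_bool (nz (last r # q))) * basis_vec (u, p, butlast r, last r # q) t)"
proof (rule tuple4_ext)
  fix u' :: 'v and p' r' q' :: "'a list"
  have r: "r \<noteq> []" using assms by (auto simp: bar_basis_def)
  let ?t = "(u', p', r', q')"
  have 1: "(?t \<in> bar_basis n \<and> p' \<noteq> [] \<and> (u', butlast p', last p' # r', q') = (u, p, r, q)) \<longleftrightarrow>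
      nz (p @ [hd r]) \<and> ?t = (u, p @ [hd r], tl r, q)"
  proof
    assume "?t \<in> bar_basis n \<and> p' \<noteq> [] \<and> (u', butlast p', last p' # r', q') = (u, p, r, q)"
    then show "nz (p @ [hd r]) \<and> ?t = (u, p @ [hd r], tl r, q)" by (auto simp: bar_basis_def)
  next
    assume a: "nz (p @ [hd r]) \<and> ?t = (u, p @ [hd r], tl r, q)"
    then show "?t \<in> bar_basis n \<and> p' \<noteq> [] \<and> (u', butlast p', last p' # r', q') = (u, p, r, q)"
      using assms r by (cases r) (auto simp: bar_basis_def successively_Cons)
  qed
  have 2: "(?t \<in> bar_basis n \<and> q' \<noteq> [] \<and> (u', p', r' @ [hd q'], tl q') = (u, p, r, q)) \<longleftrightarrow>
      nz (last r # q) \<and> ?t = (u, p, butlast r, last r # q)"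
  proof
    assume "?t \<in> bar_basis n \<and> q' \<noteq> [] \<and> (u', p', r' @ [hd q'], tl q') = (u, p, r, q)"
    then show "nz (last r # q) \<and> ?t = (u, p, butlast r, last r # q)" by (auto simp: bar_basis_def)
  next
    assume a: "nz (last r # q) \<and> ?t = (u, p, butlast r, last r # q)"
    then show "?t \<in> bar_basis n \<and> q' \<noteq> [] \<and> (u', p', r' @ [hd q'], tl q') = (u, p, r, q)"
      using assms r by (cases r rule: rev_cases) (auto simp: bar_basis_def successively_append_iff)
  qed
  have "dm n (basis_vec (u, p, r, q)) ?t =
     of_bool (?t \<in> bar_basis n \<and> p' \<noteq> [] \<and> (u', butlast p', last p' # r', q') = (u, p, r, q)) +
     (- 1) ^ Suc n * of_bool (?t \<in> bar_basis n \<and> q' \<noteq> [] \<and> (u', p', r' @ [hd q'], tl q') = (u, p, r, q))"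
    unfolding dm_def prod.case basis_vec_def
    by (cases "?t \<in> bar_basis n"; cases "p' = []"; cases "q' = []")
       (simp_all only: simp_thms if_True if_False of_bool_def mult_zero_right add_0_right mult_1_right
           add_0_left)
  then show "dm n (basis_vec (u, p, r, q)) ?t
      = of_bool (nz (p @ [hd r])) * basis_vec (u, p @ [hd r], tl r, q) ?t +
      ((- 1) ^ Suc n * of_bool (nz (last r # q))) * basis_vec (u, p, butlast r, last r # q) ?t"
    unfolding 1 2 by (simp add: basis_vec_def)
qed

lemma bar_basis_shift:
  assumes "(u, p, r, q) \<in> bar_basis (Suc n)"
  shows "nz (p @ [hd r]) \<Longrightarrow> (u, p @ [hd r], tl r, q) \<in> bar_basis n"
    and "nz (last r # q) \<Longrightarrow> (u, p, butlast r, last r # q) \<in> bar_basis n"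
proof -
  have r: "r \<noteq> []" using assms by (auto simp: bar_basis_def)
  show "nz (p @ [hd r]) \<Longrightarrow> (u, p @ [hd r], tl r, q) \<in> bar_basis n"
    using assms r by (cases r) (auto simp: bar_basis_def successively_Cons)
  show "nz (last r # q) \<Longrightarrow> (u, p, butlast r, last r # q) \<in> bar_basis n"
    using assms r by (cases r rule: rev_cases) (auto simp: bar_basis_def successively_append_iff)
qed

lemma dbar_hom: "dbar n \<in> bimod_hom A (bar (Suc n)) (bar n)"
  unfolding dbar_def
proof (rule bar_homI[OF bimodule_bar])
  fix s t assume s: "s \<in> N" and t: "t \<in> bar_basis (Suc n)"
  obtain w x u p r q where tt: "s = (w, x)" "t = (u, p, r, q)" by (cases s; cases t)
  have tu: "(u, p, r, q) \<in> bar_basis (Suc n)" using t tt by simp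
  have su: "(w, x) \<in> N" using s tt by simp
  have r: "r \<noteq> []" using tu by (auto simp: bar_basis_def)
  have lr: "pe u (p @ r @ q) = pe u ((p @ [hd r]) @ tl r @ q)" "pe u (p @ r @ q)
      = pe u (p @ butlast r @ last r # q)"
  proof -
    have 1: "p @ r @ q = (p @ [hd r]) @ tl r @ q" using r by (cases r) simp_all
    have 2: "p @ r @ q = p @ butlast r @ last r # q" using r by (cases r rule: rev_cases) simp_all
    show "pe u (p @ r @ q) = pe u ((p @ [hd r]) @ tl r @ q)" by (rule arg_cong[OF 1])
    show "pe u (p @ r @ q) = pe u (p @ butlast r @ last r # q)" by (rule arg_cong[OF 2])
  qed
  let ?a = "(u, p @ [hd r], tl r, q)" and ?b = "(u, p, butlast r, last r # q)"
  note sh = bar_basis_shift[OF tu]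
  note gb = gact_basis[OF finite_bar_basis]
  \<comment> \<open>The tuple in a term with vanishing coefficient need not belong to the basis of
    \<open>bar n\<close>, and then \<open>gact_basis\<close> says nothing about it; hence the case
    distinctions on the coefficients.\<close>
  have G: "gact act (bar_basis n) (path_class (w, x)) (dm n (basis_vec (u, p, r, q))) =
     (\<lambda>t. of_bool (nz (p @ [hd r])) * (case act (w, x) ?a of None \<Rightarrow> 0 | Some y \<Rightarrow> basis_vec y t) +
      ((- 1) ^ Suc n * of_bool (nz (last r # q))) * (case act (w, x) ?b of None \<Rightarrow> 0 | Some y \<Rightarrow> basis_vec y
          t))"
    for act
  proof -
    have "of_bool (nz (p @ [hd r])) * gact act (bar_basis n) (path_class (w, x)) (basis_vec ?a) t =
        of_bool (nz (p @ [hd r])) * (case act (w, x) ?a of None \<Rightarrow> 0 | Some y \<Rightarrow> basis_vec y t)" for t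
      using sh(1) by (cases "nz (p @ [hd r])") (simp_all add: gb su split: option.split)
    moreover have "c * of_bool (nz (last r # q)) * gact act (bar_basis n) (path_class (w, x)) (basis_vec ?b)
        t =
        c * of_bool (nz (last r # q)) * (case act (w, x) ?b of None \<Rightarrow> 0 | Some y \<Rightarrow> basis_vec y
            t)" for t and c :: 'k
      using sh(2) by (cases "nz (last r # q)") (simp_all add: gb su split: option.split)
    ultimately show ?thesis unfolding dm_basis[OF tu] by (simp only: gact_linear)
  qed
  show "dm n (gact lacts (bar_basis (Suc n)) (path_class s) (basis_vec t))
      = lact (bar n) (path_class s) (dm n (basis_vec t))"
  proof (cases "pe w x = u \<and> nz (x @ p)")
    case True
    then have t': "(w, x @ p, r, q) \<in> bar_basis (Suc n)" using lacts_bar_basis[OF s t] by (simp add: tt)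
    have 1: "of_bool (nz ((x @ p) @ [hd r])) * basis_vec (w, (x @ p) @ [hd r], tl r, q) z =
      of_bool (nz (p @ [hd r])) * (case lacts (w, x) ?a of None \<Rightarrow> (0::'k) | Some y \<Rightarrow> basis_vec y z)" for z
    proof (cases "nz (x @ p @ [hd r])")
      case nz: True
      then have "nz (p @ [hd r])" by (simp add: successively_append_iff)
      then show ?thesis using nz True by simp
    next
      case False
      then show ?thesis by simp
    qed
    have 2: "of_bool (nz (last r # q)) * basis_vec (w, x @ p, butlast r, last r # q) z =
      of_bool (nz (last r # q)) * (case lacts (w, x) ?b of None \<Rightarrow> (0::'k) | Some y \<Rightarrow> basis_vec y z)" for z
      using True by simp
    have "gact lacts (bar_basis (Suc n)) (path_class s) (basis_vec t) = basis_vec (w, x @ p, r, q)"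
      using True by (simp add: tt gb[OF su tu])
    then show ?thesis unfolding tt bar_simps G mult.assoc 
      using dm_basis[OF t'] by (simp only: 1 2 mult.assoc)
  next
    case False
    then have "\<not> (pe w x = u \<and> nz (x @ p @ [hd r]))" by (auto simp: successively_append_iff)
    then have 1: "lacts (w, x) ?a = None" and 2: "lacts (w, x) ?b = None" using False by auto
    have "gact lacts (bar_basis (Suc n)) (path_class s) (basis_vec t) = (\<lambda>_. 0)"
      using False by (auto simp: tt gb[OF su tu])
    then show ?thesis unfolding tt bar_simps G 1 2 by (simp add: dm_linear)
  qed
  show "dm n (gact racts (bar_basis (Suc n)) (path_class s) (basis_vec t))
      = ract (bar n) (dm n (basis_vec t)) (path_class s)"
  proof (cases "pe u (p @ r @ q) = w \<and> nz (q @ x)")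
    case True
    then have t': "(u, p, r, q @ x) \<in> bar_basis (Suc n)" using racts_bar_basis[OF s t] by (simp add: tt)
    have 1: "of_bool (nz (last r # q @ x)) * basis_vec (u, p, butlast r, last r # q @ x) z =
      of_bool (nz (last r # q)) * (case racts (w, x) ?b of None \<Rightarrow> (0::'k) | Some y \<Rightarrow> basis_vec y z)" for z
    proof (cases "nz (last r # q @ x)")
      case nz: True
      then have "nz (last r # q)"
        using successively_append_iff[of "\<lambda>a b. \<not> zp a b" "last r # q" x] by simp
      then show ?thesis using nz True lr(2) by simp
    next
      case False
      then show ?thesis by simp
    qed
    have 2: "of_bool (nz (p @ [hd r])) * basis_vec (u, p @ [hd r], tl r, q @ x) z =
      of_bool (nz (p @ [hd r])) * (case racts (w, x) ?a of None \<Rightarrow> (0::'k) | Some y \<Rightarrow> basis_vec y z)" for z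
      using True lr(1) by simp
    have "gact racts (bar_basis (Suc n)) (path_class s) (basis_vec t) = basis_vec (u, p, r, q @ x)"
      using True by (simp add: tt gb[OF su tu])
    then show ?thesis unfolding tt bar_simps G mult.assoc
      using dm_basis[OF t'] by (simp only: 1 2 mult.assoc)
  next
    case False
    have "nz (last r # q @ x) \<Longrightarrow> nz (q @ x)" by (auto simp: successively_Cons)
    then have 1: "racts (w, x) ?a = None" and 2: "racts (w, x) ?b = None" using False lr by auto
    have "gact racts (bar_basis (Suc n)) (path_class s) (basis_vec t) = (\<lambda>_. 0)"
      using False by (auto simp: tt gb[OF su tu])
    then show ?thesis unfolding tt bar_simps G 1 2 by (simp add: dm_linear)
  qed
next
  fix b assume "b \<in> carrier (bar (Suc n))"
  show "dm n b \<in> carrier (bar n)" by (auto simp: dm_def)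
qed (simp_all add: dm_linear)

text \<open>Two arrows cannot both move to the same side: neighbours in the middle path have product
  zero, whereas the outer paths are nonzero. The two ways of moving one arrow to each side cancel by
  the signs of consecutive degrees.\<close>

lemma dm_dm:
  assumes "b \<in> carrier (bar (Suc (Suc n)))"
  shows "dm n (dm (Suc n) b) = (\<lambda>_. 0)"
proof (rule tuple4_ext)
  fix u :: 'v and p r q :: "'a list"
  have b0: "b t = 0" if "t \<notin> bar_basis (Suc (Suc n))" for t using assms that by (cases t) simp
  show "dm n (dm (Suc n) b) (u, p, r, q) = 0"
  proof (cases "(u, p, r, q) \<in> bar_basis n")
    case True
    have 1: "b (u, butlast (butlast p), last (butlast p) # last p # r, q) = 0"
      if ne: "p \<noteq> []" "butlast p \<noteq> []"
    proof -
      obtain p1 y where p1: "p = p1 @ [y]" using ne(1) by (cases p rule: rev_cases) auto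
      moreover obtain p' x where "p1 = p' @ [x]" using ne(2) p1 by (cases p1 rule: rev_cases) auto
      ultimately have p: "p = p' @ [x, y]" by simp
      then have "\<not> zp x y" using True by (auto simp: bar_basis_def successively_append_iff)
      then show ?thesis by (intro b0) (simp add: p bar_basis_def butlast_append)
    qed
    have 2: "b (u, p, (r @ [hd q]) @ [hd (tl q)], tl (tl q)) = 0" if ne: "q \<noteq> []" "tl q \<noteq> []"
    proof -
      obtain x q1 where q1: "q = x # q1" using ne(1) by (cases q) auto
      moreover obtain y q' where "q1 = y # q'" using ne(2) q1 by (cases q1) auto
      ultimately have q: "q = x # y # q'" by simp
      then have "\<not> zp x y" using True by (auto simp: bar_basis_def)
      then show ?thesis by (intro b0) (simp add: q bar_basis_def successively_append_iff)
    qed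
    let ?c = "b (u, butlast p, last p # r @ [hd q], tl q)"
    \<comment> \<open>The differential is cut off outside the basis. If the mixed coefficient is
      nonzero, both intermediate tuples do lie in the basis, so the cut-off does not disturb the
      cancellation.\<close>
    have 3: "(u, butlast p, last p # r, q) \<in> bar_basis (Suc n)" if "p \<noteq> []" "q \<noteq> []" "?c \<noteq> 0"
    proof -
      have "(u, butlast p, last p # r @ [hd q], tl q) \<in> bar_basis (Suc (Suc n))" using b0 that by blast
      then show ?thesis using that True
        by (cases p rule: rev_cases; cases q)
           (auto simp: bar_basis_def successively_append_iff successively_Cons hd_append split: if_splits)
    qed
    have 4: "(u, p, r @ [hd q], tl q) \<in> bar_basis (Suc n)" if "p \<noteq> []" "q \<noteq> []" "?c \<noteq> 0"
    proof -
      have "(u, butlast p, last p # r @ [hd q], tl q) \<in> bar_basis (Suc (Suc n))" using b0 that by blast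
      then show ?thesis using that True
        by (cases p rule: rev_cases; cases q)
           (auto simp: bar_basis_def successively_append_iff successively_Cons hd_append split: if_splits)
    qed
    have A: "dm (Suc n) b (u, butlast p, last p # r, q) = (- 1) ^ n * (if q \<noteq> [] then ?c else 0)" if "p \<noteq> []"
    proof (cases "(u, butlast p, last p # r, q) \<in> bar_basis (Suc n)")
      case True
      have "(if butlast p \<noteq> [] then b (u, butlast (butlast p), last (butlast p) # last p # r, q) else 0) = 0"
        using 1 that by simp
      then show ?thesis unfolding dm_def prod.case using True by simp
    next
      case False
      then have "(if q \<noteq> [] then ?c else 0) = 0" using 3[OF that] by auto
      then show ?thesis unfolding dm_def prod.case using False by simp
    qed
    have B: "dm (Suc n) b (u, p, r @ [hd q], tl q) = (if p \<noteq> [] then ?c else 0)" if "q \<noteq> []"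
    proof (cases "(u, p, r @ [hd q], tl q) \<in> bar_basis (Suc n)")
      case True
      have "(if tl q \<noteq> [] then b (u, p, (r @ [hd q]) @ [hd (tl q)], tl (tl q)) else 0) = 0"
        using 2 that by simp
      then show ?thesis unfolding dm_def prod.case using True by simp
    next
      case False
      then have "(if p \<noteq> [] then ?c else 0) = 0" using 4[OF _ that] by auto
      then show ?thesis unfolding dm_def prod.case using False by simp
    qed
    have A': "(if p \<noteq> [] then dm (Suc n) b (u, butlast p, last p # r, q) else 0) =
        (if p \<noteq> [] then (- 1) ^ n * (if q \<noteq> [] then ?c else 0) else 0)" using A by simp
    have B': "(if q \<noteq> [] then dm (Suc n) b (u, p, r @ [hd q], tl q) else 0) =
        (if q \<noteq> [] then (if p \<noteq> [] then ?c else 0) else 0)" using B by simp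
    show ?thesis unfolding dm_def[of n] prod.case A' B' using True by simp
  qed (simp add: dm_def)
qed

text \<open>
  A contracting homotopy: \<open>sm\<close> moves the last arrow of \<open>p\<close> into the middle, and \<open>s0\<close> does so
    for every arrow of \<open>p\<close>,
  as \<open>p \<otimes> q - 1 \<otimes> pq\<close> telescopes.  The second term, with coefficients \<open>ez\<close>, vanishes on the kernel of
  the augmentation.
\<close>

definition sm :: "nat \<Rightarrow> (('v, 'a) bar_tuple \<Rightarrow> 'k) \<Rightarrow> ('v, 'a) bar_tuple \<Rightarrow> 'k" where
  "sm n b = (\<lambda>(u, p, r, q). if (u, p, r, q) \<in> bar_basis (Suc n) then b (u, p @ [hd r], tl r, q) else 0)"

text \<open>The sum of \<open>b\<close> over all \<open>p' \<otimes> q'\<close> with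
  \<open>p' q' = p a q\<close> in which \<open>p'\<close> contains at least \<open>p a\<close>.
  These are the tuples whose telescoping expansion involves
  \<open>p \<otimes> a \<otimes> q\<close>, so the sum is the coefficient of the homotopy
  there.\<close>

fun sz :: "(('v, 'a) bar_tuple \<Rightarrow> 'k) \<Rightarrow> 'v \<Rightarrow> 'a list \<Rightarrow> 'a \<Rightarrow> 'a list \<Rightarrow> 'k" where
  "sz b u p a [] = b (u, p @ [a], [], [])"
| "sz b u p a (x # q) = b (u, p @ [a], [], x # q) + sz b u (p @ [a]) x q"

definition s0 :: "(('v, 'a) bar_tuple \<Rightarrow> 'k) \<Rightarrow> ('v, 'a) bar_tuple \<Rightarrow> 'k" where
  "s0 b = (\<lambda>(u, p, r, q). if (u, p, r, q) \<in> bar_basis (Suc 0) then sz b u p (hd r) q else 0)"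

definition ez :: "(('v, 'a) bar_tuple \<Rightarrow> 'k) \<Rightarrow> 'v \<Rightarrow> 'a list \<Rightarrow> 'k" where
  "ez b u q = b (u, [], [], q) + (if q \<noteq> [] then sz b u [] (hd q) (tl q) else 0)"

text \<open>Exactly one of the two composites returns \<open>b (u, p, r, q)\<close>: the one
  applying \<open>dm\<close> first if \<open>p\<close> followed by the first arrow of
  \<open>r\<close> is nonzero, the other one if this product vanishes. The terms that move the first
  arrow of \<open>q\<close> cancel or are both zero.\<close>

lemma homotopy_high:
  assumes b: "b \<in> carrier (bar (Suc (Suc n)))"
  shows "(\<lambda>t. dm (Suc (Suc n)) (sm (Suc (Suc n)) b) t + sm (Suc n) (dm (Suc n) b) t) = b"
proof (rule tuple4_ext)
  fix u :: 'v and p r q :: "'a list"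
  have b0: "b t = 0" if "t \<notin> bar_basis (Suc (Suc n))" for t using b that by (cases t) simp
  show "dm (Suc (Suc n)) (sm (Suc (Suc n)) b) (u, p, r, q) + sm (Suc n) (dm (Suc n) b) (u, p, r, q)
      = b (u, p, r, q)"
  proof (cases "(u, p, r, q) \<in> bar_basis (Suc (Suc n))")
    case False
    then show ?thesis using b0 by (simp add: dm_def sm_def)
  next
    case True
    then obtain x y r' where r: "r = x # y # r'" by (auto simp: bar_basis_def length_Suc_conv)
    have pq: "nz p" "nz q" "zp x y" "zs (y # r')" "length r' = n" "(u, p @ r @ q) \<in> paths Q"
      using True by (auto simp: bar_basis_def r)
    have T1: "(u, p @ [x], y # r', q) \<in> bar_basis (Suc n) \<longleftrightarrow> nz (p @ [x])"
      using True by (auto simp: bar_basis_def r)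
    have D: "sm (Suc n) (dm (Suc n) b) (u, p, r, q) = (if nz (p @ [x]) then b (u, p, r, q) +
       (- 1) ^ Suc (Suc n) * (if q \<noteq> [] then b (u, p @ [x], (y # r') @ [hd q], tl q) else 0) else 0)"
      using True T1 by (simp add: sm_def dm_def r)
    have S1: "sm (Suc (Suc n)) b (u, butlast p, last p # r, q)
        = (if zp (last p) x then b (u, p, r, q) else 0)"
      if "p \<noteq> []"
      using True that by (cases p rule: rev_cases) (auto simp: sm_def bar_basis_def r successively_append_iff)
    have S2: "sm (Suc (Suc n)) b (u, p, r @ [hd q], tl q) = b (u, p @ [x], (y # r') @ [hd q], tl q)"
      if "q \<noteq> []"
    proof (cases "b (u, p @ [x], (y # r') @ [hd q], tl q) = 0")
      case True
      then show ?thesis by (simp add: sm_def r)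
    next
      case False
      then have "(u, p @ [x], (y # r') @ [hd q], tl q) \<in> bar_basis (Suc (Suc n))" using b0 by blast
      then have "(u, p, r @ [hd q], tl q) \<in> bar_basis (Suc (Suc (Suc n)))"
        using pq that by (cases q) (auto simp: bar_basis_def r successively_append_iff)
      then show ?thesis by (simp add: sm_def r)
    qed
    have S1': "(if p \<noteq> [] then sm (Suc (Suc n)) b (u, butlast p, last p # r, q) else 0) =
        (if p \<noteq> [] \<and> zp (last p) x then b (u, p, r, q) else 0)" using S1 by simp
    have S2': "(if q \<noteq> [] then sm (Suc (Suc n)) b (u, p, r @ [hd q], tl q) else 0) =
        (if q \<noteq> [] then b (u, p @ [x], (y # r') @ [hd q], tl q) else 0)" using S2 by simp
    have E: "dm (Suc (Suc n)) (sm (Suc (Suc n)) b) (u, p, r, q) =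
       (if p \<noteq> [] \<and> zp (last p) x then b (u, p, r, q) else 0) +
       (- 1) ^ Suc n * (if q \<noteq> [] then b (u, p @ [x], (y # r') @ [hd q], tl q) else 0)"
      unfolding dm_def prod.case S1' S2' using True by simp
    have z: "b (u, p @ [x], (y # r') @ [hd q], tl q) = 0" if "\<not> nz (p @ [x])"
      using that by (intro b0) (auto simp: bar_basis_def)
    have "nz (p @ [x]) \<longleftrightarrow> \<not> (p \<noteq> [] \<and> zp (last p) x)" using pq by (simp add: successively_append_iff)
    then show ?thesis unfolding D E using z by auto
  qed
qed

lemma sz_zero:
  assumes "b \<in> carrier (bar n)" "\<not> nz (p @ [a])" shows "sz b u p a q = 0"
  using assms(2)
proof (induction q arbitrary: p a)
  case Nil
  then have "(u, p @ [a], [], []) \<notin> bar_basis n" by (auto simp: bar_basis_def)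
  then show ?case using assms(1) by simp
next
  case (Cons x q)
  then have "(u, p @ [a], [], x # q) \<notin> bar_basis n" by (auto simp: bar_basis_def)
  moreover have "\<not> nz ((p @ [a]) @ [x])" using Cons.prems by (simp add: successively_append_iff)
  ultimately show ?case using assms(1) Cons.IH by simp
qed

text \<open>The sum telescopes along \<open>q\<close>. It stops early when a zero product is met,
  because the tuples beyond it are outside the basis; as \<open>q\<close> is nonzero this can only
  happen between \<open>a\<close> and the first arrow of \<open>q\<close>, and it leaves the second
  term.\<close>

lemma sz_dm:
  assumes b: "b \<in> carrier (bar (Suc 0))" and t: "(u, p, [a], q) \<in> bar_basis (Suc 0)"
  shows "sz (dm 0 b) u p a q = (if nz (p @ [a]) then b (u, p, [a], q) else 0) -
    (if q \<noteq> [] \<and> zp a (hd q) then b (u, p @ [a], [hd q], tl q) else 0)"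
  using t
proof (induction q arbitrary: p a)
  case Nil
  have "(u, p @ [a], [], []) \<in> bar_basis 0 \<longleftrightarrow> nz (p @ [a])" using Nil by (auto simp: bar_basis_def)
  then show ?case by (simp add: dm_def)
next
  case (Cons x q)
  have b0: "b t = 0" if "t \<notin> bar_basis (Suc 0)" for t using b that by (cases t) simp
  show ?case
  proof (cases "nz (p @ [a])")
    case True
    have 1: "(u, p @ [a], [], x # q) \<in> bar_basis 0" using Cons.prems True by (auto simp: bar_basis_def)
    have 2: "(u, p @ [a], [x], q) \<in> bar_basis (Suc 0)" using Cons.prems True
      by (auto simp: bar_basis_def successively_Cons)
    have nq: "\<not> (q \<noteq> [] \<and> zp x (hd q))" using Cons.prems by (auto simp: bar_basis_def successively_Cons)
    have "nz ((p @ [a]) @ [x]) \<longleftrightarrow> \<not> zp a x" using True by (simp add: successively_append_iff)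
    moreover have "dm 0 b (u, p @ [a], [], x # q) = b (u, p, [a], x # q) - b (u, p @ [a], [x], q)"
      using 1 by (simp add: dm_def)
    ultimately show ?thesis using True nq by (auto simp: Cons.IH[OF 2])
  next
    case False
    then have "sz (dm 0 b) u p a (x # q) = 0"
      by (intro sz_zero[of _ 0]) (auto simp: dm_def)
    moreover have "b (u, p @ [a], [x], q) = 0" using False by (intro b0) (auto simp: bar_basis_def)
    ultimately show ?thesis using False by simp
  qed
qed

text \<open>The same dichotomy as in higher degrees, with \<open>s0\<close> instead of
  \<open>sm\<close> on the lower side. The boundary term left by the telescoping sum cancels the
  term of \<open>dm\<close> that moves the first arrow of \<open>q\<close>.\<close>

lemma homotopy_1:
  assumes b: "b \<in> carrier (bar (Suc 0))"
  shows "(\<lambda>t. dm (Suc 0) (sm (Suc 0) b) t + s0 (dm 0 b) t) = b"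
proof (rule tuple4_ext)
  fix u :: 'v and p r q :: "'a list"
  have b0: "b t = 0" if "t \<notin> bar_basis (Suc 0)" for t using b that by (cases t) simp
  show "dm (Suc 0) (sm (Suc 0) b) (u, p, r, q) + s0 (dm 0 b) (u, p, r, q) = b (u, p, r, q)"
  proof (cases "(u, p, r, q) \<in> bar_basis (Suc 0)")
    case False
    then show ?thesis using b0 by (simp add: dm_def s0_def)
  next
    case True
    then obtain x where r: "r = [x]" by (auto simp: bar_basis_def length_Suc_conv)
    have t: "(u, p, [x], q) \<in> bar_basis (Suc 0)" using True r by simp
    have S0: "s0 (dm 0 b) (u, p, r, q) = (if nz (p @ [x]) then b (u, p, [x], q) else 0) -
      (if q \<noteq> [] \<and> zp x (hd q) then b (u, p @ [x], [hd q], tl q) else 0)"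
      using t by (simp add: s0_def r sz_dm[OF b t])
    have S1: "sm (Suc 0) b (u, butlast p, last p # r, q) = (if zp (last p) x then b (u, p, r, q) else 0)"
      if "p \<noteq> []"
      using True that by (cases p rule: rev_cases) (auto simp: sm_def bar_basis_def r successively_append_iff)
    have S2: "sm (Suc 0) b (u, p, r @ [hd q], tl q)
        = (if zp x (hd q) then b (u, p @ [x], [hd q], tl q) else 0)"
      if "q \<noteq> []"
    proof -
      have "(u, p, r @ [hd q], tl q) \<in> bar_basis (Suc (Suc 0)) \<longleftrightarrow> zp x (hd q)"
        using t that by (cases q) (auto simp: bar_basis_def r successively_Cons)
      then show ?thesis by (simp add: sm_def r)
    qed
    have S1': "(if p \<noteq> [] then sm (Suc 0) b (u, butlast p, last p # r, q) else 0) =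
        (if p \<noteq> [] \<and> zp (last p) x then b (u, p, r, q) else 0)" using S1 by simp
    have S2': "(if q \<noteq> [] then sm (Suc 0) b (u, p, r @ [hd q], tl q) else 0) =
        (if q \<noteq> [] \<and> zp x (hd q) then b (u, p @ [x], [hd q], tl q) else 0)" using S2 by simp
    have E: "dm (Suc 0) (sm (Suc 0) b) (u, p, r, q) =
       (if p \<noteq> [] \<and> zp (last p) x then b (u, p, r, q) else 0) +
       (if q \<noteq> [] \<and> zp x (hd q) then b (u, p @ [x], [hd q], tl q) else 0)"
      unfolding dm_def prod.case S1' S2' using True by simp
    have "nz (p @ [x]) \<longleftrightarrow> \<not> (p \<noteq> [] \<and> zp (last p) x)"
      using t by (auto simp: bar_basis_def successively_append_iff)
    then show ?thesis unfolding S0 E by (auto simp: r)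
  qed
qed

lemma homotopy_0:
  assumes b: "b \<in> carrier (bar 0)" and e: "\<And>u q. (u, q) \<in> N \<Longrightarrow> ez b u q = 0"
  shows "dm 0 (s0 b) = b"
proof (rule tuple4_ext)
  fix u :: 'v and p r q :: "'a list"
  have b0: "b t = 0" if "t \<notin> bar_basis 0" for t using b that by (cases t) simp
  show "dm 0 (s0 b) (u, p, r, q) = b (u, p, r, q)"
  proof (cases "(u, p, r, q) \<in> bar_basis 0")
    case False
    then show ?thesis using b0 by (simp add: dm_def)
  next
    case True
    then have r: "r = []" by (auto simp: bar_basis_def)
    have S1: "s0 b (u, butlast p, last p # r, q) = sz b u (butlast p) (last p) q" if "p \<noteq> []"
      using True that by (cases p rule: rev_cases) (auto simp: s0_def bar_basis_def r successively_append_iff)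
    have S2: "s0 b (u, p, r @ [hd q], tl q) = sz b u p (hd q) (tl q)" if "q \<noteq> []"
      using True that by (cases q) (auto simp: s0_def bar_basis_def r successively_Cons)
    have S1': "(if p \<noteq> [] then s0 b (u, butlast p, last p # r, q) else 0) =
        (if p \<noteq> [] then sz b u (butlast p) (last p) q else 0)" using S1 by simp
    have S2': "(if q \<noteq> [] then s0 b (u, p, r @ [hd q], tl q) else 0) =
        (if q \<noteq> [] then sz b u p (hd q) (tl q) else 0)" using S2 by simp
    have E: "dm 0 (s0 b) (u, p, r, q) = (if p \<noteq> [] then sz b u (butlast p) (last p) q else 0) -
        (if q \<noteq> [] then sz b u p (hd q) (tl q) else 0)"
      unfolding dm_def prod.case S1' S2' using True by simp
    show ?thesis
    proof (cases "p = []")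
      case False
      then have "(if p \<noteq> [] then sz b u (butlast p) (last p) q else 0) =
          b (u, p, [], q) + (if q \<noteq> [] then sz b u p (hd q) (tl q) else 0)"
        by (cases q) simp_all
      then show ?thesis unfolding E by (simp add: r)
    next
      \<comment> \<open>With trivial \<open>p\<close> there is no term moving an arrow out of
        \<open>p\<close>; the missing value is supplied by the vanishing of the full sum
        \<open>ez\<close>, that is, of the augmentation.\<close>
      case p: True
      have "(u, q) \<in> N" using True by (auto simp: bar_basis_def N_iff p r)
      then have "ez b u q = 0" by (rule e)
      then show ?thesis unfolding E by (auto simp: p r ez_def add_eq_0_iff)
    qed
  qed
qed

section \<open>The augmentation and exactness\<close>

lemma sz_linear:
  "sz (\<lambda>s. b s + c * b' s) u p a q = sz b u p a q + c * sz b' u p a q"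
  by (induction q arbitrary: p a) (simp_all add: algebra_simps)

lemma ez_linear: "ez (\<lambda>s. b s + c * b' s) u q = ez b u q + c * ez b' u q"
  by (simp add: ez_def sz_linear algebra_simps)

lemma basis_vec_apply: "basis_vec s t = (if t = s then 1 else 0 :: 'k)"
  by (simp add: basis_vec_def)

lemma sz_basis:
  "sz (basis_vec (u, p, [], q)) w P a R = of_bool (w = u \<and> P @ a # R = p @ q \<and> length P < length p)"
proof (induction R arbitrary: P a w)
  case Nil
  have "P @ [a] = p \<and> q = [] \<longleftrightarrow> P @ [a] = p @ q \<and> length P < length p"
  proof
    assume r: "P @ [a] = p @ q \<and> length P < length p"
    then have "Suc (length P) = length p + length q" by (metis length_append length_append_singleton)
    then have "length q = 0" using r by arith
    then show "P @ [a] = p \<and> q = []" using r by simp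
  qed auto
  then show ?case by (auto simp: basis_vec_apply)
next
  case (Cons x R)
  have 1: "P @ [a] = p \<and> x # R = q \<longleftrightarrow> P @ a # x # R = p @ q \<and> Suc (length P) = length p"
    using append_eq_append_conv[of "P @ [a]" p "x # R" q] by auto
  have B: "basis_vec (u, p, [], q) (w, P @ [a], [], x # R) =
      (if w = u \<and> P @ a # x # R = p @ q \<and> Suc (length P) = length p then 1 else 0 :: 'k)"
    unfolding basis_vec_apply using 1 by auto
  have IH: "sz (basis_vec (u, p, [], q)) w (P @ [a]) x R =
      (if w = u \<and> P @ a # x # R = p @ q \<and> Suc (length P) < length p then 1 else 0)"
    using Cons.IH[of w "P @ [a]" x] by simp
  show ?case unfolding sz.simps B IH by auto
qed

lemma ez_basis: "ez (basis_vec (u, p, [], q)) w g = of_bool (w = u \<and> g = p @ q)"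
proof (cases "g = []")
  case True
  then show ?thesis by (auto simp: ez_def basis_vec_apply)
next
  case False
  have "p = [] \<or> 0 < length p" by auto
  then show ?thesis using False by (auto simp: ez_def sz_basis basis_vec_apply)
qed

text \<open>The multiplication map \<open>p \<otimes> q \<mapsto> p q\<close>, obtained from
  freeness by sending the generator at a vertex to its idempotent.\<close>

definition ebar :: "(('v, 'a) bar_tuple \<Rightarrow> 'k) \<Rightarrow> (('v, 'a) qpath \<Rightarrow> 'k) set" where
  "ebar = (SOME h. h \<in> bimod_hom A (bar 0) (regular_bimodule A) \<and> (\<forall>x\<in>AP Q I 0. h (gen x) = path_class x))"

lemma regular_simps:
  "carrier (regular_bimodule A) = carrier A" "\<zero>\<^bsub>regular_bimodule A\<^esub> = \<zero>\<^bsub>A\<^esub>"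
  "x \<oplus>\<^bsub>regular_bimodule A\<^esub> y = x \<oplus>\<^bsub>A\<^esub> y" "c \<odot>\<^bsub>regular_bimodule A\<^esub> x = c \<odot>\<^bsub>A\<^esub> x"
  "lact (regular_bimodule A) a x = a \<otimes>\<^bsub>A\<^esub> x" "ract (regular_bimodule A) x a = x \<otimes>\<^bsub>A\<^esub> a"
  by (simp_all add: regular_bimodule_def module.defs bimod.defs)

lemma AP_0: "x \<in> AP Q I 0 \<longleftrightarrow> (\<exists>u\<in>verts Q. x = (u, []))"
  by (cases x) (auto simp: AP_iff)

lemma ebar: "ebar \<in> bimod_hom A (bar 0) (regular_bimodule A)" "x \<in> AP Q I 0 \<Longrightarrow> ebar (gen x) = path_class x"
proof -
  have "\<exists>h\<in>bimod_hom A (bar 0) (regular_bimodule A). \<forall>x\<in>AP Q I 0. h (gen x) = path_class x"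
  proof (rule bar_free[OF bimodule_regular])
    fix x assume "x \<in> AP Q I 0"
    then show "path_class x \<in> carrier (regular_bimodule A)" by (auto simp: AP_0 regular_simps N_iff)
  next
    fix u r assume "(u, r) \<in> AP Q I 0"
    then show "lact (regular_bimodule A) (path_class (u, [])) (path_class (u, r)) = path_class (u, r)"
      "ract (regular_bimodule A) (path_class (u, r)) (path_class (pe u r, [])) = path_class (u, r)"
      by (auto simp: AP_0 regular_simps path_class_idem)
  qed
  then have "\<exists>h. h \<in> bimod_hom A (bar 0) (regular_bimodule A) \<and> (\<forall>x\<in>AP Q I 0. h (gen x) = path_class x)"
    by blast
  note h = someI_ex[OF this, folded ebar_def]
  show "ebar \<in> bimod_hom A (bar 0) (regular_bimodule A)" "x \<in> AP Q I 0 \<Longrightarrow> ebar (gen x) = path_class x"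
    using h by simp_all
qed

text \<open>A path \<open>g\<close> is hit by exactly the tuples obtained by cutting it in two, and
  \<open>ez\<close> is the sum over these cuts. This connects the augmentation with the contracting
  homotopy.\<close>

lemma coef_ebar:
  assumes "b \<in> carrier (bar 0)"
  shows "coef (ebar b) = (\<lambda>(u, g). if (u, g) \<in> N then ez b u g else 0)"
  using assms
proof (induction b rule: bar_induct)
  case zero
  have "ebar (\<lambda>_. 0) = \<zero>\<^bsub>A\<^esub>"
    using hom_zero[OF bimodule_bar bimodule_regular ebar(1)] by (simp only: bar_simps regular_simps)
  moreover have "ez (\<lambda>_. 0) u g = 0" for u g
    using ez_linear[of "\<lambda>_. 0" "-1" "\<lambda>_. 0" u g] by simp
  ultimately show ?case by (auto simp: coef_zero)
next
  case (add b c t)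
  obtain u p q where t: "t = (u, p, [], q)" using add.hyps(2) by (auto simp: bar_basis_def)
  have tT: "(u, p, [], q) \<in> bar_basis 0" using add.hyps(2) t by simp
  note bp = bar_basis_parts[OF tT]
  have bt: "basis_vec t \<in> carrier (bar 0)" by (rule basis_in_bar[OF add.hyps(2)])
  have gc: "gen (pe u p, []) \<in> carrier (bar 0)" by (rule gen_in_bar[OF bp(2)])
  have p2: "(pe u p, q) \<in> N" using bp by simp
  have rc: "ract (bar 0) (gen (pe u p, [])) (path_class (pe u p, q)) \<in> carrier (bar 0)"
    using bimodule.ract_closed[OF bimodule_bar gc path_class_closed[OF p2]] .
  have "basis_vec t = lact (bar 0) (path_class (u, p)) (ract (bar 0) (gen (pe u p, [])) (path_class (pe u p,
      q)))"
    using basis_from_gen[OF tT] by (simp only: bar_simps(5,6) t path_end_simps)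
  then have "ebar (basis_vec t) = path_class (u, p) \<otimes>\<^bsub>A\<^esub> (path_class (pe u p, []) \<otimes>\<^bsub>A\<^esub> path_class (pe u p,
      q))"
    using hom_lact[OF ebar(1) path_class_closed[OF bp(1)] rc] hom_ract[OF ebar(1) path_class_closed[OF p2] gc]
      ebar(2)[OF bp(2)] by (simp only: regular_simps)
  also have "path_class (pe u p, []) \<otimes>\<^bsub>A\<^esub> path_class (pe u p, q) = path_class (pe u p, q)"
    using bp(5) p2 by (simp add: path_class_mult N_iff)
  also have "path_class (u, p) \<otimes>\<^bsub>A\<^esub> path_class (pe u p, q)
      = (if nz (p @ q) then path_class (u, p @ q) else \<zero>\<^bsub>A\<^esub>)"
    using bp(1) p2 by (simp add: path_class_mult)
  finally have eb: "ebar (basis_vec t) = (if nz (p @ q) then path_class (u, p @ q) else \<zero>\<^bsub>A\<^esub>)" .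
  have pq: "(u, p @ q) \<in> N \<longleftrightarrow> nz (p @ q)" using tT by (auto simp: bar_basis_def N_iff)
  have cb: "coef (ebar (basis_vec t)) = (\<lambda>(w, g). if (w, g) \<in> N then ez (basis_vec t) w g else 0)"
    unfolding eb unfolding t using pq by (auto simp: ez_basis coef_path_class coef_zero basis_vec_apply)
  have sm: "c \<odot>\<^bsub>bar 0\<^esub> basis_vec t \<in> carrier (bar 0)" using bimodule.smult_closed'[OF bimodule_bar bt] .
  have eA: "ebar b \<in> carrier A" "ebar (basis_vec t) \<in> carrier A"
    using hom_closed[OF ebar(1) add.hyps(1)] hom_closed[OF ebar(1) bt] by (simp_all only: regular_simps)
  have "ebar (\<lambda>s. b s + c * basis_vec t s) = ebar b \<oplus>\<^bsub>A\<^esub> c \<odot>\<^bsub>A\<^esub> ebar (basis_vec t)"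
    using hom_add[OF ebar(1) add.hyps(1) sm] hom_smult[OF bimodule_bar bimodule_regular ebar(1) bt]
    by (simp only: bar_simps(3,4) regular_simps)
  then show ?case using eA add.IH cb by (auto simp: coef_add coef_smult ez_linear)
qed

lemma dm_closed: "dm n b \<in> carrier (bar n)"
  by (auto simp: dm_def)

lemma dbar_eq: "b \<in> carrier (bar (Suc n)) \<Longrightarrow> dbar n b = dm n b"
  unfolding dbar_def by (simp only: restrict_apply')

lemma bar_resolution: "bimod_resolution A (regular_bimodule A) bar dbar ebar"
proof (intro bimod_resolution.intro bimod_complex.intro bimod_complex_axioms.intro
      bimod_resolution_axioms.intro)
  show "kalgebra A" by (rule kalgebra_A)
  show "bimodule A (regular_bimodule A)" by (rule bimodule_regular)
  show "bimodule A (bar i)" for i by (rule bimodule_bar)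
  show "dbar i \<in> bimod_hom A (bar (Suc i)) (bar i)" for i by (rule dbar_hom)
  show "ebar \<in> bimod_hom A (bar 0) (regular_bimodule A)" by (rule ebar(1))
next
  fix i b assume b: "b \<in> carrier (bar (Suc (Suc i)))"
  show "dbar i (dbar (Suc i) b) = \<zero>\<^bsub>bar i\<^esub>"
    using dm_dm[OF b] by (simp only: dbar_eq[OF b] dbar_eq[OF dm_closed] bar_simps(2))
next
  fix b assume "b \<in> carrier (bar 1)"
  then have b: "b \<in> carrier (bar (Suc 0))" by (simp only: One_nat_def)
  have "ez (dm 0 b) u q = 0" if uq: "(u, q) \<in> N" for u q
  proof (cases q)
    case Nil
    then show ?thesis by (simp add: ez_def dm_def)
  next
    case (Cons x q')
    have t: "(u, [], [x], q') \<in> bar_basis (Suc 0)" "(u, [], [], x # q') \<in> bar_basis 0"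
      using uq by (auto simp: bar_basis_def N_iff Cons successively_Cons)
    have "\<not> (q' \<noteq> [] \<and> zp x (hd q'))" using uq by (auto simp: N_iff Cons successively_Cons)
    then have "sz (dm 0 b) u [] x q' = b (u, [], [x], q')" using sz_dm[OF b, of u "[]" x q'] t by auto
    then show ?thesis using t(2) by (simp add: ez_def dm_def Cons)
  qed
  then have "coef (ebar (dm 0 b)) = coef \<zero>\<^bsub>A\<^esub>" unfolding coef_ebar[OF dm_closed] by (auto simp: coef_zero)
  moreover have "ebar (dm 0 b) \<in> carrier A"
    using hom_closed[OF ebar(1) dm_closed] by (simp only: regular_simps)
  ultimately have "ebar (dm 0 b) = \<zero>\<^bsub>A\<^esub>" by (intro coef_inj) simp_all
  then show "ebar (dbar 0 b) = \<zero>\<^bsub>regular_bimodule A\<^esub>" by (simp only: dbar_eq[OF b] regular_simps)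
next
  fix y assume "y \<in> carrier (regular_bimodule A)"
  then have y: "y \<in> carrier A" by (simp only: regular_simps)
  \<comment> \<open>The element \<open>1 \<otimes> y\<close>, which multiplication sends to
    \<open>y\<close>.\<close>
  define b where "b = (\<lambda>(u::'v, p::'a list, r::'a list, q). if p = [] \<and> r = [] then coef y (u, q) else 0)"
  have "b t = 0" if "t \<notin> bar_basis 0" for t
    using that coef_outside[of _ y] by (cases t) (auto simp: b_def bar_basis_def N_iff)
  then have b: "b \<in> carrier (bar 0)" unfolding bar_simps by blast
  have "sz b u P a R = 0" for u P a R by (induction R arbitrary: P a) (simp_all add: b_def)
  then have "ez b u g = coef y (u, g)" for u g by (simp add: ez_def b_def)
  then have "coef (ebar b) = coef y" unfolding coef_ebar[OF b] by (auto simp: coef_outside)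
  moreover have "ebar b \<in> carrier A" using hom_closed[OF ebar(1) b] by (simp only: regular_simps)
  ultimately have "ebar b = y" using y by (intro coef_inj)
  then show "y \<in> ebar ` carrier (bar 0)" using b by (intro image_eqI[of _ _ b]) simp_all
next
  fix b assume b: "b \<in> carrier (bar 0)" and "ebar b = \<zero>\<^bsub>regular_bimodule A\<^esub>"
  then have "coef (ebar b) = (\<lambda>_. 0)" by (simp only: regular_simps coef_zero)
  then have ez: "ez b u q = 0" if "(u, q) \<in> N" for u q
    using that fun_cong[of _ _ "(u, q)"] unfolding coef_ebar[OF b] by fastforce
  \<comment> \<open>The contracting homotopy supplies the preimage of a cycle; in higher degrees
    \<open>sm\<close> does the same.\<close>
  have "s0 b \<in> carrier (bar (Suc 0))" by (auto simp: s0_def)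
  moreover have "dbar 0 (s0 b) = b" using homotopy_0[OF b ez] dbar_eq[OF calculation] by simp
  ultimately show "b \<in> dbar 0 ` carrier (bar 1)"
    by (intro image_eqI[of _ _ "s0 b"]) (simp_all only: One_nat_def)
next
  fix i b assume b: "b \<in> carrier (bar (Suc i))" and "dbar i b = \<zero>\<^bsub>bar i\<^esub>"
  then have d0: "dm i b = (\<lambda>_. 0)" by (simp only: dbar_eq[OF b] bar_simps(2))
  have sc: "sm (Suc i) b \<in> carrier (bar (Suc (Suc i)))" by (auto simp: sm_def)
  have "dm (Suc i) (sm (Suc i) b) = b"
  proof (cases i)
    case 0
    have "sz (\<lambda>_. 0) u p a q = 0" for u p a q by (induction q arbitrary: p a) simp_all
    then have "s0 (\<lambda>_. 0) = (\<lambda>_. 0)" by (auto simp: s0_def)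
    then show ?thesis using homotopy_1[of b] b d0 unfolding 0 by simp
  next
    case (Suc j)
    have "sm (Suc j) (\<lambda>_. 0) = (\<lambda>_. 0)" by (auto simp: sm_def)
    then show ?thesis using homotopy_high[of b j] b d0 unfolding Suc by simp
  qed
  then have "dbar (Suc i) (sm (Suc i) b) = b" by (simp only: dbar_eq[OF sc])
  then show "b \<in> dbar (Suc i) ` carrier (bar (Suc (Suc i)))"
    using sc by (intro image_eqI[of _ _ "sm (Suc i) b"]) simp_all
qed

end

section \<open>Transfer of cohomology along comparison maps\<close>

context kalgebra begin

lemma chain_map_compose:
  assumes X: "\<And>i. bimodule A (X i)" and f: "chain_map A N X dX eX Y dY eY f"
    and g: "chain_map A N Y dY eY Z dZ eZ g"
    and dX: "\<And>i. dX i \<in> bimod_hom A (X (Suc i)) (X i)"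
  shows "chain_map A N X dX eX Z dZ eZ (\<lambda>i. compose (carrier (X i)) (g i) (f i))"
proof -
  have fh: "f i \<in> bimod_hom A (X i) (Y i)" and gh: "g i \<in> bimod_hom A (Y i) (Z i)" for i
    using f g by (simp_all add: chain_map_def)
  have "compose (carrier (X i)) (g i) (f i) \<in> bimod_hom A (X i) (Z i)" for i
    by (rule hom_compose[OF fh gh X])
  then show ?thesis using f g
    by (simp add: chain_map_def compose_eq hom_closed[OF fh] hom_closed[OF dX])
qed

lemma chain_map_id:
  assumes "\<And>i. bimodule A (X i)" and dX: "\<And>i. dX i \<in> bimod_hom A (X (Suc i)) (X i)"
  shows "chain_map A N X dX eX X dX eX (\<lambda>i. \<lambda>x\<in>carrier (X i). x)"
  using hom_id[OF assms(1)] by (simp add: chain_map_def hom_closed[OF dX])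

lemma coboundaries_Suc:
  "f \<in> coboundaries A X d E (Suc n) \<longleftrightarrow>
     (\<exists>c\<in>bimod_hom A (X n) E. f = compose (carrier (X (Suc n))) c (d n))"
  by (auto simp: coboundaries_def image_iff)

text \<open>Only a homotopy between \<open>u \<circ> g\<close> and the identity of \<open>Y\<close>
  is assumed. It makes composition with \<open>u\<close> injective on cohomology, which is the third
  claim. The fourth claim yields surjectivity once the lemma is applied with the two complexes
  exchanged.\<close>

lemma cohomology_transfer:
  assumes E: "bimodule A E"
    and X: "\<And>i. bimodule A (X i)" and dX: "\<And>i. dX i \<in> bimod_hom A (X (Suc i)) (X i)"
    and Y: "\<And>i. bimodule A (Y i)" and dY: "\<And>i. dY i \<in> bimod_hom A (Y (Suc i)) (Y i)"
    and u: "chain_map A N X dX eX Y dY eY u" and g: "chain_map A N Y dY eY X dX eX g"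
    and h: "\<And>i. h i \<in> bimod_hom A (Y i) (Y (Suc i))"
    and hg: "\<forall>i. \<forall>x\<in>carrier (Y (Suc i)). u (Suc i) (g (Suc i) x) \<ominus>\<^bsub>Y (Suc i)\<^esub> x =
        dY (Suc i) (h (Suc i) x) \<oplus>\<^bsub>Y (Suc i)\<^esub> h i (dY i x)"
  shows "f \<in> cocycles A Y dY E n \<Longrightarrow> compose (carrier (X n)) f (u n) \<in> cocycles A X dX E n"
    and "f \<in> coboundaries A Y dY E (Suc n) \<Longrightarrow>
           compose (carrier (X (Suc n))) f (u (Suc n)) \<in> coboundaries A X dX E (Suc n)"
    and "\<lbrakk>f \<in> cocycles A Y dY E (Suc n);
           compose (carrier (X (Suc n))) f (u (Suc n)) \<in> coboundaries A X dX E (Suc n)\<rbrakk> \<Longrightarrow>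
         f \<in> coboundaries A Y dY E (Suc n)"
    and "f \<in> cocycles A Y dY E (Suc n) \<Longrightarrow>
         (\<lambda>x\<in>carrier (Y (Suc n)). f (u (Suc n) (g (Suc n) x)) \<ominus>\<^bsub>E\<^esub> f x) \<in> coboundaries A Y dY E (Suc n)"
proof -
  interpret E: bimodule A E by fact
  interpret Xi: bimodule A "X i" for i by (rule X)
  interpret Yi: bimodule A "Y i" for i by (rule Y)
  have uh: "u i \<in> bimod_hom A (X i) (Y i)" and gh: "g i \<in> bimod_hom A (Y i) (X i)" for i
    using u g by (simp_all add: chain_map_def)
  have ud: "dY i (u (Suc i) x) = u i (dX i x)" if "x \<in> carrier (X (Suc i))" for i x
    using u that by (simp add: chain_map_def)
  have gd: "dX i (g (Suc i) x) = g i (dY i x)" if "x \<in> carrier (Y (Suc i))" for i x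
    using g that by (simp add: chain_map_def)
  show "compose (carrier (X n)) f (u n) \<in> cocycles A X dX E n" if f: "f \<in> cocycles A Y dY E n"
  proof -
    have fh: "f \<in> bimod_hom A (Y n) E" and f0: "\<And>x. x \<in> carrier (Y (Suc n)) \<Longrightarrow> f (dY n x) = \<zero>\<^bsub>E\<^esub>"
      using f by (simp_all add: cocycles_def)
    have "compose (carrier (X n)) f (u n) (dX n x) = \<zero>\<^bsub>E\<^esub>" if x: "x \<in> carrier (X (Suc n))" for x
      using f0[OF hom_closed[OF uh x]] ud[OF x] hom_closed[OF dX x] by (simp add: compose_eq)
    then show ?thesis using hom_compose[OF uh fh X] by (simp add: cocycles_def)
  qed
  show "compose (carrier (X (Suc n))) f (u (Suc n)) \<in> coboundaries A X dX E (Suc n)"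
    if fc: "f \<in> coboundaries A Y dY E (Suc n)"
  proof -
    obtain c where c: "c \<in> bimod_hom A (Y n) E" and f: "f = compose (carrier (Y (Suc n))) c (dY n)"
      using fc unfolding coboundaries_Suc by (rule bexE)
    have "compose (carrier (X (Suc n))) f (u (Suc n)) =
        compose (carrier (X (Suc n))) (compose (carrier (X n)) c (u n)) (dX n)"
      by (rule extensionalityI[OF compose_extensional compose_extensional])
         (simp add: f compose_eq hom_closed[OF uh] hom_closed[OF dX] ud)
    then show ?thesis unfolding coboundaries_Suc by (intro bexI[OF _ hom_compose[OF uh c X]])
  qed
  show main: "(\<lambda>x\<in>carrier (Y (Suc n)). f (u (Suc n) (g (Suc n) x)) \<ominus>\<^bsub>E\<^esub> f x) \<in> coboundaries A Y dY E (Suc n)"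
    if f: "f \<in> cocycles A Y dY E (Suc n)" for f
  proof -
    have fh: "f \<in> bimod_hom A (Y (Suc n)) E"
      and f0: "\<And>x. x \<in> carrier (Y (Suc (Suc n))) \<Longrightarrow> f (dY (Suc n) x) = \<zero>\<^bsub>E\<^esub>"
      using f by (simp_all add: cocycles_def)
    have c: "compose (carrier (Y n)) f (h n) \<in> bimod_hom A (Y n) E" by (rule hom_compose[OF h fh Y])
    have "f (u (Suc n) (g (Suc n) x)) \<ominus>\<^bsub>E\<^esub> f x = f (h n (dY n x))" if x: "x \<in> carrier (Y (Suc n))" for x
    proof -
      have c1: "u (Suc n) (g (Suc n) x) \<in> carrier (Y (Suc n))" using hom_closed[OF uh hom_closed[OF gh x]] .
      have c2: "h n (dY n x) \<in> carrier (Y (Suc n))" using hom_closed[OF h hom_closed[OF dY x]] .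
      have c3: "h (Suc n) x \<in> carrier (Y (Suc (Suc n)))" using hom_closed[OF h x] .
      have "f (u (Suc n) (g (Suc n) x)) \<ominus>\<^bsub>E\<^esub> f x = f (u (Suc n) (g (Suc n) x) \<ominus>\<^bsub>Y (Suc n)\<^esub> x)"
        by (rule hom_diff[OF Y E fh c1 x, symmetric])
      also have "\<dots> = f (dY (Suc n) (h (Suc n) x)) \<oplus>\<^bsub>E\<^esub> f (h n (dY n x))"
        unfolding bspec[OF spec[OF hg, of n] x] by (rule hom_add[OF fh hom_closed[OF dY c3] c2])
      finally show ?thesis using f0[OF c3] hom_closed[OF fh c2] by simp
    qed
    then have "(\<lambda>x\<in>carrier (Y (Suc n)). f (u (Suc n) (g (Suc n) x)) \<ominus>\<^bsub>E\<^esub> f x) =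
        compose (carrier (Y (Suc n))) (compose (carrier (Y n)) f (h n)) (dY n)"
      by (intro extensionalityI[OF restrict_extensional compose_extensional])
         (simp add: compose_eq hom_closed[OF dY])
    then show ?thesis unfolding coboundaries_Suc by (intro bexI[OF _ c])
  qed
  show "f \<in> coboundaries A Y dY E (Suc n)"
    if f: "f \<in> cocycles A Y dY E (Suc n)"
      and cb: "compose (carrier (X (Suc n))) f (u (Suc n)) \<in> coboundaries A X dX E (Suc n)"
  proof -
    have fh: "f \<in> bimod_hom A (Y (Suc n)) E" using f by (simp add: cocycles_def)
    obtain c where c: "c \<in> bimod_hom A (X n) E"
      and coef: "compose (carrier (X (Suc n))) f (u (Suc n)) = compose (carrier (X (Suc n))) c (dX n)"
      using cb unfolding coboundaries_Suc by (rule bexE)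
    obtain c' where c': "c' \<in> bimod_hom A (Y n) E"
      and cf': "(\<lambda>x\<in>carrier (Y (Suc n)). f (u (Suc n) (g (Suc n) x)) \<ominus>\<^bsub>E\<^esub> f x) =
        compose (carrier (Y (Suc n))) c' (dY n)"
      using main[OF f] unfolding coboundaries_Suc by (rule bexE)
    \<comment> \<open>Writing \<open>f \<circ> u = c \<circ> dX\<close> and
      \<open>f \<circ> u \<circ> g - f = c' \<circ> dY\<close> gives
      \<open>f = (c \<circ> g - c') \<circ> dY\<close>, since \<open>g\<close> commutes with the
      differentials.\<close>
    let ?c = "\<lambda>x\<in>carrier (Y n). compose (carrier (Y n)) c (g n) x \<ominus>\<^bsub>E\<^esub> c' x"
    have ch: "?c \<in> bimod_hom A (Y n) E" by (rule hom_diff_fun[OF Y E hom_compose[OF gh c Y] c'])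
    have "f x = c (g n (dY n x)) \<ominus>\<^bsub>E\<^esub> c' (dY n x)" if x: "x \<in> carrier (Y (Suc n))" for x
    proof -
      have gx: "g (Suc n) x \<in> carrier (X (Suc n))" using hom_closed[OF gh x] .
      have dx: "dY n x \<in> carrier (Y n)" using hom_closed[OF dY x] .
      have 1: "f (u (Suc n) (g (Suc n) x)) = c (g n (dY n x))"
        using fun_cong[OF coef, of "g (Suc n) x"] gx gd[OF x] by (simp add: compose_eq)
      have 2: "f (u (Suc n) (g (Suc n) x)) \<ominus>\<^bsub>E\<^esub> f x = c' (dY n x)"
        using fun_cong[OF cf', of x] x by (simp add: compose_eq)
      have k: "c (g n (dY n x)) \<in> carrier E" "f x \<in> carrier E"
        using hom_closed[OF c hom_closed[OF gh dx]] hom_closed[OF fh x] by simp_all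
      have "c (g n (dY n x)) \<ominus>\<^bsub>E\<^esub> (c (g n (dY n x)) \<ominus>\<^bsub>E\<^esub> f x) = f x"
        using k by (simp add: a_minus_def E.V.M.minus_add E.V.M.a_assoc[symmetric] E.V.M.r_neg)
      then show ?thesis using 1 2 by simp
    qed
    then have "f = compose (carrier (Y (Suc n))) ?c (dY n)"
      by (intro hom_eqI[OF fh hom_compose[OF dY ch Y]])
         (simp add: compose_eq hom_closed[OF dY])
    then show ?thesis unfolding coboundaries_Suc by (intro bexI[OF _ ch])
  qed
qed

end

section \<open>Comparison with a given projective resolution\<close>

context qsa begin

text \<open>Any injection into this type would do; it is needed to lift along the resolution by \<open>transport_bimod\<close>.\<close>

definition tup_code :: "('v, 'a) bar_tuple \<Rightarrow> 'm \<times> (('v, 'a) qpath \<Rightarrow> 'k) set \<times> (('v, 'a) qpath \<Rightarrow> 'k) set" where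
  "tup_code = (\<lambda>(u, p, r, q). (undefined, {basis_vec (u, p)}, {basis_vec (u, r @ q)}))"

lemma basis_vec_inj: "basis_vec s = (basis_vec t :: _ \<Rightarrow> 'k) \<Longrightarrow> s = t"
  by (drule fun_cong[of _ _ s]) (simp add: basis_vec_def split: if_splits)

lemma tup_code_inj: "inj_on tup_code (bar_basis n)"
proof (rule inj_onI)
  fix s t assume st: "s \<in> bar_basis n" "t \<in> bar_basis n" and eq: "tup_code s = tup_code t"
  obtain u p r q where s: "s = (u, p, r, q)" by (cases s)
  obtain u' p' r' q' where t: "t = (u', p', r', q')" by (cases t)
  have "(basis_vec (u, p) :: _ \<Rightarrow> 'k) = basis_vec (u', p')"
    and "(basis_vec (u, r @ q) :: _ \<Rightarrow> 'k) = basis_vec (u', r' @ q')"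
    using eq by (simp_all add: tup_code_def s t)
  then have "(u, p) = (u', p')" "(u, r @ q) = (u', r' @ q')" by (simp_all only: basis_vec_inj)
  moreover have "length r = length r'" using st by (simp add: s t bar_basis_def)
  ultimately show "s = t" by (simp add: s t)
qed

text \<open>Distinct tuples have distinct codes, so every coefficient can be read off at the code of
  its tuple.\<close>

lemma bar_embeds:
  "inj_on (\<lambda>b (x :: 'm \<times> _ \<times> _). \<Sum>t\<in>bar_basis n. if tup_code t = x then b t else 0) (carrier (bar n))"
proof (rule inj_onI)
  let ?i = "\<lambda>b (x :: 'm \<times> _ \<times> _). \<Sum>t\<in>bar_basis n. if tup_code t = x then b t else 0"
  fix b b' assume b: "b \<in> carrier (bar n)" "b' \<in> carrier (bar n)" and eq: "?i b = ?i b'"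
  have i: "?i b (tup_code s) = b s" if s: "s \<in> bar_basis n" for b s
  proof -
    have "?i b (tup_code s) = (\<Sum>t\<in>bar_basis n. if t = s then b t else 0)"
      using s inj_onD[OF tup_code_inj] by (intro sum.cong refl if_cong) blast+
    then show ?thesis using s finite_bar_basis[of n] by simp
  qed
  have "b s = b' s" if "s \<in> bar_basis n" for s
    using i[OF that, of b] i[OF that, of b'] fun_cong[OF eq, of "tup_code s"] by simp
  moreover have "b s = b' s" if "s \<notin> bar_basis n" for s using that b by (cases s) simp
  ultimately show "b = b'" by blast
qed

text \<open>Maps out of \<open>bar\<close> come from freeness; maps out of \<open>P\<close> come
  from projectivity, whose targets are embedded in the test type. Both homotopies compare a
  composite with the identity, which is a chain map over the same augmentation.\<close>

lemma comparison:
  fixes P :: "nat \<Rightarrow> ('k, (('v, 'a) qpath \<Rightarrow> 'k) set, 'm) bimod"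
  assumes P: "projective_resolution A (regular_bimodule A) P d e"
  shows "\<exists>u g h h'. chain_map A (regular_bimodule A) bar dbar ebar P d e u \<and>
    chain_map A (regular_bimodule A) P d e bar dbar ebar g \<and>
    (\<forall>i. h i \<in> bimod_hom A (P i) (P (Suc i))) \<and>
    (\<forall>i. \<forall>x\<in>carrier (P (Suc i)). u (Suc i) (g (Suc i) x) \<ominus>\<^bsub>P (Suc i)\<^esub> x =
        d (Suc i) (h (Suc i) x) \<oplus>\<^bsub>P (Suc i)\<^esub> h i (d i x)) \<and>
    (\<forall>i. h' i \<in> bimod_hom A (bar i) (bar (Suc i))) \<and>
    (\<forall>i. \<forall>x\<in>carrier (bar (Suc i)). g (Suc i) (u (Suc i) x) \<ominus>\<^bsub>bar (Suc i)\<^esub> x =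
        dbar (Suc i) (h' (Suc i) x) \<oplus>\<^bsub>bar (Suc i)\<^esub> h' i (dbar i x))"
proof -
  let ?E = "regular_bimodule A"
  have rP: "bimod_resolution A ?E P d e"
    by (rule bimod_resolution_of_projective[OF kalgebra_A bimodule_regular P])
  have cP: "bimod_complex A ?E P d e" by (rule bimod_resolution.axioms(1)[OF rP])
  have cB: "bimod_complex A ?E bar dbar ebar" by (rule bimod_resolution.axioms(1)[OF bar_resolution])
  note PX = bimod_complex.X[OF cP] and Pd = bimod_complex.d[OF cP] and Pe = bimod_complex.e[OF cP]
  have proj: "projective_bimodule A (P i)" for i using P by (simp add: projective_resolution_def)
  \<comment> \<open>Indicator functions of the first component embed the bimodules
    \<open>P i\<close>; below, the second component does the same for \<open>A\<close>.\<close>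
  have embP: "inj_on (\<lambda>m (x :: 'm \<times> (('v, 'a) qpath \<Rightarrow> 'k) set \<times> (('v, 'a) qpath \<Rightarrow> 'k) set). of_bool (fst x
      = m) :: 'k) S" for S
  proof (rule inj_onI)
    fix m m' assume "(\<lambda>x :: 'm \<times> (('v, 'a) qpath \<Rightarrow> 'k) set \<times> (('v, 'a) qpath \<Rightarrow> 'k) set. of_bool (fst x
        = m) :: 'k) = (\<lambda>x. of_bool (fst x = m'))"
    from fun_cong[OF this, of "(m, undefined)"] show "m = m'" by (simp split: if_splits)
  qed
  have embE: "inj_on (\<lambda>m (x :: 'm \<times> (('v, 'a) qpath \<Rightarrow> 'k) set \<times> (('v, 'a) qpath \<Rightarrow> 'k) set). of_bool (fst
      (snd x) = m) :: 'k) S" for S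
  proof (rule inj_onI)
    fix m m' assume "(\<lambda>x :: 'm \<times> (('v, 'a) qpath \<Rightarrow> 'k) set \<times> (('v, 'a) qpath \<Rightarrow> 'k) set. of_bool (fst (snd x)
        = m) :: 'k) = (\<lambda>x. of_bool (fst (snd x) = m'))"
    from fun_cong[OF this, of "(undefined, m, undefined)"] show "m = m'" by (simp split: if_splits)
  qed
  obtain u where u: "chain_map A ?E bar dbar ebar P d e u"
    using chain_map_exists[OF cB rP bar_lifts[OF PX bimodule_regular Pe] bar_lifts[OF PX PX Pd]] by (rule exE)
  obtain g where g: "chain_map A ?E P d e bar dbar ebar g"
    using chain_map_exists[OF cP bar_resolution
      projective_lifts[OF proj bimodule_bar bimodule_regular ebar(1) bar_embeds embE]
      projective_lifts[OF proj bimodule_bar bimodule_bar dbar_hom bar_embeds bar_embeds]] by (rule exE)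
  note ug = chain_map_compose[OF PX g u Pd] and gu = chain_map_compose[OF bimodule_bar u g dbar_hom]
  note idP = chain_map_id[where X = P and dX = d, OF PX Pd]
    and idB = chain_map_id[where X = bar and dX = dbar, OF bimodule_bar dbar_hom]
  obtain h where h: "\<forall>i. h i \<in> bimod_hom A (P i) (P (Suc i))"
    "\<forall>i. \<forall>x\<in>carrier (P (Suc i)). compose (carrier (P (Suc i))) (u (Suc i)) (g (Suc i)) x \<ominus>\<^bsub>P (Suc i)\<^esub>
       (\<lambda>x\<in>carrier (P (Suc i)). x) x = d (Suc i) (h (Suc i) x) \<oplus>\<^bsub>P (Suc i)\<^esub> h i (d i x)"
    using chain_homotopy_exists[OF cP rP projective_lifts[OF proj PX PX Pd embP embP] ug idP]
    by (elim exE conjE)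
  obtain h' where h': "\<forall>i. h' i \<in> bimod_hom A (bar i) (bar (Suc i))"
    "\<forall>i. \<forall>x\<in>carrier (bar (Suc i)). compose (carrier (bar (Suc i))) (g (Suc i)) (u (Suc i)) x \<ominus>\<^bsub>bar (Suc i)\<^esub>
       (\<lambda>x\<in>carrier (bar (Suc i)). x) x = dbar (Suc i) (h' (Suc i) x) \<oplus>\<^bsub>bar (Suc i)\<^esub> h' i (dbar i x)"
    using chain_homotopy_exists[OF cB bar_resolution bar_lifts[OF bimodule_bar bimodule_bar dbar_hom] gu idB]
    by (elim exE conjE)
  have "\<forall>i. \<forall>x\<in>carrier (P (Suc i)). u (Suc i) (g (Suc i) x) \<ominus>\<^bsub>P (Suc i)\<^esub> x =
        d (Suc i) (h (Suc i) x) \<oplus>\<^bsub>P (Suc i)\<^esub> h i (d i x)"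
  proof (intro allI ballI)
    fix i x assume x: "x \<in> carrier (P (Suc i))"
    show "u (Suc i) (g (Suc i) x) \<ominus>\<^bsub>P (Suc i)\<^esub> x = d (Suc i) (h (Suc i) x) \<oplus>\<^bsub>P (Suc i)\<^esub> h i (d i x)"
      using bspec[OF spec[OF h(2), of i] x] unfolding compose_eq[OF x] restrict_apply'[OF x] .
  qed
  moreover have "\<forall>i. \<forall>x\<in>carrier (bar (Suc i)). g (Suc i) (u (Suc i) x) \<ominus>\<^bsub>bar (Suc i)\<^esub> x =
        dbar (Suc i) (h' (Suc i) x) \<oplus>\<^bsub>bar (Suc i)\<^esub> h' i (dbar i x)"
  proof (intro allI ballI)
    fix i x assume x: "x \<in> carrier (bar (Suc i))"
    show "g (Suc i) (u (Suc i) x) \<ominus>\<^bsub>bar (Suc i)\<^esub> x =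
        dbar (Suc i) (h' (Suc i) x) \<oplus>\<^bsub>bar (Suc i)\<^esub> h' i (dbar i x)"
      using bspec[OF spec[OF h'(2), of i] x] unfolding compose_eq[OF x] restrict_apply'[OF x] .
  qed
  ultimately show ?thesis using u g h(1) h'(1)
    by (intro exI[of _ u] exI[of _ g] exI[of _ h] exI[of _ h'] conjI)
qed

section \<open>The reduced complex\<close>

abbreviation "S n \<equiv> parallel Q (AP Q I n) N"

definition delta :: "nat \<Rightarrow> (('v, 'a) qpair \<Rightarrow> 'k) \<Rightarrow> ('v, 'a) qpair \<Rightarrow> 'k" where
  "delta n c = (\<lambda>((u, r), (v, g)). if ((u, r), (v, g)) \<in> S (Suc n) then
      (if g \<noteq> [] \<and> hd g = hd r then c ((head Q (hd r), tl r), (head Q (hd r), tl g)) else 0) +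
      (- 1) ^ Suc n * (if g \<noteq> [] \<and> last g = last r then c ((u, butlast r), (u, butlast g)) else 0)
    else 0)"

text \<open>By freeness a homomorphism into \<open>A\<close> is given by its values at the
  generators; these are expanded in the path basis, which turns homomorphisms into functions on
  parallel pairs.\<close>

definition Psi where
  "Psi n f = (\<lambda>(\<rho>, \<gamma>). if (\<rho>, \<gamma>) \<in> S n then coef (f (gen \<rho>)) \<gamma> else 0)"

lemma S_iff: "((u, r), (v, g)) \<in> S n \<longleftrightarrow> (u, r) \<in> AP Q I n \<and> (v, g) \<in> N \<and> u = v \<and> pe u r = pe v g"
  by (simp add: parallel_def)

lemma S_pair: "(\<rho>, \<gamma>) \<in> S n \<longleftrightarrow> \<rho> \<in> AP Q I n \<and> \<gamma> \<in> N \<and> fst \<rho> = fst \<gamma> \<and> path_end Q \<rho> = path_end Q \<gamma>"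
  by (simp add: parallel_def)

text \<open>A nonzero product \<open>x q\<close> determines \<open>q\<close>, so a given coefficient
  receives a contribution from at most one basis path of \<open>a\<close>.\<close>

lemma coef_left:
  assumes a: "a \<in> carrier A" and x: "(u, x) \<in> N"
  shows "coef (path_class (u, x) \<otimes>\<^bsub>A\<^esub> a) = (\<lambda>(w, g). if (w, g) \<in> N \<and> w = u \<and> take (length x) g = x
      \<and> length x \<le> length g
           then coef a (pe u x, drop (length x) g) else 0)"
  using a
proof (induction a rule: A_induct)
  case zero
  then show ?case using x by (auto simp: coef_zero)
next
  case (add a c p)
  obtain v q where p: "p = (v, q)" by (cases p)
  have vq: "(v, q) \<in> N" using add p by simp
  have cfp: "coef (path_class p) = basis_vec (v, q)" using vq by (simp add: p coef_path_class)
  have iff: "(if pe u x = v \<and> nz (x @ q) then basis_vec (u, x @ q) (w, g) else 0) =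
     (if (w, g) \<in> N \<and> w = u \<and> take (length x) g = x \<and> length x \<le> length g
        then basis_vec (v, q) (pe u x, drop (length x) g) else (0 :: 'k))" for w g
  proof -
    have "(pe u x = v \<and> nz (x @ q) \<and> w = u \<and> g = x @ q) \<longleftrightarrow>
      ((w, g) \<in> N \<and> w = u \<and> take (length x) g = x \<and> length x \<le> length g \<and> pe u x = v \<and> drop (length x) g = q)"
      (is "?l \<longleftrightarrow> ?r")
    proof
      assume ?l
      then show ?r using x vq by (auto simp: N_iff append_in_paths)
    next
      assume r: ?r
      then have "g = x @ q" using append_take_drop_id[of "length x" g] by simp
      then show ?l using r by (auto simp: N_iff)
    qed
    then show ?thesis by (auto simp: basis_vec_def)
  qed
  have "coef (path_class (u, x) \<otimes>\<^bsub>A\<^esub> path_class p) = (\<lambda>(w, g). if pe u x = v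
      \<and> nz (x @ q) then basis_vec (u, x @ q) (w, g) else 0)"
    using x vq by (auto simp: p path_class_mult coef_zero coef_path_class N_iff append_in_paths)
  then have "coef (path_class (u, x) \<otimes>\<^bsub>A\<^esub> path_class p) = (\<lambda>(w, g). if (w, g) \<in> N \<and> w = u
      \<and> take (length x) g = x \<and> length x \<le> length g
           then coef (path_class p) (pe u x, drop (length x) g) else 0)"
    unfolding iff cfp .
  moreover have "path_class (u, x) \<otimes>\<^bsub>A\<^esub> (a \<oplus>\<^bsub>A\<^esub> c \<odot>\<^bsub>A\<^esub> path_class p)
      = (path_class (u, x) \<otimes>\<^bsub>A\<^esub> a) \<oplus>\<^bsub>A\<^esub> c \<odot>\<^bsub>A\<^esub> (path_class (u, x) \<otimes>\<^bsub>A\<^esub> path_class p)"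
    using x add by (simp add: A.r_distr mult_smult)
  ultimately show ?case using x add by (auto simp: coef_add coef_smult)
qed

lemma coef_right:
  assumes a: "a \<in> carrier A" and x: "(v, x) \<in> N"
  shows "coef (a \<otimes>\<^bsub>A\<^esub> path_class (v, x)) = (\<lambda>(w, g). if (w, g) \<in> N \<and> length x \<le> length g \<and>
           drop (length g - length x) g = x \<and> pe w (take (length g - length x) g) = v
           then coef a (w, take (length g - length x) g) else 0)"
  using a
proof (induction a rule: A_induct)
  case zero
  then show ?case using x by (auto simp: coef_zero)
next
  case (add a c p)
  obtain u q where p: "p = (u, q)" by (cases p)
  have uq: "(u, q) \<in> N" using add p by simp
  have cfp: "coef (path_class p) = basis_vec (u, q)" using uq by (simp add: p coef_path_class)
  have iff: "(if pe u q = v \<and> nz (q @ x) then basis_vec (u, q @ x) (w, g) else 0) =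
     (if (w, g) \<in> N \<and> length x \<le> length g \<and> drop (length g - length x) g = x \<and> pe w (take (length g - length
         x) g) = v
        then basis_vec (u, q) (w, take (length g - length x) g) else (0 :: 'k))" for w g
  proof -
    have "(pe u q = v \<and> nz (q @ x) \<and> w = u \<and> g = q @ x) \<longleftrightarrow>
      ((w, g) \<in> N \<and> length x \<le> length g \<and> drop (length g - length x) g = x \<and>
         pe w (take (length g - length x) g) = v \<and> w = u \<and> take (length g - length x) g = q)"
      (is "?l \<longleftrightarrow> ?r")
    proof
      assume ?l
      then show ?r using x uq by (auto simp: N_iff append_in_paths)
    next
      assume r: ?r
      then have "g = q @ x" using append_take_drop_id[of "length g - length x" g] by simp
      then show ?l using r by (auto simp: N_iff)
    qed
    then show ?thesis by (auto simp: basis_vec_def)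
  qed
  have "coef (path_class p \<otimes>\<^bsub>A\<^esub> path_class (v, x)) = (\<lambda>(w, g). if pe u q = v
      \<and> nz (q @ x) then basis_vec (u, q @ x) (w, g) else 0)"
    using x uq by (auto simp: p path_class_mult coef_zero coef_path_class N_iff append_in_paths)
  then have "coef (path_class p \<otimes>\<^bsub>A\<^esub> path_class (v, x)) = (\<lambda>(w, g). if (w, g) \<in> N \<and> length x \<le> length g \<and>
           drop (length g - length x) g = x \<and> pe w (take (length g - length x) g) = v
           then coef (path_class p) (w, take (length g - length x) g) else 0)"
    unfolding iff cfp .
  moreover have "(a \<oplus>\<^bsub>A\<^esub> c \<odot>\<^bsub>A\<^esub> path_class p) \<otimes>\<^bsub>A\<^esub> path_class (v, x)
      = (a \<otimes>\<^bsub>A\<^esub> path_class (v, x)) \<oplus>\<^bsub>A\<^esub> c \<odot>\<^bsub>A\<^esub> (path_class p \<otimes>\<^bsub>A\<^esub> path_class (v, x))"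
    using x add by (simp add: A.l_distr smult_mult)
  ultimately show ?case using x add by (auto simp: coef_add coef_smult)
qed

section \<open>Homomorphisms into the algebra in coordinates\<close>

abbreviation "E \<equiv> regular_bimodule A"

lemma hom_gen_closed:
  assumes f: "f \<in> bimod_hom A (bar n) E" and \<rho>: "\<rho> \<in> AP Q I n"
  shows "f (gen \<rho>) \<in> carrier A"
  using hom_closed[OF f gen_in_bar[OF \<rho>]] by (simp only: regular_simps)

lemma hom_gen_ends:
  assumes f: "f \<in> bimod_hom A (bar n) E" and ur: "(u, r) \<in> AP Q I n"
  shows "path_class (u, []) \<otimes>\<^bsub>A\<^esub> f (gen (u, r)) = f (gen (u, r))"
    and "f (gen (u, r)) \<otimes>\<^bsub>A\<^esub> path_class (pe u r, []) = f (gen (u, r))"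
proof -
  have e: "path_class (u, []) \<in> carrier A" "path_class (pe u r, []) \<in> carrier A"
    using AP_ends[OF ur] by (simp_all add: N_iff)
  show "path_class (u, []) \<otimes>\<^bsub>A\<^esub> f (gen (u, r)) = f (gen (u, r))"
    using hom_lact[OF f e(1) gen_in_bar[OF ur]] gen_ends(1)[OF ur] by (simp only: bar_simps(5) regular_simps)
  show "f (gen (u, r)) \<otimes>\<^bsub>A\<^esub> path_class (pe u r, []) = f (gen (u, r))"
    using hom_ract[OF f e(2) gen_in_bar[OF ur]] gen_ends(2)[OF ur] by (simp only: bar_simps(6) regular_simps)
qed

text \<open>A generator is fixed by the idempotents of its end points, hence so is its image: only
  paths parallel to \<open>\<rho>\<close> occur in it, and restricting \<open>Psi\<close> to
  \<open>S n\<close> loses nothing.\<close>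

lemma hom_gen_support:
  assumes f: "f \<in> bimod_hom A (bar n) E" and \<rho>: "\<rho> \<in> AP Q I n" and nS: "(\<rho>, \<gamma>) \<notin> S n"
  shows "coef (f (gen \<rho>)) \<gamma> = 0"
proof -
  obtain u r v g where eqs: "\<rho> = (u, r)" "\<gamma> = (v, g)" by (cases \<rho>; cases \<gamma>)
  note ur = \<rho>[unfolded eqs]
  have N: "(u, []) \<in> N" "(pe u r, []) \<in> N" using AP_ends[OF ur] by (simp_all add: N_iff)
  have fc: "f (gen (u, r)) \<in> carrier A" by (rule hom_gen_closed[OF f ur])
  have "coef (f (gen (u, r))) (v, g) = 0" if "u \<noteq> v"
    using fun_cong[OF coef_left[OF fc N(1)], of "(v, g)"] that by (simp add: hom_gen_ends(1)[OF f ur])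
  moreover have "coef (f (gen (u, r))) (v, g) = 0" if "pe u r \<noteq> pe v g"
    using fun_cong[OF coef_right[OF fc N(2)], of "(v, g)"] that by (auto simp: hom_gen_ends(2)[OF f ur])
  moreover have "coef (f (gen (u, r))) (v, g) = 0" if "(v, g) \<notin> N" using that by (rule coef_outside)
  ultimately show ?thesis using nS ur by (auto simp: eqs S_iff)
qed

lemma Psi_inj:
  assumes f: "f \<in> bimod_hom A (bar n) E" and g: "g \<in> bimod_hom A (bar n) E" and eq: "Psi n f = Psi n g"
  shows "f = g"
proof (rule bar_hom_eqI[OF bimodule_regular f g])
  fix \<rho> assume \<rho>: "\<rho> \<in> AP Q I n"
  have "coef (f (gen \<rho>)) \<gamma> = coef (g (gen \<rho>)) \<gamma>" for \<gamma>
  proof (cases "(\<rho>, \<gamma>) \<in> S n")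
    case True
    then show ?thesis using fun_cong[OF eq, of "(\<rho>, \<gamma>)"] by (simp add: Psi_def)
  next
    case False
    then show ?thesis using hom_gen_support[OF f \<rho>] hom_gen_support[OF g \<rho>] by simp
  qed
  then show "f (gen \<rho>) = g (gen \<rho>)"
    by (intro coef_inj ext hom_gen_closed[OF f \<rho>] hom_gen_closed[OF g \<rho>])
qed

text \<open>A function supported on parallel pairs defines values in \<open>e_u A e_v\<close>, as
  freeness requires.\<close>

lemma Psi_surj:
  assumes c: "\<And>w. w \<notin> S n \<Longrightarrow> c w = 0"
  shows "\<exists>f\<in>bimod_hom A (bar n) E. Psi n f = c"
proof -
  have "\<forall>\<rho>\<in>AP Q I n. \<exists>a. a \<in> carrier A \<and> coef a = (\<lambda>\<gamma>. c (\<rho>, \<gamma>))"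
  proof
    fix \<rho> assume "\<rho> \<in> AP Q I n"
    have "c (\<rho>, \<gamma>) = 0" if "\<gamma> \<notin> N" for \<gamma> using c[of "(\<rho>, \<gamma>)"] that by (simp add: S_pair)
    then show "\<exists>a. a \<in> carrier A \<and> coef a = (\<lambda>\<gamma>. c (\<rho>, \<gamma>))" using coef_surj[of "\<lambda>\<gamma>. c (\<rho>, \<gamma>)"] by blast
  qed
  then obtain m where "\<forall>\<rho>\<in>AP Q I n. m \<rho> \<in> carrier A \<and> coef (m \<rho>) = (\<lambda>\<gamma>. c (\<rho>, \<gamma>))"
    by (drule_tac bchoice) (erule exE)
  then have mA: "m \<rho> \<in> carrier A" and mc: "coef (m \<rho>) = (\<lambda>\<gamma>. c (\<rho>, \<gamma>))" if "\<rho> \<in> AP Q I n" for \<rho>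
    using that by simp_all
  have "\<exists>f\<in>bimod_hom A (bar n) E. \<forall>\<rho>\<in>AP Q I n. f (gen \<rho>) = m \<rho>"
  proof (rule bar_free[OF bimodule_regular])
    show "m \<rho> \<in> carrier E" if "\<rho> \<in> AP Q I n" for \<rho> using mA[OF that] by (simp only: regular_simps)
  next
    fix u r assume ur: "(u, r) \<in> AP Q I n"
    have N: "(u, []) \<in> N" "(pe u r, []) \<in> N" using AP_ends[OF ur] by (simp_all add: N_iff)
    have c0: "(w, g) \<notin> N \<Longrightarrow> c ((u, r), (w, g)) = 0" "w \<noteq> u \<Longrightarrow> c ((u, r), (w, g)) = 0"
      "pe w g \<noteq> pe u r \<Longrightarrow> c ((u, r), (w, g)) = 0" for w g
      by (rule c; auto simp: S_iff)+
    have "path_class (u, []) \<otimes>\<^bsub>A\<^esub> m (u, r) = m (u, r)"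
    proof (rule coef_inj)
      show "coef (path_class (u, []) \<otimes>\<^bsub>A\<^esub> m (u, r)) = coef (m (u, r))"
        unfolding coef_left[OF mA[OF ur] N(1)] mc[OF ur]
        by (rule ext) (use c0 in \<open>auto split: prod.split\<close>)
    qed (use N mA[OF ur] in simp_all)
    then show "lact E (path_class (u, [])) (m (u, r)) = m (u, r)" by (simp only: regular_simps)
    have "m (u, r) \<otimes>\<^bsub>A\<^esub> path_class (pe u r, []) = m (u, r)"
    proof (rule coef_inj)
      show "coef (m (u, r) \<otimes>\<^bsub>A\<^esub> path_class (pe u r, [])) = coef (m (u, r))"
        unfolding coef_right[OF mA[OF ur] N(2)] mc[OF ur]
        by (rule ext) (use c0 in \<open>auto split: prod.split\<close>)
    qed (use N mA[OF ur] in simp_all)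
    then show "ract E (m (u, r)) (path_class (pe u r, [])) = m (u, r)" by (simp only: regular_simps)
  qed
  then obtain f where f: "f \<in> bimod_hom A (bar n) E" "\<forall>\<rho>\<in>AP Q I n. f (gen \<rho>) = m \<rho>" by (rule bexE)
  have "Psi n f (\<rho>, \<gamma>) = c (\<rho>, \<gamma>)" for \<rho> \<gamma>
    using f(2) mc[of \<rho>] c[of "(\<rho>, \<gamma>)"] by (auto simp: Psi_def S_pair)
  then have "Psi n f w = c w" for w by (cases w) (simp only:)
  then have "Psi n f = c" by (rule ext)
  then show ?thesis using f(1) by (rule_tac bexI)
qed

lemma AP_Suc_parts:
  assumes "(u, r) \<in> AP Q I (Suc n)"
  shows "r \<noteq> []" "tail Q (hd r) = u" "(head Q (hd r), tl r) \<in> AP Q I n" "(u, butlast r) \<in> AP Q I n"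
    "(u, [hd r]) \<in> N" "(pe u (butlast r), [last r]) \<in> N" "pe u [hd r] = head Q (hd r)"
    "pe u (butlast r) = tail Q (last r)" "pe (head Q (hd r)) (tl r) = pe u r" "head Q (last r) = pe u r"
proof -
  show r: "r \<noteq> []" using assms by (auto simp: AP_iff)
  obtain a r' where ar: "r = a # r'" using r by (cases r) auto
  obtain b r'' where br: "r = r'' @ [b]" using r by (cases r rule: rev_cases) auto
  have a: "(u, a # r') \<in> paths Q" "length r' = n" "zs (a # r')" using assms by (auto simp: ar AP_iff)
  have b: "(u, r'' @ [b]) \<in> paths Q" "length r'' = n" "zs (r'' @ [b])" using assms by (auto simp: br AP_iff)
  have va: "head Q a \<in> verts Q" "tail Q a \<in> verts Q" using a(1) by (auto dest: path_start)
  have vb: "head Q b \<in> verts Q" "pe u r'' = tail Q b" "b \<in> arcs Q" "(u, r'') \<in> paths Q"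
    using b(1) by (auto simp: append_in_paths)
  show "tail Q (hd r) = u" "(head Q (hd r), tl r) \<in> AP Q I n" "(u, [hd r]) \<in> N" "pe u [hd r] = head Q (hd r)"
    "pe (head Q (hd r)) (tl r) = pe u r"
    using a va by (auto simp: ar AP_iff N_iff successively_Cons)
  show "(u, butlast r) \<in> AP Q I n" "(pe u (butlast r), [last r]) \<in> N" "pe u (butlast r) = tail Q (last r)"
    "head Q (last r) = pe u r"
    using b vb by (auto simp: br AP_iff N_iff successively_append_iff path_end_append)
qed

lemma dbar_gen:
  assumes ur: "(u, r) \<in> AP Q I (Suc n)"
  shows "dbar n (gen (u, r)) = lact (bar n) (path_class (u, [hd r])) (gen (head Q (hd r), tl r)) \<oplus>\<^bsub>bar n\<^esub>
     ((- 1) ^ Suc n) \<odot>\<^bsub>bar n\<^esub> ract (bar n) (gen (u, butlast r)) (path_class (pe u (butlast r), [last r]))"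
proof -
  note p = AP_Suc_parts[OF ur]
  have t: "(u, [], r, []) \<in> bar_basis (Suc n)" by (rule gen_bar_basis[OF ur])
  have t1: "(head Q (hd r), [], tl r, []) \<in> bar_basis n" and t2: "(u, [], butlast r, []) \<in> bar_basis n"
    using gen_bar_basis p(3,4) by blast+
  have 1: "lact (bar n) (path_class (u, [hd r])) (gen (head Q (hd r), tl r))
      = basis_vec (u, [hd r], tl r, [])"
    using gact_basis[OF finite_bar_basis p(5) t1, of lacts] by (simp add: gen_def p(7))
  have 2: "ract (bar n) (gen (u, butlast r)) (path_class (pe u (butlast r), [last r]))
      = basis_vec (u, [], butlast r, [last r])"
    using gact_basis[OF finite_bar_basis p(6) t2, of racts] by (simp add: gen_def)
  show ?thesis unfolding 1 2 using dm_basis[OF t] dbar_eq[OF gen_in_bar[OF ur]] by (simp add: gen_def)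
qed

text \<open>The differential of a generator is the first arrow times a generator plus, up to sign, a
  generator times the last arrow. Taking the coefficient at a path after such a multiplication
  removes the arrow from the path, or gives zero if the path does not begin or end with it.\<close>

lemma Psi_delta:
  assumes f: "f \<in> bimod_hom A (bar n) E"
  shows "Psi (Suc n) (compose (carrier (bar (Suc n))) f (dbar n)) = delta n (Psi n f)"
proof (rule ext)
  fix w :: "('v, 'a) qpair"
  obtain u r v g where w: "w = ((u, r), (v, g))" by (cases w) auto
  show "Psi (Suc n) (compose (carrier (bar (Suc n))) f (dbar n)) w = delta n (Psi n f) w"
  proof (cases "w \<in> S (Suc n)")
    case False
    then show ?thesis by (simp add: w Psi_def delta_def)
  next
    case True
    then have ur: "(u, r) \<in> AP Q I (Suc n)" and vg: "(u, g) \<in> N" and v: "v = u" and pe: "pe u r = pe u g"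
      by (auto simp: w S_iff)
    note p = AP_Suc_parts[OF ur]
    let ?a = "f (gen (head Q (hd r), tl r))" and ?b = "f (gen (u, butlast r))"
    have ab: "?a \<in> carrier A" "?b \<in> carrier A"
      by (rule hom_gen_closed[OF f p(3)], rule hom_gen_closed[OF f p(4)])
    note B = bimodule_bar[of n]
    note la = bimodule.lact_closed[OF B path_class_closed[OF p(5)] gen_in_bar[OF p(3)]]
    note ra = bimodule.ract_closed[OF B gen_in_bar[OF p(4)] path_class_closed[OF p(6)]]
    have "compose (carrier (bar (Suc n))) f (dbar n) (gen (u, r)) = f (dbar n (gen (u, r)))"
      by (rule compose_eq[OF gen_in_bar[OF ur]])
    also have "\<dots> = path_class (u, [hd r]) \<otimes>\<^bsub>A\<^esub> ?a \<oplus>\<^bsub>A\<^esub> ((- 1) ^ Suc n) \<odot>\<^bsub>A\<^esub> (?b \<otimes>\<^bsub>A\<^esub> path_class (pe u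
        (butlast r), [last r]))"
      unfolding dbar_gen[OF ur] hom_add[OF f la bimodule.smult_closed'[OF B ra]]
        hom_smult[OF B bimodule_regular f ra] hom_lact[OF f path_class_closed[OF p(5)] gen_in_bar[OF p(3)]]
        hom_ract[OF f path_class_closed[OF p(6)] gen_in_bar[OF p(4)]] by (simp only: regular_simps)
    finally have "coef (compose (carrier (bar (Suc n))) f (dbar n) (gen (u, r))) (u, g) =
       coef (path_class (u, [hd r]) \<otimes>\<^bsub>A\<^esub> ?a) (u, g) + (- 1) ^ Suc n * coef (?b \<otimes>\<^bsub>A\<^esub> path_class (pe u
           (butlast r), [last r])) (u, g)"
      using ab p by (simp add: coef_add coef_smult del: power_Suc)
    also have "coef (path_class (u, [hd r]) \<otimes>\<^bsub>A\<^esub> ?a) (u, g) =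
        (if g \<noteq> [] \<and> hd g = hd r then Psi n f ((head Q (hd r), tl r), (head Q (hd r), tl g)) else 0)"
    proof -
      have "(take (length [hd r]) g = [hd r] \<and> length [hd r] \<le> length g) \<longleftrightarrow> g \<noteq> [] \<and> hd g = hd r"
        by (cases g) auto
      then have "coef (path_class (u, [hd r]) \<otimes>\<^bsub>A\<^esub> ?a) (u, g) =
          (if g \<noteq> [] \<and> hd g = hd r then coef ?a (head Q (hd r), drop (length [hd r]) g) else 0)"
        using vg unfolding coef_left[OF ab(1) p(5)] p(7) by simp
      moreover have "coef ?a \<gamma> = Psi n f ((head Q (hd r), tl r), \<gamma>)" for \<gamma>
        using hom_gen_support[OF f p(3), of \<gamma>] by (simp add: Psi_def)
      ultimately show ?thesis by (simp add: drop_Suc)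
    qed
    also have "coef (?b \<otimes>\<^bsub>A\<^esub> path_class (pe u (butlast r), [last r])) (u, g) =
        (if g \<noteq> [] \<and> last g = last r then Psi n f ((u, butlast r), (u, butlast g)) else 0)"
    proof -
      have iff: "(length [last r] \<le> length g \<and> drop (length g - length [last r]) g = [last r] \<and>
           pe u (take (length g - length [last r]) g) = pe u (butlast r)) \<longleftrightarrow> g \<noteq> [] \<and> last g = last r"
      proof (cases g rule: rev_cases)
        case (snoc g' b)
        have "pe u g' = tail Q b" using vg by (auto simp: snoc N_iff append_in_paths)
        then show ?thesis using p(8) by (auto simp: snoc)
      qed simp
      have t: "take (length g - length [last r]) g = butlast g" by (simp add: butlast_conv_take)
      have "coef (?b \<otimes>\<^bsub>A\<^esub> path_class (pe u (butlast r), [last r])) (u, g) =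
          (if g \<noteq> [] \<and> last g = last r then coef ?b (u, take (length g - length [last r]) g) else 0)"
        using vg unfolding coef_right[OF ab(2) p(6)] prod.case iff by simp
      moreover have "coef ?b \<gamma> = Psi n f ((u, butlast r), \<gamma>)" for \<gamma>
        using hom_gen_support[OF f p(4), of \<gamma>] by (simp add: Psi_def)
      ultimately show ?thesis unfolding t by simp
    qed
    finally show ?thesis using True unfolding w v Psi_def[of "Suc n"] delta_def by simp
  qed
qed

lemma Psi_support: "w \<notin> S n \<Longrightarrow> Psi n f w = 0"
  by (cases w) (simp add: Psi_def)

text \<open>States an isomorphism in cohomology without forming quotients: a linear map from
  cocycles to \<open>delta\<close>-cocycles that detects coboundaries and is surjective up to them.
  This is the form in which a system of coordinates can be pulled back.\<close>

lemma cohomology_via_delta: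
  fixes P :: "nat \<Rightarrow> ('k, (('v, 'a) qpath \<Rightarrow> 'k) set, 'm) bimod"
  assumes P: "projective_resolution A E P d e"
  shows "\<exists>\<Theta> :: ('m \<Rightarrow> (('v, 'a) qpath \<Rightarrow> 'k) set) \<Rightarrow> ('v, 'a) qpair \<Rightarrow> 'k.
     (\<forall>f\<in>cocycles A P d E (Suc n). \<forall>g\<in>cocycles A P d E (Suc n).
        \<Theta> (\<lambda>x\<in>carrier (P (Suc n)). f x \<oplus>\<^bsub>E\<^esub> g x) = (\<lambda>w. \<Theta> f w + \<Theta> g w)) \<and>
     (\<forall>f\<in>cocycles A P d E (Suc n). \<forall>c. \<Theta> (\<lambda>x\<in>carrier (P (Suc n)). c \<odot>\<^bsub>E\<^esub> f x) = (\<lambda>w. c * \<Theta> f w)) \<and>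
     (\<forall>f\<in>cocycles A P d E (Suc n). (\<forall>w. w \<notin> S (Suc n) \<longrightarrow> \<Theta> f w = 0) \<and> delta (Suc n) (\<Theta> f) = (\<lambda>_. 0)) \<and>
     (\<forall>f\<in>cocycles A P d E (Suc n). f \<in> coboundaries A P d E (Suc n) \<longleftrightarrow>
        (\<exists>c. (\<forall>w. w \<notin> S n \<longrightarrow> c w = 0) \<and> \<Theta> f = delta n c)) \<and>
     (\<forall>z. (\<forall>w. w \<notin> S (Suc n) \<longrightarrow> z w = 0) \<and> delta (Suc n) z = (\<lambda>_. 0) \<longrightarrow>
        (\<exists>f\<in>cocycles A P d E (Suc n). \<exists>c. (\<forall>w. w \<notin> S n \<longrightarrow> c w = 0) \<and> \<Theta> f = (\<lambda>w. z w + delta n c w)))"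
proof -
  obtain u g h h' where u: "chain_map A E bar dbar ebar P d e u" and g: "chain_map A E P d e bar dbar ebar g"
    and h0: "\<forall>i. h i \<in> bimod_hom A (P i) (P (Suc i))"
    and hh: "\<forall>i. \<forall>x\<in>carrier (P (Suc i)). u (Suc i) (g (Suc i) x) \<ominus>\<^bsub>P (Suc i)\<^esub> x =
        d (Suc i) (h (Suc i) x) \<oplus>\<^bsub>P (Suc i)\<^esub> h i (d i x)"
    and h0': "\<forall>i. h' i \<in> bimod_hom A (bar i) (bar (Suc i))"
    and hh': "\<forall>i. \<forall>x\<in>carrier (bar (Suc i)). g (Suc i) (u (Suc i) x) \<ominus>\<^bsub>bar (Suc i)\<^esub> x =
        dbar (Suc i) (h' (Suc i) x) \<oplus>\<^bsub>bar (Suc i)\<^esub> h' i (dbar i x)"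
    using comparison[OF P] by (elim exE conjE) (rule that)
  note h = spec[OF h0] and h' = spec[OF h0']
  have rP: "bimod_resolution A E P d e"
    by (rule bimod_resolution_of_projective[OF kalgebra_A bimodule_regular P])
  have cP: "bimod_complex A E P d e" by (rule bimod_resolution.axioms(1)[OF rP])
  note PX = bimod_complex.X[OF cP] and Pd = bimod_complex.d[OF cP]
  note T = cohomology_transfer[where X = bar and dX = dbar and Y = P
    and dY = d, OF bimodule_regular bimodule_bar dbar_hom PX Pd u g h hh]
  note T' = cohomology_transfer[where X = P and dX = d and Y = bar
    and dY = dbar, OF bimodule_regular PX Pd bimodule_bar dbar_hom g u h' hh']
  have uh: "u i \<in> bimod_hom A (bar i) (P i)" for i using u by (simp add: chain_map_def)
  let ?n = "Suc n"
  \<comment> \<open>Pull a cocycle back to the Koszul resolution, then take coordinates.\<close>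
  define \<Theta> where "\<Theta> f = Psi ?n (compose (carrier (bar ?n)) f (u ?n))"
    for f :: "'m \<Rightarrow> (('v, 'a) qpath \<Rightarrow> 'k) set"
  have val: "\<Theta> f (\<rho>, \<gamma>) = (if (\<rho>, \<gamma>) \<in> S ?n then coef (f (u ?n (gen \<rho>))) \<gamma> else 0)" for f \<rho> \<gamma>
    using gen_in_bar[of \<rho> ?n] by (simp add: \<Theta>_def Psi_def S_pair compose_eq del: bar_simps)
  have ug: "u ?n (gen \<rho>) \<in> carrier (P ?n)" if "\<rho> \<in> AP Q I ?n" for \<rho>
    by (rule hom_closed[OF uh gen_in_bar[OF that]])
  have ch: "f \<in> bimod_hom A (P ?n) E" if "f \<in> cocycles A P d E ?n" for f using that
    by (simp add: cocycles_def)
  have fA: "f (u ?n (gen \<rho>)) \<in> carrier A" if "f \<in> cocycles A P d E ?n" "\<rho> \<in> AP Q I ?n" for f \<rho>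
    using hom_closed[OF ch[OF that(1)] ug[OF that(2)]] by (simp only: regular_simps)
  have 1: "\<Theta> (\<lambda>x\<in>carrier (P ?n). f x \<oplus>\<^bsub>E\<^esub> g x) = (\<lambda>w. \<Theta> f w + \<Theta> g w)"
    if "f \<in> cocycles A P d E ?n" "g \<in> cocycles A P d E ?n" for f g
  proof (rule ext)
    fix w :: "('v, 'a) qpair"
    obtain \<rho> \<gamma> where w: "w = (\<rho>, \<gamma>)" by (cases w)
    show "\<Theta> (\<lambda>x\<in>carrier (P ?n). f x \<oplus>\<^bsub>E\<^esub> g x) w = \<Theta> f w + \<Theta> g w"
      using fA[OF that(1), of \<rho>] fA[OF that(2), of \<rho>] ug[of \<rho>]
      by (simp add: w val S_pair regular_simps coef_add)
  qed
  have 2: "\<Theta> (\<lambda>x\<in>carrier (P ?n). c \<odot>\<^bsub>E\<^esub> f x) = (\<lambda>w. c * \<Theta> f w)" if "f \<in> cocycles A P d E ?n" for f c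
  proof (rule ext)
    fix w :: "('v, 'a) qpair"
    obtain \<rho> \<gamma> where w: "w = (\<rho>, \<gamma>)" by (cases w)
    show "\<Theta> (\<lambda>x\<in>carrier (P ?n). c \<odot>\<^bsub>E\<^esub> f x) w = c * \<Theta> f w"
      using fA[OF that, of \<rho>] ug[of \<rho>] by (simp add: w val S_pair regular_simps coef_smult)
  qed
  have zero_hom: "(\<lambda>x\<in>carrier (bar i). \<zero>\<^bsub>A\<^esub>) \<in> bimod_hom A (bar i) E" for i
    using hom_smult_fun[OF bimodule_bar bimodule_regular, of "\<lambda>x\<in>carrier (bar i). \<zero>\<^bsub>A\<^esub>" i 0]
      bar_free[OF bimodule_regular, of i "\<lambda>_. \<zero>\<^bsub>A\<^esub>"]
  proof -
    obtain f where f: "f \<in> bimod_hom A (bar i) E"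
      using Psi_surj[of i "\<lambda>_. 0"] by blast
    have "(\<lambda>x\<in>carrier (bar i). 0 \<odot>\<^bsub>E\<^esub> f x) \<in> bimod_hom A (bar i) E"
      by (rule hom_smult_fun[OF bimodule_bar bimodule_regular f])
    moreover have "(\<lambda>x\<in>carrier (bar i). 0 \<odot>\<^bsub>E\<^esub> f x) = (\<lambda>x\<in>carrier (bar i). \<zero>\<^bsub>A\<^esub>)"
    proof (rule restrict_ext)
      fix x assume "x \<in> carrier (bar i)"
      from bimodule.smult_0[OF bimodule_regular hom_closed[OF f this]]
      show "0 \<odot>\<^bsub>E\<^esub> f x = \<zero>\<^bsub>A\<^esub>" by (simp only: regular_simps)
    qed
    ultimately show ?thesis by simp
  qed
  have Psi0: "Psi i (\<lambda>x\<in>carrier (bar i). \<zero>\<^bsub>A\<^esub>) = (\<lambda>_. 0)" for i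
    using gen_in_bar[of _ i] by (auto simp: Psi_def S_pair coef_zero fun_eq_iff restrict_def simp del:
        bar_simps)
  have coc_iff: "c \<in> cocycles A bar dbar E i \<longleftrightarrow> delta i (Psi i c) = (\<lambda>_. 0)"
    if c: "c \<in> bimod_hom A (bar i) E" for c i
  proof
    assume "c \<in> cocycles A bar dbar E i"
    then have "compose (carrier (bar (Suc i))) c (dbar i) = (\<lambda>x\<in>carrier (bar (Suc i)). \<zero>\<^bsub>A\<^esub>)"
      by (intro extensionalityI[OF compose_extensional restrict_extensional])
         (simp add: cocycles_def compose_eq regular_simps del: bar_simps)
    then show "delta i (Psi i c) = (\<lambda>_. 0)" using Psi_delta[OF c] Psi0 by simp
  next
    assume z: "delta i (Psi i c) = (\<lambda>_. 0)"
    have "compose (carrier (bar (Suc i))) c (dbar i) = (\<lambda>x\<in>carrier (bar (Suc i)). \<zero>\<^bsub>A\<^esub>)"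
      by (rule Psi_inj[OF hom_compose[OF dbar_hom c bimodule_bar] zero_hom]) (simp only: Psi_delta[OF c]
          Psi0 z)
    then have "c (dbar i x) = \<zero>\<^bsub>A\<^esub>" if "x \<in> carrier (bar (Suc i))" for x
      using compose_eq[OF that, of c "dbar i"] that by (simp del: bar_simps)
    then show "c \<in> cocycles A bar dbar E i" using c by (simp add: cocycles_def regular_simps del: bar_simps)
  qed
  have 3: "(\<forall>w. w \<notin> S ?n \<longrightarrow> \<Theta> f w = 0) \<and> delta ?n (\<Theta> f) = (\<lambda>_. 0)" if f: "f \<in> cocycles A P d E ?n" for f
  proof -
    have "compose (carrier (bar ?n)) f (u ?n) \<in> bimod_hom A (bar ?n) E"
      by (rule hom_compose[OF uh ch[OF f] bimodule_bar])
    from coc_iff[OF this] T(1)[OF f] have "delta ?n (\<Theta> f) = (\<lambda>_. 0)" by (simp add: \<Theta>_def)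
    then show ?thesis by (simp add: \<Theta>_def Psi_support)
  qed
  have 4: "f \<in> coboundaries A P d E ?n \<longleftrightarrow> (\<exists>c. (\<forall>w. w \<notin> S n \<longrightarrow> c w = 0) \<and> \<Theta> f = delta n c)"
    if f: "f \<in> cocycles A P d E ?n" for f
  proof
    assume "f \<in> coboundaries A P d E ?n"
    then have "compose (carrier (bar ?n)) f (u ?n) \<in> coboundaries A bar dbar E ?n" by (rule T(2))
    then obtain c where c: "c \<in> bimod_hom A (bar n) E"
      and eq: "compose (carrier (bar ?n)) f (u ?n) = compose (carrier (bar ?n)) c (dbar n)"
      unfolding coboundaries_Suc by (rule bexE)
    have "\<Theta> f = delta n (Psi n c)" unfolding \<Theta>_def eq by (rule Psi_delta[OF c])
    then show "\<exists>c. (\<forall>w. w \<notin> S n \<longrightarrow> c w = 0) \<and> \<Theta> f = delta n c"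
      by (intro exI[of _ "Psi n c"]) (simp add: Psi_support)
  next
    assume "\<exists>c. (\<forall>w. w \<notin> S n \<longrightarrow> c w = 0) \<and> \<Theta> f = delta n c"
    then obtain c where c0: "\<And>w. w \<notin> S n \<Longrightarrow> c w = 0" and eq: "\<Theta> f = delta n c" by blast
    obtain c' where c': "c' \<in> bimod_hom A (bar n) E" "Psi n c' = c" using Psi_surj[of n c, OF c0]
      by (rule bexE)
    have "compose (carrier (bar ?n)) f (u ?n) = compose (carrier (bar ?n)) c' (dbar n)"
      by (rule Psi_inj[OF hom_compose[OF uh ch[OF f] bimodule_bar] hom_compose[OF dbar_hom c'(1)
          bimodule_bar]])
         (simp only: Psi_delta[OF c'(1)] c'(2) eq flip: \<Theta>_def)
    then have "compose (carrier (bar ?n)) f (u ?n) \<in> coboundaries A bar dbar E ?n"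
      unfolding coboundaries_Suc using c'(1) by (intro bexI)
    then show "f \<in> coboundaries A P d E ?n" by (rule T(3)[OF f])
  qed
  have 5: "\<exists>f\<in>cocycles A P d E ?n. \<exists>c. (\<forall>w. w \<notin> S n \<longrightarrow> c w = 0) \<and> \<Theta> f = (\<lambda>w. z w + delta n c w)"
    if z0: "\<And>w. w \<notin> S ?n \<Longrightarrow> z w = 0" and dz: "delta ?n z = (\<lambda>_. 0)" for z
  proof -
    obtain y where y: "y \<in> bimod_hom A (bar ?n) E" "Psi ?n y = z" using Psi_surj[of ?n z, OF z0]
      by (rule bexE)
    have yc: "y \<in> cocycles A bar dbar E ?n" using coc_iff[OF y(1)] y(2) dz by simp
    \<comment> \<open>Pulling \<open>y\<close> back along \<open>g\<close> and then along
      \<open>u\<close> returns \<open>y\<close> up to a coboundary, by the homotopy on the Koszul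
      side.\<close>
    let ?f = "compose (carrier (P ?n)) y (g ?n)"
    have f: "?f \<in> cocycles A P d E ?n" by (rule T'(1)[OF yc])
    obtain c where c: "c \<in> bimod_hom A (bar n) E"
      and eq: "(\<lambda>x\<in>carrier (bar ?n). y (g ?n (u ?n x)) \<ominus>\<^bsub>E\<^esub> y x) = compose (carrier (bar ?n)) c (dbar n)"
      using T'(4)[OF yc] unfolding coboundaries_Suc by (rule bexE)
    have "\<Theta> ?f w = z w + delta n (Psi n c) w" for w
    proof (cases "w \<in> S ?n")
      case False
      then show ?thesis using 3[OF f] z0[OF False] by (cases w) (auto simp: delta_def)
    next
      case True
      obtain \<rho> \<gamma> where w: "w = (\<rho>, \<gamma>)" by (cases w)
      have \<rho>: "\<rho> \<in> AP Q I ?n" using True by (simp add: w S_pair)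
      let ?a = "y (g ?n (u ?n (gen \<rho>)))" and ?b = "y (gen \<rho>)"
        and ?c = "compose (carrier (bar ?n)) c (dbar n) (gen \<rho>)"
      have fy: "?f (u ?n (gen \<rho>)) = ?a" by (rule compose_eq[OF ug[OF \<rho>]])
      have a: "?a \<in> carrier A" using fA[OF f \<rho>] unfolding fy .
      have b: "?b \<in> carrier A" by (rule hom_gen_closed[OF y(1) \<rho>])
      have cc: "?c \<in> carrier A"
        by (rule hom_gen_closed[OF hom_compose[OF dbar_hom c bimodule_bar] \<rho>])
      have "?c \<oplus>\<^bsub>E\<^esub> ?b = (?a \<ominus>\<^bsub>E\<^esub> ?b) \<oplus>\<^bsub>E\<^esub> ?b"
        using fun_cong[OF eq, of "gen \<rho>"] gen_in_bar[OF \<rho>] by (simp only: restrict_apply')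
      also have "\<dots> = ?a"
      proof -
        interpret E: bimodule A E by (rule bimodule_regular)
        have "?a \<in> carrier E" "?b \<in> carrier E" using a b by (simp_all only: regular_simps)
        then show ?thesis by (simp add: a_minus_def E.V.M.a_assoc E.V.M.l_neg)
      qed
      finally have "?a = ?c \<oplus>\<^bsub>A\<^esub> ?b" unfolding regular_simps by (rule sym)
      then have "coef ?a \<gamma> = coef ?c \<gamma> + coef ?b \<gamma>" using coef_add[OF cc b] by simp
      moreover have "delta n (Psi n c) w = coef ?c \<gamma>"
        using Psi_delta[OF c, symmetric] True by (simp add: w Psi_def)
      moreover have "z w = coef ?b \<gamma>" using y(2) True by (auto simp: w Psi_def)
      moreover have "\<Theta> ?f w = coef ?a \<gamma>" using val[of ?f \<rho> \<gamma>] True fy by (simp only: w if_True)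
      ultimately show ?thesis by simp
    qed
    then have "\<Theta> ?f = (\<lambda>w. z w + delta n (Psi n c) w)" by (rule ext)
    then show ?thesis using f by (intro bexI[OF _ f] exI[of _ "Psi n c"]) (simp add: Psi_support)
  qed
  show ?thesis
  proof (rule exI[of _ \<Theta>], intro conjI)
    show "\<forall>f\<in>cocycles A P d E ?n. \<forall>g\<in>cocycles A P d E ?n.
        \<Theta> (\<lambda>x\<in>carrier (P ?n). f x \<oplus>\<^bsub>E\<^esub> g x) = (\<lambda>w. \<Theta> f w + \<Theta> g w)"
      by (intro ballI 1)
    show "\<forall>f\<in>cocycles A P d E ?n. \<forall>c. \<Theta> (\<lambda>x\<in>carrier (P ?n). c \<odot>\<^bsub>E\<^esub> f x) = (\<lambda>w. c * \<Theta> f w)"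
      by (intro ballI allI 2)
    show "\<forall>f\<in>cocycles A P d E ?n. (\<forall>w. w \<notin> S ?n \<longrightarrow> \<Theta> f w = 0) \<and> delta ?n (\<Theta> f) = (\<lambda>_. 0)"
      by (rule ballI, rule 3)
    show "\<forall>f\<in>cocycles A P d E ?n. f \<in> coboundaries A P d E ?n \<longleftrightarrow>
        (\<exists>c. (\<forall>w. w \<notin> S n \<longrightarrow> c w = 0) \<and> \<Theta> f = delta n c)"
      by (rule ballI, rule 4)
    show "\<forall>z. (\<forall>w. w \<notin> S ?n \<longrightarrow> z w = 0) \<and> delta ?n z = (\<lambda>_. 0) \<longrightarrow>
        (\<exists>f\<in>cocycles A P d E ?n. \<exists>c. (\<forall>w. w \<notin> S n \<longrightarrow> c w = 0) \<and> \<Theta> f = (\<lambda>w. z w + delta n c w))"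
    proof (intro allI impI, elim conjE)
      fix z assume a: "\<forall>w. w \<notin> S ?n \<longrightarrow> z w = 0" and dz: "delta ?n z = (\<lambda>_. 0)"
      show "\<exists>f\<in>cocycles A P d E ?n. \<exists>c. (\<forall>w. w \<notin> S n \<longrightarrow> c w = 0) \<and> \<Theta> f = (\<lambda>w. z w + delta n c w)"
        by (rule 5[OF _ dz]) (rule a[rule_format])
    qed
  qed
qed

end

section \<open>Dimensions by coordinates\<close>

text \<open>The map \<open>\<psi>\<close> identifies \<open>V\<close> with the functions on
  \<open>K\<close>; preimages of the unit vectors form a basis.\<close>

lemma dim_by_coordinates:
  fixes V :: "('k::field, 'x, 'z) module_scheme" and \<psi> :: "'x \<Rightarrow> 's \<Rightarrow> 'k"
  assumes vs: "vectorspace class_ring V" and K: "finite K"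
    and add: "\<And>x y. \<lbrakk>x \<in> carrier V; y \<in> carrier V\<rbrakk> \<Longrightarrow> \<psi> (x \<oplus>\<^bsub>V\<^esub> y) = (\<lambda>s. \<psi> x s + \<psi> y s)"
    and smult: "\<And>c x. x \<in> carrier V \<Longrightarrow> \<psi> (c \<odot>\<^bsub>V\<^esub> x) = (\<lambda>s. c * \<psi> x s)"
    and inj: "\<And>x y. \<lbrakk>x \<in> carrier V; y \<in> carrier V; \<psi> x = \<psi> y\<rbrakk> \<Longrightarrow> x = y"
    and supp: "\<And>x s. \<lbrakk>x \<in> carrier V; s \<notin> K\<rbrakk> \<Longrightarrow> \<psi> x s = 0"
    and surj: "\<And>k. k \<in> K \<Longrightarrow> \<exists>x\<in>carrier V. \<psi> x = basis_vec k"
  shows "kfin_dim V \<and> kdim V = card K"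
proof -
  interpret V: vectorspace class_ring V by fact
  have "\<forall>k\<in>K. \<exists>x. x \<in> carrier V \<and> \<psi> x = basis_vec k" using surj by blast
  then obtain g where g: "\<forall>k\<in>K. g k \<in> carrier V \<and> \<psi> (g k) = basis_vec k"
    by (drule_tac bchoice) (erule exE)
  then have gc: "\<And>k. k \<in> K \<Longrightarrow> g k \<in> carrier V" and gb: "\<And>k. k \<in> K \<Longrightarrow> \<psi> (g k) = basis_vec k" by simp_all
  have gi: "inj_on g K"
  proof (rule inj_onI)
    fix k l assume kl: "k \<in> K" "l \<in> K" "g k = g l"
    then have "basis_vec k = (basis_vec l :: _ \<Rightarrow> 'k)" using gb[of k] gb[of l] by simp
    from fun_cong[OF this, of k] show "k = l" by (simp add: basis_vec_def split: if_splits)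
  qed
  have \<psi>0: "\<psi> \<zero>\<^bsub>V\<^esub> = (\<lambda>_. 0)"
    using smult[of "\<zero>\<^bsub>V\<^esub>" 0] V.smult_l_null[of "\<zero>\<^bsub>V\<^esub>"] by simp
  have lc: "V.lincomb a (g ` L) \<in> carrier V \<and> \<psi> (V.lincomb a (g ` L)) = (\<lambda>s. if s \<in> L then a (g s) else 0)"
    if "L \<subseteq> K" for a L
  proof -
    have "finite L" using that K by (rule finite_subset)
    then show ?thesis using that
    proof (induction L rule: finite_induct)
      case empty
      then show ?case by (simp add: V.lincomb_def \<psi>0)
    next
      case (insert k L)
      have n: "g k \<notin> g ` L" using insert gi by (auto simp: inj_on_def)
      have sub: "g ` L \<subseteq> carrier V" using insert.prems gc by auto
      have k: "k \<in> K" "L \<subseteq> K" using insert.prems by auto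
      have m: "a (g k) \<odot>\<^bsub>V\<^esub> g k \<in> carrier V" using V.smult_closed[of "a (g k)" "g k"] gc[OF k(1)] by simp
      have "V.lincomb a (g ` insert k L) = a (g k) \<odot>\<^bsub>V\<^esub> g k \<oplus>\<^bsub>V\<^esub> V.lincomb a (g ` L)"
        using insert.hyps n sub gc[OF k(1)] by (simp add: V.lincomb_insert2)
      then show ?case using insert.IH[OF k(2)] m insert.hyps
        by (auto simp: add smult gc[OF k(1)] gb[OF k(1)] basis_vec_def fun_eq_iff)
    qed
  qed
  let ?A = "g ` K"
  have sub: "?A \<subseteq> carrier V" using gc by auto
  have fin: "finite ?A" using K by simp
  have gen: "V.span ?A = carrier V"
  proof
    show "V.span ?A \<subseteq> carrier V" using V.span_is_subset2[OF sub] .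
    show "carrier V \<subseteq> V.span ?A"
    proof
      fix x assume x: "x \<in> carrier V"
      define a where "a = (\<lambda>v. \<psi> x (the_inv_into K g v))"
      have "\<psi> (V.lincomb a ?A) = \<psi> x"
        using lc[of K a] supp[OF x] by (auto simp: a_def the_inv_into_f_f[OF gi] fun_eq_iff)
      then have "V.lincomb a ?A = x" using lc[of K a] x by (intro inj) auto
      then show "x \<in> V.span ?A" using fin V.finite_span[OF fin sub] by force
    qed
  qed
  have li: "V.lin_indpt ?A"
  proof
    assume "V.lin_dep ?A"
    then obtain a A' v where A': "finite A'" "A' \<subseteq> ?A" "V.lincomb a A' = \<zero>\<^bsub>V\<^esub>" "v \<in> A'" "a v \<noteq> 0"
      unfolding V.lin_dep_def by (auto simp: class_ring_simps)
    define L where "L = {k \<in> K. g k \<in> A'}"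
    have L: "A' = g ` L" "L \<subseteq> K" using A'(2) by (auto simp: L_def)
    obtain k where k: "k \<in> L" "v = g k" using A'(4) L by blast
    have "(\<lambda>s. if s \<in> L then a (g s) else 0) = (\<lambda>_. 0)" using lc[OF L(2), of a] A'(3) L(1) \<psi>0 by simp
    from fun_cong[OF this, of k] show False using k A'(5) by simp
  qed
  have "V.basis ?A" using li gen sub by (simp add: V.basis_def)
  then have "V.dim = card ?A" using V.dim_basis[OF fin] by simp
  moreover have "V.fin_dim" unfolding V.fin_dim_def using fin sub gen by blast
  ultimately show ?thesis using card_image[OF gi] by simp
qed

text \<open>By \<open>ker\<close> the set \<open>W\<close> is the kernel of \<open>\<phi>\<close>,
  so it is a subspace and \<open>\<phi>\<close> induces injective coordinates on the quotient, read
  off at any representative of a coset.\<close>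

lemma dim_kquot:
  fixes V :: "('k::field, 'x, 'z) module_scheme" and \<phi> :: "'x \<Rightarrow> 's \<Rightarrow> 'k"
  assumes vs: "vectorspace class_ring V" and K: "finite K" and W: "W \<subseteq> carrier V"
    and add: "\<And>x y. \<lbrakk>x \<in> carrier V; y \<in> carrier V\<rbrakk> \<Longrightarrow> \<phi> (x \<oplus>\<^bsub>V\<^esub> y) = (\<lambda>s. \<phi> x s + \<phi> y s)"
    and smult: "\<And>c x. x \<in> carrier V \<Longrightarrow> \<phi> (c \<odot>\<^bsub>V\<^esub> x) = (\<lambda>s. c * \<phi> x s)"
    and ker: "\<And>x. x \<in> carrier V \<Longrightarrow> x \<in> W \<longleftrightarrow> \<phi> x = (\<lambda>_. 0)"
    and supp: "\<And>x s. \<lbrakk>x \<in> carrier V; s \<notin> K\<rbrakk> \<Longrightarrow> \<phi> x s = 0"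
    and surj: "\<And>k. k \<in> K \<Longrightarrow> \<exists>x\<in>carrier V. \<phi> x = basis_vec k"
  shows "kfin_dim (kquot V W) \<and> kdim (kquot V W) = card K"
proof -
  interpret V: vectorspace class_ring V by fact
  have smc: "c \<odot>\<^bsub>V\<^esub> x \<in> carrier V" if "x \<in> carrier V" for c x using V.smult_closed[of c x] that by simp
  have neg: "\<phi> (\<ominus>\<^bsub>V\<^esub> x) = (\<lambda>s. - \<phi> x s)" if "x \<in> carrier V" for x
    using smult[OF that, of "-1"] V.smult_l_minus[of 1 x] that V.smult_one[of x]
      by (simp add: class_ring_simps)
  have \<phi>0: "\<phi> \<zero>\<^bsub>V\<^esub> = (\<lambda>_. 0)"
    using smult[of "\<zero>\<^bsub>V\<^esub>" 0] V.smult_l_null[of "\<zero>\<^bsub>V\<^esub>"] by simp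
  have sg: "subgroup W (add_monoid V)"
  proof
    show "W \<subseteq> carrier (add_monoid V)" using W by simp
    fix x assume x: "x \<in> W"
    have xc: "x \<in> carrier V" using x W by blast
    then have "\<ominus>\<^bsub>V\<^esub> x \<in> W" using ker[of "\<ominus>\<^bsub>V\<^esub> x"] ker[of x] neg[OF xc] x by simp
    then show "inv\<^bsub>add_monoid V\<^esub> x \<in> W" by (simp add: a_inv_def)
    fix y assume y: "y \<in> W"
    have yc: "y \<in> carrier V" using y W by blast
    have "x \<oplus>\<^bsub>V\<^esub> y \<in> W" using ker[of "x \<oplus>\<^bsub>V\<^esub> y"] ker[OF xc] ker[OF yc] add[OF xc yc] x y xc yc by simp
    then show "x \<otimes>\<^bsub>add_monoid V\<^esub> y \<in> W" by simp
  next
    show "\<one>\<^bsub>add_monoid V\<^esub> \<in> W" using ker[of "\<zero>\<^bsub>V\<^esub>"] \<phi>0 by simp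
  qed
  interpret W: abelian_subgroup W V
    by (rule abelian_subgroupI3) (simp_all add: additive_subgroup_def sg V.M.abelian_group_axioms)
  let ?c = "\<lambda>x. W +>\<^bsub>V\<^esub> x"
  have ceq: "?c x = ?c y \<longleftrightarrow> \<phi> x = \<phi> y" if "x \<in> carrier V" "y \<in> carrier V" for x y
  proof -
    have d: "x \<ominus>\<^bsub>V\<^esub> y \<in> carrier V" using that by simp
    have "\<phi> (x \<ominus>\<^bsub>V\<^esub> y) = (\<lambda>s. \<phi> x s - \<phi> y s)" using that by (simp add: a_minus_def add neg)
    then have 1: "x \<ominus>\<^bsub>V\<^esub> y \<in> W \<longleftrightarrow> \<phi> x = \<phi> y" using ker[OF d] by (auto simp: fun_eq_iff)
    have "?c x = ?c y \<longleftrightarrow> x \<ominus>\<^bsub>V\<^esub> y \<in> W"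
    proof
      assume eq: "?c x = ?c y"
      have "x \<in> ?c y" using W.a_rcos_self[OF that(1)] eq by simp
      then obtain w where w: "w \<in> W" "x = w \<oplus>\<^bsub>V\<^esub> y" by (auto simp: a_r_coset_def r_coset_def)
      have "w \<in> carrier V" using w W by blast
      then show "x \<ominus>\<^bsub>V\<^esub> y \<in> W" using w that by (simp add: a_minus_def V.M.a_assoc V.M.r_neg)
    next
      assume w: "x \<ominus>\<^bsub>V\<^esub> y \<in> W"
      have "x = (x \<ominus>\<^bsub>V\<^esub> y) \<oplus>\<^bsub>V\<^esub> y" using that by (simp add: a_minus_def V.M.a_assoc V.M.l_neg)
      then have "x \<in> ?c y" using w by (auto simp: a_r_coset_def r_coset_def)
      then show "?c x = ?c y" using V.M.a_repr_independence[OF _ that(2) sg] by simp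
    qed
    then show ?thesis using 1 by simp
  qed
  have cA: "carrier (kquot V W) = ?c ` carrier V" and c0: "\<zero>\<^bsub>kquot V W\<^esub> = W"
    and cadd: "add (kquot V W) = set_add V"
    and csm: "smult (kquot V W) = (\<lambda>c X. \<Union>x\<in>X. W +>\<^bsub>V\<^esub> (c \<odot>\<^bsub>V\<^esub> x))"
    by (auto simp: kquot_def ring.defs module.defs FactRing_def A_RCOSETS_def')
  have qadd: "?c x \<oplus>\<^bsub>kquot V W\<^esub> ?c y = ?c (x \<oplus>\<^bsub>V\<^esub> y)" if "x \<in> carrier V" "y \<in> carrier V" for x y
    unfolding cadd by (rule W.a_rcos_sum[OF that])
  have qzero: "\<zero>\<^bsub>kquot V W\<^esub> = ?c \<zero>\<^bsub>V\<^esub>"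
    unfolding c0 using V.M.a_coset_add_zero[OF W] by simp
  have qsm: "c \<odot>\<^bsub>kquot V W\<^esub> ?c x = ?c (c \<odot>\<^bsub>V\<^esub> x)" if "x \<in> carrier V" for c x
  proof -
    have "?c (c \<odot>\<^bsub>V\<^esub> y) = ?c (c \<odot>\<^bsub>V\<^esub> x)" if y: "y \<in> ?c x" for y
    proof -
      have yc: "y \<in> carrier V" using W.a_elemrcos_carrier[OF \<open>x \<in> carrier V\<close> y] .
      have "?c x = ?c y" using V.M.a_repr_independence[OF y \<open>x \<in> carrier V\<close> sg] by simp
      then have "\<phi> x = \<phi> y" using ceq[OF \<open>x \<in> carrier V\<close> yc] by simp
      then show ?thesis using ceq[OF smc[OF yc] smc[OF \<open>x \<in> carrier V\<close>]] smult yc \<open>x \<in> carrier V\<close> by simp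
    qed
    then have "(\<Union>y\<in>?c x. ?c (c \<odot>\<^bsub>V\<^esub> y)) = (\<Union>y\<in>?c x. ?c (c \<odot>\<^bsub>V\<^esub> x))" by (intro SUP_cong refl)
    moreover have "x \<in> ?c x" by (rule W.a_rcos_self[OF that])
    ultimately show ?thesis unfolding csm by auto
  qed
  have rep: "\<exists>x\<in>carrier V. X = ?c x" if "X \<in> carrier (kquot V W)" for X using that unfolding cA by blast
  have cc: "?c x \<in> carrier (kquot V W)" if "x \<in> carrier V" for x using that unfolding cA by blast
  have vsq: "vectorspace class_ring (kquot V W)"
  proof (rule vectorspace_class_ringI)
    show "\<zero>\<^bsub>kquot V W\<^esub> \<in> carrier (kquot V W)" unfolding qzero by (rule cc) simp
    fix c c' :: 'k and X Y Z
    assume X: "X \<in> carrier (kquot V W)"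
    obtain x where x: "x \<in> carrier V" "X = ?c x" using rep[OF X] by blast
    show "c \<odot>\<^bsub>kquot V W\<^esub> X \<in> carrier (kquot V W)" using x qsm[OF x(1)] cc[OF smc] by simp
    show "(c + c') \<odot>\<^bsub>kquot V W\<^esub> X = c \<odot>\<^bsub>kquot V W\<^esub> X \<oplus>\<^bsub>kquot V W\<^esub> c' \<odot>\<^bsub>kquot V W\<^esub> X"
      using x V.smult_l_distr[of c c' x] by (simp add: qsm qadd smc)
    show "(c * c') \<odot>\<^bsub>kquot V W\<^esub> X = c \<odot>\<^bsub>kquot V W\<^esub> (c' \<odot>\<^bsub>kquot V W\<^esub> X)"
      using x V.smult_assoc1[of c c' x] by (simp add: qsm smc)
    show "1 \<odot>\<^bsub>kquot V W\<^esub> X = X" using x V.smult_one[of x] by (simp add: qsm)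
    show "0 \<odot>\<^bsub>kquot V W\<^esub> X = \<zero>\<^bsub>kquot V W\<^esub>" using x V.smult_l_null[of x] by (simp add: qsm qzero)
    show "\<zero>\<^bsub>kquot V W\<^esub> \<oplus>\<^bsub>kquot V W\<^esub> X = X" using x by (simp add: qzero qadd)
    assume Y: "Y \<in> carrier (kquot V W)"
    obtain y where y: "y \<in> carrier V" "Y = ?c y" using rep[OF Y] by blast
    show "X \<oplus>\<^bsub>kquot V W\<^esub> Y \<in> carrier (kquot V W)" using x y by (simp add: qadd cc)
    show "X \<oplus>\<^bsub>kquot V W\<^esub> Y = Y \<oplus>\<^bsub>kquot V W\<^esub> X" using x y by (simp add: qadd V.M.a_comm)
    show "c \<odot>\<^bsub>kquot V W\<^esub> (X \<oplus>\<^bsub>kquot V W\<^esub> Y) = c \<odot>\<^bsub>kquot V W\<^esub> X \<oplus>\<^bsub>kquot V W\<^esub> c \<odot>\<^bsub>kquot V W\<^esub> Y"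
      using x y V.smult_r_distr[of c x y] by (simp add: qsm qadd smc)
    assume Z: "Z \<in> carrier (kquot V W)"
    obtain z where z: "z \<in> carrier V" "Z = ?c z" using rep[OF Z] by blast
    show "X \<oplus>\<^bsub>kquot V W\<^esub> Y \<oplus>\<^bsub>kquot V W\<^esub> Z = X \<oplus>\<^bsub>kquot V W\<^esub> (Y \<oplus>\<^bsub>kquot V W\<^esub> Z)"
      using x y z by (simp add: qadd V.M.a_assoc)
  qed
  define \<psi> where "\<psi> X = \<phi> (SOME x. x \<in> carrier V \<and> X = ?c x)" for X
  have \<psi>: "\<psi> (?c x) = \<phi> x" if x: "x \<in> carrier V" for x
  proof -
    have "\<exists>y. y \<in> carrier V \<and> ?c x = ?c y" using x by blast
    from someI_ex[OF this] have y: "(SOME y. y \<in> carrier V \<and> ?c x = ?c y) \<in> carrier V"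
      "?c x = ?c (SOME y. y \<in> carrier V \<and> ?c x = ?c y)" by auto
    then show ?thesis using ceq[OF x y(1)] by (simp add: \<psi>_def)
  qed
  show ?thesis
  proof (rule dim_by_coordinates[OF vsq K, of \<psi>])
    fix X Y assume X: "X \<in> carrier (kquot V W)"
    obtain x where x: "x \<in> carrier V" "X = ?c x" using rep[OF X] by blast
    show "\<psi> (c \<odot>\<^bsub>kquot V W\<^esub> X) = (\<lambda>s. c * \<psi> X s)" for c using x by (simp add: qsm \<psi> smc smult)
    show "\<psi> X s = 0" if "s \<notin> K" for s using x that by (simp add: \<psi> supp)
    assume Y: "Y \<in> carrier (kquot V W)"
    obtain y where y: "y \<in> carrier V" "Y = ?c y" using rep[OF Y] by blast
    show "\<psi> (X \<oplus>\<^bsub>kquot V W\<^esub> Y) = (\<lambda>s. \<psi> X s + \<psi> Y s)" using x y by (simp add: qadd \<psi> add)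
    show "X = Y" if "\<psi> X = \<psi> Y" using x y that ceq[OF x(1) y(1)] by (simp add: \<psi>)
  next
    fix k assume "k \<in> K"
    then obtain x where x: "x \<in> carrier V" "\<phi> x = basis_vec k" using surj by blast
    then show "\<exists>X\<in>carrier (kquot V W). \<psi> X = basis_vec k" using cc[OF x(1)] \<psi>[OF x(1)]
      by (intro bexI[of _ "?c x"]) simp_all
  qed
qed

section \<open>Linear algebra in spaces of functions\<close>

interpretation FV: vector_space "\<lambda>c (f :: 's \<Rightarrow> 'k::field) s. c * f s"
  by unfold_locales (auto simp: fun_eq_iff algebra_simps)

text \<open>
  \<open>KS\<close> and \<open>KT\<close> are sets of coordinates on the kernel of \<open>\<delta>\<close> and on \<open>Z\<close>; hence the image of \<open>\<delta>\<close>
  has dimension \<open>card S - card KS\<close>, and the index set \<open>K\<close> is a basis of a complement of it in \<open>Z\<close>.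
\<close>

lemma quotient_coordinates:
  fixes \<delta> :: "('s \<Rightarrow> 'k::field) \<Rightarrow> ('t \<Rightarrow> 'k)"
  assumes fS: "finite S" and fT: "finite KT" and KS: "KS \<subseteq> S"
    and dadd: "\<And>c c'. \<delta> (\<lambda>s. c s + c' s) = (\<lambda>t. \<delta> c t + \<delta> c' t)"
    and dsm: "\<And>a c. \<delta> (\<lambda>s. a * c s) = (\<lambda>t. a * \<delta> c t)"
    and KS1: "\<And>c. \<lbrakk>\<And>s. s \<notin> S \<Longrightarrow> c s = 0; \<delta> c = (\<lambda>_. 0); \<And>s. s \<in> KS \<Longrightarrow> c s = 0\<rbrakk> \<Longrightarrow> c = (\<lambda>_. 0)"
    and KS2: "\<And>v. \<exists>c. (\<forall>s. s \<notin> S \<longrightarrow> c s = 0) \<and> \<delta> c = (\<lambda>_. 0) \<and> (\<forall>s\<in>KS. c s = v s)"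
    and Z0: "(\<lambda>_. 0) \<in> Z" and Zadd: "\<And>x y. \<lbrakk>x \<in> Z; y \<in> Z\<rbrakk> \<Longrightarrow> (\<lambda>t. x t + y t) \<in> Z"
    and Zsm: "\<And>a x. x \<in> Z \<Longrightarrow> (\<lambda>t. a * x t) \<in> Z"
    and dZ: "\<And>c. (\<And>s. s \<notin> S \<Longrightarrow> c s = 0) \<Longrightarrow> \<delta> c \<in> Z"
    and KT1: "\<And>z. \<lbrakk>z \<in> Z; \<And>t. t \<in> KT \<Longrightarrow> z t = 0\<rbrakk> \<Longrightarrow> z = (\<lambda>_. 0)"
    and KT2: "\<And>v. \<exists>z\<in>Z. \<forall>t\<in>KT. z t = v t"
  shows "\<exists>(K :: ('t \<Rightarrow> 'k) set) \<psi>. finite K \<and> card K + card S = card KT + card KS \<and>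
     (\<forall>x\<in>Z. \<forall>y\<in>Z. \<psi> (\<lambda>t. x t + y t) = (\<lambda>k. \<psi> x k + \<psi> y k)) \<and>
     (\<forall>a. \<forall>x\<in>Z. \<psi> (\<lambda>t. a * x t) = (\<lambda>k. a * \<psi> x k)) \<and>
     (\<forall>x\<in>Z. \<forall>k. k \<notin> K \<longrightarrow> \<psi> x k = 0) \<and>
     (\<forall>k\<in>K. k \<in> Z \<and> \<psi> k = basis_vec k) \<and>
     (\<forall>x\<in>Z. \<psi> x = (\<lambda>_. 0) \<longleftrightarrow> (\<exists>c. (\<forall>s. s \<notin> S \<longrightarrow> c s = 0) \<and> x = \<delta> c))"
proof -
  have fKS: "finite KS" using KS fS by (rule finite_subset)
  have sub: "FV.subspace Z"
    unfolding FV.subspace_def using Z0 Zadd Zsm by (auto simp: zero_fun_def plus_fun_def)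
  \<comment> \<open>The basis of \<open>Z\<close> dual to the coordinates in
    \<open>KT\<close>.\<close>
  define bZ where "bZ t = (SOME z. z \<in> Z \<and> (\<forall>t'\<in>KT. z t' = basis_vec t t'))" for t
  have bZ: "bZ t \<in> Z" "\<And>t'. t' \<in> KT \<Longrightarrow> bZ t t' = basis_vec t t'" for t
  proof -
    have "\<exists>z. z \<in> Z \<and> (\<forall>t'\<in>KT. z t' = basis_vec t t')" using KT2[of "basis_vec t"] by blast
    from someI_ex[OF this, folded bZ_def] show "bZ t \<in> Z" "\<And>t'. t' \<in> KT \<Longrightarrow> bZ t t' = basis_vec t t'" by auto
  qed
  have ext0: "x = y" if "x \<in> Z" "y \<in> Z" "\<And>t. t \<in> KT \<Longrightarrow> x t = y t" for x y
  proof -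
    have "(\<lambda>t. x t + (-1) * y t) = (\<lambda>_. 0)" using that by (intro KT1 Zadd Zsm) auto
    then show ?thesis by (auto simp: fun_eq_iff)
  qed
  have sum_eval: "(\<Sum>t\<in>L. (\<lambda>s. a t * f t s)) s = (\<Sum>t\<in>L. a t * f t s)" for L :: "'u set" and a
    and f :: "'u \<Rightarrow> 't \<Rightarrow> 'k" and s
    by (induction L rule: infinite_finite_induct) (auto simp: zero_fun_def plus_fun_def)
  have Zsum: "(\<Sum>t\<in>L. (\<lambda>s. a t * f t s)) \<in> Z" if "\<And>t. t \<in> L \<Longrightarrow> f t \<in> Z" for L :: "'u set" and a
    and f :: "'u \<Rightarrow> 't \<Rightarrow> 'k"
    using FV.subspace_sum[OF sub, of L "\<lambda>t s. a t * f t s"] Zsm that by blast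
  have inj_indep: "inj_on f L \<and> FV.independent (f ` L)"
    if "finite L" "\<And>a. (\<Sum>t\<in>L. (\<lambda>s. a t * f t s)) = (\<lambda>_. 0) \<Longrightarrow> \<forall>t\<in>L. a t = 0" for L :: "'u set"
      and f :: "'u \<Rightarrow> 't \<Rightarrow> 'k"
  proof -
    have inj: "inj_on f L"
    proof (rule inj_onI, rule ccontr)
      fix x y assume xy: "x \<in> L" "y \<in> L" "f x = f y" "x \<noteq> y"
      define a where "a t = (if t = x then 1 else if t = y then -1 else 0 :: 'k)" for t
      have "(\<Sum>t\<in>L. (\<lambda>s. a t * f t s)) = (\<lambda>_. 0)"
      proof
        fix s
        have "(\<Sum>t\<in>L. a t * f t s) = (\<Sum>t\<in>{x, y}. a t * f t s)"
          using xy that(1) by (intro sum.mono_neutral_right) (auto simp: a_def)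
        also have "\<dots> = 0" using xy by (simp add: a_def)
        finally show "(\<Sum>t\<in>L. (\<lambda>s. a t * f t s)) s = 0" by (simp add: sum_eval)
      qed
      from that(2)[OF this] xy(1) show False by (auto simp: a_def)
    qed
    have "FV.independent (f ` L)"
      unfolding FV.independent_explicit_module
    proof (intro allI impI)
      fix t u v assume t: "finite t" "t \<subseteq> f ` L" and s0: "(\<Sum>v\<in>t. (\<lambda>s. u v * v s)) = 0" and v: "v \<in> t"
      obtain M where M: "M \<subseteq> L" "t = f ` M" using t(2) by (auto simp: subset_image_iff)
      define a where "a x = (if x \<in> M then u (f x) else 0)" for x
      have "(\<Sum>x\<in>L. (\<lambda>s. a x * f x s)) = (\<Sum>x\<in>M. (\<lambda>s. a x * f x s))"
        using M that(1) by (intro sum.mono_neutral_right) (auto simp: a_def zero_fun_def)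
      also have "\<dots> = (\<Sum>x\<in>M. (\<lambda>s. u (f x) * f x s))" by (intro sum.cong refl) (simp add: a_def)
      also have "\<dots> = (\<Sum>v\<in>t. (\<lambda>s. u v * v s))"
        unfolding M(2) by (subst sum.reindex) (auto intro: inj_on_subset[OF inj M(1)])
      finally have "(\<Sum>x\<in>L. (\<lambda>s. a x * f x s)) = (\<lambda>_. 0)" unfolding s0 zero_fun_def .
      then have a0: "\<forall>x\<in>L. a x = 0" by (rule that(2))
      obtain x where "x \<in> M" "v = f x" using v M(2) by blast
      have "a x = 0" using a0 M(1) \<open>x \<in> M\<close> by blast
      moreover have "a x = u v" using \<open>x \<in> M\<close> \<open>v = f x\<close> by (simp add: a_def)
      ultimately show "u v = 0" by simp
    qed
    then show ?thesis using inj by blast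
  qed
  have Zb: "inj_on bZ KT \<and> FV.independent (bZ ` KT)"
  proof (rule inj_indep[OF fT])
    fix a assume z: "(\<Sum>t\<in>KT. (\<lambda>s. a t * bZ t s)) = (\<lambda>_. 0)"
    have "(\<Sum>t\<in>KT. a t * bZ t t') = a t'" if "t' \<in> KT" for t'
    proof -
      have "(\<Sum>t\<in>KT. a t * bZ t t') = (\<Sum>t\<in>KT. if t = t' then a t' else 0)"
        using that by (intro sum.cong refl) (simp add: bZ(2) basis_vec_def)
      then show ?thesis using that fT by simp
    qed
    then show "\<forall>t\<in>KT. a t = 0" using fun_cong[OF z] by (simp add: sum_eval)
  qed
  have Zspan: "Z \<subseteq> FV.span (bZ ` KT)"
  proof
    fix z assume z: "z \<in> Z"
    have "z = (\<Sum>t\<in>KT. (\<lambda>s. z t * bZ t s))"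
    proof (rule ext0[OF z Zsum[OF bZ(1)]])
      fix t' assume t': "t' \<in> KT"
      have "(\<Sum>t\<in>KT. z t * bZ t t') = (\<Sum>t\<in>KT. if t = t' then z t' else 0)"
        using t' by (intro sum.cong refl) (simp add: bZ(2) basis_vec_def)
      then show "z t' = (\<Sum>t\<in>KT. (\<lambda>s. z t * bZ t s)) t'" using t' fT by (simp add: sum_eval)
    qed
    also have "\<dots> \<in> FV.span (bZ ` KT)" by (intro FV.span_sum FV.span_scale FV.span_base) simp
    finally show "z \<in> FV.span (bZ ` KT)" .
  qed
  \<comment> \<open>Modulo the kernel every function can be made to vanish on \<open>KS\<close>, so
    the images of the unit vectors at the remaining places form a basis of the image of
    \<open>\<delta>\<close>.\<close>
  define J where "J = S - KS"
  have fJ: "finite J" using fS by (simp add: J_def)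
  define bB where "bB s = \<delta> (basis_vec s)" for s
  have d0: "\<delta> (\<lambda>_. 0) = (\<lambda>_. 0)" using dsm[of 0 "\<lambda>_. 0"] by simp
  have dsum: "\<delta> (\<lambda>x. \<Sum>s\<in>L. a s * basis_vec s x) = (\<Sum>s\<in>L. (\<lambda>t. a s * bB s t))" for L a
  proof (induction L rule: infinite_finite_induct)
    case (insert s L)
    have "\<delta> (\<lambda>x. \<Sum>s\<in>insert s L. a s * basis_vec s x) = \<delta> (\<lambda>x. a s * basis_vec s x
        + (\<Sum>s\<in>L. a s * basis_vec s x))"
      using insert.hyps by simp
    also have "\<dots> = (\<lambda>t. a s * bB s t + (\<Sum>s\<in>L. (\<lambda>t. a s * bB s t)) t)"
      unfolding dadd dsm insert.IH bB_def ..
    finally show ?case using insert.hyps by (simp add: plus_fun_def)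
  qed (simp_all add: d0 zero_fun_def)
  have expand: "(\<Sum>s\<in>L. c s * basis_vec s x) = (if x \<in> L then c x else 0)" if "finite L" for L
    and c :: "'s \<Rightarrow> 'k" and x
  proof -
    have "(\<Sum>s\<in>L. c s * basis_vec s x) = (\<Sum>s\<in>L. if s = x then c x else 0)"
      by (intro sum.cong refl) (simp add: basis_vec_def)
    then show ?thesis using that by simp
  qed
  have Bb: "inj_on bB J \<and> FV.independent (bB ` J)"
  proof (rule inj_indep[OF fJ])
    fix a assume z: "(\<Sum>s\<in>J. (\<lambda>t. a s * bB s t)) = (\<lambda>_. 0)"
    define c where "c x = (\<Sum>s\<in>J. a s * basis_vec s x)" for x
    have cx: "c x = (if x \<in> J then a x else 0)" for x unfolding c_def by (rule expand[OF fJ])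
    have "c = (\<lambda>_. 0)"
    proof (rule KS1)
      show "\<delta> c = (\<lambda>_. 0)" unfolding c_def using dsum z by simp
    qed (simp_all add: cx J_def)
    then have "c s = 0" for s by simp
    then show "\<forall>s\<in>J. a s = 0" unfolding cx by metis
  qed
  have BZ: "bB ` J \<subseteq> Z" unfolding bB_def by (auto intro!: dZ simp: basis_vec_def J_def)
  have Bspan: "x \<in> FV.span (bB ` J) \<longleftrightarrow> (\<exists>c. (\<forall>s. s \<notin> S \<longrightarrow> c s = 0) \<and> x = \<delta> c)" for x
  proof
    assume "x \<in> FV.span (bB ` J)"
    then show "\<exists>c. (\<forall>s. s \<notin> S \<longrightarrow> c s = 0) \<and> x = \<delta> c"
    proof (induction rule: FV.span_induct_alt)
      case base
      then show ?case using d0 by (intro exI[of _ "\<lambda>_. 0"]) (simp add: zero_fun_def)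
    next
      case (step a b y)
      then obtain s c where s: "s \<in> J" "b = bB s" and c: "\<forall>s. s \<notin> S \<longrightarrow> c s = 0" "y = \<delta> c" by blast
      have "\<delta> (\<lambda>x. a * basis_vec s x + c x) = (\<lambda>t. a * b t) + y"
        unfolding dadd dsm s(2) c(2) bB_def plus_fun_def ..
      then show ?case using s(1) c(1)
        by (intro exI[of _ "\<lambda>x. a * basis_vec s x + c x"]) (auto simp: basis_vec_def J_def)
    qed
  next
    assume "\<exists>c. (\<forall>s. s \<notin> S \<longrightarrow> c s = 0) \<and> x = \<delta> c"
    then obtain c where c: "\<And>s. s \<notin> S \<Longrightarrow> c s = 0" "x = \<delta> c" by blast
    obtain c' where c': "\<And>s. s \<notin> S \<Longrightarrow> c' s = 0" "\<delta> c' = (\<lambda>_. 0)" "\<And>s. s \<in> KS \<Longrightarrow> c' s = c s"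
      using KS2[of c] by blast
    \<comment> \<open>Subtracting the kernel element that agrees with \<open>c\<close> on
      \<open>KS\<close> leaves the image unchanged and moves the support into
      \<open>J\<close>.\<close>
    define c2 where "c2 s = c s + (-1) * c' s" for s
    have "\<delta> c2 = x" unfolding c2_def dadd dsm c'(2) using c(2) by simp
    moreover have "c2 = (\<lambda>x. \<Sum>s\<in>J. c2 s * basis_vec s x)"
    proof
      fix x
      show "c2 x = (\<Sum>s\<in>J. c2 s * basis_vec s x)"
        unfolding expand[OF fJ] using c(1)[of x] c'(1,3)[of x] by (auto simp: c2_def J_def)
    qed
    ultimately have "x = (\<Sum>s\<in>J. (\<lambda>t. c2 s * bB s t))" using dsum[of c2 J] by simp
    also have "\<dots> \<in> FV.span (bB ` J)" by (intro FV.span_sum FV.span_scale FV.span_base imageI)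
    finally show "x \<in> FV.span (bB ` J)" .
  qed
  \<comment> \<open>The basis of the image is completed to a basis \<open>B\<close> of
    \<open>Z\<close>. The added vectors form \<open>K\<close>, which is why the index set consists
    of functions; the coordinates \<open>\<psi>\<close> are the coefficients at them.\<close>
  obtain B where B: "bB ` J \<subseteq> B" "B \<subseteq> Z" "FV.independent B" "Z \<subseteq> FV.span B"
    using FV.maximal_independent_subset_extend[OF BZ] Bb by blast
  have spans: "FV.span B = Z" "FV.span (bZ ` KT) = Z"
  proof -
    have "bZ ` KT \<subseteq> Z" using bZ(1) by blast
    then have "FV.span B \<subseteq> Z" "FV.span (bZ ` KT) \<subseteq> Z"
      by (rule_tac FV.span_minimal[OF B(2) sub], rule_tac FV.span_minimal[OF _ sub])
    then show "FV.span B = Z" "FV.span (bZ ` KT) = Z" using B(4) Zspan by simp_all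
  qed
  have finB: "finite B"
  proof -
    obtain f where "bij_betw f (bZ ` KT) B"
      using FV.bij_if_span_eq_span_bases[OF conjunct2[OF Zb] B(3)] spans by auto
    then show ?thesis using fT bij_betw_finite by blast
  qed
  have cardB: "card B = card KT"
  proof -
    obtain f where "bij_betw f (bZ ` KT) B"
      using FV.bij_if_span_eq_span_bases[OF conjunct2[OF Zb] B(3)] spans by auto
    then show ?thesis using bij_betw_same_card card_image[OF conjunct1[OF Zb]] by fastforce
  qed
  define K where "K = B - bB ` J"
  define \<psi> where "\<psi> x = (\<lambda>k. if k \<in> K then FV.representation B x k else 0)" for x
  have inspan: "x \<in> FV.span B" if "x \<in> Z" for x using that spans by simp
  have card: "card K + card S = card KT + card KS"
  proof -
    have "card K = card B - card (bB ` J)" unfolding K_def using B(1) finB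
      by (meson card_Diff_subset finite_subset)
    moreover have "card (bB ` J) = card J" using Bb by (simp add: card_image)
    moreover have "card (bB ` J) \<le> card B" using B(1) finB by (rule card_mono[rotated])
    moreover have "card J = card S - card KS" unfolding J_def by (rule card_Diff_subset[OF fKS KS])
    moreover have "card KS \<le> card S" by (rule card_mono[OF fS KS])
    ultimately show ?thesis using cardB by arith
  qed
  have ker: "\<psi> x = (\<lambda>_. 0) \<longleftrightarrow> x \<in> FV.span (bB ` J)" if x: "x \<in> Z" for x
  proof
    assume z: "\<psi> x = (\<lambda>_. 0)"
    have "x = (\<Sum>b\<in>B. (\<lambda>s. FV.representation B x b * b s))"
      using FV.sum_representation_eq[OF B(3) inspan[OF x] finB subset_refl] by simp
    also have "\<dots> \<in> FV.span (bB ` J)"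
    proof (rule FV.span_sum)
      fix b assume b: "b \<in> B"
      show "(\<lambda>s. FV.representation B x b * b s) \<in> FV.span (bB ` J)"
      proof (cases "b \<in> K")
        case True
        then have "FV.representation B x b = 0" using fun_cong[OF z, of b] by (simp add: \<psi>_def)
        then show ?thesis using FV.span_zero by (simp add: zero_fun_def)
      next
        case False
        then have "b \<in> bB ` J" using b by (simp add: K_def)
        then show ?thesis by (intro FV.span_scale FV.span_base)
      qed
    qed
    finally show "x \<in> FV.span (bB ` J)" .
  next
    assume "x \<in> FV.span (bB ` J)"
    then have "FV.representation B x = FV.representation (bB ` J) x"
      using FV.representation_extend[OF B(3) _ B(1)] by blast
    then have "FV.representation B x k = 0" if "k \<in> K" for k
      using FV.representation_ne_zero[of "bB ` J" x k] that by (auto simp: K_def)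
    then show "\<psi> x = (\<lambda>_. 0)" by (auto simp: \<psi>_def)
  qed
  show ?thesis
  proof (intro exI[of _ K] exI[of _ \<psi>] conjI ballI allI impI)
    show "finite K" using finB by (simp add: K_def)
    show "card K + card S = card KT + card KS" by (rule card)
  next
    fix x y assume "x \<in> Z" "y \<in> Z"
    then show "\<psi> (\<lambda>t. x t + y t) = (\<lambda>k. \<psi> x k + \<psi> y k)"
      using FV.representation_add[OF B(3) inspan inspan, of y x] by (auto simp: \<psi>_def plus_fun_def)
  next
    fix a x assume "x \<in> Z"
    then show "\<psi> (\<lambda>t. a * x t) = (\<lambda>k. a * \<psi> x k)"
      using FV.representation_scale[OF B(3) inspan, of x a] by (auto simp: \<psi>_def)
  next
    fix x k assume "k \<notin> K" then show "\<psi> x k = 0" by (simp add: \<psi>_def)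
  next
    fix k assume k: "k \<in> K"
    then show "k \<in> Z" using B(2) by (auto simp: K_def)
    show "\<psi> k = basis_vec k"
      using k FV.representation_basis[OF B(3), of k] by (auto simp: \<psi>_def K_def basis_vec_def)
  next
    fix x assume "x \<in> Z"
    then show "\<psi> x = (\<lambda>_. 0) \<longleftrightarrow> (\<exists>c. (\<forall>s. s \<notin> S \<longrightarrow> c s = 0) \<and> x = \<delta> c)"
      using ker Bspan by simp
  qed
qed

lemma free_space_simps:
  "x \<oplus>\<^bsub>free_space S\<^esub> y = (\<lambda>s. x s + y s)" "a \<odot>\<^bsub>free_space S\<^esub> x = (\<lambda>s. a * x s)" "\<zero>\<^bsub>free_space S\<^esub> = (\<lambda>_. 0)"
  by (simp_all add: free_space_def)

lemma carrier_free_space: "carrier (free_space S) = {f. finite {s. f s \<noteq> 0} \<and> {s. f s \<noteq> 0} \<subseteq> S}"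
  by (simp add: free_space_def)

lemma vectorspace_free_space: "vectorspace class_ring (free_space S :: ('k::field, 's \<Rightarrow> 'k) module)"
proof (rule vectorspace_class_ringI)
  let ?V = "free_space S :: ('k, 's \<Rightarrow> 'k) module"
  show "x \<oplus>\<^bsub>?V\<^esub> y \<in> carrier ?V" if h: "x \<in> carrier ?V" "y \<in> carrier ?V" for x y
  proof -
    have "{s. x s + y s \<noteq> 0} \<subseteq> {s. x s \<noteq> 0} \<union> {s. y s \<noteq> 0}" by auto
    moreover have "finite ({s. x s \<noteq> 0} \<union> {s. y s \<noteq> 0})" using h by (simp add: carrier_free_space)
    ultimately have "finite {s. x s + y s \<noteq> 0}" by (rule finite_subset)
    moreover have "{s. x s + y s \<noteq> 0} \<subseteq> S"
      using h \<open>{s. x s + y s \<noteq> 0} \<subseteq> _\<close> unfolding carrier_free_space by blast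
    ultimately show ?thesis unfolding carrier_free_space free_space_simps by simp
  qed
  show "a \<odot>\<^bsub>?V\<^esub> x \<in> carrier ?V" if h: "x \<in> carrier ?V" for a x
  proof -
    have "{s. a * x s \<noteq> 0} \<subseteq> {s. x s \<noteq> 0}" by auto
    moreover have "finite {s. x s \<noteq> 0}" using h by (simp add: carrier_free_space)
    ultimately have "finite {s. a * x s \<noteq> 0}" by (rule finite_subset)
    then show ?thesis using h unfolding carrier_free_space free_space_simps by auto
  qed
  show "\<zero>\<^bsub>?V\<^esub> \<in> carrier ?V" by (simp add: carrier_free_space free_space_simps)
qed (simp_all only: free_space_simps add_ac distrib_left distrib_right mult.assoc mult_1_left mult_zero_left
    add_0_left)

context qsa begin

section \<open>Cancelling common arrows\<close>

abbreviation "nzp \<equiv> nonzero_prod Q I"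

lemma finite_nzp: "finite {b. nzp a b}" "finite {c. nzp c a}"
  by (rule finite_subset[OF _ finite_arcs], auto simp: nonzero_prod_iff)+

lemma nzp_right_unique: assumes "nzp a b" "nzp a c" shows "b = c"
proof -
  have "card {\<beta>. nzp a \<beta>} \<le> 1" using S2[of a] assms by (auto simp: nonzero_prod_iff)
  then have "card {\<beta>. nzp a \<beta>} \<le> Suc 0" by simp
  then show ?thesis using card_le_Suc0_iff_eq[OF finite_nzp(1), of a] assms by blast
qed

lemma nzp_left_unique: assumes "nzp b a" "nzp c a" shows "b = c"
proof -
  have "card {\<gamma>. nzp \<gamma> a} \<le> 1" using S2[of a] assms by (auto simp: nonzero_prod_iff)
  then have "card {\<gamma>. nzp \<gamma> a} \<le> Suc 0" by simp
  then show ?thesis using card_le_Suc0_iff_eq[OF finite_nzp(2), of a] assms by blast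
qed

lemma zero_prodD: "zp a b \<Longrightarrow> a \<in> arcs Q" "zp a b \<Longrightarrow> b \<in> arcs Q" "zp a b \<Longrightarrow> head Q a = tail Q b"
  by (simp_all add: zero_prod_def)

definition agree_first :: "('v, 'a) qpair \<Rightarrow> bool" where
  "agree_first w \<longleftrightarrow> snd (snd w) \<noteq> [] \<and> hd (snd (snd w)) = hd (snd (fst w))"

definition agree_last :: "('v, 'a) qpair \<Rightarrow> bool" where
  "agree_last w \<longleftrightarrow> snd (snd w) \<noteq> [] \<and> last (snd (snd w)) = last (snd (fst w))"

definition left_maximal :: "('v, 'a) qpair \<Rightarrow> bool" where
  "left_maximal w \<longleftrightarrow> \<not> (\<exists>\<beta>\<in>arcs Q. head Q \<beta> = fst (snd w) \<and> (tail Q \<beta>, \<beta> # snd (snd w)) \<in> N)"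

definition right_maximal :: "('v, 'a) qpair \<Rightarrow> bool" where
  "right_maximal w \<longleftrightarrow> \<not> (\<exists>\<beta>\<in>arcs Q. tail Q \<beta> = path_end Q (snd w) \<and> (fst (snd w), snd (snd w) @ [\<beta>]) \<in> N)"

lemma pairs_ab_eq:
  "pairs_ab Q I 1 1 n = {w \<in> S n. agree_first w \<and> agree_last w}" "pairs_ab Q I 1 0 n
      = {w \<in> S n. agree_first w \<and> \<not> agree_last w}"
  "pairs_ab Q I 0 1 n = {w \<in> S n. \<not> agree_first w \<and> agree_last w}" "pairs_ab Q I 0 0 n
      = {w \<in> S n. \<not> agree_first w \<and> \<not> agree_last w}"
  by (auto simp: pairs_ab_def agree_first_def agree_last_def)

lemma left_max_eq: "left_max Q I X = {w \<in> X. left_maximal w}"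
  and right_max_eq: "right_max Q I X = {w \<in> X. right_maximal w}"
  by (auto simp: left_max_def right_max_def left_maximal_def right_maximal_def)

lemma S_cases:
  assumes "w \<in> S n"
  obtains u r g where "w = ((u, r), (u, g))" "(u, r) \<in> paths Q" "length r
      = n" "zs r" "(u, g) \<in> paths Q" "nz g"
    "pe u r = pe u g"
proof -
  obtain u r v g where w: "w = ((u, r), (v, g))" by (metis surj_pair)
  then show ?thesis using assms by (intro that[of u r g]) (auto simp: S_iff AP_iff N_iff)
qed

lemma S_intro: "((u, r), (u, g)) \<in> S n \<longleftrightarrow> (u, r) \<in> paths Q \<and> length r = n \<and> zs r \<and> (u, g) \<in> paths Q \<and> nz g
    \<and> pe u r = pe u g"
  by (auto simp: S_iff AP_iff N_iff)

lemma finite_S: "finite (S n)"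
proof -
  have "S n \<subseteq> (verts Q \<times> {p. set p \<subseteq> arcs Q \<and> length p = n}) \<times> N"
    by (auto simp: S_iff AP_iff paths_def awalk_def)
  then show ?thesis
    by (rule finite_subset) (intro finite_cartesian_product finite_lists_length_eq finite_verts finite_arcs
        finite_N)
qed

lemma path_ends: "\<lbrakk>(u, p) \<in> paths Q; p \<noteq> []\<rbrakk> \<Longrightarrow> u = tail Q (hd p) \<and> hd p \<in> arcs Q \<and> last p \<in> arcs Q \<and> pe u p
    = head Q (last p)"
proof -
  assume p: "(u, p) \<in> paths Q" "p \<noteq> []"
  obtain a q where aq: "p = a # q" using p(2) by (cases p) auto
  obtain q' b where bq: "p = q' @ [b]" using p(2) by (cases p rule: rev_cases) auto
  have "u = tail Q (hd p) \<and> hd p \<in> arcs Q" using p(1) unfolding aq by simp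
  moreover have "last p \<in> arcs Q \<and> pe u p = head Q (last p)"
    using p(1) unfolding bq by (simp add: append_in_paths path_end_append)
  ultimately show ?thesis by simp
qed

lemma left_maximal_iff: "\<lbrakk>(u, g) \<in> paths Q; nz g; g \<noteq> []\<rbrakk> \<Longrightarrow> left_maximal (\<rho>, (u, g)) \<longleftrightarrow> \<not> (\<exists>\<beta>. nzp \<beta> (hd g))"
  by (cases g) (auto simp: left_maximal_def N_iff nonzero_prod_iff)

lemma right_maximal_iff: "\<lbrakk>(u, g) \<in> paths Q; nz g; g \<noteq> []\<rbrakk> \<Longrightarrow> right_maximal (\<rho>, (u, g))
    \<longleftrightarrow> \<not> (\<exists>\<beta>. nzp (last g) \<beta>)"
  by (cases g rule: rev_cases)
     (auto simp: right_maximal_def N_iff nonzero_prod_iff append_in_paths path_end_append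
         successively_append_iff tail_in_verts)

text \<open>Since \<open>r\<close> is a closed path, its last arrow ends at \<open>u\<close>, and an
  arrow alone is a nonzero path prolonging the trivial one.\<close>

lemma not_left_maximal_Nil: "\<lbrakk>((u, r), (u, [])) \<in> S n; r \<noteq> []\<rbrakk> \<Longrightarrow> \<not> left_maximal ((u, r), (u, []))"
  using path_ends[of u r] by (auto simp: left_maximal_def N_iff S_intro)

definition drop_first :: "('v, 'a) qpair \<Rightarrow> ('v, 'a) qpair" where
  "drop_first = (\<lambda>((u, r), (v, g)). ((head Q (hd r), tl r), (head Q (hd r), tl g)))"

definition drop_last :: "('v, 'a) qpair \<Rightarrow> ('v, 'a) qpair" where
  "drop_last = (\<lambda>((u, r), (v, g)). ((u, butlast r), (u, butlast g)))"

lemma delta_eq: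
  "w \<in> S (Suc n) \<Longrightarrow> delta n c w = (if agree_first w then c (drop_first w) else 0)
      + (- 1) ^ Suc n * (if agree_last w then c (drop_last w) else 0)"
  by (cases w rule: S_cases) (auto simp: delta_def drop_first_def drop_last_def agree_first_def
      agree_last_def)

lemma delta_zero_iff: "delta n c = (\<lambda>_. 0) \<longleftrightarrow> (\<forall>w\<in>S (Suc n).
    (if agree_first w then c (drop_first w) else 0) + (- 1) ^ Suc n * (if agree_last w then c (drop_last w)
        else 0) = 0)"
proof
  assume "delta n c = (\<lambda>_. 0)"
  then show "\<forall>w\<in>S (Suc n). (if agree_first w then c (drop_first w) else 0)
      + (- 1) ^ Suc n * (if agree_last w then c (drop_last w) else 0) = 0"
    using delta_eq[of _ n c] by metis
next
  assume h: "\<forall>w\<in>S (Suc n). (if agree_first w then c (drop_first w) else 0)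
      + (- 1) ^ Suc n * (if agree_last w then c (drop_last w) else 0) = 0"
  show "delta n c = (\<lambda>_. 0)"
  proof
    fix w show "delta n c w = 0"
    proof (cases "w \<in> S (Suc n)")
      case True then show ?thesis using h delta_eq[OF True, of c] by simp
    next
      case False then show ?thesis by (cases w) (auto simp: delta_def)
    qed
  qed
qed

lemma drop_first_in_S: assumes "w \<in> S (Suc n)" "agree_first w" shows "drop_first w \<in> S n"
  using assms(1)
proof (cases rule: S_cases)
  case (1 u r g)
  have "r \<noteq> []" "g \<noteq> []" "hd g = hd r" using 1 assms(2) by (auto simp: agree_first_def)
  then show ?thesis using 1 by (cases r; cases g) (auto simp: drop_first_def S_intro successively_Cons)
qed

lemma drop_last_in_S: assumes "w \<in> S (Suc n)" "agree_last w" shows "drop_last w \<in> S n"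
  using assms(1)
proof (cases rule: S_cases)
  case (1 u r g)
  have "r \<noteq> []" "g \<noteq> []" "last g = last r" using 1 assms(2) by (auto simp: agree_last_def)
  then show ?thesis using 1
    by (cases r rule: rev_cases; cases g rule: rev_cases)
       (auto simp: drop_last_def S_intro successively_append_iff append_in_paths path_end_append)
qed

text \<open>The prolonged pair is the place where the equation for the given pair is read off. Its
  other term is present only if the last arrows agree; over a trivial \<open>\<gamma>\<close> the
  prolonged path is \<open>\<beta>\<close> itself, which is then both first and last.\<close>

lemma L_lift:
  assumes w: "((u, r), (u, g)) \<in> S n" and n: "n \<ge> 1" and \<beta>: "zp \<beta> (hd r)" and g: "g \<noteq> [] \<Longrightarrow> nzp \<beta> (hd g)"
  defines "w' \<equiv> ((tail Q \<beta>, \<beta> # r), (tail Q \<beta>, \<beta> # g))"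
  shows "w' \<in> S (Suc n)" "agree_first w'" "drop_first w' = ((u, r), (u, g))"
    "agree_last w' \<longleftrightarrow> (if g = [] then last r = \<beta> else agree_last ((u, r), (u, g)))"
proof -
  have r: "r \<noteq> []" using w n by (auto simp: S_intro)
  have u: "u = tail Q (hd r)" "hd r \<in> arcs Q" using w r path_ends[of u r] by (auto simp: S_intro)
  have h: "head Q \<beta> = u" "\<beta> \<in> arcs Q" using zero_prodD[OF \<beta>] u by simp_all
  show "w' \<in> S (Suc n)" using w \<beta> g h r
    by (auto simp: w'_def S_intro successively_Cons nonzero_prod_iff)
  show "agree_first w'" by (simp add: w'_def agree_first_def)
  show "drop_first w' = ((u, r), (u, g))" by (simp add: w'_def drop_first_def h)
  show "agree_last w' \<longleftrightarrow> (if g = [] then last r = \<beta> else agree_last ((u, r), (u, g)))" using r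
    by (auto simp: w'_def agree_last_def)
qed

lemma R_lift:
  assumes w: "((u, r), (u, g)) \<in> S n" and n: "n \<ge> 1" and \<beta>: "zp (last r) \<beta>" and g: "g \<noteq> [] \<Longrightarrow> nzp (last g) \<beta>"
  defines "w' \<equiv> ((u, r @ [\<beta>]), (u, g @ [\<beta>]))"
  shows "w' \<in> S (Suc n)" "agree_last w'" "drop_last w' = ((u, r), (u, g))"
    "agree_first w' \<longleftrightarrow> (if g = [] then hd r = \<beta> else agree_first ((u, r), (u, g)))"
proof -
  have r: "r \<noteq> []" using w n by (auto simp: S_intro)
  have e: "pe u r = head Q (last r)" using w r path_ends[of u r] by (auto simp: S_intro)
  have h: "pe u r = tail Q \<beta>" "\<beta> \<in> arcs Q" using zero_prodD[OF \<beta>] e by simp_all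
  show "w' \<in> S (Suc n)" using w \<beta> g h r
    by (auto simp: w'_def S_intro successively_append_iff nonzero_prod_iff append_in_paths path_end_append)
  show "agree_last w'" by (simp add: w'_def agree_last_def)
  show "drop_last w' = ((u, r), (u, g))" by (simp add: w'_def drop_last_def)
  show "agree_first w' \<longleftrightarrow> (if g = [] then hd r = \<beta> else agree_first ((u, r), (u, g)))" using r
    by (auto simp: w'_def agree_first_def)
qed

text \<open>By (S2) an arrow has a nonzero product with at most one arrow after it. So if
  \<open>\<beta>\<close> prolongs \<open>\<gamma>\<close> and the first arrows differ, the product
  of \<open>\<beta>\<close> with the first arrow of \<open>\<rho>\<close> is zero, and
  \<open>\<beta>\<close> prolongs the whole pair.\<close>

lemma L_lift_zp:
  assumes "(u, r) \<in> paths Q" "(u, g) \<in> paths Q" "r \<noteq> []" "g \<noteq> []" "hd g \<noteq> hd r" "nzp \<beta> (hd g)"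
  shows "zp \<beta> (hd r)"
proof (rule ccontr)
  assume "\<not> zp \<beta> (hd r)"
  then have "nzp \<beta> (hd r)" using path_ends[of u r] path_ends[of u g] assms by (auto simp: nonzero_prod_iff)
  then show False using nzp_right_unique[OF assms(6)] assms(5) by blast
qed

lemma R_lift_zp:
  assumes "(u, r) \<in> paths Q" "(u, g) \<in> paths Q" "pe u r
      = pe u g" "r \<noteq> []" "g \<noteq> []" "last g \<noteq> last r" "nzp (last g) \<beta>"
  shows "zp (last r) \<beta>"
proof (rule ccontr)
  assume "\<not> zp (last r) \<beta>"
  then have "nzp (last r) \<beta>" using path_ends[of u r] path_ends[of u g] assms by (auto simp: nonzero_prod_iff)
  then show False using nzp_left_unique[OF assms(7)] assms(6) by blast
qed

text \<open>The inverse prolongs both paths by the arrow that continues \<open>\<gamma>\<close> to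
  the left, unique by (S2). After the cancellation the first arrows differ, one having a zero and
  the other a nonzero product with the cancelled arrow. Length at least two keeps the remaining
  \<open>\<gamma>\<close> nontrivial.\<close>

lemma drop_first_bij:
  assumes n: "n \<ge> 1"
  shows "bij_betw drop_first {w \<in> S (Suc n). agree_first w \<and> length (snd (snd w)) \<ge> 2}
           {w \<in> S n. snd (snd w) \<noteq> [] \<and> \<not> agree_first w \<and> \<not> left_maximal w}" (is "bij_betw _ ?X ?Y")
    and "w \<in> S (Suc n) \<Longrightarrow> agree_first w \<Longrightarrow> length (snd (snd w)) \<ge> 2 \<Longrightarrow> agree_last (drop_first w) \<longleftrightarrow> agree_last w"
proof -
  have X: "\<exists>u a b r x g. w = ((u, a # b # r), (u, a # x # g)) \<and> u = tail Q a \<and> zp a b \<and> nzp a x"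
    if w: "w \<in> ?X" for w
  proof -
    obtain u r g where 1: "w = ((u, r), (u, g))" "(u, r) \<in> paths Q" "length r
        = Suc n" "zs r" "(u, g) \<in> paths Q" "nz g"
      using w S_cases[of w "Suc n"] by blast
    obtain a b r' where r: "r = a # b # r'" using 1(3) n by (cases r; cases "tl r") auto
    obtain a' x g' where g: "g = a' # x # g'" using w 1(1) by (cases g; cases "tl g") auto
    have "a' = a" using w by (simp add: 1(1) agree_first_def r g)
    then show ?thesis using 1 by (auto simp: r g nonzero_prod_iff)
  qed
  show "agree_last (drop_first w) \<longleftrightarrow> agree_last w"
    if "w \<in> S (Suc n)" "agree_first w" "length (snd (snd w)) \<ge> 2"
    using X[of w] that by (auto simp: drop_first_def agree_last_def)
  show "bij_betw drop_first ?X ?Y"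
    unfolding bij_betw_def
  proof
    show "inj_on drop_first ?X"
    proof (rule inj_onI)
      fix w w' assume w: "w \<in> ?X" and w': "w' \<in> ?X" and eq: "drop_first w = drop_first w'"
      obtain u a b r x g where 1: "w = ((u, a # b # r), (u, a # x # g))" "u = tail Q a" "nzp a x"
        using X[OF w] by blast
      obtain u' a' b' r' x' g' where 2: "w' = ((u', a' # b' # r'), (u', a' # x' # g'))" "u'
          = tail Q a'" "nzp a' x'"
        using X[OF w'] by blast
      have "x = x'" "b = b'" "r = r'" "g = g'" using eq by (auto simp: 1 2 drop_first_def)
      then show "w = w'" using nzp_left_unique[of a x a'] 1 2 by auto
    qed
    show "drop_first ` ?X = ?Y"
    proof
      show "drop_first ` ?X \<subseteq> ?Y"
      proof
        fix y assume "y \<in> drop_first ` ?X"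
        then obtain w where w: "w \<in> ?X" "y = drop_first w" by blast
        obtain u a b r x g where 1: "w = ((u, a # b # r), (u, a # x # g))" "u = tail Q a" "zp a b" "nzp a x"
          using X[OF w(1)] by blast
        have S: "y \<in> S n" using drop_first_in_S[of w n] w by simp
        have yy: "y = ((head Q a, b # r), (head Q a, x # g))" using w(2) by (simp add: 1 drop_first_def)
        have "x \<noteq> b" using 1 by (auto simp: nonzero_prod_iff)
        moreover have "\<not> left_maximal y" using S 1(4) left_maximal_iff[of "head Q a" "x # g"]
          by (auto simp: yy S_intro)
        ultimately show "y \<in> ?Y" using S by (simp add: yy agree_first_def)
      qed
      show "?Y \<subseteq> drop_first ` ?X"
      proof
        fix y assume y: "y \<in> ?Y"
        then obtain u r g where 1: "y = ((u, r), (u, g))" "(u, r) \<in> paths Q" "length r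
            = n" "zs r" "(u, g) \<in> paths Q" "nz g"
          using S_cases[of y n] by blast
        have g: "g \<noteq> []" and r: "r \<noteq> []" using y 1 n by auto
        have ne: "hd g \<noteq> hd r" using y g by (auto simp: 1(1) agree_first_def)
        obtain \<beta> where \<beta>: "nzp \<beta> (hd g)" using y left_maximal_iff[OF 1(5,6) g] by (auto simp: 1(1))
        have z: "zp \<beta> (hd r)" by (rule L_lift_zp[OF 1(2,5) r g ne \<beta>])
        have S: "((u, r), (u, g)) \<in> S n" using y 1(1) by simp
        note L = L_lift[OF S n z \<beta>]
        show "y \<in> drop_first ` ?X" using L(1,2,3) g
          by (intro image_eqI[OF _ CollectI]) (auto simp: 1(1) Suc_le_eq)
      qed
    qed
  qed
qed

text \<open>The mirror image of \<open>drop_first_bij\<close>. Left maximality depends only on the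
  first arrow of a nontrivial \<open>\<gamma>\<close>, which survives the cancellation when its
  length is at least two.\<close>

lemma drop_last_bij:
  assumes n: "n \<ge> 1"
  shows "bij_betw drop_last {w \<in> S (Suc n). agree_last w \<and> length (snd (snd w)) \<ge> 2}
           {w \<in> S n. snd (snd w) \<noteq> [] \<and> \<not> agree_last w \<and> \<not> right_maximal w}" (is "bij_betw _ ?X ?Y")
    and "w \<in> S (Suc n) \<Longrightarrow> agree_last w \<Longrightarrow> length (snd (snd w)) \<ge> 2 \<Longrightarrow> agree_first (drop_last w) \<longleftrightarrow> agree_first w"
    and "w \<in> S (Suc n) \<Longrightarrow> agree_last w \<Longrightarrow> length (snd (snd w)) \<ge> 2 \<Longrightarrow> left_maximal (drop_last w)
        \<longleftrightarrow> left_maximal w"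
proof -
  have X: "\<exists>u a b r x g. w = ((u, r @ [b, a]), (u, g @ [x, a])) \<and> zp b a \<and> nzp x a" if w: "w \<in> ?X" for w
  proof -
    obtain u r g where 1: "w = ((u, r), (u, g))" "(u, r) \<in> paths Q" "length r
        = Suc n" "zs r" "(u, g) \<in> paths Q" "nz g"
      using w S_cases[of w "Suc n"] by blast
    obtain r0 a where r0: "r = r0 @ [a]" using 1(3) by (cases r rule: rev_cases) auto
    obtain r' b where r': "r0 = r' @ [b]" using 1(3) n r0 by (cases r0 rule: rev_cases) auto
    obtain g0 a' where g0: "g = g0 @ [a']" using w 1(1) by (cases g rule: rev_cases) auto
    obtain g' x where g': "g0 = g' @ [x]" using w 1(1) g0 by (cases g0 rule: rev_cases) auto
    have a: "a' = a" using w by (simp add: 1(1) agree_last_def r0 g0)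
    have "zp b a" using 1(4) by (simp add: r0 r' successively_append_iff)
    moreover have "nzp x a" using 1(5,6)
      by (auto simp: g0 g' a successively_append_iff append_in_paths nonzero_prod_iff)
    ultimately show ?thesis using 1(1) by (auto simp: r0 r' g0 g' a)
  qed
  show "agree_first (drop_last w) \<longleftrightarrow> agree_first w"
    if w: "w \<in> S (Suc n)" "agree_last w" "length (snd (snd w)) \<ge> 2"
  proof -
    obtain u a b r x g where "w = ((u, r @ [b, a]), (u, g @ [x, a]))" using X[of w] w by blast
    then show ?thesis by (simp add: drop_last_def agree_first_def butlast_append hd_append)
  qed
  show "left_maximal (drop_last w) \<longleftrightarrow> left_maximal w"
    if w: "w \<in> S (Suc n)" "agree_last w" "length (snd (snd w)) \<ge> 2"
  proof -
    obtain u a b r x g where 1: "w = ((u, r @ [b, a]), (u, g @ [x, a]))" using X[of w] w by blast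
    have S: "drop_last w \<in> S n" by (rule drop_last_in_S[OF w(1,2)])
    have R: "drop_last w = ((u, r @ [b]), (u, g @ [x]))" by (simp add: 1 drop_last_def butlast_append)
    have "left_maximal w \<longleftrightarrow> \<not> (\<exists>\<beta>. nzp \<beta> (hd (g @ [x, a])))" unfolding 1 using w(1)
      by (intro left_maximal_iff) (auto simp: 1 S_intro)
    moreover have "left_maximal (drop_last w) \<longleftrightarrow> \<not> (\<exists>\<beta>. nzp \<beta> (hd (g @ [x])))" unfolding R using S
      by (intro left_maximal_iff) (auto simp: R S_intro)
    ultimately show ?thesis by (simp add: hd_append)
  qed
  show "bij_betw drop_last ?X ?Y"
    unfolding bij_betw_def
  proof
    show "inj_on drop_last ?X"
    proof (rule inj_onI)
      fix w w' assume w: "w \<in> ?X" and w': "w' \<in> ?X" and eq: "drop_last w = drop_last w'"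
      obtain u a b r x g where 1: "w = ((u, r @ [b, a]), (u, g @ [x, a]))" "nzp x a" using X[OF w] by blast
      obtain u' a' b' r' x' g' where 2: "w' = ((u', r' @ [b', a']), (u', g' @ [x', a']))" "nzp x' a'"
        using X[OF w'] by blast
      have "x = x'" "b = b'" "r = r'" "g = g'" "u = u'" using eq
        by (auto simp: 1 2 drop_last_def butlast_append)
      then show "w = w'" using nzp_right_unique[of x a a'] 1 2 by auto
    qed
    show "drop_last ` ?X = ?Y"
    proof
      show "drop_last ` ?X \<subseteq> ?Y"
      proof
        fix y assume "y \<in> drop_last ` ?X"
        then obtain w where w: "w \<in> ?X" "y = drop_last w" by blast
        obtain u a b r x g where 1: "w = ((u, r @ [b, a]), (u, g @ [x, a]))" "zp b a" "nzp x a"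
          using X[OF w(1)] by blast
        have S: "y \<in> S n" using drop_last_in_S[of w n] w by simp
        have yy: "y = ((u, r @ [b]), (u, g @ [x]))" using w(2) by (simp add: 1 drop_last_def butlast_append)
        have "x \<noteq> b" using 1 by (auto simp: nonzero_prod_iff)
        moreover have "\<not> right_maximal y" using S 1(3) right_maximal_iff[of u "g @ [x]"]
          by (auto simp: yy S_intro)
        ultimately show "y \<in> ?Y" using S by (simp add: yy agree_last_def)
      qed
      show "?Y \<subseteq> drop_last ` ?X"
      proof
        fix y assume y: "y \<in> ?Y"
        then obtain u r g where 1: "y = ((u, r), (u, g))" "(u, r) \<in> paths Q" "length r
            = n" "zs r" "(u, g) \<in> paths Q" "nz g"
            "pe u r = pe u g"
          using S_cases[of y n] by blast
        have g: "g \<noteq> []" and r: "r \<noteq> []" using y 1 n by auto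
        have ne: "last g \<noteq> last r" using y g by (auto simp: 1(1) agree_last_def)
        obtain \<beta> where \<beta>: "nzp (last g) \<beta>" using y right_maximal_iff[OF 1(5,6) g] by (auto simp: 1(1))
        have z: "zp (last r) \<beta>" by (rule R_lift_zp[OF 1(2,5,7) r g ne \<beta>])
        have S: "((u, r), (u, g)) \<in> S n" using y 1(1) by simp
        note R = R_lift[OF S n z \<beta>]
        show "y \<in> drop_last ` ?X" using R(1,2,3) g
          by (intro image_eqI[OF _ CollectI]) (auto simp: 1(1) Suc_le_eq)
      qed
    qed
  qed
qed

section \<open>Rotation of complete pairs\<close>

abbreviation "CP n \<equiv> complete_pairs Q I n"
abbreviation "IP n \<equiv> incomplete_pairs Q I n"
abbreviation "CP0 n \<equiv> complete_pairs_0 Q I n"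
abbreviation "GP n \<equiv> gentle_pairs Q I n"

lemma CP_iff: "((u, r), (v, g)) \<in> CP n \<longleftrightarrow> ((u, r), (u, [])) \<in> S n \<and> v = u \<and> g = [] \<and> zp (last r) (hd r)"
  by (auto simp: complete_pairs_def parallel_def trivial_paths_def AP_iff N_iff dest: path_start)

lemma IP_iff: "((u, r), (v, g)) \<in> IP n \<longleftrightarrow> ((u, r), (u, [])) \<in> S n \<and> v = u \<and> g = [] \<and> nzp (last r) (hd r)"
  by (auto simp: incomplete_pairs_def parallel_def trivial_paths_def AP_iff N_iff dest: path_start)

lemma CP_cases:
  assumes "w \<in> CP n"
  obtains u r where "w = ((u, r), (u, []))" "(u, r) \<in> paths Q" "length r = n" "zs r" "pe u r
      = u" "zp (last r) (hd r)"
proof -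
  obtain u r v g where w: "w = ((u, r), (v, g))" by (metis surj_pair)
  then show ?thesis using assms by (intro that[of u r]) (auto simp: CP_iff S_intro)
qed

lemma closed_pairs:
  assumes n: "n \<ge> 1"
  shows "{w \<in> S n. snd (snd w) = []} = CP n \<union> IP n" "CP n \<inter> IP n = {}"
proof -
  have "w \<in> CP n \<union> IP n" if w: "w \<in> S n" "snd (snd w) = []" for w
    using w(1)
  proof (cases rule: S_cases)
    case (1 u r g)
    have r: "r \<noteq> []" and g: "g = []" using 1 n w(2) by auto
    show ?thesis using 1 path_ends[OF 1(2) r] w(1) by (auto simp: g CP_iff IP_iff nonzero_prod_iff)
  qed
  then show "{w \<in> S n. snd (snd w) = []} = CP n \<union> IP n" by (auto simp: CP_iff IP_iff)
  show "CP n \<inter> IP n = {}" by (auto simp: CP_iff IP_iff nonzero_prod_iff)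
qed

text \<open>The inverse of \<open>\<tau>\<close> on complete pairs. Its direction is the one in
  which the cocycle equation at \<open>(\<alpha>_1...\<alpha>_n \<alpha>_1, \<alpha>_1)\<close>
  passes from one complete pair to the next.\<close>

definition rot :: "('v, 'a) qpair \<Rightarrow> ('v, 'a) qpair" where
  "rot = (\<lambda>((u, r), \<gamma>). ((head Q (hd r), rotate1 r), (head Q (hd r), [])))"

lemma rot_tau:
  assumes w: "w \<in> CP n" and n: "n \<ge> 1"
  shows "rot w \<in> CP n" "tau Q w \<in> CP n" "tau Q (rot w) = w" "rot (tau Q w) = w"
proof -
  obtain u r where 1: "w = ((u, r), (u, []))" "(u, r) \<in> paths Q" "length r = n" "zs r" "pe u r
      = u" "zp (last r) (hd r)"
    using CP_cases[OF w] .
  obtain a s where s: "r = a # s" using 1(3) n by (cases r) auto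
  obtain s' b where s': "r = s' @ [b]" using 1(3) n by (cases r rule: rev_cases) auto
  have a: "u = tail Q a" "a \<in> arcs Q" "(head Q a, s) \<in> paths Q" "pe (head Q a) s = u" using 1
    by (auto simp: s)
  have b: "(u, s') \<in> paths Q" "b \<in> arcs Q" "pe u s' = tail Q b" "head Q b = u" "zs s'" "s' \<noteq> []
      \<Longrightarrow> zp (last s') b"
    using 1(2,4,5) by (auto simp: s' append_in_paths path_end_append successively_append_iff)
  have "rot w = ((head Q a, s @ [a]), (head Q a, []))" by (simp add: 1(1) rot_def s)
  moreover have "zs s" "zp (last r) a" "s \<noteq> [] \<Longrightarrow> zp a (hd s)" using 1 by (auto simp: s successively_Cons)
  ultimately show "rot w \<in> CP n" using a 1(3)
    by (auto simp: CP_iff S_intro s append_in_paths path_end_append successively_append_iff hd_append)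
  have T: "tau Q w = ((tail Q b, b # s'), (tail Q b, []))" by (simp add: 1(1) tau_def s')
  have "zp b (hd r)" "pe u s' = tail Q b" using 1(6) b by (simp_all add: s')
  then have "s' \<noteq> [] \<Longrightarrow> zp b (hd s')" "s' = [] \<Longrightarrow> zp b b" by (auto simp: s' hd_append)
  then show "tau Q w \<in> CP n" unfolding T using b 1(3)
    by (auto simp: CP_iff S_intro s' successively_Cons)
  show "tau Q (rot w) = w" using a(1) by (simp add: 1(1) rot_def tau_def s)
  have "rot (tau Q w) = ((head Q b, s' @ [b]), (head Q b, []))" unfolding T by (simp add: rot_def)
  then show "rot (tau Q w) = w" unfolding 1(1) s' b(4) .
qed

lemma rot_pow_CP: "\<lbrakk>w \<in> CP n; n \<ge> 1\<rbrakk> \<Longrightarrow> (rot ^^ k) w \<in> CP n"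
  by (induction k) (simp_all add: rot_tau)

lemma CP_eqI:
  assumes "w \<in> CP n" "w' \<in> CP n" "snd (fst w) = snd (fst w')" "n \<ge> 1" shows "w = w'"
proof -
  obtain u r where 1: "w = ((u, r), (u, []))" "(u, r) \<in> paths Q" "length r = n" using CP_cases[OF assms(1)] .
  obtain u' r' where 2: "w' = ((u', r'), (u', []))" "(u', r') \<in> paths Q" using CP_cases[OF assms(2)] .
  have "r \<noteq> []" using 1(3) assms(4) by auto
  then show ?thesis using assms(3) path_ends[of u r] path_ends[of u' r'] 1 2 by simp
qed

lemma rot_list: "snd (fst ((rot ^^ k) w)) = rotate k (snd (fst w))"
  by (induction k) (simp_all add: rot_def split: prod.split, metis fst_conv snd_conv prod.collapse)

lemma rot_order: assumes "w \<in> CP n" "n \<ge> 1" shows "(rot ^^ n) w = w"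
proof (rule CP_eqI[OF rot_pow_CP[OF assms] assms(1) _ assms(2)])
  have "length (snd (fst w)) = n" using assms(1) by (cases rule: CP_cases) simp
  then show "snd (fst ((rot ^^ n) w)) = snd (fst w)" using rotate_id[of n "snd (fst w)"]
    by (simp add: rot_list)
qed

lemma tau_as_rot: assumes "w \<in> CP n" "n \<ge> 1" shows "tau Q w = (rot ^^ (n - 1)) w"
proof -
  have "(rot ^^ n) w = rot ((rot ^^ (n - 1)) w)" using assms(2) by (cases n) simp_all
  then have "tau Q w = tau Q (rot ((rot ^^ (n - 1)) w))" using rot_order[OF assms] by simp
  then show ?thesis using rot_tau(3)[OF rot_pow_CP[OF assms] assms(2)] by simp
qed

lemma tau_pow_as_rot: assumes "w \<in> CP n" "n \<ge> 1" shows "\<exists>j. (tau Q ^^ k) w = (rot ^^ j) w"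
proof (induction k)
  case 0
  show ?case by (rule exI[of _ 0]) simp
next
  case (Suc k)
  then obtain j where j: "(tau Q ^^ k) w = (rot ^^ j) w" by blast
  have "(tau Q ^^ Suc k) w = tau Q ((rot ^^ j) w)" using j by simp
  also have "\<dots> = (rot ^^ (n - 1)) ((rot ^^ j) w)" by (rule tau_as_rot[OF rot_pow_CP[OF assms] assms(2)])
  also have "\<dots> = (rot ^^ (n - 1 + j)) w" by (simp add: funpow_add)
  finally show ?case by blast
qed

lemma inv_tau:
  assumes "w \<in> CP n" "n \<ge> 1" shows "(inv_into (CP n) (tau Q) ^^ k) w = (rot ^^ k) w"
proof (induction k)
  case (Suc k)
  have inj: "inj_on (tau Q) (CP n)"
    by (rule inj_on_inverseI[of _ rot]) (rule rot_tau(4)[OF _ assms(2)])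
  have c: "(rot ^^ k) w \<in> CP n" by (rule rot_pow_CP[OF assms])
  have "inv_into (CP n) (tau Q) ((rot ^^ k) w) = rot ((rot ^^ k) w)"
    by (rule inv_into_f_eq[OF inj rot_tau(1)[OF c assms(2)] rot_tau(3)[OF c assms(2)]])
  then show ?case using Suc by simp
qed simp

text \<open>On complete pairs \<open>rot\<close> is inverse to \<open>\<tau>\<close> and its
  \<open>n\<close>-th power is the identity. Hence all integer powers of \<open>\<tau>\<close> are
  nonnegative powers of \<open>rot\<close>, and conversely.\<close>

lemma GP_iff:
  assumes n: "n \<ge> 1"
  shows "w \<in> GP n \<longleftrightarrow> w \<in> CP n \<and> (\<forall>k. (rot ^^ k) w \<in> CP0 n)"
proof
  assume w: "w \<in> GP n"
  then have c: "w \<in> CP n" and t: "\<And>m. tau_power Q I n m w \<in> CP0 n" by (simp_all add: gentle_pairs_def)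
  have "(rot ^^ k) w \<in> CP0 n" for k
  proof (cases k)
    case 0
    then show ?thesis using t[of 0] by (simp add: tau_power_def)
  next
    case (Suc j)
    have "tau_power Q I n (- int (Suc j)) w = (inv_into (CP n) (tau Q) ^^ Suc j) w"
      unfolding tau_power_def by (simp del: funpow.simps of_nat_Suc)
    also have "\<dots> = (rot ^^ Suc j) w" by (rule inv_tau[OF c n])
    finally show ?thesis using t[of "- int (Suc j)"] unfolding Suc by (simp only:)
  qed
  then show "w \<in> CP n \<and> (\<forall>k. (rot ^^ k) w \<in> CP0 n)" using c by blast
next
  assume h: "w \<in> CP n \<and> (\<forall>k. (rot ^^ k) w \<in> CP0 n)"
  have "tau_power Q I n m w \<in> CP0 n" for m
  proof (cases "m \<ge> 0")
    case True
    obtain j where "(tau Q ^^ nat m) w = (rot ^^ j) w" using tau_pow_as_rot[OF conjunct1[OF h] n] by blast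
    then show ?thesis using h True by (simp add: tau_power_def)
  next
    case False
    then show ?thesis using h inv_tau[OF conjunct1[OF h] n, of "nat (- m)"] by (simp add: tau_power_def)
  qed
  then show "w \<in> GP n" using h by (simp add: gentle_pairs_def)
qed

lemma rot_GP: assumes "n \<ge> 1" "w \<in> GP n" shows "rot w \<in> GP n"
proof -
  have w: "w \<in> CP n" "\<And>k. (rot ^^ k) w \<in> CP0 n" using assms GP_iff by blast+
  have "(rot ^^ k) (rot w) \<in> CP0 n" for k
    using w(2)[of "Suc k"] by (simp only: funpow_Suc_right comp_apply)
  then show ?thesis using rot_tau(1)[OF w(1) assms(1)] GP_iff[OF assms(1)] by blast
qed

lemma rot_pow_GP: "\<lbrakk>n \<ge> 1; w \<in> GP n\<rbrakk> \<Longrightarrow> (rot ^^ k) w \<in> GP n"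
  by (induction k) (simp_all add: rot_GP)

lemma GP_CP: "w \<in> GP n \<Longrightarrow> w \<in> CP n"
  by (simp add: gentle_pairs_def)

lemma tau_GP: assumes "n \<ge> 1" "w \<in> GP n" shows "tau Q w \<in> GP n"
  using tau_as_rot[OF GP_CP[OF assms(2)] assms(1)] rot_pow_GP[OF assms] by simp

lemma finite_GP: "finite (GP n)"
proof (rule finite_subset[OF _ finite_S])
  show "GP n \<subseteq> S n"
  proof
    fix w assume "w \<in> GP n"
    then have c: "w \<in> CP n" by (rule GP_CP)
    obtain u r v g where w: "w = ((u, r), (v, g))" by (metis surj_pair)
    show "w \<in> S n" using c unfolding w CP_iff by simp
  qed
qed

section \<open>Orbits of gentle pairs\<close>

definition rot_orbit :: "('v, 'a) qpair \<Rightarrow> ('v, 'a) qpair set" where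
  "rot_orbit w = range (\<lambda>k. (rot ^^ k) w)"

text \<open>The choice depends only on the orbit as a set, so all rotations of a pair share one
  representative.\<close>

definition orbit_rep :: "('v, 'a) qpair \<Rightarrow> ('v, 'a) qpair" where
  "orbit_rep w = (SOME x. x \<in> rot_orbit w)"

definition orbit_reps :: "nat \<Rightarrow> ('v, 'a) qpair set" where
  "orbit_reps n = orbit_rep ` GP n"

lemma orbit_rep_in: "orbit_rep w \<in> rot_orbit w"
proof -
  have "w \<in> rot_orbit w" unfolding rot_orbit_def by (rule image_eqI[of _ _ 0]) simp_all
  then show ?thesis unfolding orbit_rep_def by (rule someI)
qed

lemma rot_orbit_rot: assumes "w \<in> CP n" "n \<ge> 1" shows "rot_orbit (rot w) = rot_orbit w"
proof
  show "rot_orbit (rot w) \<subseteq> rot_orbit w"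
  proof
    fix x assume "x \<in> rot_orbit (rot w)"
    then obtain k where "x = (rot ^^ k) (rot w)" by (auto simp: rot_orbit_def)
    then have "x = (rot ^^ Suc k) w" by (simp only: funpow_Suc_right comp_apply)
    then show "x \<in> rot_orbit w" unfolding rot_orbit_def by (rule range_eqI)
  qed
  show "rot_orbit w \<subseteq> rot_orbit (rot w)"
  proof
    fix x assume "x \<in> rot_orbit w"
    then obtain k where "x = (rot ^^ k) w" by (auto simp: rot_orbit_def)
    then have "x = (rot ^^ k) ((rot ^^ n) w)" using rot_order[OF assms] by simp
    also have "\<dots> = (rot ^^ k) ((rot ^^ (n - 1)) (rot w))" using assms(2)
      by (cases n) (simp_all add: funpow_swap1)
    also have "\<dots> = (rot ^^ (k + (n - 1))) (rot w)" by (simp add: funpow_add)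
    finally show "x \<in> rot_orbit (rot w)" by (auto simp: rot_orbit_def)
  qed
qed

lemma rot_orbit_rot_pow: "\<lbrakk>w \<in> CP n; n \<ge> 1\<rbrakk> \<Longrightarrow> rot_orbit ((rot ^^ k) w) = rot_orbit w"
  by (induction k) (simp_all add: rot_orbit_rot[OF rot_pow_CP])

lemma orbit_rep_rot: "\<lbrakk>w \<in> CP n; n \<ge> 1\<rbrakk> \<Longrightarrow> orbit_rep (rot w) = orbit_rep w"
  by (simp add: orbit_rep_def rot_orbit_rot)

lemma orbit_rep_eq_rot: "\<exists>k. orbit_rep w = (rot ^^ k) w"
  using orbit_rep_in[of w] by (auto simp: rot_orbit_def)

lemma orbit_rep_orbit_rep: assumes "w \<in> CP n" "n \<ge> 1" shows "orbit_rep (orbit_rep w) = orbit_rep w"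
proof -
  obtain k where "orbit_rep w = (rot ^^ k) w" using orbit_rep_eq_rot by blast
  then have "rot_orbit (orbit_rep w) = rot_orbit w" using rot_orbit_rot_pow[OF assms] by simp
  then show ?thesis by (simp add: orbit_rep_def)
qed

lemma orbit_reps_D: assumes "w \<in> orbit_reps n" "n \<ge> 1" shows "w \<in> GP n" "orbit_rep w = w"
proof -
  obtain x where x: "x \<in> GP n" "w = orbit_rep x" using assms(1) by (auto simp: orbit_reps_def)
  obtain k where "orbit_rep x = (rot ^^ k) x" using orbit_rep_eq_rot by blast
  then show "w \<in> GP n" using rot_pow_GP[OF assms(2) x(1)] x(2) by simp
  show "orbit_rep w = w" using orbit_rep_orbit_rep[OF GP_CP[OF x(1)] assms(2)] x(2) by simp
qed

lemma const_on_orbit: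
  assumes "\<And>w. w \<in> GP n \<Longrightarrow> c (rot w) = (c w :: 'k)" "w \<in> GP n" "n \<ge> 1"
  shows "c w = c (orbit_rep w)"
proof -
  have "c ((rot ^^ k) w) = c w" for k
    by (induction k) (simp_all add: assms(1) rot_pow_GP[OF assms(3,2)])
  moreover obtain k where "orbit_rep w = (rot ^^ k) w" using orbit_rep_eq_rot by blast
  ultimately show ?thesis by simp
qed

text \<open>Read on functions, \<open>1 - \<tau>\<close> sends \<open>f\<close> to
  \<open>f - f \<circ> rot\<close>. Its kernel consists of the functions constant on orbits and has
  the orbit representatives as coordinates, so by rank and nullity the cokernel has as many
  dimensions as there are orbits.\<close>

lemma kdim_gentle:
  assumes n: "n \<ge> 1"
  shows "kdim (gentle_coinvariants Q I n) = card (orbit_reps n)"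
proof -
  define \<delta> :: "(('v, 'a) qpair \<Rightarrow> 'k) \<Rightarrow> ('v, 'a) qpair \<Rightarrow> 'k"
    where "\<delta> f = (\<lambda>w. if w \<in> GP n then f w - f (rot w) else 0)" for f
  define Z where "Z = {f :: ('v, 'a) qpair \<Rightarrow> 'k. \<forall>w. w \<notin> GP n \<longrightarrow> f w = 0}"
  have ONG: "orbit_reps n \<subseteq> GP n" using orbit_reps_D(1)[OF _ n] by blast
  have "\<exists>(K :: (('v, 'a) qpair \<Rightarrow> 'k) set) \<psi>. finite K \<and> card K + card (GP n) = card (GP n)
      + card (orbit_reps n) \<and>
     (\<forall>x\<in>Z. \<forall>y\<in>Z. \<psi> (\<lambda>t. x t + y t) = (\<lambda>k. \<psi> x k + \<psi> y k)) \<and>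
     (\<forall>a. \<forall>x\<in>Z. \<psi> (\<lambda>t. a * x t) = (\<lambda>k. a * \<psi> x k)) \<and>
     (\<forall>x\<in>Z. \<forall>k. k \<notin> K \<longrightarrow> \<psi> x k = (0::'k)) \<and>
     (\<forall>k\<in>K. k \<in> Z \<and> \<psi> k = basis_vec k) \<and>
     (\<forall>x\<in>Z. \<psi> x = (\<lambda>_. 0) \<longleftrightarrow> (\<exists>c. (\<forall>s. s \<notin> GP n \<longrightarrow> c s = 0) \<and> x = \<delta> c))"
  proof (rule quotient_coordinates[OF finite_GP finite_GP ONG])
    fix c c' :: "('v, 'a) qpair \<Rightarrow> 'k" and a :: 'k
    show "\<delta> (\<lambda>s. c s + c' s) = (\<lambda>t. \<delta> c t + \<delta> c' t)" "\<delta> (\<lambda>s. a * c s) = (\<lambda>t. a * \<delta> c t)"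
      by (auto simp: \<delta>_def algebra_simps)
  next
    fix c :: "('v, 'a) qpair \<Rightarrow> 'k"
    assume c: "\<And>s. s \<notin> GP n \<Longrightarrow> c s = 0" "\<delta> c = (\<lambda>_. 0)" "\<And>s. s \<in> orbit_reps n \<Longrightarrow> c s = 0"
    have r: "c (rot w) = c w" if "w \<in> GP n" for w using fun_cong[OF c(2), of w] that by (simp add: \<delta>_def)
    show "c = (\<lambda>_. 0)"
    proof
      fix w show "c w = 0"
      proof (cases "w \<in> GP n")
        case True
        have "c w = c (orbit_rep w)" by (rule const_on_orbit[where c = c and n = n, OF r True n])
        then show ?thesis using c(3)[of "orbit_rep w"] True by (simp add: orbit_reps_def)
      qed (rule c(1))
    qed
  next
    fix v :: "('v, 'a) qpair \<Rightarrow> 'k"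
    let ?c = "\<lambda>w. if w \<in> GP n then v (orbit_rep w) else 0"
    have "\<delta> ?c = (\<lambda>_. 0)" using rot_GP[OF n] orbit_rep_rot[OF GP_CP n] by (auto simp: \<delta>_def)
    moreover have "\<forall>s\<in>orbit_reps n. ?c s = v s" using orbit_reps_D[OF _ n] by simp
    ultimately show "\<exists>c. (\<forall>s. s \<notin> GP n \<longrightarrow> c s = 0) \<and> \<delta> c = (\<lambda>_. 0) \<and> (\<forall>s\<in>orbit_reps n. c s = v s)"
      by (intro exI[of _ ?c]) simp
  next
    fix z :: "('v, 'a) qpair \<Rightarrow> 'k" assume z: "z \<in> Z" "\<And>t. t \<in> GP n \<Longrightarrow> z t = 0"
    have z0: "\<forall>w. w \<notin> GP n \<longrightarrow> z w = 0" using z(1) unfolding Z_def by (rule CollectD)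
    show "z = (\<lambda>_. 0)"
    proof
      fix w show "z w = 0" using spec[OF z0, of w] z(2)[of w] by (cases "w \<in> GP n") simp_all
    qed
  next
    fix v :: "('v, 'a) qpair \<Rightarrow> 'k"
    show "\<exists>z\<in>Z. \<forall>t\<in>GP n. z t = v t" by (intro bexI[of _ "\<lambda>w. if w \<in> GP n then v w else 0"]) (auto simp: Z_def)
  qed (auto simp: Z_def \<delta>_def)
  then obtain K :: "(('v, 'a) qpair \<Rightarrow> 'k) set" and \<psi>
    where K: "finite K" "card K + card (GP n) = card (GP n) + card (orbit_reps n)"
    and \<psi>add: "\<forall>x\<in>Z. \<forall>y\<in>Z. \<psi> (\<lambda>t. x t + y t) = (\<lambda>k. \<psi> x k + \<psi> y k)"
    and \<psi>sm: "\<forall>a. \<forall>x\<in>Z. \<psi> (\<lambda>t. a * x t) = (\<lambda>k. a * \<psi> x k)"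
    and \<psi>0: "\<forall>x\<in>Z. \<forall>k. k \<notin> K \<longrightarrow> \<psi> x k = (0::'k)"
    and \<psi>b: "\<forall>k\<in>K. k \<in> Z \<and> \<psi> k = basis_vec k"
    and \<psi>ker: "\<forall>x\<in>Z. \<psi> x = (\<lambda>_. 0) \<longleftrightarrow> (\<exists>c. (\<forall>s. s \<notin> GP n \<longrightarrow> c s = 0) \<and> x = \<delta> c)"
    by (elim exE conjE) (rule that)
  let ?V = "free_space (GP n) :: ('k, ('v, 'a) qpair \<Rightarrow> 'k) module"
  have cV: "carrier ?V = Z"
  proof -
    have fin: "finite {w. f w \<noteq> 0}" if f: "f \<in> Z" for f
    proof (rule finite_subset[OF _ finite_GP[of n]])
      have f0: "\<forall>w. w \<notin> GP n \<longrightarrow> f w = 0" using f unfolding Z_def by (rule CollectD)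
      show "{w. f w \<noteq> 0} \<subseteq> GP n"
      proof
        fix w assume "w \<in> {w. f w \<noteq> 0}"
        then show "w \<in> GP n" using spec[OF f0, of w] by (cases "w \<in> GP n") simp_all
      qed
    qed
    have "carrier ?V = {f. finite {s. f s \<noteq> 0} \<and> {s. f s \<noteq> 0} \<subseteq> GP n}" by (rule carrier_free_space)
    also have "\<dots> = {f \<in> Z. finite {w. f w \<noteq> 0}}" unfolding Z_def by blast
    also have "\<dots> = Z" using fin by blast
    finally show ?thesis .
  qed
  note opV = free_space_simps[where S = "GP n"]
  have tl: "(\<lambda>w. f w - tau_lin Q I n f w) = \<delta> f" if f: "f \<in> Z" for f
  proof
    fix w
    show "f w - tau_lin Q I n f w = \<delta> f w"
    proof (cases "w \<in> GP n")
      case True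
      \<comment> \<open>The defining sum of \<open>tau_lin\<close> has a single term, because
        \<open>\<tau>\<close> permutes the gentle pairs with inverse \<open>rot\<close>.\<close>
      have "{w' \<in> GP n. tau Q w' = w} = {rot w}"
        using True rot_GP[OF n True] rot_tau(3)[OF GP_CP[OF True] n] rot_tau(4)[OF GP_CP n] by auto
      then show ?thesis using True by (simp add: tau_lin_def \<delta>_def)
    next
      case False
      then have e: "{w' \<in> GP n. tau Q w' = w} = {}" using tau_GP[OF n] by blast
      have "f w = 0" using False f unfolding Z_def by blast
      then show ?thesis using False unfolding tau_lin_def \<delta>_def e by simp
    qed
  qed
  let ?W = "(\<lambda>f w. f w - tau_lin Q I n f w) ` carrier ?V"
  have W: "?W = {x. \<exists>c. (\<forall>s. s \<notin> GP n \<longrightarrow> c s = 0) \<and> x = \<delta> c}"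
  proof -
    have "?W = \<delta> ` Z" unfolding cV by (rule image_cong[OF refl tl])
    then show ?thesis unfolding Z_def by blast
  qed
  have "kfin_dim (kquot ?V ?W) \<and> kdim (kquot ?V ?W) = card K"
  proof (rule dim_kquot[OF vectorspace_free_space K(1), where \<phi> = \<psi>])
    have "\<delta> c \<in> Z" for c unfolding Z_def \<delta>_def by simp
    then show "?W \<subseteq> carrier ?V" unfolding W unfolding cV by blast
    fix x assume x: "x \<in> carrier ?V"
    show "x \<in> ?W \<longleftrightarrow> \<psi> x = (\<lambda>_. 0)" unfolding W using \<psi>ker x unfolding cV by simp
    show "\<psi> x s = 0" if "s \<notin> K" for s using \<psi>0 x that unfolding cV by simp
    show "\<psi> (c \<odot>\<^bsub>?V\<^esub> x) = (\<lambda>s. c * \<psi> x s)" for c using \<psi>sm x unfolding cV opV by simp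
    fix y assume y: "y \<in> carrier ?V"
    show "\<psi> (x \<oplus>\<^bsub>?V\<^esub> y) = (\<lambda>s. \<psi> x s + \<psi> y s)" using \<psi>add x y unfolding cV opV by simp
  next
    fix k assume "k \<in> K"
    then show "\<exists>x\<in>carrier ?V. \<psi> x = basis_vec k" using \<psi>b unfolding cV by (intro bexI[of _ k]) simp_all
  qed
  then show ?thesis using K(2) by (simp add: gentle_coinvariants_def)
qed

section \<open>Coordinates of cocycles\<close>

definition cocycle_reps :: "nat \<Rightarrow> ('v, 'a) qpair set" where
  "cocycle_reps n = (if even n \<or> CHAR('k) = 2 then orbit_reps n else {})"

definition kernel_coords :: "nat \<Rightarrow> ('v, 'a) qpair set" where
  "kernel_coords n = {w \<in> S n. agree_first w} \<union> {w \<in> S n. \<not> agree_first w \<and> agree_last w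
      \<and> left_maximal w} \<union> {w \<in> S n. \<not> agree_first w \<and> \<not> agree_last w \<and> left_maximal w \<and> right_maximal w} \<union>
     empty_pairs Q I n \<union> cocycle_reps n"

text \<open>The last arrows of the prolonged pair differ, so its equation has the given pair as its
  only term.\<close>

lemma delta_L_lift:
  assumes d: "delta n c = (\<lambda>_. 0)" and w: "((u, r), (u, g)) \<in> S n" and n: "n \<ge> 1"
    and \<beta>: "zp \<beta> (hd r)" and g: "g \<noteq> [] \<Longrightarrow> nzp \<beta> (hd g)"
    and agree_last: "if g = [] then last r \<noteq> \<beta> else \<not> agree_last ((u, r), (u, g))"
  shows "c ((u, r), (u, g)) = 0"
proof -
  note L = L_lift[OF w n \<beta> g]
  have "\<not> agree_last ((tail Q \<beta>, \<beta> # r), tail Q \<beta>, \<beta> # g)" using L(4) agree_last by (cases "g = []") auto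
  then show ?thesis using d delta_eq[OF L(1), of c] L(2,3) by simp
qed

lemma delta_R_lift:
  assumes d: "delta n c = (\<lambda>_. 0)" and w: "((u, r), (u, g)) \<in> S n" and n: "n \<ge> 1"
    and \<beta>: "zp (last r) \<beta>" and g: "g \<noteq> [] \<Longrightarrow> nzp (last g) \<beta>"
    and agree_first: "if g = [] then hd r \<noteq> \<beta> else \<not> agree_first ((u, r), (u, g))"
  shows "c ((u, r), (u, g)) = 0"
proof -
  note R = R_lift[OF w n \<beta> g]
  have "\<not> agree_first ((u, r @ [\<beta>]), u, g @ [\<beta>])" using R(4) agree_first by (cases "g = []") auto
  then show ?thesis using d delta_eq[OF R(1), of c] R(2,3) by simp
qed

text \<open>An arrow witnessing that the pair is outside \<open>CP0 n\<close> prolongs it on one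
  side, and by being different from the arrow at the other end it leaves a single term in the
  equation.\<close>

lemma closed_not_CP0:
  assumes d: "delta n c = (\<lambda>_. 0)" and n: "n \<ge> 1" and w: "w \<in> CP n" "w \<notin> CP0 n"
  shows "c w = 0"
proof -
  obtain u r where 1: "w = ((u, r), (u, []))" "(u, r) \<in> paths Q" "length r = n" "zs r" "pe u r
      = u" "zp (last r) (hd r)"
    using CP_cases[OF w(1)] .
  have S: "((u, r), (u, [])) \<in> S n" using w(1) unfolding 1(1) CP_iff by simp
  have "(\<exists>\<delta>. \<delta> \<noteq> last r \<and> zp \<delta> (hd r)) \<or> (\<exists>\<beta>. \<beta> \<noteq> hd r \<and> zp (last r) \<beta>)"
    using w unfolding 1(1) by (auto simp: complete_pairs_0_def)
  then show ?thesis
  proof (elim disjE exE conjE)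
    fix \<delta> assume \<delta>: "\<delta> \<noteq> last r" "zp \<delta> (hd r)"
    show ?thesis unfolding 1(1) by (rule delta_L_lift[OF d S n \<delta>(2)]) (use \<delta>(1) in auto)
  next
    fix \<beta> assume \<beta>: "\<beta> \<noteq> hd r" "zp (last r) \<beta>"
    show ?thesis unfolding 1(1) by (rule delta_R_lift[OF d S n \<beta>(2)]) (use \<beta>(1) in auto)
  qed
qed

text \<open>The pair is \<open>(\<alpha>_1...\<alpha>_n \<alpha>_1, \<alpha>_1)\<close>: cancelling
  its last arrow gives \<open>w\<close>, cancelling its first arrow gives the rotation of
  \<open>w\<close>.\<close>

lemma rot_src:
  assumes n: "n \<ge> 1" and w: "w \<in> CP n"
  obtains w' where "w' \<in> S (Suc n)" "agree_first w'" "agree_last w'" "length (snd (snd w'))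
      = 1" "drop_first w' = rot w" "drop_last w' = w"
proof -
  obtain u r where 1: "w = ((u, r), (u, []))" "(u, r) \<in> paths Q" "length r = n" "zs r" "pe u r
      = u" "zp (last r) (hd r)"
    using CP_cases[OF w] .
  have S: "((u, r), (u, [])) \<in> S n" using w unfolding 1(1) CP_iff by simp
  have r: "r \<noteq> []" using 1(3) n by auto
  note R = R_lift[OF S n 1(6)]
  have "drop_first ((u, r @ [hd r]), (u, [] @ [hd r])) = rot w"
    using r by (cases r) (simp_all add: drop_first_def rot_def 1(1))
  then show ?thesis using R 1(1) by (intro that[of "((u, r @ [hd r]), (u, [] @ [hd r]))"]) auto
qed

lemma delta_rot:
  assumes d: "delta n c = (\<lambda>_. 0)" and n: "n \<ge> 1" and w: "w \<in> CP n"
  shows "c (rot w) = (- 1) ^ n * c w"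
proof -
  obtain w' where "w' \<in> S (Suc n)" "agree_first w'" "agree_last w'" "drop_first w' = rot w" "drop_last w'
      = w" using rot_src[OF n w] .
  then show ?thesis using d delta_eq[of w' n c] by simp
qed

lemma delta_rot_pow:
  assumes "delta n c = (\<lambda>_. 0)" "n \<ge> 1" "w \<in> CP n"
  shows "c ((rot ^^ k) w) = ((- 1) ^ n) ^ k * c w"
  by (induction k) (simp_all add: delta_rot[OF assms(1,2) rot_pow_CP[OF assms(3,2)]])

lemma two_neq_0: "CHAR('k) \<noteq> 2 \<Longrightarrow> (2 :: 'k) \<noteq> 0"
proof
  assume c: "CHAR('k) \<noteq> 2" "(2 :: 'k) = 0"
  then have "of_nat 2 = (0 :: 'k)" by simp
  then have "CHAR('k) dvd 2" by (simp only: of_nat_eq_0_iff_char_dvd)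
  then have "CHAR('k) \<le> 2" "CHAR('k) \<noteq> 0" using dvd_imp_le[of "CHAR('k)" 2] dvd_0_left[of 2]
    by (simp, metis zero_neq_numeral)
  moreover have "CHAR('k) \<noteq> 1" by simp
  ultimately show False using c(1) by simp
qed

lemma minus_one_char_2: "CHAR('k) = 2 \<Longrightarrow> (- 1 :: 'k) = 1"
proof -
  assume "CHAR('k) = 2"
  then have "CHAR('k) dvd 2" by simp
  then have "of_nat 2 = (0 :: 'k)" by (simp only: of_nat_eq_0_iff_char_dvd)
  then have "(1 :: 'k) + 1 = 0" by simp
  then show ?thesis by (metis add_eq_0_iff)
qed

lemma sgn_one: "even n \<or> CHAR('k) = 2 \<Longrightarrow> (- 1 :: 'k) ^ n = 1"
proof (cases "even n")
  case False
  assume "even n \<or> CHAR('k) = 2"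
  then have "(- 1 :: 'k) = 1" using False minus_one_char_2 by blast
  then show ?thesis by (simp only: power_one)
qed simp

text \<open>If some rotation lies outside \<open>CP0 n\<close>, the value vanishes there and, up to
  sign, along the whole orbit. On a gentle orbit the value is constant when the sign is trivial,
  hence decided by the representative.\<close>

lemma complete_cocycle_zero:
  assumes d: "delta n c = (\<lambda>_. 0)" and n: "n \<ge> 1" and O: "\<And>w. w \<in> cocycle_reps n \<Longrightarrow> c w = 0" and w: "w \<in> CP n"
  shows "c w = 0"
proof (cases "w \<in> GP n")
  case False
  then obtain k where k: "(rot ^^ k) w \<notin> CP0 n" using GP_iff[OF n] w by blast
  have "c ((rot ^^ k) w) = 0" by (rule closed_not_CP0[OF d n rot_pow_CP[OF w n] k])
  then show ?thesis using delta_rot_pow[OF d n w, of k] by simp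
next
  case G: True
  show ?thesis
  proof (cases "even n \<or> CHAR('k) = 2")
    case True
    have r: "c (rot x) = c x" if "x \<in> GP n" for x
      using delta_rot[OF d n GP_CP[OF that]] sgn_one[OF True] by simp
    have "c w = c (orbit_rep w)" by (rule const_on_orbit[where c = c and n = n, OF r G n])
    moreover have "orbit_rep w \<in> cocycle_reps n" using True G by (simp add: cocycle_reps_def orbit_reps_def)
    ultimately show ?thesis using O by simp
  next
    case False
    \<comment> \<open>Once around the orbit: \<open>n\<close> rotations are the identity, but for
      odd \<open>n\<close> they multiply the value by \<open>-1\<close>.\<close>
    have "c w = ((- 1) ^ n) ^ n * c w" using delta_rot_pow[OF d n w, of n] rot_order[OF w n] by simp
    moreover have "((- 1 :: 'k) ^ n) ^ n = - 1" using False by simp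
    ultimately have "c w = - 1 * c w" by (simp only:)
    then have "2 * c w = 0" by (metis add.right_inverse mult_2 mult_minus1)
    moreover have "(2 :: 'k) \<noteq> 0" using False two_neq_0 by blast
    ultimately show ?thesis by simp
  qed
qed

text \<open>Every pair outside the coordinates can be prolonged on one side. The equation there has
  the pair as its only term, or one further term which is itself a coordinate; complete pairs are
  treated along their orbits.\<close>

lemma kernel_coords_determines:
  assumes n: "n \<ge> 1" and d: "delta n c = (\<lambda>_. 0)" and s: "\<And>w. w \<notin> S n \<Longrightarrow> c w = 0"
    and K: "\<And>w. w \<in> kernel_coords n \<Longrightarrow> c w = 0"
  shows "c = (\<lambda>_. 0)"
proof
  fix w
  show "c w = 0"
  proof (cases "w \<in> S n \<and> w \<notin> kernel_coords n")
    case False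
    then show ?thesis using s K by blast
  next
    case True
    then have wS: "w \<in> S n" and wK: "w \<notin> kernel_coords n" by blast+
    have nsa: "\<not> agree_first w" and h: "agree_last w \<Longrightarrow> \<not> left_maximal w" "\<not> agree_last w \<Longrightarrow> left_maximal w
        \<Longrightarrow> \<not> right_maximal w" and e: "w \<notin> empty_pairs Q I n"
      using wS wK unfolding kernel_coords_def by blast+
    obtain u r g where 1: "w = ((u, r), (u, g))" "(u, r) \<in> paths Q" "length r
        = n" "zs r" "(u, g) \<in> paths Q" "nz g"
      "pe u r = pe u g" using S_cases[OF wS] .
    have S: "((u, r), (u, g)) \<in> S n" using wS 1(1) by simp
    have r: "r \<noteq> []" using 1(3) n by auto
    show ?thesis
    proof (cases "g = []")
      case g: False
      have neq: "hd g \<noteq> hd r" using nsa g by (simp add: 1(1) agree_first_def)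
      show ?thesis
      proof (cases "left_maximal w")
        case False
        then obtain \<beta> where \<beta>: "nzp \<beta> (hd g)" using left_maximal_iff[OF 1(5,6) g] by (auto simp: 1(1))
        have z: "zp \<beta> (hd r)" by (rule L_lift_zp[OF 1(2,5) r g neq \<beta>])
        show ?thesis
        proof (cases "agree_last w")
          case True
          \<comment> \<open>A pair in \<open>(0,1)\<^sub>n\<close> that is not left maximal. The
            second term of the equation at the prolonged pair begins on both sides with
            \<open>\<beta>\<close>, so it is a coordinate and vanishes.\<close>
          note L = L_lift[OF S n z \<beta>]
          have agree_last: "agree_last ((tail Q \<beta>, \<beta> # r), tail Q \<beta>, \<beta> # g)" using L(4) g True 1(1) by simp
          have "drop_last ((tail Q \<beta>, \<beta> # r), tail Q \<beta>, \<beta> # g)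
              = ((tail Q \<beta>, \<beta> # butlast r), tail Q \<beta>, \<beta> # butlast g)"
            using r g by (simp add: drop_last_def)
          moreover have "agree_first ((tail Q \<beta>, \<beta> # butlast r), tail Q \<beta>, \<beta> # butlast g)"
            by (simp add: agree_first_def)
          ultimately have "drop_last ((tail Q \<beta>, \<beta> # r), tail Q \<beta>, \<beta> # g) \<in> kernel_coords n"
            using drop_last_in_S[OF L(1) agree_last] unfolding kernel_coords_def by simp
          then have "c (drop_last ((tail Q \<beta>, \<beta> # r), tail Q \<beta>, \<beta> # g)) = 0" by (rule K)
          then show ?thesis using d delta_eq[OF L(1), of c] L(2,3) 1(1) by simp
        next
          case False
          show ?thesis unfolding 1(1) by (rule delta_L_lift[OF d S n z \<beta>]) (use False g 1(1) in auto)
        qed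
      next
        case True
        \<comment> \<open>A left maximal pair outside the coordinates agrees at neither end and is
          not right maximal, so it is prolonged to the right instead.\<close>
        then have nsb: "\<not> agree_last w" "\<not> right_maximal w" using h by blast+
        obtain \<beta> where \<beta>: "nzp (last g) \<beta>" using nsb(2) right_maximal_iff[OF 1(5,6) g] by (auto simp: 1(1))
        have "last g \<noteq> last r" using nsb(1) g by (simp add: 1(1) agree_last_def)
        then have z: "zp (last r) \<beta>" by (rule R_lift_zp[OF 1(2,5,7) r g _ \<beta>])
        show ?thesis unfolding 1(1) by (rule delta_R_lift[OF d S n z \<beta>]) (use nsa g 1(1) in auto)
      qed
    next
      case g: True
      have "w \<in> {w \<in> S n. snd (snd w) = []}" using wS by (simp add: 1(1) g)
      then have "w \<in> CP n \<or> w \<in> IP n" unfolding closed_pairs(1)[OF n]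
        by (rule UnE) (rule disjI1 disjI2, assumption)+
      then show ?thesis
      proof
        assume cw: "w \<in> CP n"
        have "cocycle_reps n \<subseteq> kernel_coords n" unfolding kernel_coords_def by blast
        then have "c x = 0" if "x \<in> cocycle_reps n" for x using that by (intro K) blast
        then show ?thesis by (rule complete_cocycle_zero[OF d n _ cw])
      next
        assume i: "w \<in> IP n"
        have nz: "nzp (last r) (hd r)" using i unfolding 1(1) IP_iff by simp
        \<comment> \<open>A zero product through the vertex of an incomplete pair forces its value
          to vanish: either \<open>\<beta>\<close> prolongs \<open>\<rho>\<close> on the left, or by
          (S2) \<open>\<beta>\<close> is the last arrow of \<open>\<rho>\<close> and
          \<open>\<delta>\<close> prolongs it on the right. Incompleteness keeps the prolonging
          arrow different from the arrow at the other end.\<close>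
        have "\<exists>\<beta> \<delta>. head Q \<beta> = u \<and> tail Q \<delta> = u \<and> zp \<beta> \<delta>" using e i by (simp add: empty_pairs_def 1(1))
        then obtain \<beta> \<delta> where bd: "head Q \<beta> = u" "tail Q \<delta> = u" "zp \<beta> \<delta>" by blast
        show ?thesis
        proof (cases "zp \<beta> (hd r)")
          case True
          have "last r \<noteq> \<beta>" using True nz by (auto simp: nonzero_prod_iff)
          then show ?thesis using delta_L_lift[OF d S n True] by (simp add: 1(1) g)
        next
          case False
          have "nzp \<beta> (hd r)" using False bd(1) zero_prodD[OF bd(3)] path_ends[OF 1(2) r]
            by (auto simp: nonzero_prod_iff)
          then have "\<beta> = last r" using nz nzp_left_unique by blast
          then have z: "zp (last r) \<delta>" using bd(3) by simp
          have "hd r \<noteq> \<delta>" using z nz by (auto simp: nonzero_prod_iff)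
          then show ?thesis using delta_R_lift[OF d S n z] by (simp add: 1(1) g)
        qed
      qed
    qed
  qed
qed

section \<open>Extending prescribed values to a cocycle\<close>

lemma empty_pairs_D:
  assumes "w \<in> empty_pairs Q I n"
  obtains u r where "w = ((u, r), (u, []))" "w \<in> S n" "w \<in> IP n" "\<And>\<beta> \<delta>. head Q \<beta> = u \<Longrightarrow> \<not> zp \<beta> \<delta>"
proof -
  obtain u r v g where w: "w = ((u, r), (v, g))" by (metis surj_pair)
  have i: "w \<in> IP n" and e: "\<not> (\<exists>\<beta> \<delta>. head Q \<beta> = u \<and> tail Q \<delta> = u \<and> zp \<beta> \<delta>)"
    using assms unfolding empty_pairs_def w by simp_all
  have "((u, r), (u, [])) \<in> S n \<and> v = u \<and> g = []" using i unfolding w IP_iff by simp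
  moreover have "\<not> zp \<beta> \<delta>" if "head Q \<beta> = u" for \<beta> \<delta> using e that zero_prodD(3)[of \<beta> \<delta>] by fastforce
  ultimately show ?thesis using that[of u r] i w by simp
qed

text \<open>
  The cocycle with prescribed values \<open>v\<close>.  A pair in \<open>(0,1)\<^sub>n\<close> that can be prolonged to the left is tied to a
  pair in \<open>(1,a)\<^sub>n\<close> by the equation at the prolonged pair, whence its value; the prolonging arrow is
  unique by (S2).
\<close>

definition cocycle_ext :: "nat \<Rightarrow> (('v, 'a) qpair \<Rightarrow> 'k) \<Rightarrow> ('v, 'a) qpair \<Rightarrow> 'k" where
  "cocycle_ext n v w = (if w \<notin> S n then 0
     else if snd (snd w) \<noteq> [] then
       (if agree_first w then v w
        else if agree_last w then
          (if left_maximal w then v w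
           else (- 1) ^ n * (let \<beta> = SOME \<beta>. nzp \<beta> (hd (snd (snd w))) in
             v ((tail Q \<beta>, \<beta> # butlast (snd (fst w))), (tail Q \<beta>, \<beta> # butlast (snd (snd w))))))
        else if left_maximal w \<and> right_maximal w then v w else 0)
     else if w \<in> empty_pairs Q I n then v w
     else if w \<in> GP n \<and> (even n \<or> CHAR('k) = 2) then v (orbit_rep w) else 0)"

lemma cocycle_ext_closed:
  assumes "w \<in> S n" "snd (snd w) = []"
  shows "cocycle_ext n v w = (if w \<in> empty_pairs Q I n then v w
     else if w \<in> GP n \<and> (even n \<or> CHAR('k) = 2) then v (orbit_rep w) else 0)"
  using assms by (simp add: cocycle_ext_def)

text \<open>The zero product at \<open>u\<close> rules out an empty pair and failing
  \<open>CP0 n\<close> rules out a gentle one, so the default value zero applies.\<close>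

lemma cocycle_ext_not_CP0:
  assumes "((u, r), (u, [])) \<in> S n" "zp \<beta> \<delta>" "head Q \<beta> = u" "((u, r), (u, [])) \<notin> CP0 n" "n \<ge> 1"
  shows "cocycle_ext n v ((u, r), (u, [])) = 0"
proof -
  have "((u, r), (u, [])) \<notin> empty_pairs Q I n"
  proof
    assume "((u, r), (u, [])) \<in> empty_pairs Q I n"
    then show False by (rule empty_pairs_D) (use assms(2,3) in auto)
  qed
  moreover have "((u, r), (u, [])) \<notin> GP n"
  proof
    assume "((u, r), (u, [])) \<in> GP n"
    then have "\<forall>k. (rot ^^ k) ((u, r), (u, [])) \<in> CP0 n" using GP_iff[OF assms(5)] by blast
    from spec[OF this, of 0] show False using assms(4) by simp
  qed
  ultimately show ?thesis using cocycle_ext_closed[OF assms(1)] by simp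
qed

lemma CP_not_empty: "w \<in> CP n \<Longrightarrow> n \<ge> 1 \<Longrightarrow> w \<notin> empty_pairs Q I n"
  using closed_pairs(2)[of n] by (auto simp: empty_pairs_def)

lemma CP_S: "w \<in> CP n \<Longrightarrow> w \<in> S n \<and> snd (snd w) = []"
proof -
  assume c: "w \<in> CP n"
  obtain u r v g where w: "w = ((u, r), (v, g))" by (metis surj_pair)
  show ?thesis using c unfolding w CP_iff by simp
qed

text \<open>Rotation preserves gentleness and the representative, so the two values agree; they are
  nonzero only where \<open>(-1)^n = 1\<close>.\<close>

lemma cocycle_ext_rot:
  assumes n: "n \<ge> 1" and w: "w \<in> CP n"
  shows "cocycle_ext n v (rot w) + (- 1) ^ Suc n * cocycle_ext n v w = 0"
proof -
  have r: "rot w \<in> CP n" by (rule rot_tau(1)[OF w n])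
  have "rot w \<in> GP n \<longleftrightarrow> w \<in> GP n"
    using rot_GP[OF n, of w] tau_GP[OF n, of "rot w"] rot_tau(3)[OF w n] by auto
  then have e: "cocycle_ext n v (rot w) = (if w \<in> GP n \<and> (even n \<or> CHAR('k) = 2) then v (orbit_rep w) else 0)"
    using cocycle_ext_closed[of "rot w" n v] CP_S[OF r] CP_not_empty[OF r n] unfolding orbit_rep_rot[OF w n]
      by simp
  have "cocycle_ext n v w = (if w \<in> GP n \<and> (even n \<or> CHAR('k) = 2) then v (orbit_rep w) else 0)"
    using cocycle_ext_closed[of w n v] CP_S[OF w] CP_not_empty[OF w n] by simp
  then show ?thesis using sgn_one[of n] unfolding e by (cases "w \<in> GP n \<and> (even n \<or> CHAR('k) = 2)") auto
qed

text \<open>Only pairs agreeing at some end have an equation to check. If \<open>\<gamma>\<close> is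
  longer than an arrow, the cancelled pairs still have nontrivial second path; if it is an arrow,
  they are closed pairs, and rotation or the default value takes over.\<close>

lemma cocycle_ext_cocycle:
  assumes n: "n \<ge> 1"
  shows "delta n (cocycle_ext n v) = (\<lambda>_. 0)"
  unfolding delta_zero_iff
proof
  fix w assume wS: "w \<in> S (Suc n)"
  let ?c = "cocycle_ext n v"
  let ?goal = "(if agree_first w then ?c (drop_first w) else 0)
      + (- 1) ^ Suc n * (if agree_last w then ?c (drop_last w) else 0) = 0"
  obtain u r g where 1: "w = ((u, r), (u, g))" "(u, r) \<in> paths Q" "length r
      = Suc n" "zs r" "(u, g) \<in> paths Q" "nz g"
    "pe u r = pe u g" using S_cases[OF wS] .
  consider (no) "\<not> agree_first w" "\<not> agree_last w" | (long) "length g \<ge> 2" | (short) a where "g = [a]"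
    by (cases g; cases "tl g") (auto simp: 1(1) agree_first_def agree_last_def)
  then show ?goal
  proof cases
    case no
    then show ?thesis by simp
  next
    case long
    then have l: "length (snd (snd w)) \<ge> 2" by (simp add: 1(1))
    have L: "drop_first w \<in> S n \<and> snd (snd (drop_first w)) \<noteq> [] \<and> \<not> agree_first (drop_first w)
        \<and> \<not> left_maximal (drop_first w) \<and> (agree_last (drop_first w) \<longleftrightarrow> agree_last w)" if "agree_first w"
      using bij_betwE[OF drop_first_bij(1)[OF n]] drop_first_bij(2)[OF n wS that l] wS l that by blast
    have R: "drop_last w \<in> S n \<and> snd (snd (drop_last w)) \<noteq> [] \<and> \<not> agree_last (drop_last w)
        \<and> \<not> right_maximal (drop_last w) \<and> (agree_first (drop_last w) \<longleftrightarrow> agree_first w)" if "agree_last w"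
    proof -
      have "w \<in> {w \<in> S (Suc n). agree_last w \<and> 2 \<le> length (snd (snd w))}" using wS l that by simp
      with bij_betwE[OF drop_last_bij(1)[OF n]] have "drop_last w \<in> {w \<in> S n. snd (snd w) \<noteq> []
          \<and> \<not> agree_last w \<and> \<not> right_maximal w}" by (rule bspec)
      then show ?thesis using drop_last_bij(2)[OF n wS that l] by simp
    qed
    show ?thesis
    proof (cases "agree_first w")
      case a: True
      show ?thesis
      proof (cases "agree_last w")
        case b: True
        obtain a x g' where g: "g = a # x # g'" using long by (cases g; cases "tl g") auto
        obtain r' where r: "r = a # r'" using a 1(3) g by (cases r) (auto simp: 1(1) agree_first_def)
        have r': "r' \<noteq> []" using 1(3) n r by auto
        have nz: "nzp a x" using 1(5,6) by (auto simp: g nonzero_prod_iff)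
        have u: "tail Q a = u" using 1(5) by (simp add: g)
        have Lw: "drop_first w = ((head Q a, r'), (head Q a, x # g'))" by (simp add: 1(1) drop_first_def r g)
        have Rw: "drop_last w = ((u, a # butlast r'), (u, a # butlast (x # g')))" using r'
          by (simp add: 1(1) drop_last_def r g)
        \<comment> \<open>By (S2) the arrow chosen in \<open>cocycle_ext\<close> is the one that was
          cancelled, so the value at \<open>drop_first w\<close> is defined exactly by the equation
          at \<open>w\<close>.\<close>
        have s: "(SOME \<beta>. nzp \<beta> x) = a" using nz nzp_left_unique[OF _ nz] by (rule some_equality)
        have "?c (drop_first w) = (- 1) ^ n * (let \<beta> = SOME \<beta>. nzp \<beta> x in
             v ((tail Q \<beta>, \<beta> # butlast r'), (tail Q \<beta>, \<beta> # butlast (x # g'))))"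
          using L[OF a] b unfolding cocycle_ext_def Lw
            by (simp only: simp_thms if_True if_False fst_conv snd_conv list.sel)
        also have "\<dots> = (- 1) ^ n * v (drop_last w)" unfolding s Let_def Rw u ..
        finally have cL: "?c (drop_first w) = (- 1) ^ n * v (drop_last w)" .
        have cR: "?c (drop_last w) = v (drop_last w)" using R[OF b] a by (simp add: cocycle_ext_def)
        show ?thesis unfolding cL cR using a b by simp
      next
        case b: False
        \<comment> \<open>The cancelled pair agrees at neither end and is not left maximal, so it
          received the default value zero. In the mirrored case below it is right maximality that
          fails.\<close>
        have "?c (drop_first w) = 0" using L[OF a] b by (simp add: cocycle_ext_def)
        then show ?thesis using b by simp
      qed
    next
      case a: False
      have "?c (drop_last w) = 0" if "agree_last w" using R[OF that] a by (simp add: cocycle_ext_def)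
      then show ?thesis using a by simp
    qed
  next
    case (short a)
    have r: "r \<noteq> []" "tl r \<noteq> []" "butlast r \<noteq> []" using 1(3) n by (cases r; cases "tl r"; auto)+
    have sab: "agree_first w \<longleftrightarrow> hd r = a" "agree_last w \<longleftrightarrow> last r = a"
      by (auto simp: 1(1) agree_first_def agree_last_def short)
    have Lw: "drop_first w = ((head Q (hd r), tl r), (head Q (hd r), []))"
      by (simp add: 1(1) drop_first_def short)
    have Rw: "drop_last w = ((u, butlast r), (u, []))" by (simp add: 1(1) drop_last_def short)
    have zl: "zp (hd r) (hd (tl r))" using 1(4) r by (cases r; cases "tl r") auto
    have zr: "zp (last (butlast r)) (last r)"
    proof -
      have "r = butlast (butlast r) @ [last (butlast r)] @ [last r]"
        using r append_butlast_last_id[of "butlast r"] append_butlast_last_id[of r] by (metis append.assoc)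
      then show ?thesis using 1(4) by (metis append_Cons append_Nil successively_append_iff
          successively.simps(3))
    qed
    have lr: "last (tl r) = last r" using r by (simp add: last_tl)
    have hr: "hd (butlast r) = hd r" using r by (cases r) auto
    consider (both) "agree_first w" "agree_last w" | (left) "agree_first w" "\<not> agree_last w"
        | (right) "\<not> agree_first w" "agree_last w" | (none) "\<not> agree_first w" "\<not> agree_last w" by blast
    then show ?thesis
    proof cases
      case both
      have RS: "((u, butlast r), (u, [])) \<in> S n" using drop_last_in_S[OF wS both(2)] by (simp add: Rw)
      have C: "drop_last w \<in> CP n" using RS zr both sab hr by (simp add: Rw CP_iff)
      have "r = hd r # tl r" using r by simp
      moreover have "r = butlast r @ [last r]" using r by simp
      \<comment> \<open>Here \<open>\<rho>\<close> begins and ends with the same arrow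
        \<open>a\<close>, so removing it at the front is the rotation of removing it at the
        back.\<close>
      ultimately have "tl r = tl (butlast r) @ [last r]" using r by (metis list.sel(3) tl_append2)
      then have "rotate1 (butlast r) = tl r" using r hr both sab by (cases "butlast r") auto
      then have "rot (drop_last w) = drop_first w" by (simp add: Rw Lw rot_def hr)
      then show ?thesis using cocycle_ext_rot[OF n C, of v] both by simp
    next
      case left
      have LS: "((head Q (hd r), tl r), (head Q (hd r), [])) \<in> S n" using drop_first_in_S[OF wS left(1)]
        by (simp add: Lw)
      \<comment> \<open>The cancelled arrow has a zero product with the next one but differs from
        the last arrow of the closed path, so it witnesses that the remaining pair is outside
        \<open>CP0 n\<close>. Symmetrically in the next case.\<close>
      have "hd r \<noteq> last (tl r)" using left sab lr by simp
      then have "((head Q (hd r), tl r), (head Q (hd r), [])) \<notin> CP0 n" using zl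
        by (auto simp: complete_pairs_0_def)
      then have "?c (drop_first w) = 0" unfolding Lw by (rule cocycle_ext_not_CP0[OF LS zl refl _ n])
      then show ?thesis using left by simp
    next
      case right
      have RS: "((u, butlast r), (u, [])) \<in> S n" using drop_last_in_S[OF wS right(2)] by (simp add: Rw)
      have h: "head Q (last (butlast r)) = u" using RS path_ends[of u "butlast r"] r by (auto simp: S_intro)
      have "last r \<noteq> hd (butlast r)" using right sab hr by simp
      then have "((u, butlast r), (u, [])) \<notin> CP0 n" using zr by (auto simp: complete_pairs_0_def)
      then have "?c (drop_last w) = 0" unfolding Rw by (rule cocycle_ext_not_CP0[OF RS zr h _ n])
      then show ?thesis using right by simp
    next
      case none
      then show ?thesis by simp
    qed
  qed
qed

lemma cocycle_reps_D: assumes "w \<in> cocycle_reps n" "n \<ge> 1" shows "w \<in> GP n" "orbit_rep w = w" "even n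
    \<or> CHAR('k) = 2" "w \<in> CP n"
proof -
  have h: "w \<in> orbit_reps n" "even n \<or> CHAR('k) = 2" using assms(1)
    by (simp_all add: cocycle_reps_def split: if_splits)
  show "w \<in> GP n" "orbit_rep w = w" "even n \<or> CHAR('k) = 2" using orbit_reps_D[OF h(1) assms(2)] h(2)
    by simp_all
  then show "w \<in> CP n" by (intro GP_CP)
qed

lemma closed_S: assumes "w \<in> S n" "snd (snd w)
    = []" "n \<ge> 1" shows "\<not> agree_first w" "\<not> agree_last w" "\<not> left_maximal w"
proof -
  show "\<not> agree_first w" "\<not> agree_last w" using assms(2) by (simp_all add: agree_first_def agree_last_def)
  obtain u r g where 1: "w = ((u, r), (u, g))" "length r = n" using S_cases[OF assms(1)] .
  have "r \<noteq> []" using 1(2) assms(3) by auto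
  then show "\<not> left_maximal w" using not_left_maximal_Nil[of u r n] assms(1,2) by (simp add: 1(1))
qed

lemma cocycle_ext_kernel_coords:
  assumes n: "n \<ge> 1" and w: "w \<in> kernel_coords n"
  shows "cocycle_ext n v w = v w"
proof -
  consider (a) "w \<in> S n" "agree_first w" | (b) "w \<in> S n" "\<not> agree_first w" "agree_last w" "left_maximal w"
      | (c) "w \<in> S n" "\<not> agree_first w" "\<not> agree_last w" "left_maximal w" "right_maximal w"
    | (e) "w \<in> empty_pairs Q I n" | (o) "w \<in> cocycle_reps n" using w unfolding kernel_coords_def by blast
  then show ?thesis
  proof cases
    case a
    moreover have "snd (snd w) \<noteq> []" using a closed_S(1)[OF a(1) _ n] by blast
    ultimately show ?thesis by (simp add: cocycle_ext_def)
  next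
    case b
    moreover have "snd (snd w) \<noteq> []" using b closed_S(3)[OF b(1) _ n] by blast
    ultimately show ?thesis by (simp add: cocycle_ext_def)
  next
    case c
    moreover have "snd (snd w) \<noteq> []" using c closed_S(3)[OF c(1) _ n] by blast
    ultimately show ?thesis by (simp add: cocycle_ext_def)
  next
    case e
    obtain u r where "w = ((u, r), (u, []))" "w \<in> S n" using empty_pairs_D[OF e] .
    then have "w \<in> S n \<and> snd (snd w) = []" by simp
    then show ?thesis using e by (simp add: cocycle_ext_def)
  next
    case o
    note O = cocycle_reps_D[OF o n]
    show ?thesis using cocycle_ext_closed[of w n v] CP_S[OF O(4)] CP_not_empty[OF O(4) n] O by simp
  qed
qed

section \<open>Counting pairs\<close>

lemma card_split: "finite X \<Longrightarrow> card {w \<in> X. F w} = card {w \<in> X. F w \<and> H w} + card {w \<in> X. F w \<and> \<not> H w}"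
proof -
  assume f: "finite X"
  have "{w \<in> X. F w} = {w \<in> X. F w \<and> H w} \<union> {w \<in> X. F w \<and> \<not> H w}" by blast
  moreover have "card ({w \<in> X. F w \<and> H w} \<union> {w \<in> X. F w \<and> \<not> H w}) = card {w \<in> X. F w \<and> H w}
      + card {w \<in> X. F w \<and> \<not> H w}"
    using f by (intro card_Un_disjoint) auto
  ultimately show ?thesis by simp
qed

abbreviation "lg w \<equiv> length (snd (snd w))"

lemma card_not_left_maximal:
  assumes n: "n \<ge> 1"
  shows "card {w \<in> S n. (\<not> agree_first w \<and> snd (snd w) \<noteq> []) \<and> \<not> left_maximal w}
      = card {w \<in> S (Suc n). agree_first w \<and> lg w \<ge> 2}"
proof -
  have "card {w \<in> S n. snd (snd w) \<noteq> [] \<and> \<not> agree_first w \<and> \<not> left_maximal w}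
      = card {w \<in> S (Suc n). agree_first w \<and> lg w \<ge> 2}"
    using bij_betw_same_card[OF drop_first_bij(1)[OF n]] by simp
  moreover have "{w \<in> S n. (\<not> agree_first w \<and> snd (snd w) \<noteq> []) \<and> \<not> left_maximal w}
      = {w \<in> S n. snd (snd w) \<noteq> [] \<and> \<not> agree_first w \<and> \<not> left_maximal w}" by blast
  ultimately show ?thesis by simp
qed

text \<open>The bijection \<open>drop_last\<close> restricts to these sets, because cancelling the
  last arrow changes neither the agreement of the first arrows nor left maximality.\<close>

lemma card_not_right_maximal:
  assumes n: "n \<ge> 1"
  shows "card {w \<in> S n. (((\<not> agree_first w \<and> snd (snd w) \<noteq> []) \<and> left_maximal w) \<and> \<not> agree_last w)
      \<and> \<not> right_maximal w} =
    card {w \<in> S (Suc n). (\<not> agree_first w \<and> agree_last w \<and> left_maximal w) \<and> lg w \<ge> 2}"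
proof -
  let ?X = "{w \<in> S (Suc n). agree_last w \<and> lg w \<ge> 2}"
    and ?Y = "{w \<in> S n. snd (snd w) \<noteq> [] \<and> \<not> agree_last w \<and> \<not> right_maximal w}"
  have eq: "{w \<in> ?X. \<not> agree_first w \<and> left_maximal w} = {w \<in> ?X. \<not> agree_first (drop_last w)
      \<and> left_maximal (drop_last w)}"
    using drop_last_bij(2,3)[OF n] by blast
  have "bij_betw drop_last {w \<in> ?X. \<not> agree_first w \<and> left_maximal w} {w \<in> ?Y. \<not> agree_first w
      \<and> left_maximal w}"
    unfolding eq by (rule bij_betw_Collect[OF drop_last_bij(1)[OF n]]) (rule refl)
  then have "card {w \<in> ?X. \<not> agree_first w \<and> left_maximal w} = card {w \<in> ?Y. \<not> agree_first w
      \<and> left_maximal w}" by (rule bij_betw_same_card)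
  moreover have "{w \<in> S n. (((\<not> agree_first w \<and> snd (snd w) \<noteq> []) \<and> left_maximal w) \<and> \<not> agree_last w)
      \<and> \<not> right_maximal w} = {w \<in> ?Y. \<not> agree_first w \<and> left_maximal w}" by blast
  moreover have "{w \<in> S (Suc n). (\<not> agree_first w \<and> agree_last w \<and> left_maximal w) \<and> lg w \<ge> 2}
      = {w \<in> ?X. \<not> agree_first w \<and> left_maximal w}" by blast
  ultimately show ?thesis by simp
qed

text \<open>Pairs over an arrow \<open>a\<close> that agree at both ends have the form
  \<open>(\<alpha>_1...\<alpha>_n \<alpha>_1, \<alpha>_1)\<close>; cancelling the last arrow gives
  each complete pair once.\<close>

lemma card_CP:
  assumes n: "n \<ge> 1"
  shows "card {w \<in> S (Suc n). (agree_first w \<and> \<not> lg w \<ge> 2) \<and> agree_last w} = card (CP n)"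
proof -
  let ?X = "{w \<in> S (Suc n). (agree_first w \<and> \<not> lg w \<ge> 2) \<and> agree_last w}"
  have X: "\<exists>u a s. w = ((u, a # s @ [a]), (u, [a])) \<and> zp (last (a # s)) a" if w: "w \<in> ?X" for w
  proof -
    have wS: "w \<in> S (Suc n)" using w by simp
    obtain u r g where 1: "w = ((u, r), (u, g))" "length r = Suc n" "zs r" using S_cases[OF wS] .
    obtain a g' where g: "g = a # g'" using w by (cases g) (simp_all add: 1(1) agree_first_def)
    have g': "g' = []" using w by (cases g') (simp_all add: 1(1) g)
    obtain b s' where b: "r = b # s'" using 1(2) by (cases r) auto
    have "s' \<noteq> []" using 1(2) n b by auto
    then obtain s c where c: "s' = s @ [c]" by (cases s' rule: rev_cases) auto
    have "b = a" "c = a" using w by (auto simp: 1(1) agree_first_def agree_last_def g g' b c)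
    moreover have "zp (last (b # s)) c" using 1(3) successively_append_iff[of zp "b # s" "[c]"]
      by (simp add: b c)
    ultimately show ?thesis using 1(1) by (simp add: g g' b c)
  qed
  have "bij_betw drop_last ?X (CP n)"
    unfolding bij_betw_def
  proof
    show "inj_on drop_last ?X"
    proof (rule inj_onI)
      fix w w' assume w: "w \<in> ?X" and w': "w' \<in> ?X" and eq: "drop_last w = drop_last w'"
      obtain u a s where 1: "w = ((u, a # s @ [a]), (u, [a]))" using X[OF w] by blast
      obtain u' a' s' where 2: "w' = ((u', a' # s' @ [a']), (u', [a']))" using X[OF w'] by blast
      show "w = w'" using eq by (simp add: 1 2 drop_last_def butlast_append)
    qed
    show "drop_last ` ?X = CP n"
    proof
      show "drop_last ` ?X \<subseteq> CP n"
      proof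
        fix y assume "y \<in> drop_last ` ?X"
        then obtain w where w: "w \<in> ?X" "y = drop_last w" by blast
        obtain u a s where 1: "w = ((u, a # s @ [a]), (u, [a]))" "zp (last (a # s)) a" using X[OF w(1)]
          by blast
        have y: "y = ((u, a # s), (u, []))" by (simp add: w(2) 1(1) drop_last_def butlast_append)
        have "y \<in> S n" using drop_last_in_S[of w n] w by simp
        then show "y \<in> CP n" using 1(2) unfolding y CP_iff by simp
      qed
      show "CP n \<subseteq> drop_last ` ?X"
      proof
        fix y assume y: "y \<in> CP n"
        obtain w where w: "w \<in> S (Suc n)" "agree_first w" "agree_last w" "lg w = 1" "drop_last w = y"
          using rot_src[OF n y] .
        show "y \<in> drop_last ` ?X" by (rule image_eqI[of _ _ w]) (use w in simp_all)
      qed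
    qed
  qed
  then show ?thesis by (rule bij_betw_same_card)
qed

lemma empty_sub_IP: "empty_pairs Q I n \<subseteq> IP n"
  unfolding empty_pairs_def by blast

lemma finite_IP: "finite (IP n)" and finite_CP: "finite (CP n)"
proof -
  have "IP n \<subseteq> S n"
  proof
    fix w assume c: "w \<in> IP n"
    obtain u r v g where w: "w = ((u, r), (v, g))" by (metis surj_pair)
    show "w \<in> S n" using c unfolding w IP_iff by simp
  qed
  then show "finite (IP n)" by (rule finite_subset) (rule finite_S)
  have "CP n \<subseteq> S n" using CP_S by blast
  then show "finite (CP n)" by (rule finite_subset) (rule finite_S)
qed

lemma card_IP: "card (IP n) = card (empty_pairs Q I n) + card (nonempty_pairs Q I n)"
proof -
  have "card (IP n - empty_pairs Q I n) = card (IP n) - card (empty_pairs Q I n)"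
    by (rule card_Diff_subset[OF finite_subset[OF empty_sub_IP finite_IP] empty_sub_IP])
  then show ?thesis using card_mono[OF finite_IP empty_sub_IP, of n] by (simp add: nonempty_pairs_def)
qed

lemma card_closed:
  assumes n: "n \<ge> 1"
  shows "card {w \<in> S n. \<not> agree_first w \<and> \<not> snd (snd w) \<noteq> []} = card (CP n) + card (empty_pairs Q I n)
      + card (nonempty_pairs Q I n)"
proof -
  have "{w \<in> S n. \<not> agree_first w \<and> \<not> snd (snd w) \<noteq> []} = {w \<in> S n. snd (snd w) = []}"
    using closed_S(1)[OF _ _ n] by blast
  also have "\<dots> = CP n \<union> IP n" by (rule closed_pairs(1)[OF n])
  finally show ?thesis using card_Un_disjoint[OF finite_CP finite_IP closed_pairs(2)[OF n]] card_IP[of n]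
    by simp
qed

lemma finite_cocycle_reps: "finite (cocycle_reps n)"
  unfolding cocycle_reps_def orbit_reps_def using finite_GP by simp

text \<open>The union is disjoint: pairs with trivial \<open>\<gamma>\<close> agree at no end and
  are never left maximal, and complete pairs are not empty ones.\<close>

lemma card_kernel_coords:
  assumes n: "n \<ge> 1"
  shows "card (kernel_coords n) = card {w \<in> S n. agree_first w} + card {w \<in> S n. \<not> agree_first w
      \<and> agree_last w \<and> left_maximal w} +
    card {w \<in> S n. \<not> agree_first w \<and> \<not> agree_last w \<and> left_maximal w \<and> right_maximal w} + card (empty_pairs
        Q I n) + card (cocycle_reps n)"
proof -
  let ?A = "{w \<in> S n. agree_first w}" and ?B = "{w \<in> S n. \<not> agree_first w \<and> agree_last w \<and> left_maximal w}"
    and ?C = "{w \<in> S n. \<not> agree_first w \<and> \<not> agree_last w \<and> left_maximal w \<and> right_maximal w}"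
      and ?E = "empty_pairs Q I n"
  have f: "finite ?A" "finite ?B" "finite ?C" "finite ?E" "finite (cocycle_reps n)"
    using finite_S[of n] finite_subset[OF empty_sub_IP finite_IP] finite_cocycle_reps by simp_all
  have path_class: "\<not> agree_first w \<and> \<not> left_maximal w" if "w \<in> ?E \<union> cocycle_reps n" for w
  proof -
    have "w \<in> CP n \<union> IP n" using that cocycle_reps_D(4)[OF _ n] empty_sub_IP by blast
    then have "w \<in> S n \<and> snd (snd w) = []" using closed_pairs(1)[OF n] by blast
    then show ?thesis using closed_S[OF _ _ n] by blast
  qed
  have d1: "?A \<inter> ?B = {}" "(?A \<union> ?B) \<inter> ?C = {}" by blast+
  have d2: "(?A \<union> ?B \<union> ?C) \<inter> ?E = {}" "(?A \<union> ?B \<union> ?C) \<inter> cocycle_reps n = {}" using path_class by blast+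
  have "?E \<inter> cocycle_reps n = {}" using cocycle_reps_D(4)[OF _ n] CP_not_empty[OF _ n] by blast
  then have d3: "(?A \<union> ?B \<union> ?C \<union> ?E) \<inter> cocycle_reps n = {}" using d2 by blast
  show ?thesis unfolding kernel_coords_def
    using card_Un_disjoint[OF _ f(5) d3] card_Un_disjoint[OF _ f(4) d2(1)] card_Un_disjoint[OF _ f(3) d1(2)]
      card_Un_disjoint[OF f(1,2) d1(1)] f by simp
qed

text \<open>Agreement at an end makes \<open>\<gamma>\<close> nontrivial, so length below two means
  that \<open>\<gamma>\<close> is an arrow.\<close>

lemma arrow_pairs:
  "(pairs_ab Q I 1 0 n \<union> left_max Q I (pairs_ab Q I 0 1 n)) \<inter> parallel Q (AP Q I n) (arrow_paths Q) =
     {w \<in> S n. (agree_first w \<and> \<not> lg w \<ge> 2) \<and> \<not> agree_last w} \<union> {w \<in> S n. (\<not> agree_first w \<and> agree_last w \<and>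
         left_maximal w) \<and> \<not> lg w \<ge> 2}"
proof -
  have ne: "snd (snd w) \<noteq> []" if "agree_first w \<or> agree_last w" for w using that
    by (auto simp: agree_first_def agree_last_def)
  have "w \<in> parallel Q (AP Q I n) (arrow_paths Q) \<longleftrightarrow> \<not> lg w \<ge> 2" if w: "w \<in> S n" "snd (snd w) \<noteq> []" for w
  proof -
    obtain u r g where 1: "w = ((u, r), (u, g))" "(u, r) \<in> paths Q" "length r
        = n" "zs r" "(u, g) \<in> paths Q" "nz g"
      "pe u r = pe u g" using S_cases[OF w(1)] .
    have g: "g \<noteq> []" using w(2) by (simp add: 1(1))
    have P: "((u, r), (u, g)) \<in> parallel Q (AP Q I n) (arrow_paths Q) \<longleftrightarrow> (u, g) \<in> arrow_paths Q"
      using w(1) by (auto simp: 1(1) parallel_def)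
    have "(u, g) \<in> arrow_paths Q \<longleftrightarrow> \<not> length g \<ge> 2"
      using path_ends[OF 1(5) g] g by (cases g; cases "tl g") (auto simp: arrow_paths_def)
    then show ?thesis using P by (simp add: 1(1))
  qed
  then show ?thesis unfolding pairs_ab_eq left_max_eq using ne by blast
qed

text \<open>Pairs of degree \<open>n\<close> are split by trivial \<open>\<gamma>\<close>,
  maximality and agreement. Those that are not left maximal, those prolongable only on the right,
  and the complete ones are matched with coordinates of degree \<open>Suc n\<close>; in that degree
  there remain the pairs over an arrow, the maximal ones, the empty ones and the orbits. Nonempty
  incomplete pairs have no partner.\<close>

lemma card_identity:
  assumes n: "n \<ge> 1"
  shows "card (kernel_coords (Suc n)) + card (kernel_coords n) + card (nonempty_pairs Q I n) =
    card (S n) + card (left_max Q I (right_max Q I (pairs_ab Q I 0 0 (Suc n)))) + card (empty_pairs Q I (Suc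
        n)) +
    card ((pairs_ab Q I 1 0 (Suc n) \<union> left_max Q I (pairs_ab Q I 0 1 (Suc n))) \<inter> parallel Q (AP Q I (Suc n))
        (arrow_paths Q)) +
    card (cocycle_reps (Suc n)) + card (cocycle_reps n)"
proof -
  note sp = card_split[OF finite_S]
  have 1: "card (S n) = card {w \<in> S n. agree_first w} + card {w \<in> S n. \<not> agree_first w}"
    using sp[of n "\<lambda>_. True" agree_first] by simp
  have 2: "card {w \<in> S n. \<not> agree_first w} = card {w \<in> S n. \<not> agree_first w \<and> snd (snd w) \<noteq> []}
      + card {w \<in> S n. \<not> agree_first w \<and> \<not> snd (snd w) \<noteq> []}"
    by (rule sp)
  have 3: "card {w \<in> S n. \<not> agree_first w \<and> snd (snd w) \<noteq> []} = card {w \<in> S n. (\<not> agree_first w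
      \<and> snd (snd w) \<noteq> []) \<and> left_maximal w} +
     card {w \<in> S n. (\<not> agree_first w \<and> snd (snd w) \<noteq> []) \<and> \<not> left_maximal w}" by (rule sp)
  have 4: "card {w \<in> S n. (\<not> agree_first w \<and> snd (snd w) \<noteq> []) \<and> left_maximal w} =
     card {w \<in> S n. ((\<not> agree_first w \<and> snd (snd w) \<noteq> []) \<and> left_maximal w) \<and> agree_last w} +
     card {w \<in> S n. ((\<not> agree_first w \<and> snd (snd w) \<noteq> []) \<and> left_maximal w) \<and> \<not> agree_last w}" by (rule sp)
  have 5: "card {w \<in> S n. ((\<not> agree_first w \<and> snd (snd w) \<noteq> []) \<and> left_maximal w) \<and> \<not> agree_last w} =
     card {w \<in> S n. (((\<not> agree_first w \<and> snd (snd w) \<noteq> []) \<and> left_maximal w) \<and> \<not> agree_last w) \<and>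
         right_maximal w} +
     card {w \<in> S n. (((\<not> agree_first w \<and> snd (snd w) \<noteq> []) \<and> left_maximal w) \<and> \<not> agree_last w) \<and> \<not>
         right_maximal w}" by (rule sp)
  have lm: "snd (snd w) \<noteq> []" if "w \<in> S n" "left_maximal w" for w using closed_S(3)[OF that(1) _ n] that(2)
    by blast
  have 6: "{w \<in> S n. ((\<not> agree_first w \<and> snd (snd w) \<noteq> []) \<and> left_maximal w) \<and> agree_last w}
      = {w \<in> S n. \<not> agree_first w \<and> agree_last w \<and> left_maximal w}" using lm by blast
  have 7: "{w \<in> S n. (((\<not> agree_first w \<and> snd (snd w) \<noteq> []) \<and> left_maximal w) \<and> \<not> agree_last w)
      \<and> right_maximal w} =
    {w \<in> S n. \<not> agree_first w \<and> \<not> agree_last w \<and> left_maximal w \<and> right_maximal w}" using lm by blast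
  have 8: "card {w \<in> S (Suc n). agree_first w} = card {w \<in> S (Suc n). agree_first w \<and> lg w \<ge> 2}
      + card {w \<in> S (Suc n). agree_first w \<and> \<not> lg w \<ge> 2}"
    by (rule sp)
  have 9: "card {w \<in> S (Suc n). agree_first w \<and> \<not> lg w \<ge> 2} = card {w \<in> S (Suc n). (agree_first w
      \<and> \<not> lg w \<ge> 2) \<and> agree_last w} +
    card {w \<in> S (Suc n). (agree_first w \<and> \<not> lg w \<ge> 2) \<and> \<not> agree_last w}" by (rule sp)
  have 10: "card {w \<in> S (Suc n). \<not> agree_first w \<and> agree_last w \<and> left_maximal w}
      = card {w \<in> S (Suc n). (\<not> agree_first w \<and> agree_last w \<and> left_maximal w) \<and> lg w \<ge> 2} +
    card {w \<in> S (Suc n). (\<not> agree_first w \<and> agree_last w \<and> left_maximal w) \<and> \<not> lg w \<ge> 2}" by (rule sp)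
  have 11: "left_max Q I (right_max Q I (pairs_ab Q I 0 0 (Suc n))) = {w \<in> S (Suc n). \<not> agree_first w
      \<and> \<not> agree_last w \<and> left_maximal w \<and> right_maximal w}"
    unfolding pairs_ab_eq left_max_eq right_max_eq by blast
  have 12: "card ({w \<in> S (Suc n). (agree_first w \<and> \<not> lg w \<ge> 2)
      \<and> \<not> agree_last w} \<union> {w \<in> S (Suc n). (\<not> agree_first w \<and> agree_last w \<and> left_maximal w) \<and> \<not> lg w \<ge> 2}) =
    card {w \<in> S (Suc n). (agree_first w \<and> \<not> lg w \<ge> 2) \<and> \<not> agree_last w} + card {w \<in> S (Suc n). (\<not>
        agree_first w \<and> agree_last w \<and> left_maximal w) \<and> \<not> lg w \<ge> 2}"
    by (rule card_Un_disjoint) (use finite_S in auto)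
  show ?thesis
    unfolding arrow_pairs 11 12
    using 1 2 3 4 5 8 9 10 card_not_left_maximal[OF n] card_not_right_maximal[OF n] card_CP[OF n]
        card_closed[OF n] card_kernel_coords[OF n] card_kernel_coords[of "Suc n"]
    unfolding 6 7 by linarith
qed

text \<open>Of two consecutive degrees exactly one is even, so outside characteristic 2 one of the
  two sets of representatives is empty.\<close>

lemma c_number_eq: "n \<ge> 1 \<Longrightarrow> c_number Q I (Suc n) = card (cocycle_reps (Suc n)) + card (cocycle_reps n)"
  by (simp add: c_number_def kdim_gentle cocycle_reps_def)

end

section \<open>Hochschild cohomology\<close>

context kalgebra begin

lemma vectorspace_cocycles:
  assumes X: "\<And>i. bimodule A (X i)" and N: "bimodule A N" and d: "\<And>i. d i \<in> bimod_hom A (X (Suc i)) (X i)"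
  shows "vectorspace class_ring ((hom_space A (X n) N)\<lparr>carrier := cocycles A X d N n\<rparr>)"
    (is "vectorspace class_ring ?V")
proof -
  interpret N: bimodule A N by (rule N)
  have hom: "f \<in> bimod_hom A (X n) N" and cyc: "x \<in> carrier (X (Suc n)) \<Longrightarrow> f (d n x) = \<zero>\<^bsub>N\<^esub>"
    if "f \<in> cocycles A X d N n" for f x using that by (simp_all add: cocycles_def)
  have c: "f x \<in> carrier N" if "f \<in> cocycles A X d N n" "x \<in> carrier (X n)" for f x
    by (rule hom_closed[OF hom[OF that(1)] that(2)])
  have dc: "d n x \<in> carrier (X n)" if "x \<in> carrier (X (Suc n))" for x by (rule hom_closed[OF d that])
  have eqI: "f = g" if "f \<in> carrier (X n) \<rightarrow>\<^sub>E carrier N" "g \<in> carrier (X n) \<rightarrow>\<^sub>E carrier N"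
    "\<And>x. x \<in> carrier (X n) \<Longrightarrow> f x = g x" for f g using that by (rule PiE_ext)
  have ext: "f \<in> carrier (X n) \<rightarrow>\<^sub>E carrier N" if "f \<in> cocycles A X d N n" for f
    using hom[OF that] by (simp add: bimod_hom_def)
  have add: "(\<lambda>x\<in>carrier (X n). f x \<oplus>\<^bsub>N\<^esub> g x) \<in> cocycles A X d N n"
    if f: "f \<in> cocycles A X d N n" and g: "g \<in> cocycles A X d N n" for f g
    using hom_add_fun[OF X N hom[OF f] hom[OF g]] by (simp add: cocycles_def dc cyc[OF f] cyc[OF g])
  have smult: "(\<lambda>x\<in>carrier (X n). a \<odot>\<^bsub>N\<^esub> f x) \<in> cocycles A X d N n" if f: "f \<in> cocycles A X d N n" for a f
    using hom_smult_fun[OF X N hom[OF f], of a] by (simp add: cocycles_def dc cyc[OF f])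
  have z: "(\<lambda>x\<in>carrier (X n). \<zero>\<^bsub>N\<^esub>) \<in> cocycles A X d N n"
  proof -
    interpret Xn: bimodule A "X n" by (rule X)
    show ?thesis by (simp add: cocycles_def bimod_hom_def dc Xn.lact_closed Xn.ract_closed)
  qed
  have ops: "carrier ?V = cocycles A X d N n" "\<zero>\<^bsub>?V\<^esub> = (\<lambda>x\<in>carrier (X n). \<zero>\<^bsub>N\<^esub>)"
    "f \<oplus>\<^bsub>?V\<^esub> g = (\<lambda>x\<in>carrier (X n). f x \<oplus>\<^bsub>N\<^esub> g x)" "a \<odot>\<^bsub>?V\<^esub> f = (\<lambda>x\<in>carrier (X n). a \<odot>\<^bsub>N\<^esub> f x)" for f g a
    by (simp_all add: hom_space_def)
  show ?thesis
  proof (rule vectorspace_class_ringI, unfold ops)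
    fix f assume f: "f \<in> cocycles A X d N n"
    show "(\<lambda>x\<in>carrier (X n). (\<lambda>x\<in>carrier (X n). \<zero>\<^bsub>N\<^esub>) x \<oplus>\<^bsub>N\<^esub> f x) = f"
      by (rule eqI[OF ext[OF add[OF z f]] ext[OF f]]) (simp add: c[OF f])
    show "(\<lambda>x\<in>carrier (X n). 1 \<odot>\<^bsub>N\<^esub> f x) = f"
      by (rule eqI[OF ext[OF smult[OF f]] ext[OF f]]) (simp add: c[OF f])
  qed (simp_all only: add smult z, (rule restrict_ext, simp add: c N.V.M.a_ac N.smult_add_l N.smult_add_r
      N.smult_smult)+)
qed

lemma coboundaries_sub_cocycles:
  assumes X: "\<And>i. bimodule A (X i)" and N: "bimodule A N" and d: "\<And>i. d i \<in> bimod_hom A (X (Suc i)) (X i)"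
    and dd: "\<And>i x. x \<in> carrier (X (Suc (Suc i))) \<Longrightarrow> d i (d (Suc i) x) = \<zero>\<^bsub>X i\<^esub>"
  shows "coboundaries A X d N (Suc n) \<subseteq> cocycles A X d N (Suc n)"
proof
  fix f assume "f \<in> coboundaries A X d N (Suc n)"
  then obtain c where c: "c \<in> bimod_hom A (X n) N" "f = compose (carrier (X (Suc n))) c (d n)"
    unfolding coboundaries_Suc by blast
  have "f (d (Suc n) x) = \<zero>\<^bsub>N\<^esub>" if x: "x \<in> carrier (X (Suc (Suc n)))" for x
    using compose_eq[OF hom_closed[OF d x], of c "d n"] dd[OF x] hom_zero[OF X N c(1)] c(2) by simp
  then show "f \<in> cocycles A X d N (Suc n)" using hom_compose[OF d c(1) X] c(2) by (simp add: cocycles_def)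
qed

end

context qsa begin

text \<open>After the first arrow is cancelled the new first arrows differ, and likewise at the
  other end, so the same side cannot be cancelled twice. Cancellations on opposite sides commute and
  come with opposite total signs.\<close>

lemma delta_delta:
  assumes n: "n \<ge> 1"
  shows "delta (Suc n) (delta n c) = (\<lambda>_. 0)"
  unfolding delta_zero_iff
proof
  fix w assume wS: "w \<in> S (Suc (Suc n))"
  obtain u r g where 1: "w = ((u, r), (u, g))" "length r = Suc (Suc n)" using S_cases[OF wS] .
  have l0: "snd (snd (drop_first w)) = tl g" "snd (snd (drop_last w)) = butlast g"
    by (simp_all add: 1(1) drop_first_def drop_last_def)
  have short: "\<not> lg w \<ge> 2 \<Longrightarrow> tl g = [] \<and> butlast g = []" by (cases g; cases "tl g") (simp_all add: 1(1))
  have n1: "1 \<le> Suc n" by simp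
  have La: "\<not> agree_first (drop_first w)" if "agree_first w"
  proof (cases "lg w \<ge> 2")
    case True
    have "w \<in> {w \<in> S (Suc (Suc n)). agree_first w \<and> lg w \<ge> 2}" using wS that True by simp
    then have "drop_first w \<in> {w \<in> S (Suc n). snd (snd w) \<noteq> [] \<and> \<not> agree_first w \<and> \<not> left_maximal w}"
      by (rule bspec[OF bij_betwE[OF drop_first_bij(1)[OF n1]]])
    then show ?thesis by blast
  qed (use short l0 in \<open>simp add: agree_first_def\<close>)
  have Rb: "\<not> agree_last (drop_last w)" if "agree_last w"
  proof (cases "lg w \<ge> 2")
    case True
    have "w \<in> {w \<in> S (Suc (Suc n)). agree_last w \<and> lg w \<ge> 2}" using wS that True by simp
    then have "drop_last w \<in> {w \<in> S (Suc n). snd (snd w) \<noteq> [] \<and> \<not> agree_last w \<and> \<not> right_maximal w}"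
      by (rule bspec[OF bij_betwE[OF drop_last_bij(1)[OF n1]]])
    then show ?thesis by blast
  qed (use short l0 in \<open>simp add: agree_last_def\<close>)
  have ab: "agree_first w \<and> agree_last (drop_first w) \<longleftrightarrow> agree_last w \<and> agree_first (drop_last w)"
  proof (cases "lg w \<ge> 2")
    case True
    show ?thesis using drop_first_bij(2)[of "Suc n" w] drop_last_bij(2)[of "Suc n" w] wS True by auto
  qed (use short l0 in \<open>simp add: agree_first_def agree_last_def\<close>)
  have LR: "drop_last (drop_first w) = drop_first (drop_last w)" using 1(2)
    by (cases r; cases "tl r") (auto simp: 1(1) drop_first_def drop_last_def butlast_tl)
  have L: "delta n c (drop_first w) = (- 1) ^ Suc n * (if agree_last (drop_first w) then c (drop_last
      (drop_first w)) else 0)" if "agree_first w"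
    using delta_eq[OF drop_first_in_S[OF wS that], of c] La[OF that] by simp
  have R: "delta n c (drop_last w) = (if agree_first (drop_last w) then c (drop_first (drop_last w)) else
      0)" if "agree_last w"
    using delta_eq[OF drop_last_in_S[OF wS that], of c] Rb[OF that] by simp
  show "(if agree_first w then delta n c (drop_first w) else 0)
      + (- 1) ^ Suc (Suc n) * (if agree_last w then delta n c (drop_last w) else 0) = 0"
    using L R ab unfolding LR by (cases "agree_first w"; cases "agree_last w") auto
qed

lemma delta_linear: "delta n (\<lambda>w. c w + c' w) = (\<lambda>w. delta n c w + delta n c' w)" "delta n (\<lambda>w. a * c w)
    = (\<lambda>w. a * delta n c w)"
proof -
  have "delta n (\<lambda>w. c w + c' w) w = delta n c w + delta n c' w \<and> delta n (\<lambda>w. a * c w) w = a * delta n c w"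
    for w
  proof -
    obtain u r v g where w: "w = ((u, r), (v, g))" by (metis surj_pair)
    show ?thesis unfolding w delta_def by (simp add: algebra_simps)
  qed
  then show "delta n (\<lambda>w. c w + c' w) = (\<lambda>w. delta n c w + delta n c' w)" "delta n (\<lambda>w. a * c w)
      = (\<lambda>w. a * delta n c w)"
    by (intro ext; blast)+
qed

lemma delta_support: "w \<notin> S (Suc n) \<Longrightarrow> delta n c w = 0"
  by (cases w) (auto simp: delta_def)

lemma kernel_coords_sub_S: assumes "n \<ge> 1" shows "kernel_coords n \<subseteq> S n"
proof -
  have "empty_pairs Q I n \<subseteq> S n" "cocycle_reps n \<subseteq> S n"
    using empty_sub_IP[of n] cocycle_reps_D(4)[OF _ assms] closed_pairs(1)[OF assms] by blast+
  then show ?thesis unfolding kernel_coords_def by blast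
qed

lemma cocycle_ext_support: "w \<notin> S n \<Longrightarrow> cocycle_ext n v w = 0"
  by (simp add: cocycle_ext_def)

text \<open>Kernel coordinates serve twice: in degree \<open>Suc m\<close> for the cocycles, in
  degree \<open>m\<close> for the kernel of the incoming differential and thereby for the rank of
  the coboundaries. The resulting coordinates on the quotient are pulled back along
  \<open>\<Theta>\<close>.\<close>

lemma HH_dim:
  fixes P :: "nat \<Rightarrow> ('k, (('v, 'a) qpath \<Rightarrow> 'k) set, 'm) bimod"
  assumes P: "projective_resolution A E P d e" and m: "m \<ge> 1"
  shows "kfin_dim (HH A P d (Suc m)) \<and> kdim (HH A P d (Suc m)) + card (S m) = card (kernel_coords (Suc m))
      + card (kernel_coords m)"
proof -
  let ?n = "Suc m"
  define Z where "Z = {z :: ('v, 'a) qpair \<Rightarrow> 'k. (\<forall>w. w \<notin> S ?n \<longrightarrow> z w = 0) \<and> delta ?n z = (\<lambda>_. 0)}"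
  have ZI: "z \<in> Z" if "\<And>w. w \<notin> S ?n \<Longrightarrow> z w = 0" "delta ?n z = (\<lambda>_. 0)" for z
    unfolding Z_def by (rule CollectI, rule conjI, intro allI impI, rule that(1), assumption, rule that(2))
  have ZD: "w \<notin> S ?n \<Longrightarrow> z w = 0" "delta ?n z = (\<lambda>_. 0)" if "z \<in> Z" for z w
    using that unfolding Z_def by blast+
  have "\<exists>(K :: (('v, 'a) qpair \<Rightarrow> 'k) set) \<psi>. finite K \<and> card K + card (S m) = card (kernel_coords ?n)
      + card (kernel_coords m) \<and>
     (\<forall>x\<in>Z. \<forall>y\<in>Z. \<psi> (\<lambda>t. x t + y t) = (\<lambda>k. \<psi> x k + \<psi> y k)) \<and>
     (\<forall>a. \<forall>x\<in>Z. \<psi> (\<lambda>t. a * x t) = (\<lambda>k. a * \<psi> x k)) \<and>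
     (\<forall>x\<in>Z. \<forall>k. k \<notin> K \<longrightarrow> \<psi> x k = (0::'k)) \<and>
     (\<forall>k\<in>K. k \<in> Z \<and> \<psi> k = basis_vec k) \<and>
     (\<forall>x\<in>Z. \<psi> x = (\<lambda>_. 0) \<longleftrightarrow> (\<exists>c. (\<forall>s. s \<notin> S m \<longrightarrow> c s = 0) \<and> x = delta m c))"
  proof (rule quotient_coordinates[OF finite_S finite_subset[OF kernel_coords_sub_S finite_S]
      kernel_coords_sub_S[OF m] delta_linear])
    show "1 \<le> ?n" by simp
    show "c = (\<lambda>_. 0)" if "\<And>s. s \<notin> S m \<Longrightarrow> c s = 0" "delta m c = (\<lambda>_. 0)" "\<And>s. s \<in> kernel_coords m \<Longrightarrow> c s = 0"
      for c :: "('v, 'a) qpair \<Rightarrow> 'k"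
      by (rule kernel_coords_determines[OF m that(2,1,3)])
    show "\<exists>c. (\<forall>s. s \<notin> S m \<longrightarrow> c s = 0) \<and> delta m c = (\<lambda>_. 0) \<and> (\<forall>s\<in>kernel_coords m. c s = v s)"
      for v :: "('v, 'a) qpair \<Rightarrow> 'k"
      using cocycle_ext_support[of _ m v] cocycle_ext_cocycle[OF m, of v] cocycle_ext_kernel_coords[OF m, of
          _ v] by blast
    show "(\<lambda>_. 0) \<in> Z" by (rule ZI) (auto simp: delta_def)
    show "(\<lambda>t. x t + y t) \<in> Z" if "x \<in> Z" "y \<in> Z" for x y
      by (rule ZI) (simp_all add: delta_linear ZD[OF that(1)] ZD[OF that(2)])
    show "(\<lambda>t. a * x t) \<in> Z" if "x \<in> Z" for a x by (rule ZI) (simp_all add: delta_linear ZD[OF that])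
    show "delta m c \<in> Z" for c by (rule ZI[OF delta_support delta_delta[OF m]])
    show "z = (\<lambda>_. 0)" if "z \<in> Z" "\<And>t. t \<in> kernel_coords ?n \<Longrightarrow> z t = 0" for z
      by (rule kernel_coords_determines[OF _ ZD(2)[OF that(1)] ZD(1)[OF that(1)] that(2)]) simp_all
    show "\<exists>z\<in>Z. \<forall>t\<in>kernel_coords ?n. z t = v t" for v :: "('v, 'a) qpair \<Rightarrow> 'k"
    proof (rule bexI[of _ "cocycle_ext ?n v"])
      show "cocycle_ext ?n v \<in> Z" by (rule ZI[OF cocycle_ext_support cocycle_ext_cocycle]) simp_all
      show "\<forall>t\<in>kernel_coords ?n. cocycle_ext ?n v t = v t" using cocycle_ext_kernel_coords[of ?n _ v] by simp
    qed
  qed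
  then obtain K :: "(('v, 'a) qpair \<Rightarrow> 'k) set" and \<psi>
    where K: "finite K" "card K + card (S m) = card (kernel_coords ?n) + card (kernel_coords m)"
    and \<psi>add: "\<forall>x\<in>Z. \<forall>y\<in>Z. \<psi> (\<lambda>t. x t + y t) = (\<lambda>k. \<psi> x k + \<psi> y k)"
    and \<psi>sm: "\<forall>a. \<forall>x\<in>Z. \<psi> (\<lambda>t. a * x t) = (\<lambda>k. a * \<psi> x k)"
    and \<psi>0: "\<forall>x\<in>Z. \<forall>k. k \<notin> K \<longrightarrow> \<psi> x k = (0::'k)"
    and \<psi>b: "\<forall>k\<in>K. k \<in> Z \<and> \<psi> k = basis_vec k"
    and \<psi>ker: "\<forall>x\<in>Z. \<psi> x = (\<lambda>_. 0) \<longleftrightarrow> (\<exists>c. (\<forall>s. s \<notin> S m \<longrightarrow> c s = 0) \<and> x = delta m c)"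
    by (elim exE conjE) (rule that)
  obtain \<Theta> :: "('m \<Rightarrow> (('v, 'a) qpath \<Rightarrow> 'k) set) \<Rightarrow> ('v, 'a) qpair \<Rightarrow> 'k" where
    \<Theta>add: "\<forall>f\<in>cocycles A P d E ?n. \<forall>g\<in>cocycles A P d E ?n.
        \<Theta> (\<lambda>x\<in>carrier (P ?n). f x \<oplus>\<^bsub>E\<^esub> g x) = (\<lambda>w. \<Theta> f w + \<Theta> g w)"
    and \<Theta>sm: "\<forall>f\<in>cocycles A P d E ?n. \<forall>c. \<Theta> (\<lambda>x\<in>carrier (P ?n). c \<odot>\<^bsub>E\<^esub> f x) = (\<lambda>w. c * \<Theta> f w)"
    and \<Theta>Z: "\<forall>f\<in>cocycles A P d E ?n. (\<forall>w. w \<notin> S ?n \<longrightarrow> \<Theta> f w = 0) \<and> delta ?n (\<Theta> f) = (\<lambda>_. 0)"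
    and \<Theta>ker: "\<forall>f\<in>cocycles A P d E ?n. f \<in> coboundaries A P d E ?n \<longleftrightarrow> (\<exists>c. (\<forall>w. w \<notin> S m \<longrightarrow> c w = 0) \<and> \<Theta> f
        = delta m c)"
    and \<Theta>surj: "\<forall>z. (\<forall>w. w \<notin> S ?n \<longrightarrow> z w = 0) \<and> delta ?n z = (\<lambda>_. 0) \<longrightarrow>
        (\<exists>f\<in>cocycles A P d E ?n. \<exists>c. (\<forall>w. w \<notin> S m \<longrightarrow> c w = 0) \<and> \<Theta> f = (\<lambda>w. z w + delta m c w))"
    using cohomology_via_delta[OF P, where n = m] by (elim exE conjE) (rule that)
  have Z: "\<Theta> f \<in> Z" if "f \<in> cocycles A P d E ?n" for f
    using bspec[OF \<Theta>Z that] unfolding Z_def mem_Collect_eq .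
  have cP: "bimod_complex A E P d e"
    by (rule bimod_resolution.axioms(1)[OF bimod_resolution_of_projective[OF kalgebra_A bimodule_regular P]])
  note X = bimod_complex.X[OF cP] and dP = bimod_complex.d[OF cP] and ddP = bimod_complex.dd[OF cP]
  let ?V = "(hom_space A (P ?n) E)\<lparr>carrier := cocycles A P d E ?n\<rparr>"
  have vs: "vectorspace class_ring ?V"
    by (rule kalgebra.vectorspace_cocycles[OF kalgebra_A]) (rule X bimodule_regular dP)+
  have cV: "carrier ?V = cocycles A P d E ?n" by simp
  have opV: "f \<oplus>\<^bsub>?V\<^esub> g = (\<lambda>x\<in>carrier (P ?n). f x \<oplus>\<^bsub>E\<^esub> g x)"
    "a \<odot>\<^bsub>?V\<^esub> f = (\<lambda>x\<in>carrier (P ?n). a \<odot>\<^bsub>E\<^esub> f x)" for f g a by (simp_all add: hom_space_def)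
  have "kfin_dim (kquot ?V (coboundaries A P d E ?n)) \<and> kdim (kquot ?V (coboundaries A P d E ?n)) = card K"
  proof (rule dim_kquot[OF vs K(1), where \<phi> = "\<lambda>f. \<psi> (\<Theta> f)"], unfold cV opV)
    show "coboundaries A P d E ?n \<subseteq> cocycles A P d E ?n"
      by (rule kalgebra.coboundaries_sub_cocycles[OF kalgebra_A]) (rule X bimodule_regular dP ddP,
          assumption?)+
    fix f assume f: "f \<in> cocycles A P d E ?n"
    show "f \<in> coboundaries A P d E ?n \<longleftrightarrow> \<psi> (\<Theta> f) = (\<lambda>_. 0)"
      unfolding bspec[OF \<Theta>ker f] bspec[OF \<psi>ker Z[OF f]] ..
    show "\<psi> (\<Theta> f) s = 0" if "s \<notin> K" for s using \<psi>0 Z[OF f] that by blast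
    show "\<psi> (\<Theta> (\<lambda>x\<in>carrier (P ?n). a \<odot>\<^bsub>E\<^esub> f x)) = (\<lambda>s. a * \<psi> (\<Theta> f) s)" for a
      unfolding spec[OF bspec[OF \<Theta>sm f]] by (rule bspec[OF spec[OF \<psi>sm] Z[OF f]])
    fix g assume g: "g \<in> cocycles A P d E ?n"
    show "\<psi> (\<Theta> (\<lambda>x\<in>carrier (P ?n). f x \<oplus>\<^bsub>E\<^esub> g x)) = (\<lambda>s. \<psi> (\<Theta> f) s + \<psi> (\<Theta> g) s)"
      unfolding bspec[OF bspec[OF \<Theta>add f] g] by (rule bspec[OF bspec[OF \<psi>add Z[OF f]] Z[OF g]])
  next
    fix k assume k: "k \<in> K"
    have kZ: "k \<in> Z" and \<psi>k: "\<psi> k = basis_vec k" using \<psi>b k by blast+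
    have "(\<forall>w. w \<notin> S ?n \<longrightarrow> k w = 0) \<and> delta ?n k = (\<lambda>_. 0)" using kZ unfolding Z_def by (rule CollectD)
    from mp[OF spec[OF \<Theta>surj] this] obtain f c where f: "f \<in> cocycles A P d E ?n" "\<forall>w. w \<notin> S m \<longrightarrow> c w = 0"
      "\<Theta> f = (\<lambda>w. k w + delta m c w)" by (elim bexE exE conjE) (rule that)
    \<comment> \<open>The preimage hits \<open>k\<close> only up to a coboundary, on which
      \<open>\<psi>\<close> vanishes.\<close>
    have dZ: "delta m c \<in> Z" by (rule ZI[OF delta_support delta_delta[OF m]])
    have "\<psi> (delta m c) = (\<lambda>_. 0)" using bspec[OF \<psi>ker dZ] f(2) by blast
    then have "\<psi> (\<Theta> f) = basis_vec k" unfolding f(3) bspec[OF bspec[OF \<psi>add kZ] dZ] \<psi>k by simp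
    then show "\<exists>x\<in>cocycles A P d E ?n. \<psi> (\<Theta> x) = basis_vec k" using f(1) by (rule bexI)
  qed
  then show ?thesis using K(2) unfolding ext_space_def by simp
qed

end

theorem theorem3p14:
  fixes Q :: "('v, 'a) pre_digraph"
    and I :: "(('v, 'a) qpath \<Rightarrow> 'k::alg_closed_field) set"
    and P :: "nat \<Rightarrow> ('k, (('v, 'a) qpath \<Rightarrow> 'k) set, 'm) bimod"
    and d :: "nat \<Rightarrow> 'm \<Rightarrow> 'm"
    and \<epsilon> :: "'m \<Rightarrow> (('v, 'a) qpath \<Rightarrow> 'k) set"
    and n :: nat
  assumes "quadratic_string_algebra Q I"
    and "n \<ge> 2"
    and "projective_resolution (quiver_algebra Q I) (regular_bimodule (quiver_algebra Q I)) P d \<epsilon>"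
  shows "kfin_dim (HH (quiver_algebra Q I) P d n) \<and>
    int (kdim (HH (quiver_algebra Q I) P d n)) =
      int (card (left_max Q I (right_max Q I (pairs_ab Q I 0 0 n))))
      + int (card (empty_pairs Q I n))
      - int (card (nonempty_pairs Q I (n - 1)))
      + int (card ((pairs_ab Q I 1 0 n \<union> left_max Q I (pairs_ab Q I 0 1 n))
                   \<inter> parallel Q (AP Q I n) (arrow_paths Q)))
      + int (c_number Q I n)"
proof -
  obtain m where n: "n = Suc m" and m: "m \<ge> 1" using assms(2) by (cases n) auto
  interpret qsa Q I by (rule qsa.intro[OF assms(1)])
  show ?thesis
  proof
    show "kfin_dim (HH (quiver_algebra Q I) P d n)" using HH_dim[OF assms(3) m] unfolding n by (rule conjunct1)
  next
    \<comment> \<open>Dimension and counts are related by identities of natural numbers with all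
      subtracted terms moved across; the passage to integers happens only here.\<close>
    have ar: "int k = int l + int e - int ne + int ab + int cn"
      if "k + s = a + b" "a + b + ne = s + l + e + ab + o1 + o2" "cn = o1 + o2" for k l e ne ab cn s a b o1 o2 :: nat
      using that by linarith
    show "int (kdim (HH (quiver_algebra Q I) P d n)) = int (card (left_max Q I (right_max Q I (pairs_ab Q I 0 0 n))))
      + int (card (empty_pairs Q I n)) - int (card (nonempty_pairs Q I (n - 1)))
      + int (card ((pairs_ab Q I 1 0 n \<union> left_max Q I (pairs_ab Q I 0 1 n)) \<inter> parallel Q (AP Q I n) (arrow_paths Q)))
      + int (c_number Q I n)"
      unfolding n diff_Suc_1 by (rule ar[OF conjunct2[OF HH_dim[OF assms(3) m]] card_identity[OF m] c_number_eq[OF m]])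
  qed
qed

end
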